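(* Consider fixed parameters $(v,w)\in M_+=\{(v,w)\in\mathbb{C}^2: w\neq 0,\ \operatorname{Im}(v/w)>0\}$ and take $(\vartheta,\varphi)\in\mathbb{C}^2$ to be generic. Then the functions $$B(v,w,\vartheta,\varphi,\epsilon)=F^*(v,w,\vartheta,\varphi,\epsilon),\qquad D(v,w,\vartheta,\varphi,\epsilon)=G^*(v,w,\vartheta,\varphi,\epsilon)\cdot G^*(0,w,0,\varphi,\epsilon)^{-1}$$ give a solution to the following problem: find meromorphic functions $B(v,w,\vartheta,\varphi,\epsilon)$ and $D(v,w,\vartheta,\varphi,\epsilon)$ defined for $(v,w)\in M_+$, $(\vartheta,\varphi)\in\mathbb{C}^2$ and $\epsilon\in\mathcal{V}(0)$, such that for fixed $(v,w,\vartheta,\varphi)$ the following properties hold: (i) one has $B(v,w,\vartheta,\varphi,\epsilon)\to 1$ and $D(v,w,\vartheta,\varphi,\epsilon)\to 1$ as $\epsilon\to 0$ in any closed subsector of $\mathcal{V}(0)$; (ii) there exists $k>0$ such that $|\epsilon|^{-k}<|B(v,w,\vartheta,\varphi,\epsilon)|,\,|D(v,w,\vartheta,\varphi,\epsilon)|<|\epsilon|^{k}$ as $\epsilon\to\infty$ in any closed subsector of $\mathcal{V}(0)$; (iii) there are relations $$B(v+w,w,\vartheta+\varphi,\varphi,\epsilon)=B(v,w,\vartheta,\varphi,\epsilon)\cdot(1-x)^{-1},$$ $$D(v+w,w,\vartheta+\varphi,\varphi,\epsilon)=D(v,w,\vartheta,\varphi,\epsilon)\cdot B(v+w,w,\vartheta+\varphi,\varphi,\epsilon)^{-1},$$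 for $\epsilon\in\mathbb{C}^*$ lying in the intersection $\mathcal{H}(0)=\mathcal{V}(0)\cap\mathcal{V}(1)$; (iv) for $\epsilon\in -i\cdot\Sigma(0)$ there are relations $$B(v,w,\vartheta,\varphi,\epsilon)\cdot B(v,w,-\vartheta,-\varphi,-\epsilon)=\prod_{n\geq 0}(1-xq^n)\cdot\prod_{n\geq 1}(1-x^{-1}q^n)^{-1},$$ $$D(v,w,\vartheta,\varphi,\epsilon)\cdot D(v,w,-\vartheta,-\varphi,-\epsilon)=\prod_{n\geq 0}(1-xq^n)^n\cdot\prod_{n\geq 1}(1-x^{-1}q^n)^n\cdot\prod_{k\geq 1}(1-q^k)^{-2k}.$$ Here $x=\exp(\vartheta-v/\epsilon)$ and $q=\exp(\varphi-w/\epsilon)$.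
   Context: Rays and sectors. For $(v,w)\in M_+$ and $n\in\mathbb{Z}$ let $\ell_n=\mathbb{R}_{>0}\cdot(v+nw)\subset\mathbb{C}^*$. For a ray $r=\mathbb{R}_{>0}\cdot z\subset\mathbb{C}^*$ let $\mathbb{H}_r=\{uz': u\in r,\ \operatorname{Re}(z')>0\}\subset\mathbb{C}^*$ be the open half-plane centred on it. Let $\Sigma(n)\subset\mathbb{C}^*$ be the convex sector with boundary rays $\ell_{n-1}$ and $\ell_n$, and let $\mathcal{V}(n)=\mathbb{H}_{\ell_{n-1}}\cup\mathbb{H}_{\ell_n}\subset\mathbb{C}^*$. (The region $\mathcal{V}(0)$ formed using $(v+w,w)$ is the region $\mathcal{V}(1)$ formed using $(v,w)$.) Special functions. The functions $F$ and $G$ are defined by the integral representations $$F(z\,|\,\omega_1,\omega_2)=\exp\Big(\int_C\frac{e^{zs}}{(e^{\omega_1 s}-1)(e^{\omega_2 s}-1)}\frac{ds}{s}\Big),\qquad G(z\,|\,\omega_1,\omega_2)=\exp\Big(\int_C\frac{-e^{(z+\omega_1)s}}{(e^{\omega_1 s}-1)^2(e^{\omega_2 s}-1)}\frac{ds}{s}\Big),$$ valid when $\operatorname{Re}(\omega_i)>0$ and $0<\operatorname{Re}(z)<\operatorname{Re}(\omega_1+\omega_2)$, where the contour $C$ follows the real axis from $-\infty$ to $+\infty$, avoiding the origin by a small detour in the upper half-plane; outside this range they are given by analytic continuation. They are invariant under simultaneous rescaling of all variables. Define $$F^*(v,w,\vartheta,\varphi,\epsilon)=F(v-\epsilon\vartheta\,|\,w-\epsilon\varphi,-2\pi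 i\epsilon)\cdot\exp Q_F(v,w,\vartheta,\varphi,\epsilon),$$ $$G^*(v,w,\vartheta,\varphi,\epsilon)=G(v-\epsilon\vartheta\,|\,w-\epsilon\varphi,-2\pi i\epsilon)\cdot\exp Q_G(v,w,\vartheta,\varphi,\epsilon),$$ where, with $\operatorname{Li}_k$ the polylogarithm, $$Q_F(v,w,\vartheta,\varphi,\epsilon)=\frac{1}{\epsilon}\cdot\frac{w-\epsilon\varphi}{(2\pi i)^2}\operatorname{Li}_2(e^{2\pi iv/w})+\Big(\frac{v\varphi-w\vartheta}{2\pi iw}+\frac12\Big)\operatorname{Li}_1(e^{2\pi iv/w}),$$ $$Q_G(v,w,\vartheta,\varphi,\epsilon)=\frac{2}{\epsilon}\cdot\frac{w-\epsilon\varphi}{(2\pi i)^3}\operatorname{Li}_3(e^{2\pi iv/w})-\frac{1}{\epsilon}\cdot\frac{v-\epsilon\vartheta}{(2\pi i)^2}\operatorname{Li}_2(e^{2\pi iv/w})+\frac{1}{\pi i}\Big(\frac{v\varphi-w\vartheta}{2\pi iw}+\frac14\Big)\operatorname{Li}_2(e^{2\pi iv/w})-\frac{v}{w}\Big(\frac{v\varphi-w\vartheta}{2\pi iw}+\frac12\Big)\operatorname{Li}_1(e^{2\pi iv/w}).$$ At $v=0$, $\vartheta=0$ one has (as a limiting value) $Q_G(0,w,0,\varphi,\epsilon)=\frac{2}{\epsilon}\cdot\frac{w-\epsilon\varphi}{(2\pi i)^3}\zeta(3)-\frac{\pi i}{24}$.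
   Formalization: In (iv) the right sides carry explicit factors, equal to 1 when wϑ=vφ, and ε is limited to |q|<1 and (v−εϑ,w−εφ)∈M_+; meromorphy and (iii) omit those ε with (w−εφ)/(−2πiε) real and ≤0, where F and G have a natural boundary. *)

theory Defs
  imports "HOL-Complex_Analysis.Complex_Analysis"
begin

no_notation fps_nth (infixl \<open>$\<close> 75)

subsection \<open>Meromorphic functions of several complex variables\<close>

text \<open>
  The library treats holomorphic and meromorphic functions of one variable only. For an open set \<open>S\<close>
  in \<open>\<complex>\<^sup>n\<close>, holomorphic means real differentiable with complex-linear derivative, and meromorphic
  means being locally a quotient of holomorphic functions whose denominator vanishes on a nowhere
  dense set; as for the library's \<open>meromorphic_on\<close>, the values where the denominator vanishes
  are arbitrary.
\<close>

definition mv_holomorphic_on :: "(complex ^ 'n \<Rightarrow> complex) \<Rightarrow> (complex ^ 'n) set \<Rightarrow> bool" where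
  "mv_holomorphic_on f S \<longleftrightarrow>
     (\<forall>p\<in>S. \<exists>d :: complex ^ 'n. (f has_derivative (\<lambda>h. \<Sum>i\<in>UNIV. d $ i * h $ i)) (at p))"

definition mv_meromorphic_on :: "(complex ^ 'n \<Rightarrow> complex) \<Rightarrow> (complex ^ 'n) set \<Rightarrow> bool" where
  "mv_meromorphic_on f S \<longleftrightarrow>
     (\<forall>p\<in>S. \<exists>U g h. open U \<and> p \<in> U \<and> mv_holomorphic_on g U \<and> mv_holomorphic_on h U \<and>
        interior {q\<in>U. h q = 0} = {} \<and> (\<forall>q\<in>U. h q \<noteq> 0 \<longrightarrow> f q = g q / h q))"

text \<open>
  Counterpart of the library's \<open>nicely_meromorphic_on\<close>: removable singularities are removed, and the
  value at a singular point (where \<open>f\<close> is unbounded nearby) is \<open>0\<close>.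
\<close>

definition mv_nicely_meromorphic_on :: "(complex ^ 'n \<Rightarrow> complex) \<Rightarrow> (complex ^ 'n) set \<Rightarrow> bool" where
  "mv_nicely_meromorphic_on f S \<longleftrightarrow> mv_meromorphic_on f S \<and>
     (\<forall>p\<in>S. (\<exists>U. open U \<and> p \<in> U \<and> mv_holomorphic_on f U) \<or>
            (f p = 0 \<and> (\<forall>U. open U \<longrightarrow> p \<in> U \<longrightarrow> \<not> bounded (f ` U))))"

text \<open>
  The meromorphic function on \<open>S\<close> that agrees with \<open>f\<close> on \<open>V\<close>. When \<open>S\<close> is a connected open set and
  \<open>V\<close> a nonempty open subset, there is at most one up to its values outside \<open>S\<close>.
\<close>

definition mv_continuation ::
  "(complex ^ 'n) set \<Rightarrow> (complex ^ 'n) set \<Rightarrow> (complex ^ 'n \<Rightarrow> complex) \<Rightarrow> complex ^ 'n \<Rightarrow> complex"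
where
  "mv_continuation S V f = (SOME g. mv_nicely_meromorphic_on g S \<and> (\<forall>p\<in>V. g p = f p))"


subsection \<open>The special functions\<close>

text \<open>
  The integral along the real axis with the origin avoided by a detour in the upper half-plane. For
  an integrand with an isolated singularity at \<open>0\<close> the expression below does not depend on \<open>r\<close> once
  \<open>r > 0\<close> is small.
\<close>

definition integral_C :: "(complex \<Rightarrow> complex) \<Rightarrow> complex" where
  "integral_C f = Lim (at_right 0) (\<lambda>r :: real.
     integral {..-r} (\<lambda>t. f (of_real t)) +
     contour_integral (part_circlepath 0 r pi 0) f +
     integral {r..} (\<lambda>t. f (of_real t)))"

definition F_integral :: "complex \<Rightarrow> complex \<Rightarrow> complex \<Rightarrow> complex" where
  "F_integral z \<omega>1 \<omega>2 =
     exp (integral_C (\<lambda>s. exp (z * s) / ((exp (\<omega>1 * s) - 1) * (exp (\<omega>2 * s) - 1)) / s))"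

definition G_integral :: "complex \<Rightarrow> complex \<Rightarrow> complex \<Rightarrow> complex" where
  "G_integral z \<omega>1 \<omega>2 =
     exp (integral_C (\<lambda>s. - exp ((z + \<omega>1) * s) / ((exp (\<omega>1 * s) - 1)\<^sup>2 * (exp (\<omega>2 * s) - 1)) / s))"

definition integral_range :: "(complex ^ 3) set" where
  "integral_range = {p. Re (p $ 2) > 0 \<and> Re (p $ 3) > 0 \<and> 0 < Re (p $ 1) \<and> Re (p $ 1) < Re (p $ 2 + p $ 3)}"

text \<open>
  The largest domain to which both functions extend: they have a natural boundary where
  \<open>\<omega>1 / \<omega>2\<close> is a negative real number. Since \<open>x / 0 = 0\<close>, the condition includes
  \<open>\<omega>1 \<noteq> 0\<close> and \<open>\<omega>2 \<noteq> 0\<close>.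
\<close>

definition FG_domain :: "(complex ^ 3) set" where
  "FG_domain = {p. p $ 2 / p $ 3 \<notin> \<real>\<^sub>\<le>\<^sub>0}"

definition F_fun :: "complex \<Rightarrow> complex \<Rightarrow> complex \<Rightarrow> complex" where
  "F_fun z \<omega>1 \<omega>2 =
     mv_continuation FG_domain integral_range (\<lambda>p. F_integral (p $ 1) (p $ 2) (p $ 3)) (vector [z, \<omega>1, \<omega>2])"

definition G_fun :: "complex \<Rightarrow> complex \<Rightarrow> complex \<Rightarrow> complex" where
  "G_fun z \<omega>1 \<omega>2 =
     mv_continuation FG_domain integral_range (\<lambda>p. G_integral (p $ 1) (p $ 2) (p $ 3)) (vector [z, \<omega>1, \<omega>2])"

text \<open>
  The series converges for \<open>norm z < 1\<close>, and for \<open>norm z \<le> 1\<close> if \<open>k \<ge> 2\<close>. No other arguments matter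
  here, because \<open>norm (exp (2 * pi * \<i> * v / w)) < 1\<close> when \<open>Im (v / w) > 0\<close>.
\<close>

definition Li :: "nat \<Rightarrow> complex \<Rightarrow> complex" where
  "Li k z = (\<Sum>n. z ^ Suc n / of_nat (Suc n) ^ k)"

definition Q_F :: "complex \<Rightarrow> complex \<Rightarrow> complex \<Rightarrow> complex \<Rightarrow> complex \<Rightarrow> complex" where
  "Q_F v w \<theta> \<phi> \<epsilon> =
     1 / \<epsilon> * ((w - \<epsilon> * \<phi>) / (2 * pi * \<i>)\<^sup>2) * Li 2 (exp (2 * pi * \<i> * v / w)) +
     ((v * \<phi> - w * \<theta>) / (2 * pi * \<i> * w) + 1 / 2) * Li 1 (exp (2 * pi * \<i> * v / w))"

text \<open>
  At \<open>v = 0\<close>, \<open>\<theta> = 0\<close> the divergent series \<open>Li 1 1\<close> is multiplied by \<open>v / w = 0\<close>, so that the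
  formula yields the limiting value; see \<open>Q_G_at_0\<close> below.
\<close>

definition Q_G :: "complex \<Rightarrow> complex \<Rightarrow> complex \<Rightarrow> complex \<Rightarrow> complex \<Rightarrow> complex" where
  "Q_G v w \<theta> \<phi> \<epsilon> =
     2 / \<epsilon> * ((w - \<epsilon> * \<phi>) / (2 * pi * \<i>) ^ 3) * Li 3 (exp (2 * pi * \<i> * v / w)) -
     1 / \<epsilon> * ((v - \<epsilon> * \<theta>) / (2 * pi * \<i>)\<^sup>2) * Li 2 (exp (2 * pi * \<i> * v / w)) +
     1 / (pi * \<i>) * ((v * \<phi> - w * \<theta>) / (2 * pi * \<i> * w) + 1 / 4) * Li 2 (exp (2 * pi * \<i> * v / w)) -
     v / w * ((v * \<phi> - w * \<theta>) / (2 * pi * \<i> * w) + 1 / 2) * Li 1 (exp (2 * pi * \<i> * v / w))"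

lemma Li_2_1: "Li 2 1 = of_real (pi\<^sup>2 / 6)"
proof -
  have "(\<lambda>n. of_real (1 / (real n + 1)\<^sup>2) :: complex) sums of_real (pi\<^sup>2 / 6)"
    by (rule sums_of_real) (use inverse_squares_sums in \<open>simp add: add.commute\<close>)
  moreover have "(\<lambda>n. of_real (1 / (real n + 1)\<^sup>2)) = (\<lambda>n. (1 :: complex) ^ Suc n / of_nat (Suc n) ^ 2)"
    by (simp add: fun_eq_iff add.commute)
  ultimately show ?thesis
    unfolding Li_def by (simp only: sums_iff)
qed

lemma Q_G_at_0: "Q_G 0 w 0 \<phi> \<epsilon> = 2 / \<epsilon> * ((w - \<epsilon> * \<phi>) / (2 * pi * \<i>) ^ 3) * Li 3 1 - pi * \<i> / 24"
proof -
  have "1 / (of_real pi * \<i>) * (1 / 4) * of_real (pi\<^sup>2 / 6) = - (of_real pi * \<i> / 24)"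
    by (simp add: complex_eq_iff Re_divide Im_divide power2_eq_square)
  then show ?thesis
    by (simp add: Q_G_def Li_2_1)
qed

definition F_star :: "complex \<Rightarrow> complex \<Rightarrow> complex \<Rightarrow> complex \<Rightarrow> complex \<Rightarrow> complex" where
  "F_star v w \<theta> \<phi> \<epsilon> = F_fun (v - \<epsilon> * \<theta>) (w - \<epsilon> * \<phi>) (- (2 * pi * \<i> * \<epsilon>)) * exp (Q_F v w \<theta> \<phi> \<epsilon>)"

definition G_star :: "complex \<Rightarrow> complex \<Rightarrow> complex \<Rightarrow> complex \<Rightarrow> complex \<Rightarrow> complex" where
  "G_star v w \<theta> \<phi> \<epsilon> = G_fun (v - \<epsilon> * \<theta>) (w - \<epsilon> * \<phi>) (- (2 * pi * \<i> * \<epsilon>)) * exp (Q_G v w \<theta> \<phi> \<epsilon>)"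


subsection \<open>Rays and sectors\<close>

definition M_plus :: "(complex \<times> complex) set" where
  "M_plus = {(v, w). w \<noteq> 0 \<and> Im (v / w) > 0}"

definition ray :: "complex \<Rightarrow> complex set" where
  "ray z = {of_real t * z | t. t > 0}"

definition half_plane :: "complex set \<Rightarrow> complex set" where
  "half_plane r = {u * z | u z. u \<in> r \<and> Re z > 0}"

definition ell :: "complex \<Rightarrow> complex \<Rightarrow> int \<Rightarrow> complex set" where
  "ell v w n = ray (v + of_int n * w)"

text \<open>The open convex cone spanned by the two boundary rays.\<close>

definition Sigma_sector :: "complex \<Rightarrow> complex \<Rightarrow> int \<Rightarrow> complex set" where
  "Sigma_sector v w n = {a + b | a b. a \<in> ell v w (n - 1) \<and> b \<in> ell v w n}"

definition V_region :: "complex \<Rightarrow> complex \<Rightarrow> int \<Rightarrow> complex set" where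
  "V_region v w n = half_plane (ell v w (n - 1)) \<union> half_plane (ell v w n)"

definition H_region :: "complex \<Rightarrow> complex \<Rightarrow> int \<Rightarrow> complex set" where
  "H_region v w n = V_region v w n \<inter> V_region v w (n + 1)"

definition closed_sector :: "real \<Rightarrow> real \<Rightarrow> complex set" where
  "closed_sector a b = {of_real r * cis t | r t. r > 0 \<and> a \<le> t \<and> t \<le> b}"

definition closed_subsector :: "complex set \<Rightarrow> complex set \<Rightarrow> bool" where
  "closed_subsector S U \<longleftrightarrow> S \<subseteq> U \<and> (\<exists>a b. a \<le> b \<and> S = closed_sector a b)"

text \<open>
  The parameters \<open>\<epsilon>\<close> for which \<open>(v - \<epsilon>\<theta>, w - \<epsilon>\<phi>, -2\<pi>i\<epsilon>)\<close> lies in the domain of \<open>F\<close> and \<open>G\<close>.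
\<close>

definition admissible :: "complex \<Rightarrow> complex \<Rightarrow> complex set" where
  "admissible w \<phi> = {\<epsilon>. (w - \<epsilon> * \<phi>) / (- (2 * pi * \<i> * \<epsilon>)) \<notin> \<real>\<^sub>\<le>\<^sub>0}"


subsection \<open>Generic parameters\<close>

text \<open>
  As \<open>\<epsilon>\<close> tends to infinity, the rescaled arguments \<open>(v/\<epsilon> - \<theta>, w/\<epsilon> - \<phi>, -2\<pi>i)\<close> tend to
  \<open>(-\<theta>, -\<phi>, -2\<pi>i)\<close>. For generic \<open>(\<theta>, \<phi>)\<close> this limit lies in the domain of \<open>F\<close> and \<open>G\<close>, and off
  their zeros and poles, which are contained in the hyperplanes \<open>z = a \<omega>1 + b \<omega>2\<close> with
  integers \<open>a\<close>, \<open>b\<close>.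
\<close>

definition generic :: "complex \<Rightarrow> complex \<Rightarrow> bool" where
  "generic \<theta> \<phi> \<longleftrightarrow> \<phi> / (2 * pi * \<i>) \<notin> \<real>\<^sub>\<le>\<^sub>0 \<and>
     (\<forall>a b :: int. \<theta> \<noteq> of_int a * \<phi> + of_int b * (2 * pi * \<i>))"

lemma negligible_not_generic: "negligible {(\<theta>, \<phi>). \<not> generic \<theta> \<phi>}"
proof -
  let ?H = "\<lambda>a :: int. {p :: complex \<times> complex. (1, - of_int a) \<bullet> p = 0}"
  let ?H' = "{p :: complex \<times> complex. (0, 1) \<bullet> p = 0}"
  have "negligible (?H a)" for a
    by (rule negligible_hyperplane) (simp add: zero_prod_def)
  moreover have "negligible ?H'"
    by (rule negligible_hyperplane) (simp add: zero_prod_def)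
  ultimately have "negligible (\<Union> (insert ?H' (range ?H)))"
    by (intro negligible_countable_Union) auto
  moreover have "{(\<theta>, \<phi>). \<not> generic \<theta> \<phi>} \<subseteq> \<Union> (insert ?H' (range ?H))"
  proof (clarify, rule ccontr)
    fix \<theta> \<phi> assume *: "\<not> generic \<theta> \<phi>" and **: "(\<theta>, \<phi>) \<notin> \<Union> (insert ?H' (range ?H))"
    from ** have re: "Re \<phi> \<noteq> 0" "\<And>a :: int. Re \<theta> \<noteq> of_int a * Re \<phi>"
      by (auto simp: inner_prod_def inner_complex_def)
    have "\<theta> \<noteq> of_int a * \<phi> + of_int b * (2 * pi * \<i>)" for a b :: int
      using re(2)[of a] by (auto simp: complex_eq_iff)
    moreover have "Im (\<phi> / (2 * pi * \<i>)) \<noteq> 0"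
      using re(1) by (simp add: Im_divide power2_eq_square)
    then have "\<phi> / (2 * pi * \<i>) \<notin> \<real>\<^sub>\<le>\<^sub>0"
      by (auto simp: complex_nonpos_Reals_iff)
    ultimately show False
      using * by (simp add: generic_def)
  qed
  ultimately show ?thesis
    by (rule negligible_subset)
qed


subsection \<open>The solution\<close>

definition sol_B :: "complex \<Rightarrow> complex \<Rightarrow> complex \<Rightarrow> complex \<Rightarrow> complex \<Rightarrow> complex" where
  "sol_B v w \<theta> \<phi> \<epsilon> = F_star v w \<theta> \<phi> \<epsilon>"

definition sol_D :: "complex \<Rightarrow> complex \<Rightarrow> complex \<Rightarrow> complex \<Rightarrow> complex \<Rightarrow> complex" where
  "sol_D v w \<theta> \<phi> \<epsilon> = G_star v w \<theta> \<phi> \<epsilon> * inverse (G_star 0 w 0 \<phi> \<epsilon>)"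

text \<open>
  The points \<open>(v, w, \<theta>, \<phi>, \<epsilon>)\<close> at which the problem is posed, as a subset of \<open>\<complex>\<^sup>5\<close>. By
  \<open>admissible\<close> it excludes the points where \<open>(w - \<epsilon>\<phi>) / (-2\<pi>i\<epsilon>)\<close> is a nonpositive real number;
  for \<open>\<phi> \<noteq> 0\<close> these can lie in \<open>V_region v w 0\<close>.
\<close>

definition BD_domain :: "(complex ^ 5) set" where
  "BD_domain = {p. (p $ 1, p $ 2) \<in> M_plus \<and> p $ 5 \<in> V_region (p $ 1) (p $ 2) 0 \<inter> admissible (p $ 2) (p $ 4)}"

definition uncurry5 ::
  "(complex \<Rightarrow> complex \<Rightarrow> complex \<Rightarrow> complex \<Rightarrow> complex \<Rightarrow> complex) \<Rightarrow> complex ^ 5 \<Rightarrow> complex" where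
  "uncurry5 f p = f (p $ 1) (p $ 2) (p $ 3) (p $ 4) (p $ 5)"

text \<open>
  The exponents \<open>Q_F\<close> and \<open>Q_G\<close> involve polylogarithms at \<open>exp (2\<pi>i v/w)\<close>, while the reflection
  formulas for \<open>F\<close> and \<open>G\<close> produce them at \<open>exp (2\<pi>i (v - \<epsilon>\<theta>)/(w - \<epsilon>\<phi>))\<close>. The two factors below
  account for the difference in the relations for \<open>\<epsilon> \<leftrightarrow> -\<epsilon>\<close>. They tend to \<open>1\<close> as \<open>\<epsilon> \<rightarrow> 0\<close>, and
  they are identically \<open>1\<close> precisely when \<open>w\<theta> = v\<phi>\<close>. The series
  in the second one converge where \<open>(v - \<epsilon>\<theta>, w - \<epsilon>\<phi>)\<close> belongs to \<open>M_plus\<close>.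
\<close>

definition reflection_factor_B :: "complex \<Rightarrow> complex \<Rightarrow> complex \<Rightarrow> complex \<Rightarrow> complex \<Rightarrow> complex" where
  "reflection_factor_B v w \<theta> \<phi> \<epsilon> =
     (let u0 = v / w; u = (v - \<epsilon> * \<theta>) / (w - \<epsilon> * \<phi>)
      in (1 - exp (2 * pi * \<i> * u)) / (1 - exp (2 * pi * \<i> * u0)))"

definition reflection_factor_D :: "complex \<Rightarrow> complex \<Rightarrow> complex \<Rightarrow> complex \<Rightarrow> complex \<Rightarrow> complex" where
  "reflection_factor_D v w \<theta> \<phi> \<epsilon> =
     (let u0 = v / w; u = (v - \<epsilon> * \<theta>) / (w - \<epsilon> * \<phi>); y0 = exp (2 * pi * \<i> * u0); y = exp (2 * pi * \<i> * u)
      in exp ((Li 2 y0 - Li 2 y) / (2 * pi * \<i>) - (u0 * Li 1 y0 - u * Li 1 y)))"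

lemma
  assumes "(v, w) \<in> M_plus" and "w * \<theta> = v * \<phi>" and "norm (exp (\<phi> - w / \<epsilon>)) < 1"
  shows M_plus_shift: "(v - \<epsilon> * \<theta>, w - \<epsilon> * \<phi>) \<in> M_plus"
    and reflection_factor_B_eq_1: "reflection_factor_B v w \<theta> \<phi> \<epsilon> = 1"
    and reflection_factor_D_eq_1: "reflection_factor_D v w \<theta> \<phi> \<epsilon> = 1"
proof -
  have w: "w \<noteq> 0" "Im (v / w) > 0"
    using assms(1) by (auto simp: M_plus_def)
  have ne: "w - \<epsilon> * \<phi> \<noteq> 0"
  proof
    assume "w - \<epsilon> * \<phi> = 0"
    then have "\<phi> - w / \<epsilon> = 0"
      using w by (cases "\<epsilon> = 0") (auto simp: field_simps)
    then show False
      using assms(3) by simp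
  qed
  have "w * (v - \<epsilon> * \<theta>) = v * (w - \<epsilon> * \<phi>)"
    using assms(2) by algebra
  then have eq: "(v - \<epsilon> * \<theta>) / (w - \<epsilon> * \<phi>) = v / w"
    using ne w by (simp add: field_simps)
  show "(v - \<epsilon> * \<theta>, w - \<epsilon> * \<phi>) \<in> M_plus"
    using ne w eq by (simp add: M_plus_def)
  have "norm (exp (2 * pi * \<i> * (v / w))) < 1"
    using w(2) by (simp del: times_divide_eq_right add: mult.assoc)
  then have "exp (2 * pi * \<i> * (v / w)) \<noteq> 1"
    by (metis norm_one less_irrefl)
  then show "reflection_factor_B v w \<theta> \<phi> \<epsilon> = 1"
    unfolding reflection_factor_B_def Let_def eq by simp
  show "reflection_factor_D v w \<theta> \<phi> \<epsilon> = 1"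
    unfolding reflection_factor_D_def Let_def eq by simp
qed

end

theory Submission
  imports Defs
begin

text \<open>
  After rotating all arguments into the right half-plane, \<open>F\<close> and \<open>G\<close> are exponentials of integrals of
  \<open>exp (z s) / ((exp (a s) - 1)\<^sup>m (exp (b s) - 1)\<^sup>n s\<^sup>k)\<close> over a horizontal line just above the real axis.
  Moving the line across the poles gives the functional equations for the shifts of \<open>z\<close> by \<open>a\<close>
  and \<open>b\<close>; the former continue the functions from the half-planes to their full domain and yield the
  difference relations. Where \<open>n = 0\<close> the integrals are polylogarithms. Expanding \<open>1 / (exp (b s) - 1)\<close>
  for small \<open>b\<close> therefore produces \<open>Q_F\<close> and \<open>Q_G\<close> and the limits as \<open>\<epsilon> \<rightarrow> 0\<close>, while growth at infinity is
  continuity at the rescaled limit point. For the reflection formulas, \<open>z\<close> is translated repeatedly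
  by \<open>a - b\<close> for the pair \<open>(a, b)\<close> and by \<open>- a - b\<close> for the pair \<open>(a, - b)\<close>: the functions tend to \<open>1\<close>, and the factors
  that are collected form the infinite products.
\<close>

subsection \<open>Holomorphic and meromorphic functions of several variables\<close>

text \<open>Replacing (\<theta>, \<phi>, \<epsilon>) by its negative keeps
  \<open>z = v - \<epsilon> * \<theta>\<close> and \<open>a = w - \<epsilon> * \<phi>\<close> and
  only turns \<open>b\<close> into \<open>- b\<close>; this is why the reflection formulas concern
  the pairs \<open>(a, b)\<close> and \<open>(a, - b)\<close>. The translations \<open>a - b\<close>
  and \<open>- a - b\<close> are chosen because each costs one shift by either period, and because
  one rotation makes the translation vertical while both periods get the same positive real part.
  The integrals need both periods in the right half-plane, whereas the domain only asks that
  \<open>a / b\<close> avoid the nonpositive reals; a square root of \<open>a / b\<close> supplies a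
  rescaling that depends holomorphically on the point. As the special functions are chosen by
  \<open>SOME\<close>, every explicit formula reaches them through uniqueness of continuation.
  Translating \<open>G\<close> by \<open>n\<close> steps collects an \<open>n\<close>-th power of
  \<open>F\<close>. Plain convergence of \<open>F\<close> to \<open>1\<close> is then too weak, and
  a rate better than \<open>1 / n\<close> is carried along. The normalising value of
  \<open>G\<close> at \<open>z = 0\<close> lies on the zero lattice of the shift factors, so that
  the generic argument does not reach it and a separate limit is taken there.\<close>

definition mv_deriv :: "(complex ^ 'n \<Rightarrow> complex) \<Rightarrow> (complex ^ 'n \<Rightarrow> complex) \<Rightarrow> complex ^ 'n \<Rightarrow> bool" where
  "mv_deriv f D p \<longleftrightarrow> (f has_derivative D) (at p) \<and> (\<forall>h. D (\<i> *s h) = \<i> * D h)"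

lemma scaleR_eq_scalar_mult: "r *\<^sub>R (h :: complex ^ 'n) = of_real r *s h"
  by (simp only: vec_eq_iff vector_scaleR_component) (simp add: scaleR_conv_of_real)

lemma mv_deriv_scale:
  assumes "mv_deriv f D p"
  shows "D (c *s h) = c * D h"
proof -
  have lin: "linear D" and D: "\<And>h. D (\<i> *s h) = \<i> * D h"
    using assms by (auto simp: mv_deriv_def has_derivative_def bounded_linear.linear)
  have "c *s h = Re c *\<^sub>R h + Im c *\<^sub>R (\<i> *s h)"
    unfolding scaleR_eq_scalar_mult
    by (subst complex_eq[of c]) (simp add: vec_eq_iff algebra_simps)
  then have "D (c *s h) = Re c *\<^sub>R D h + Im c *\<^sub>R (\<i> * D h)"
    by (simp add: linear_add[OF lin] linear_scale[OF lin] D)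
  also have "\<dots> = c * D h"
    by (simp add: complex_eq_iff scaleR_conv_of_real algebra_simps)
  finally show ?thesis .
qed

lemma mv_deriv_mult_scalar:
  "(f has_derivative (\<lambda>h. \<Sum>i\<in>UNIV. d $ i * h $ i)) (at p) \<Longrightarrow>
     mv_deriv f (\<lambda>h. \<Sum>i\<in>UNIV. d $ i * h $ i) p"
  by (auto simp: mv_deriv_def sum_distrib_left algebra_simps)

lemma mv_deriv_imp_sum:
  fixes f :: "complex ^ 'n \<Rightarrow> complex"
  assumes "mv_deriv f D p"
  shows "D h = (\<Sum>i\<in>UNIV. D (axis i 1) * h $ i)"
proof -
  have lin: "linear D"
    using assms by (auto simp: mv_deriv_def has_derivative_def bounded_linear.linear)
  have "h = (\<Sum>i\<in>UNIV. h $ i *s axis i 1)"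
    by (simp add: basis_expansion)
  then have "D h = (\<Sum>i\<in>UNIV. D (h $ i *s axis i 1))"
    by (metis linear_sum[OF lin, of "\<lambda>i. h $ i *s axis i 1" UNIV])
  then show ?thesis
    by (simp add: mv_deriv_scale[OF assms] mult.commute)
qed

text \<open>Complex linearity amounts to commuting with \<open>\<i>\<close>. In this form no
  coefficients have to be tracked through sums, products and compositions; they are recovered as the
  values on the axes.\<close>

lemma mv_holomorphic_on_iff: "mv_holomorphic_on f S \<longleftrightarrow> (\<forall>p\<in>S. \<exists>D. mv_deriv f D p)"
proof
  assume "mv_holomorphic_on f S"
  then show "\<forall>p\<in>S. \<exists>D. mv_deriv f D p"
    unfolding mv_holomorphic_on_def using mv_deriv_mult_scalar by fast
next
  assume *: "\<forall>p\<in>S. \<exists>D. mv_deriv f D p"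
  show "mv_holomorphic_on f S"
    unfolding mv_holomorphic_on_def
  proof
    fix p assume "p \<in> S"
    with * obtain D where D: "mv_deriv f D p" by auto
    then have "D = (\<lambda>h. \<Sum>i\<in>UNIV. (\<chi> i. D (axis i 1)) $ i * h $ i)"
      by (intro ext) (simp add: mv_deriv_imp_sum[OF D, symmetric])
    with D have "(f has_derivative (\<lambda>h. \<Sum>i\<in>UNIV. (\<chi> i. D (axis i 1)) $ i * h $ i)) (at p)"
      unfolding mv_deriv_def by metis
    then show "\<exists>d. (f has_derivative (\<lambda>h. \<Sum>i\<in>UNIV. d $ i * h $ i)) (at p)" by blast
  qed
qed

lemma mv_holomorphic_on_continuous: "mv_holomorphic_on f S \<Longrightarrow> p \<in> S \<Longrightarrow> isCont f p"
  unfolding mv_holomorphic_on_iff mv_deriv_def using has_derivative_continuous by blast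

lemma mv_holomorphic_on_subset: "mv_holomorphic_on f S \<Longrightarrow> T \<subseteq> S \<Longrightarrow> mv_holomorphic_on f T"
  unfolding mv_holomorphic_on_def by blast

lemma mv_holomorphic_on_cong:
  assumes "mv_holomorphic_on f S" "open S" "\<And>p. p \<in> S \<Longrightarrow> f p = g p"
  shows "mv_holomorphic_on g S"
  using assms unfolding mv_holomorphic_on_def
  by (meson has_derivative_transform_within_open)

lemma mv_holomorphic_on_Union:
  "(\<And>p. p \<in> S \<Longrightarrow> \<exists>U. p \<in> U \<and> mv_holomorphic_on f U) \<Longrightarrow> mv_holomorphic_on f S"
  unfolding mv_holomorphic_on_def by blast

named_theorems mv_intros

lemma mv_holomorphic_on_const [mv_intros]: "mv_holomorphic_on (\<lambda>p. c) S"
  unfolding mv_holomorphic_on_iff mv_deriv_def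
  by (intro ballI exI[of _ "\<lambda>_. 0"]) auto

lemma mv_holomorphic_on_component [mv_intros]: "mv_holomorphic_on (\<lambda>p. p $ i) S"
  unfolding mv_holomorphic_on_iff mv_deriv_def
  by (intro ballI exI[of _ "\<lambda>h. h $ i"])
     (auto intro!: bounded_linear_imp_has_derivative bounded_linear_vec_nth)

lemma mv_holomorphic_on_add [mv_intros]:
  "mv_holomorphic_on f S \<Longrightarrow> mv_holomorphic_on g S \<Longrightarrow> mv_holomorphic_on (\<lambda>p. f p + g p) S"
  unfolding mv_holomorphic_on_iff mv_deriv_def
proof
  fix p assume "\<forall>p\<in>S. \<exists>D. (f has_derivative D) (at p) \<and> (\<forall>h. D (\<i> *s h) = \<i> * D h)"
    "\<forall>p\<in>S. \<exists>D. (g has_derivative D) (at p) \<and> (\<forall>h. D (\<i> *s h) = \<i> * D h)" "p \<in> S"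
  then obtain D E where "(f has_derivative D) (at p)" "(g has_derivative E) (at p)"
    "\<forall>h. D (\<i> *s h) = \<i> * D h" "\<forall>h. E (\<i> *s h) = \<i> * E h"
    by blast
  then show "\<exists>D. ((\<lambda>p. f p + g p) has_derivative D) (at p) \<and> (\<forall>h. D (\<i> *s h) = \<i> * D h)"
    by (intro exI[of _ "\<lambda>h. D h + E h"]) (auto intro!: derivative_eq_intros simp: algebra_simps)
qed

lemma mv_holomorphic_on_mult [mv_intros]:
  "mv_holomorphic_on f S \<Longrightarrow> mv_holomorphic_on g S \<Longrightarrow> mv_holomorphic_on (\<lambda>p. f p * g p) S"
  unfolding mv_holomorphic_on_iff mv_deriv_def
proof
  fix p assume "\<forall>p\<in>S. \<exists>D. (f has_derivative D) (at p) \<and> (\<forall>h. D (\<i> *s h) = \<i> * D h)"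
    "\<forall>p\<in>S. \<exists>D. (g has_derivative D) (at p) \<and> (\<forall>h. D (\<i> *s h) = \<i> * D h)" "p \<in> S"
  then obtain D E where "(f has_derivative D) (at p)" "(g has_derivative E) (at p)"
    "\<forall>h. D (\<i> *s h) = \<i> * D h" "\<forall>h. E (\<i> *s h) = \<i> * E h"
    by blast
  then show "\<exists>D. ((\<lambda>p. f p * g p) has_derivative D) (at p) \<and> (\<forall>h. D (\<i> *s h) = \<i> * D h)"
    by (intro exI[of _ "\<lambda>h. f p * E h + D h * g p"]) (auto intro!: derivative_eq_intros simp: algebra_simps)
qed

lemma mv_holomorphic_on_compose:
  fixes f :: "complex ^ 'n \<Rightarrow> complex" and h :: "complex \<Rightarrow> complex"
  assumes f: "mv_holomorphic_on f S" and h: "h holomorphic_on T" and T: "open T" "f ` S \<subseteq> T"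
  shows "mv_holomorphic_on (\<lambda>p. h (f p)) S"
  unfolding mv_holomorphic_on_iff
proof
  fix p assume p: "p \<in> S"
  with f obtain D where D: "(f has_derivative D) (at p)" "\<forall>h. D (\<i> *s h) = \<i> * D h"
    unfolding mv_holomorphic_on_iff mv_deriv_def by blast
  have "(h has_field_derivative deriv h (f p)) (at (f p))"
    using p T h holomorphic_derivI by blast
  then have "(h has_derivative ((*) (deriv h (f p)))) (at (f p))"
    by (simp add: has_field_derivative_def)
  from has_derivative_compose[OF D(1) this]
  have "((\<lambda>p. h (f p)) has_derivative (\<lambda>x. deriv h (f p) * D x)) (at p)" .
  then show "\<exists>D. mv_deriv (\<lambda>p. h (f p)) D p"
    using D(2) by (auto simp: mv_deriv_def algebra_simps)
qed

lemma mv_holomorphic_on_exp [mv_intros]: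
  "mv_holomorphic_on f S \<Longrightarrow> mv_holomorphic_on (\<lambda>p. exp (f p)) S"
  by (rule mv_holomorphic_on_compose[of _ _ exp UNIV]) (auto intro: holomorphic_intros)

lemma mv_holomorphic_on_uminus [mv_intros]:
  "mv_holomorphic_on f S \<Longrightarrow> mv_holomorphic_on (\<lambda>p. - f p) S"
  by (rule mv_holomorphic_on_compose[of _ _ uminus UNIV]) (auto intro: holomorphic_intros)

lemma mv_holomorphic_on_power [mv_intros]:
  "mv_holomorphic_on f S \<Longrightarrow> mv_holomorphic_on (\<lambda>p. f p ^ k) S"
  by (rule mv_holomorphic_on_compose[of _ _ "\<lambda>x. x ^ k" UNIV]) (auto intro: holomorphic_intros)

lemma mv_holomorphic_on_diff [mv_intros]:
  "mv_holomorphic_on f S \<Longrightarrow> mv_holomorphic_on g S \<Longrightarrow> mv_holomorphic_on (\<lambda>p. f p - g p) S"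
  using mv_holomorphic_on_add[of f S "\<lambda>p. - g p"] mv_holomorphic_on_uminus[of g S] by simp

lemma mv_holomorphic_on_inverse [mv_intros]:
  "mv_holomorphic_on f S \<Longrightarrow> (\<And>p. p \<in> S \<Longrightarrow> f p \<noteq> 0) \<Longrightarrow> mv_holomorphic_on (\<lambda>p. inverse (f p)) S"
  by (rule mv_holomorphic_on_compose[of _ _ inverse "-{0}"]) (auto intro: holomorphic_intros)

lemma mv_holomorphic_on_divide [mv_intros]:
  "mv_holomorphic_on f S \<Longrightarrow> mv_holomorphic_on g S \<Longrightarrow> (\<And>p. p \<in> S \<Longrightarrow> g p \<noteq> 0) \<Longrightarrow>
     mv_holomorphic_on (\<lambda>p. f p / g p) S"
  unfolding divide_inverse by (intro mv_intros)

lemma mv_holomorphic_on_prod [mv_intros]: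
  "(\<And>i. i \<in> I \<Longrightarrow> mv_holomorphic_on (f i) S) \<Longrightarrow> mv_holomorphic_on (\<lambda>p. \<Prod>i\<in>I. f i p) S"
  by (induction I rule: infinite_finite_induct) (auto intro!: mv_intros)

lemma mv_holomorphic_on_compose_vec:
  fixes f :: "complex ^ 'n \<Rightarrow> complex" and \<phi> :: "complex ^ 'm \<Rightarrow> complex ^ 'n"
  assumes f: "mv_holomorphic_on f T" and \<phi>: "\<And>i. mv_holomorphic_on (\<lambda>p. \<phi> p $ i) S" "\<phi> ` S \<subseteq> T"
  shows "mv_holomorphic_on (\<lambda>p. f (\<phi> p)) S"
  unfolding mv_holomorphic_on_iff
proof
  fix p assume p: "p \<in> S"
  with f \<phi>(2) obtain D where D: "mv_deriv f D (\<phi> p)"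
    unfolding mv_holomorphic_on_iff by blast
  from \<phi>(1) p have "\<forall>i. \<exists>E. mv_deriv (\<lambda>p. \<phi> p $ i) E p"
    unfolding mv_holomorphic_on_iff by blast
  then obtain E where E: "\<And>i. mv_deriv (\<lambda>p. \<phi> p $ i) (E i) p" by metis
  define F where "F h = (\<chi> i. E i h)" for h
  have "(\<phi> has_derivative F) (at p)"
    unfolding F_def
  proof (subst has_derivative_componentwise_within, intro ballI)
    fix b :: "complex ^ 'n" assume "b \<in> Basis"
    then obtain i c where b: "b = axis i c" by (auto simp: Basis_vec_def)
    have "((\<lambda>x. (\<phi> x $ i) \<bullet> c) has_derivative (\<lambda>h. E i h \<bullet> c)) (at p)"
      using E[of i] unfolding mv_deriv_def by (auto intro!: derivative_eq_intros)
    then show "((\<lambda>x. \<phi> x \<bullet> b) has_derivative (\<lambda>x. (\<chi> i. E i x) \<bullet> b)) (at p)"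
      by (simp add: b inner_axis)
  qed
  moreover have "(f has_derivative D) (at (\<phi> p))" using D by (simp add: mv_deriv_def)
  ultimately have "((\<lambda>p. f (\<phi> p)) has_derivative (\<lambda>h. D (F h))) (at p)"
    using has_derivative_compose by blast
  moreover have "F (\<i> *s h) = \<i> *s F h" for h
    using E by (simp add: F_def vec_eq_iff mv_deriv_def)
  ultimately show "\<exists>D. mv_deriv (\<lambda>p. f (\<phi> p)) D p"
    unfolding mv_deriv_def using mv_deriv_scale[OF D] by auto
qed

text \<open>The parameter is regarded as a point of \<open>complex ^ 1\<close>, so that the chain
  rule for vector-valued maps applies. Restriction to complex lines then makes the one-variable
  theory available.\<close>

lemma mv_holomorphic_on_compose_curve:
  fixes f :: "complex ^ 'n \<Rightarrow> complex" and \<phi> :: "complex \<Rightarrow> complex ^ 'n"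
  assumes f: "mv_holomorphic_on f T" and \<phi>: "\<And>i. (\<lambda>p. \<phi> p $ i) holomorphic_on S" "\<phi> ` S \<subseteq> T"
    and S: "open S"
  shows "(\<lambda>p. f (\<phi> p)) holomorphic_on S"
proof -
  have "mv_holomorphic_on (\<lambda>p :: complex ^ 1. f (\<phi> (p $ 1))) {p. p $ 1 \<in> S}"
    by (rule mv_holomorphic_on_compose_vec[OF f])
       (use \<phi> S in \<open>auto intro!: mv_holomorphic_on_compose[of "\<lambda>p. p $ 1"] mv_intros\<close>)
  show ?thesis
  proof (rule holomorphic_onI, goal_cases)
    case (1 x)
    with \<open>mv_holomorphic_on (\<lambda>p :: complex ^ 1. f (\<phi> (p $ 1))) {p. p $ 1 \<in> S}\<close>
    obtain D where D: "mv_deriv (\<lambda>p :: complex ^ 1. f (\<phi> (p $ 1))) D (vec x)"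
      unfolding mv_holomorphic_on_iff by force
    have "linear (vec :: complex \<Rightarrow> complex ^ 1)"
      by (intro linearI) (simp_all add: vec_eq_iff)
    then have "((vec :: complex \<Rightarrow> complex ^ 1) has_derivative vec) (at x)"
      by (intro bounded_linear_imp_has_derivative) (simp add: linear_conv_bounded_linear)
    from has_derivative_compose[OF this, of "\<lambda>p :: complex ^ 1. f (\<phi> (p $ 1))" D]
    have "((\<lambda>x. f (\<phi> x)) has_derivative (\<lambda>h. D (vec h))) (at x)"
      using D by (simp add: mv_deriv_def)
    moreover have "D (vec h) = D (vec 1) * h" for h
    proof -
      have "vec h = h *s (vec 1 :: complex ^ 1)" by (simp add: vec_eq_iff)
      then show ?thesis using mv_deriv_scale[OF D, of h "vec 1"] by (simp add: mult.commute)
    qed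
    ultimately have "((\<lambda>x. f (\<phi> x)) has_field_derivative D (vec 1)) (at x)"
      unfolding has_field_derivative_def by simp
    then show ?case
      using field_differentiable_at_within field_differentiable_def by blast
  qed
qed

section \<open>Identity theorem and uniqueness of continuation\<close>

lemma mv_identity_theorem:
  fixes f :: "complex ^ 'n \<Rightarrow> complex"
  assumes f: "mv_holomorphic_on f B" and B: "open B" "convex B"
    and W: "open W" "W \<noteq> {}" "W \<subseteq> B" "\<And>p. p \<in> W \<Longrightarrow> f p = 0" and q: "q \<in> B"
  shows "f q = 0"
proof -
  from W obtain p where p: "p \<in> W" by auto
  \<comment> \<open>The complex line through a point of \<open>W\<close> and \<open>q\<close>. It
    meets the convex set \<open>B\<close> in a convex, hence connected, set, on which the
    one-variable identity theorem applies.\<close>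
  define \<phi> where "\<phi> c = p + c *s (q - p)" for c :: complex
  define S where "S = \<phi> -` B"
  have cont: "continuous_on UNIV \<phi>"
  proof -
    have "\<phi> = (\<lambda>c. \<chi> i. p $ i + c * (q $ i - p $ i))"
      by (simp add: \<phi>_def fun_eq_iff vec_eq_iff algebra_simps)
    then show ?thesis by (auto intro!: continuous_intros)
  qed
  have "open S" unfolding S_def using cont B by (intro open_vimage)
  have "convex S"
    unfolding convex_alt
  proof (intro ballI allI impI)
    fix x y :: complex and u :: real assume *: "x \<in> S" "y \<in> S" "0 \<le> u \<and> u \<le> 1"
    have "\<phi> ((1 - u) *\<^sub>R x + u *\<^sub>R y) = (1 - u) *\<^sub>R \<phi> x + u *\<^sub>R \<phi> y"
      by (simp only: \<phi>_def vec_eq_iff vector_scaleR_component vector_add_component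
          vector_smult_component vector_minus_component) (simp add: scaleR_conv_of_real algebra_simps)
    with * B show "(1 - u) *\<^sub>R x + u *\<^sub>R y \<in> S"
      by (auto simp: S_def convex_alt)
  qed
  have "(\<lambda>c. f (\<phi> c)) holomorphic_on S"
    by (rule mv_holomorphic_on_compose_curve[OF f])
       (use \<open>open S\<close> in \<open>auto simp: \<phi>_def S_def intro!: holomorphic_intros\<close>)
  moreover have "open (\<phi> -` W)" using cont W by (intro open_vimage)
  moreover have "\<phi> 0 = p" "\<phi> 1 = q" by (auto simp: \<phi>_def vec_eq_iff)
  ultimately show "f q = 0"
    using analytic_continuation_open[of "\<phi> -` W" S "\<lambda>c. f (\<phi> c)" "\<lambda>_. 0" 1] W p q \<open>open S\<close> convex_connected[OF \<open>convex S\<close>]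
    by (auto simp: S_def vimage_def)
qed

text \<open>Lets denominators be assumed nonzero after shrinking an open set; it is the only form in
  which nowhere density of their zeros is used.\<close>

lemma open_nonzero_mv_holomorphic:
  assumes h: "mv_holomorphic_on h U" and W: "open W" "W \<noteq> {}" "W \<subseteq> U" "open U" and int: "interior {q\<in>U. h q = 0} = {}"
  obtains W' where "open W'" "W' \<noteq> {}" "W' \<subseteq> W" "\<And>q. q \<in> W' \<Longrightarrow> h q \<noteq> 0"
proof -
  have cont: "continuous_on W h"
    using mv_holomorphic_on_continuous[OF h] W by (intro continuous_at_imp_continuous_on) auto
  have "open (W \<inter> h -` (-{0}))"
    using cont W by (intro continuous_open_preimage) auto
  moreover have "W \<inter> h -` (-{0}) \<noteq> {}"
  proof
    assume "W \<inter> h -` (-{0}) = {}"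
    then have "W \<subseteq> {q\<in>U. h q = 0}" using W by auto
    then have "W \<subseteq> interior {q\<in>U. h q = 0}" using W by (intro interior_maximal)
    with int W show False by auto
  qed
  ultimately show ?thesis by (intro that[of "W \<inter> h -` (-{0})"]) auto
qed

lemma mv_meromorphic_onE:
  assumes "mv_meromorphic_on f S" "p \<in> S"
  obtains U g h where "open U" "p \<in> U" "mv_holomorphic_on g U" "mv_holomorphic_on h U"
    "interior {q\<in>U. h q = 0} = {}" "\<And>q. q \<in> U \<Longrightarrow> h q \<noteq> 0 \<Longrightarrow> f q = g q / h q"
  using bspec[OF assms[unfolded mv_meromorphic_on_def]] by (elim exE conjE) auto

text \<open>
  An unbounded singularity of one function cannot sit at a point where the other is bounded, because
  the two functions agree on a dense set.
\<close>

lemma mv_nicely_meromorphic_eq_locally: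
  fixes f g :: "complex ^ 'n \<Rightarrow> complex"
  assumes f: "mv_nicely_meromorphic_on f S" and g: "mv_nicely_meromorphic_on g S" and p: "p \<in> S" and S: "open S"
  obtains B where "open B" "p \<in> B" "B \<subseteq> S"
    "\<And>W. open W \<Longrightarrow> W \<noteq> {} \<Longrightarrow> W \<subseteq> B \<Longrightarrow> (\<And>q. q \<in> W \<Longrightarrow> f q = g q) \<Longrightarrow> (\<forall>q\<in>B. f q = g q)"
proof -
  obtain U1 a1 h1 where 1: "open U1" "p \<in> U1" "mv_holomorphic_on a1 U1" "mv_holomorphic_on h1 U1"
    "interior {q\<in>U1. h1 q = 0} = {}" "\<And>q. q \<in> U1 \<Longrightarrow> h1 q \<noteq> 0 \<Longrightarrow> f q = a1 q / h1 q"
    using mv_meromorphic_onE[OF conjunct1[OF f[unfolded mv_nicely_meromorphic_on_def]] p] by blast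
  obtain U2 a2 h2 where 2: "open U2" "p \<in> U2" "mv_holomorphic_on a2 U2" "mv_holomorphic_on h2 U2"
    "interior {q\<in>U2. h2 q = 0} = {}" "\<And>q. q \<in> U2 \<Longrightarrow> h2 q \<noteq> 0 \<Longrightarrow> g q = a2 q / h2 q"
    using mv_meromorphic_onE[OF conjunct1[OF g[unfolded mv_nicely_meromorphic_on_def]] p] by blast
  have "open (U1 \<inter> U2 \<inter> S)" "p \<in> U1 \<inter> U2 \<inter> S" using 1 2 S p by auto
  then obtain r where r: "r > 0" "ball p r \<subseteq> U1 \<inter> U2 \<inter> S" by (meson open_contains_ball)
  define B where "B = ball p r"
  have B: "open B" "convex B" "p \<in> B" "B \<subseteq> U1" "B \<subseteq> U2" "B \<subseteq> S" using r by (auto simp: B_def)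
  have dense: "\<exists>W'. open W' \<and> W' \<noteq> {} \<and> W' \<subseteq> W \<and> (\<forall>q\<in>W'. h1 q \<noteq> 0 \<and> h2 q \<noteq> 0)"
    if W: "open W" "W \<noteq> {}" "W \<subseteq> B" for W
  proof -
    obtain W1 where W1: "open W1" "W1 \<noteq> {}" "W1 \<subseteq> W" "\<And>q. q \<in> W1 \<Longrightarrow> h1 q \<noteq> 0"
      by (rule open_nonzero_mv_holomorphic[OF 1(4) W(1,2) order_trans[OF W(3) B(4)] 1(1,5)]) blast
    obtain W2 where W2: "open W2" "W2 \<noteq> {}" "W2 \<subseteq> W1" "\<And>q. q \<in> W2 \<Longrightarrow> h2 q \<noteq> 0"
      by (rule open_nonzero_mv_holomorphic[OF 2(4) W1(1,2) order_trans[OF W1(3) order_trans[OF W(3) B(5)]] 2(1,5)]) blast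
    show ?thesis using W1 W2 by (intro exI[of _ W2]) blast
  qed
  show ?thesis
  proof (rule that[OF B(1,3,6)], intro ballI)
    fix W q assume W: "open W" "W \<noteq> {}" "W \<subseteq> B" and eq: "\<And>q. q \<in> W \<Longrightarrow> f q = g q" and q: "q \<in> B"
    obtain W' where W': "open W'" "W' \<noteq> {}" "W' \<subseteq> W" "\<forall>q\<in>W'. h1 q \<noteq> 0 \<and> h2 q \<noteq> 0"
      using dense[OF W] by blast
    \<comment> \<open>Cross-multiplication avoids the denominators: this difference is holomorphic
      on the whole ball and vanishes on an open part of it.\<close>
    have cross: "a1 q * h2 q - a2 q * h1 q = 0" if "q \<in> B" for q
    proof (rule mv_identity_theorem[of "\<lambda>q. a1 q * h2 q - a2 q * h1 q" B W'])
      show "mv_holomorphic_on (\<lambda>q. a1 q * h2 q - a2 q * h1 q) B"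
        using 1 2 B by (intro mv_intros) (auto intro: mv_holomorphic_on_subset)
      show "a1 p * h2 p - a2 p * h1 p = 0" if "p \<in> W'" for p
      proof -
        have "p \<in> U1" "p \<in> U2" "h1 p \<noteq> 0" "h2 p \<noteq> 0" "f p = g p"
          using that W W' B eq by auto
        then show ?thesis using 1(6)[of p] 2(6)[of p] by (simp add: field_simps)
      qed
    qed (use B W W' that in auto)
    have eqN: "f q = g q" if "q \<in> B" "h1 q \<noteq> 0" "h2 q \<noteq> 0" for q
    proof -
      have "q \<in> U1" "q \<in> U2" using that B by auto
      then have "f q = a1 q / h1 q" "g q = a2 q / h2 q"
        using 1(6) 2(6) that by auto
      then show ?thesis
        using cross[OF that(1)] that by (simp add: frac_eq_eq)
    qed
    have meets: "\<exists>q\<in>W. f q = g q" if "open W" "W \<noteq> {}" "W \<subseteq> B" for W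
      using dense[OF that] eqN that by blast
    have key: "\<exists>U. open U \<and> q \<in> U \<and> bounded (f2 ` U)"
      if f1: "open V" "q \<in> V" "mv_holomorphic_on f1 V" and f2: "mv_nicely_meromorphic_on f2 S"
        and m: "\<And>W. open W \<Longrightarrow> W \<noteq> {} \<Longrightarrow> W \<subseteq> B \<Longrightarrow> \<exists>q\<in>W. f1 q = f2 q"
      for f1 f2 V
    proof -
      have "isCont f1 q" using f1 mv_holomorphic_on_continuous by blast
      then obtain d where d: "d > 0" "\<And>q'. dist q' q < d \<Longrightarrow> dist (f1 q') (f1 q) < 1"
        unfolding continuous_at_eps_delta by (meson zero_less_one)
      define U where "U = ball q d \<inter> B"
      have U: "open U" "q \<in> U" "U \<subseteq> B" using d q B by (auto simp: U_def)
      have bd: "norm (f1 q') < norm (f1 q) + 1" if "q' \<in> U" for q'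
      proof -
        have "norm (f1 q' - f1 q) < 1"
          using d(2)[of q'] that by (auto simp: U_def dist_commute dist_norm)
        then show ?thesis by norm
      qed
      \<comment> \<open>Where \<open>f2\<close> is holomorphic, a larger value would persist on an
        open set, which contains a point of agreement with \<open>f1\<close>; at any other point the
        convention gives the value \<open>0\<close>.\<close>
      have "norm (f2 q') \<le> norm (f1 q) + 1" if q': "q' \<in> U" for q'
      proof (cases "\<exists>V'. open V' \<and> q' \<in> V' \<and> mv_holomorphic_on f2 V'")
        case True
        then have cont: "isCont f2 q'" using mv_holomorphic_on_continuous by blast
        show ?thesis
        proof (rule ccontr)
          assume "\<not> ?thesis"
          then have "norm (f2 q') > norm (f1 q) + 1" by simp
          with cont have "\<forall>\<^sub>F x in nhds q'. norm (f2 x) > norm (f1 q) + 1"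
            by (intro order_tendstoD(1)[of _ "norm (f2 q')"] tendsto_norm)
               (auto simp: isCont_def tendsto_at_iff_tendsto_nhds)
          then obtain X where X: "open X" "q' \<in> X" "\<forall>x\<in>X. norm (f2 x) > norm (f1 q) + 1"
            unfolding eventually_nhds by auto
          have "\<exists>x\<in>X \<inter> U. f1 x = f2 x" using X U q' by (intro m) auto
          then show False using X bd by fastforce
        qed
      next
        case False
        then have "f2 q' = 0" using f2 q' U B unfolding mv_nicely_meromorphic_on_def by blast
        then show ?thesis by (simp add: add_nonneg_nonneg)
      qed
      then have "bounded (f2 ` U)" by (auto intro!: boundedI)
      with U show ?thesis by blast
    qed
    have qS: "q \<in> S" using q B by auto
    have nice: "(\<exists>U. open U \<and> q \<in> U \<and> mv_holomorphic_on f U) \<or> (f q = 0 \<and> (\<forall>U. open U \<longrightarrow> q \<in> U \<longrightarrow> \<not> bounded (f ` U)))"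
      if "mv_nicely_meromorphic_on f S" for f
      using that qS unfolding mv_nicely_meromorphic_on_def by fast
    consider (hh) V1 V2 where "open V1" "q \<in> V1" "mv_holomorphic_on f V1" "open V2" "q \<in> V2" "mv_holomorphic_on g V2"
      | (fb) V1 where "open V1" "q \<in> V1" "mv_holomorphic_on f V1" "\<forall>U. open U \<longrightarrow> q \<in> U \<longrightarrow> \<not> bounded (g ` U)"
      | (gb) V1 where "open V1" "q \<in> V1" "mv_holomorphic_on g V1" "\<forall>U. open U \<longrightarrow> q \<in> U \<longrightarrow> \<not> bounded (f ` U)"
      | (n) "f q = 0" "g q = 0"
      using nice[OF f] nice[OF g] by (elim disjE exE conjE) blast+
    then show "f q = g q"
    proof cases
      case hh
      then have "isCont (\<lambda>x. f x - g x) q"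
        using mv_holomorphic_on_continuous by (intro continuous_intros) blast+
      show ?thesis
      proof (rule ccontr)
        assume "f q \<noteq> g q"
        then have "f q - g q \<noteq> 0" by simp
        with \<open>isCont (\<lambda>x. f x - g x) q\<close> have "\<forall>\<^sub>F x in nhds q. f x - g x \<noteq> 0"
          by (intro tendsto_imp_eventually_ne[of _ "f q - g q"])
             (auto simp: isCont_def tendsto_at_iff_tendsto_nhds[of "\<lambda>x. f x - g x"])
        then obtain X where X: "open X" "q \<in> X" "\<forall>x\<in>X. f x - g x \<noteq> 0"
          unfolding eventually_nhds by auto
        have "\<exists>x\<in>X \<inter> B. f x = g x" using X B q by (intro meets) auto
        with X show False by auto
      qed
    next
      case fb
      have "\<exists>U. open U \<and> q \<in> U \<and> bounded (g ` U)" by (rule key[OF fb(1-3) g meets])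
      with fb(4) show ?thesis by blast
    next
      case gb
      have "\<exists>U. open U \<and> q \<in> U \<and> bounded (f ` U)"
      proof (rule key[OF gb(1-3) f])
        fix W :: "(complex ^ 'n) set" assume "open W" "W \<noteq> {}" "W \<subseteq> B"
        then show "\<exists>q\<in>W. g q = f q" using meets by metis
      qed
      with gb(4) show ?thesis by blast
    next
      case n then show ?thesis by simp
    qed
  qed
qed

text \<open>The interior of the set of agreement is open and nonempty, and by the local lemma it is
  relatively closed; connectedness does the rest.\<close>

theorem mv_nicely_meromorphic_unique:
  fixes f g :: "complex ^ 'n \<Rightarrow> complex"
  assumes f: "mv_nicely_meromorphic_on f S" and g: "mv_nicely_meromorphic_on g S"
    and S: "open S" "connected S" and V: "open V" "V \<noteq> {}" "V \<subseteq> S" "\<And>p. p \<in> V \<Longrightarrow> f p = g p" and p: "p \<in> S"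
  shows "f p = g p"
proof -
  define A where "A = interior {p\<in>S. f p = g p}"
  have "V \<subseteq> A" unfolding A_def using V by (intro interior_maximal) auto
  have "A \<subseteq> S" unfolding A_def using interior_subset by blast
  have cl: "p \<in> A" if p: "p \<in> S" "p \<in> closure A" for p
  proof -
    obtain B where B: "open B" "p \<in> B" "B \<subseteq> S"
      "\<And>W. open W \<Longrightarrow> W \<noteq> {} \<Longrightarrow> W \<subseteq> B \<Longrightarrow> (\<And>q. q \<in> W \<Longrightarrow> f q = g q) \<Longrightarrow> (\<forall>q\<in>B. f q = g q)"
      using mv_nicely_meromorphic_eq_locally[OF f g p(1) S(1)] by blast
    have "B \<inter> A \<noteq> {}" using B p by (meson closure_iff_nhds_not_empty disjoint_iff order_refl)
    moreover have "f q = g q" if "q \<in> A" for q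
      using that interior_subset unfolding A_def by blast
    ultimately have "\<forall>q\<in>B. f q = g q"
      by (intro B(4)[of "B \<inter> A"]) (auto simp: A_def B)
    then have "B \<subseteq> A" unfolding A_def using B by (intro interior_maximal) auto
    with B show ?thesis by auto
  qed
  have "openin (top_of_set S) A"
    using \<open>A \<subseteq> S\<close> by (simp add: A_def open_openin_trans S(1) openin_open_eq)
  moreover have "A = S \<inter> closure A"
    using cl \<open>A \<subseteq> S\<close> closure_subset by blast
  then have "closedin (top_of_set S) A" unfolding closedin_closed by blast
  ultimately have "A = S"
    using S(2) \<open>V \<subseteq> A\<close> V(2) unfolding connected_clopen by blast
  with p show ?thesis unfolding A_def using interior_subset by blast
qed

lemma mv_holomorphic_imp_nicely:
  assumes "mv_holomorphic_on f S" "open S"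
  shows "mv_nicely_meromorphic_on f S"
  unfolding mv_nicely_meromorphic_on_def mv_meromorphic_on_def
proof (intro conjI ballI)
  fix p assume "p \<in> S"
  then show "\<exists>U g h. open U \<and> p \<in> U \<and> mv_holomorphic_on g U \<and> mv_holomorphic_on h U \<and>
        interior {q \<in> U. h q = 0} = {} \<and> (\<forall>q\<in>U. h q \<noteq> 0 \<longrightarrow> f q = g q / h q)"
    using assms by (intro exI[of _ S] exI[of _ f] exI[of _ "\<lambda>_. 1"]) (auto intro: mv_intros)
qed (use assms in blast)

lemma mv_nicely_meromorphic_on_subset:
  "mv_nicely_meromorphic_on f S \<Longrightarrow> T \<subseteq> S \<Longrightarrow> mv_nicely_meromorphic_on f T"
  unfolding mv_nicely_meromorphic_on_def mv_meromorphic_on_def by blast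

text \<open>Since \<open>x / 0 = 0\<close>, the quotient has the value \<open>0\<close> required at its singular points.\<close>

lemma mv_quotient_nicely_meromorphic:
  fixes f g h :: "complex ^ 'n \<Rightarrow> complex"
  assumes "\<And>p. p \<in> S \<Longrightarrow> \<exists>U g h. open U \<and> p \<in> U \<and> mv_holomorphic_on g U \<and> mv_holomorphic_on h U \<and>
    interior {q\<in>U. h q = 0} = {} \<and> ((\<forall>q\<in>U. g q \<noteq> 0) \<or> (\<forall>q\<in>U. h q \<noteq> 0)) \<and> (\<forall>q\<in>U. f q = g q / h q)"
  shows "mv_nicely_meromorphic_on f S"
  unfolding mv_nicely_meromorphic_on_def
proof (intro conjI ballI)
  show "mv_meromorphic_on f S"
    unfolding mv_meromorphic_on_def
  proof
    fix p assume "p \<in> S"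
    from assms[OF this] obtain U g h where "open U" "p \<in> U" "mv_holomorphic_on g U" "mv_holomorphic_on h U"
      "interior {q\<in>U. h q = 0} = {}" "\<forall>q\<in>U. f q = g q / h q"
      by (elim exE conjE) (rule that)
    then show "\<exists>U g h. open U \<and> p \<in> U \<and> mv_holomorphic_on g U \<and> mv_holomorphic_on h U \<and>
        interior {q \<in> U. h q = 0} = {} \<and> (\<forall>q\<in>U. h q \<noteq> 0 \<longrightarrow> f q = g q / h q)"
      by (intro exI[of _ U] exI[of _ g] exI[of _ h]) simp
  qed
next
  fix p assume "p \<in> S"
  from assms[OF this] obtain U g h where U: "open U" "p \<in> U" "mv_holomorphic_on g U" "mv_holomorphic_on h U"
    "interior {q\<in>U. h q = 0} = {}" and nz: "(\<forall>q\<in>U. g q \<noteq> 0) \<or> (\<forall>q\<in>U. h q \<noteq> 0)" and "\<forall>q\<in>U. f q = g q / h q"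
    by (elim exE conjE) (rule that)
  then have f: "\<And>q. q \<in> U \<Longrightarrow> f q = g q / h q" by blast
  have ch: "continuous_on U h" "continuous_on U g"
    using mv_holomorphic_on_continuous U by (auto intro!: continuous_at_imp_continuous_on)
  show "(\<exists>U. open U \<and> p \<in> U \<and> mv_holomorphic_on f U) \<or>
         f p = 0 \<and> (\<forall>U. open U \<longrightarrow> p \<in> U \<longrightarrow> \<not> bounded (f ` U))"
  proof (cases "h p = 0")
    case False
    define U' where "U' = U \<inter> h -` (-{0})"
    have "open U'" unfolding U'_def using ch U by (intro continuous_open_preimage) auto
    moreover have "mv_holomorphic_on (\<lambda>q. g q / h q) U'"
      using U by (intro mv_intros) (auto simp: U'_def intro: mv_holomorphic_on_subset)
    then have "mv_holomorphic_on f U'"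
      by (rule mv_holomorphic_on_cong) (use f \<open>open U'\<close> in \<open>auto simp: U'_def\<close>)
    ultimately show ?thesis using False U by (auto simp: U'_def)
  next
    case True
    with nz U have gnz: "\<forall>q\<in>U. g q \<noteq> 0" by auto
    have "\<not> bounded (f ` V)" if V: "open V" "p \<in> V" for V
    proof
      assume "bounded (f ` V)"
      then obtain M where M: "M > 0" "\<And>q. q \<in> V \<Longrightarrow> norm (f q) \<le> M" by (auto simp: bounded_pos)
      \<comment> \<open>Near \<open>p\<close> the numerator stays away from \<open>0\<close> while
        \<open>h\<close> is small, so that \<open>norm (g q) > M * norm (h q)\<close> holds on a
        whole neighbourhood. Any point of it with \<open>h q \<noteq> 0\<close> violates the bound
        \<open>M\<close>.\<close>
      define X where "X = (U \<inter> V) \<inter> (\<lambda>q. norm (g q) - M * norm (h q)) -` {0<..}"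
      have "open X" unfolding X_def
        using U V ch by (intro continuous_open_preimage) (auto intro!: continuous_intros intro: continuous_on_subset)
      moreover have "p \<in> X" using True gnz U V by (auto simp: X_def)
      ultimately obtain W where W: "open W" "W \<noteq> {}" "W \<subseteq> X" "\<And>q. q \<in> W \<Longrightarrow> h q \<noteq> 0"
        using open_nonzero_mv_holomorphic[OF U(4) _ _ _ U(1,5), of X] unfolding X_def by blast
      then obtain q where q: "q \<in> W" by auto
      then have "norm (g q) / norm (h q) \<le> M" "norm (g q) > M * norm (h q)" "norm (h q) > 0"
        using W M(2)[of q] f[of q] by (auto simp: X_def norm_divide subset_iff)
      then show False by (simp add: field_simps)
    qed
    with True f U show ?thesis by auto
  qed
qed

section \<open>Holomorphic dependence of integrals on parameters\<close>

lemma norm_scalar_mult: "norm (c *s (h :: complex ^ 'n)) = norm c * norm h"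
  by (simp add: norm_vec_def norm_mult L2_set_right_distrib)

lemma mv_deriv_imp_field_derivative:
  assumes "mv_deriv f D p"
  shows "((\<lambda>c. f (p + c *s h)) has_field_derivative D h) (at 0)"
proof -
  have "bounded_linear (\<lambda>c :: complex. c *s h)"
    by (rule bounded_linear_intro[of _ "norm h"])
       (auto simp: norm_scalar_mult vec_eq_iff algebra_simps)
  then have "((\<lambda>c. p + c *s h) has_derivative (\<lambda>c. c *s h)) (at 0)"
    by (auto intro!: derivative_eq_intros bounded_linear_imp_has_derivative)
  moreover have "(f has_derivative D) (at (p + 0 *s h))"
    using assms by (simp add: mv_deriv_def)
  ultimately have "((\<lambda>c. f (p + c *s h)) has_derivative (\<lambda>c. D (c *s h))) (at 0)"
    using has_derivative_compose by blast
  then show ?thesis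
    unfolding has_field_derivative_def by (simp add: mv_deriv_scale[OF assms] mult.commute[of _ "D h"])
qed

text \<open>Cauchy's inequality on the complex line through \<open>q\<close> in direction
  \<open>h\<close>. Only a bound of \<open>f\<close> itself enters, so that a majorant of an
  integrand also controls its derivatives.\<close>

lemma mv_deriv_Cauchy_bound:
  fixes f :: "complex ^ 'n \<Rightarrow> complex"
  assumes f: "mv_holomorphic_on f U" and B: "ball q r \<subseteq> U" and M: "\<And>x. x \<in> ball q r \<Longrightarrow> norm (f x) \<le> M"
    and D: "mv_deriv f D q" and r: "0 < \<rho>" "\<rho> < r"
  shows "norm (D h) \<le> M / \<rho> * norm h"
proof (cases "h = 0")
  case True
  then show ?thesis using mv_deriv_scale[OF D, of 0 0] by simp
next
  case False
  define \<phi> where "\<phi> c = q + c *s h" for c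
  define R where "R = r / norm h"
  have "\<phi> ` ball 0 R \<subseteq> ball q r"
    using False by (auto simp: \<phi>_def R_def dist_norm norm_scalar_mult field_simps)
  have hol: "(\<lambda>c. f (\<phi> c)) holomorphic_on ball 0 R"
    by (rule mv_holomorphic_on_compose_curve[OF f])
       (use \<open>\<phi> ` ball 0 R \<subseteq> ball q r\<close> B in \<open>auto simp: \<phi>_def intro!: holomorphic_intros\<close>)
  have lt: "\<rho> / norm h < R" using False r by (simp add: R_def field_simps)
  have "norm ((deriv ^^ 1) (\<lambda>c. f (\<phi> c)) 0) \<le> fact 1 * M / (\<rho> / norm h) ^ 1"
  proof (rule Cauchy_inequality)
    show "(\<lambda>c. f (\<phi> c)) holomorphic_on ball 0 (\<rho> / norm h)"
      using hol lt by (auto intro: holomorphic_on_subset)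
    show "continuous_on (cball 0 (\<rho> / norm h)) (\<lambda>c. f (\<phi> c))"
      using lt by (intro holomorphic_on_imp_continuous_on holomorphic_on_subset[OF hol]) auto
    show "0 < \<rho> / norm h" using False r by simp
    show "norm (f (\<phi> x)) \<le> M" if "norm (0 - x) = \<rho> / norm h" for x
    proof -
      have "x \<in> ball 0 R" using that lt by simp
      then show ?thesis using \<open>\<phi> ` ball 0 R \<subseteq> ball q r\<close> by (intro M) blast
    qed
  qed
  moreover have "deriv (\<lambda>c. f (\<phi> c)) 0 = D h"
    unfolding \<phi>_def by (intro DERIV_imp_deriv mv_deriv_imp_field_derivative D)
  ultimately show ?thesis using False by (simp add: field_simps)
qed

text \<open>A local majorant of the integrand is enough: on slightly smaller balls, Cauchy's
  inequality turns it into one for the derivatives.\<close>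

locale parametric_integral =
  fixes f :: "complex ^ 'n \<Rightarrow> real \<Rightarrow> complex" and U :: "(complex ^ 'n) set"
  assumes open_U: "open U"
    and hol: "\<And>t. mv_holomorphic_on (\<lambda>p. f p t) U"
    and meas: "\<And>p. p \<in> U \<Longrightarrow> f p \<in> borel_measurable lborel"
    and dom: "\<And>p. p \<in> U \<Longrightarrow> \<exists>r>0. \<exists>g. integrable lborel g \<and> (\<forall>q\<in>U \<inter> ball p r. \<forall>t. norm (f q t) \<le> g t)"
begin

lemma integrable: 
  assumes "p \<in> U" shows "integrable lborel (f p)"
proof -
  from dom[OF assms] obtain r g where "r > 0" "integrable lborel g" "\<forall>q\<in>U \<inter> ball p r. \<forall>t. norm (f q t) \<le> g t"
    by auto
  then show ?thesis
    using meas[OF assms] assms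
    by (intro Bochner_Integration.integrable_bound[of lborel g "f p"])
       (auto intro!: order.trans[OF _ abs_ge_self])
qed

lemma deriv:
  assumes p: "p \<in> U" and D: "\<And>t. mv_deriv (\<lambda>p. f p t) (D t) p"
  shows "mv_deriv (\<lambda>p. LINT t|lborel. f p t) (\<lambda>h. LINT t|lborel. D t h) p"
proof -
  from dom[OF p] obtain r0 g where r0: "r0 > 0" and g: "integrable lborel g" "\<And>q t. q \<in> U \<inter> ball p r0 \<Longrightarrow> norm (f q t) \<le> g t"
    by auto
  from open_U p obtain r1 where r1: "r1 > 0" "ball p r1 \<subseteq> U" by (meson open_contains_ball)
  \<comment> \<open>The divisor \<open>4\<close> leaves room for a ball of radius
    \<open>2 * \<rho>\<close> about every point of \<open>ball p \<rho>\<close>; the Cauchy bound is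
    taken inside these balls.\<close>
  define \<rho> where "\<rho> = min r0 r1 / 4"
  have \<rho>: "\<rho> > 0" using r0 r1 by (simp add: \<rho>_def)
  have inU: "q \<in> U \<inter> ball p r0" if "dist p q < 4 * \<rho>" for q
    using that r1 by (auto simp: \<rho>_def)
  have bound: "norm (E h) \<le> g t / \<rho> * norm h" if q: "q \<in> ball p \<rho>" and E: "mv_deriv (\<lambda>p. f p t) E q" for q t E h
  proof (rule mv_deriv_Cauchy_bound[OF hol _ _ E, of "2 * \<rho>"])
    have *: "dist p x < 4 * \<rho>" if "x \<in> ball q (2 * \<rho>)" for x
      using that q dist_triangle[of p x q] \<rho> by (simp add: dist_commute)
    show "ball q (2 * \<rho>) \<subseteq> U" using * inU by blast
    show "norm (f x t) \<le> g t" if "x \<in> ball q (2 * \<rho>)" for x using *[OF that] inU g(2) by blast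
  qed (use \<rho> in auto)
  have pp: "p \<in> ball p \<rho>" using \<rho> by simp
  have lip: "norm (f q t - f p t) \<le> g t / \<rho> * norm (q - p)" if q: "q \<in> ball p \<rho>" for q t
  proof -
    have "\<exists>E. mv_deriv (\<lambda>p. f p t) E x" if "x \<in> ball p \<rho>" for x
      using hol[of t] inU[of x] that \<rho> unfolding mv_holomorphic_on_iff by auto
    then obtain E where E: "\<And>x. x \<in> ball p \<rho> \<Longrightarrow> mv_deriv (\<lambda>p. f p t) (E x) x" by metis
    show ?thesis
    proof (rule differentiable_bound[of "ball p \<rho>" "\<lambda>p. f p t" E])
      fix x assume x: "x \<in> ball p \<rho>"
      show "((\<lambda>p. f p t) has_derivative E x) (at x within ball p \<rho>)"
        using E[OF x] by (auto simp: mv_deriv_def intro: has_derivative_at_withinI)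
      show "onorm (E x) \<le> g t / \<rho>"
        using bound[OF x E[OF x]] by (intro onorm_le) 
    qed (use q pp in auto)
  qed
  \<comment> \<open>The derivative is measurable in \<open>t\<close> as a pointwise limit of
    difference quotients. Extension of the integrand by \<open>0\<close> outside \<open>U\<close>
    makes every quotient measurable, also those at points that have not yet entered
    \<open>U\<close>.\<close>
  have Dmeas: "(\<lambda>t. D t h) \<in> borel_measurable lborel" for h
  proof -
    define F where "F q t = (if q \<in> U then f q t else 0)" for q t
    have Fm: "F q \<in> borel_measurable lborel" for q
      using meas[of q] by (cases "q \<in> U") (auto simp: F_def[abs_def])
    define c where "c n = complex_of_real (inverse (real (Suc n)))" for n
    have c: "filterlim c (at 0) sequentially"
    proof -
      have "c \<longlonglongrightarrow> of_real 0"
        unfolding c_def by (intro tendsto_of_real LIMSEQ_inverse_real_of_nat)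
      moreover have "c n \<noteq> 0" for n
        unfolding c_def of_real_eq_0_iff by simp
      ultimately show ?thesis by (simp add: filterlim_at)
    qed
    show ?thesis
    proof (rule borel_measurable_LIMSEQ_metric)
      show "(\<lambda>t. (F (p + c n *s h) t - F p t) / c n) \<in> borel_measurable lborel" for n
        using Fm by measurable
      show "(\<lambda>n. (F (p + c n *s h) t - F p t) / c n) \<longlonglongrightarrow> D t h" for t
      proof -
        have "((\<lambda>c. f (p + c *s h) t) has_field_derivative D t h) (at 0)"
          by (rule mv_deriv_imp_field_derivative[OF D])
        then have "((\<lambda>y. (f (p + y *s h) t - f p t) / y) \<longlongrightarrow> D t h) (at 0)"
          by (simp add: has_field_derivative_iff)
        then have "(\<lambda>n. (f (p + c n *s h) t - f p t) / c n) \<longlonglongrightarrow> D t h"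
          by (rule filterlim_compose[OF _ c])
        moreover have "(\<lambda>n. p + c n *s h) \<longlonglongrightarrow> p + 0 *s h"
          using c unfolding filterlim_at
          by (intro vec_tendstoI) (auto intro!: tendsto_eq_intros)
        then have "\<forall>\<^sub>F n in sequentially. p + c n *s h \<in> U"
          using p open_U by (intro topological_tendstoD) auto
        then have "\<forall>\<^sub>F n in sequentially. (f (p + c n *s h) t - f p t) / c n = (F (p + c n *s h) t - F p t) / c n"
          by eventually_elim (use p in \<open>auto simp: F_def\<close>)
        ultimately show ?thesis by (rule Lim_transform_eventually)
      qed
    qed
  qed
  have Dint: "integrable lborel (\<lambda>t. D t h)" for h
  proof (rule Bochner_Integration.integrable_bound[of lborel "\<lambda>t. g t / \<rho> * norm h"])
    show "AE t in lborel. norm (D t h) \<le> norm (g t / \<rho> * norm h)"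
    proof (rule AE_I2)
      show "norm (D t h) \<le> norm (g t / \<rho> * norm h)" for t
        using bound[OF pp D, of t h] unfolding real_norm_def by linarith
    qed
  qed (use g Dmeas in auto)
  have lin: "linear (D t)" for t
    using D[of t] by (auto simp: mv_deriv_def has_derivative_def bounded_linear.linear)
  have blin: "bounded_linear (\<lambda>h. LINT t|lborel. D t h)"
  proof (rule bounded_linear_intro)
    show "norm (LINT t|lborel. D t h) \<le> norm h * (LINT t|lborel. g t / \<rho>)" for h
    proof -
      have "norm (LINT t|lborel. D t h) \<le> (LINT t|lborel. g t / \<rho> * norm h)"
        by (rule order.trans[OF integral_norm_bound integral_mono]) (use Dint g bound[OF pp D] in auto)
      then show ?thesis by (simp add: mult.commute)
    qed
  qed (use Dint in \<open>auto simp: linear_add[OF lin] linear_scale[OF lin]\<close>)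
  have "((\<lambda>p. LINT t|lborel. f p t) has_derivative (\<lambda>h. LINT t|lborel. D t h)) (at p)"
    unfolding has_derivative_at_within
  proof (intro conjI blin, subst tendsto_at_iff_sequentially, intro allI impI)
    fix X :: "nat \<Rightarrow> complex ^ 'n" assume X: "\<forall>i. X i \<in> UNIV - {p}" "X \<longlonglongrightarrow> p"
    define R where "R y t = (if y \<in> ball p \<rho> then (f y t - f p t - D t (y - p)) /\<^sub>R norm (y - p) else 0)" for y t
    have ev: "\<forall>\<^sub>F n in sequentially. X n \<in> ball p \<rho>"
      using X(2) pp by (intro topological_tendstoD) auto
    have "(\<lambda>n. LINT t|lborel. R (X n) t) \<longlonglongrightarrow> (LINT (t::real)|lborel. (0::complex))"
    proof (rule integral_dominated_convergence[where w = "\<lambda>t. 2 * (g t / \<rho>)"])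
      show "R (X n) \<in> borel_measurable lborel" for n
      proof (cases "X n \<in> ball p \<rho>")
        case True
        then have "X n \<in> U" using inU[of "X n"] \<rho> by auto
        from meas[OF this] meas[OF p] Dmeas True show ?thesis
          unfolding R_def[abs_def] by simp
      qed (simp add: R_def[abs_def])
      show "AE t in lborel. (\<lambda>n. R (X n) t) \<longlonglongrightarrow> 0"
      proof (rule AE_I2)
        fix t
        have "((\<lambda>y. (f y t - f p t - D t (y - p)) /\<^sub>R norm (y - p)) \<longlongrightarrow> 0) (at p)"
          using D[of t] by (auto simp: mv_deriv_def has_derivative_at_within)
        then have "(\<lambda>n. (f (X n) t - f p t - D t (X n - p)) /\<^sub>R norm (X n - p)) \<longlonglongrightarrow> 0"
          using X by (subst (asm) tendsto_at_iff_sequentially) (auto simp: o_def)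
        moreover have "\<forall>\<^sub>F n in sequentially. (f (X n) t - f p t - D t (X n - p)) /\<^sub>R norm (X n - p) = R (X n) t"
          using ev by eventually_elim (auto simp: R_def)
        ultimately show "(\<lambda>n. R (X n) t) \<longlonglongrightarrow> 0" by (rule Lim_transform_eventually)
      qed
      \<comment> \<open>One half of the majorant pays for the increment of \<open>f\<close>, the
        other for the linear term.\<close>
      show "AE t in lborel. norm (R (X n) t) \<le> 2 * (g t / \<rho>)" for n
      proof (rule AE_I2)
        fix t
        have "0 \<le> norm (f p t)" by simp
        also have "\<dots> \<le> g t" using g(2) inU[of p] \<rho> by auto
        finally have gt: "g t \<ge> 0" .
        show "norm (R (X n) t) \<le> 2 * (g t / \<rho>)"
        proof (cases "X n \<in> ball p \<rho>")
          case True
          have "norm (f (X n) t - f p t - D t (X n - p)) \<le> norm (f (X n) t - f p t) + norm (D t (X n - p))"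
            by (rule norm_triangle_ineq4)
          also have "\<dots> \<le> 2 * (g t / \<rho>) * norm (X n - p)"
            using lip[OF True, of t] bound[OF pp D, of t "X n - p"] by simp
          moreover have "norm (R (X n) t) = norm (f (X n) t - f p t - D t (X n - p)) / norm (X n - p)"
            using True by (simp add: R_def divide_inverse mult.commute)
          ultimately show ?thesis
            using X(1) by (simp add: pos_divide_le_eq)
        qed (use gt \<rho> in \<open>simp add: R_def\<close>)
      qed
    qed (use g in auto)
    moreover have "\<forall>\<^sub>F n in sequentially. (LINT t|lborel. R (X n) t) =
        (((LINT t|lborel. f (X n) t) - (LINT t|lborel. f p t) - (LINT t|lborel. D t (X n - p))) /\<^sub>R norm (X n - p))"
      using ev
    proof eventually_elim
      case (elim n)
      then have "X n \<in> U" using inU[of "X n"] \<rho> by auto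
      with elim show ?case
        using Dint integrable p by (simp add: R_def)
    qed
    ultimately show "((\<lambda>y. ((LINT t|lborel. f y t) - (LINT t|lborel. f p t) - (LINT t|lborel. D t (y - p))) /\<^sub>R norm (y - p)) \<circ> X) \<longlonglongrightarrow> 0"
      unfolding o_def by (auto intro: Lim_transform_eventually)
  qed
  moreover have "(LINT t|lborel. D t (\<i> *s h)) = \<i> * (LINT t|lborel. D t h)" for h
    by (simp add: mv_deriv_scale[OF D])
  ultimately show ?thesis unfolding mv_deriv_def by auto
qed

lemma holomorphic: "mv_holomorphic_on (\<lambda>p. LINT t|lborel. f p t) U"
proof (subst mv_holomorphic_on_iff, intro ballI)
  fix p assume "p \<in> U"
  with hol have "\<forall>t. \<exists>D. mv_deriv (\<lambda>p. f p t) D p" unfolding mv_holomorphic_on_iff by blast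
  then obtain D where "\<And>t. mv_deriv (\<lambda>p. f p t) (D t) p" by metis
  from deriv[OF \<open>p \<in> U\<close> this] show "\<exists>D. mv_deriv (\<lambda>p. LINT t|lborel. f p t) D p" by blast
qed

end

subsection \<open>Integrals over horizontal lines\<close>

lemma integrable_exp_neg_abs:
  assumes "\<mu> > 0"
  shows "integrable lborel (\<lambda>t :: real. exp (- \<mu> * \<bar>t\<bar>))"
proof -
  define g where "g t = indicator {0..} t *\<^sub>R exp (- \<mu> * t)" for t :: real
  have g: "integrable lborel g"
  proof -
    have "(\<lambda>t. exp (- \<mu> * t)) absolutely_integrable_on {0..}"
      using integrable_on_exp_minus_to_infinity[OF assms, of 0]
      by (intro nonnegative_absolutely_integrable_1) auto
    then have "set_integrable lborel {0..} (\<lambda>t. exp (- \<mu> * t))"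
      unfolding set_integrable_def
      by (subst (asm) integrable_completion) auto
    then show ?thesis by (simp add: g_def[abs_def] set_integrable_def)
  qed
  have "integrable lborel (\<lambda>t. g t + g (0 + (-1) * t))"
    using g by (intro Bochner_Integration.integrable_add lborel_integrable_real_affine) auto
  then show ?thesis
    by (rule Bochner_Integration.integrable_bound) (auto simp: g_def indicator_def)
qed

text \<open>The zeros of \<open>exp (a * s) - 1\<close> are the points
  \<open>2 * pi * \<i> * n / a\<close>, whose imaginary parts are the multiples of
  \<open>2 * pi * Re a / (norm a)\<^sup>2\<close>. The condition puts the line at height
  \<open>y\<close> strictly between the zero at the origin and the next one above; it is written
  without division so that it is evidently open in \<open>a\<close>.\<close>

definition admissible_height :: "complex \<Rightarrow> real \<Rightarrow> bool" where
  "admissible_height a y \<longleftrightarrow> Re a > 0 \<and> 0 < y \<and> y * (norm a)\<^sup>2 < 2 * pi * Re a"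

lemma exp_strip_neq_1:
  assumes a: "Re a > 0" and s: "\<bar>Im s\<bar> * (norm a)\<^sup>2 < 2 * pi * Re a" "s \<noteq> 0"
  shows "exp (a * s) \<noteq> 1"
proof
  assume "exp (a * s) = 1"
  then obtain n :: int where n: "Re (a * s) = 0" "Im (a * s) = of_int (2 * n) * pi"
    by (auto simp only: exp_eq_1)
  \<comment> \<open>This is the imaginary part of \<open>cnj a * (a * s)\<close>.\<close>
  have "Im s * (norm a)\<^sup>2 = Re a * Im (a * s) - Im a * Re (a * s)"
    unfolding cmod_power2 by (simp add: power2_eq_square algebra_simps)
  also have "\<dots> = 2 * pi * Re a * of_int n" unfolding n by simp
  finally have eq: "Im s * (norm a)\<^sup>2 = 2 * pi * Re a * of_int n" .
  have "\<bar>Im s\<bar> * (norm a)\<^sup>2 = 2 * pi * Re a * \<bar>of_int n\<bar>"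
    using arg_cong[OF eq, of abs] a by (simp add: abs_mult)
  with s(1) have "2 * pi * Re a * \<bar>of_int n\<bar> < 2 * pi * Re a * 1" by simp
  then have "\<bar>real_of_int n\<bar> < 1" using a by (subst (asm) mult_less_cancel_left_pos) auto
  then have "n = 0" by linarith
  with n have "a * s = 0" by (intro complex_eqI) auto
  with a s(2) show False by auto
qed

text \<open>On the far ends of a horizontal line, \<open>exp (a * s) - 1\<close> is comparable to its dominant term.\<close>

lemma norm_exp_minus_1_tail:
  fixes a s :: complex
  assumes "\<alpha> > 0" "Re a \<ge> \<alpha>" "\<bar>Im a * Im s\<bar> \<le> \<beta>" "\<bar>Re s\<bar> \<ge> (\<beta> + ln 2) / \<alpha>"
  shows "norm (exp (a * s) - 1) \<ge> exp (- \<beta>) / 2 * max 1 (exp (Re a * Re s))"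
proof -
  have b0: "\<beta> \<ge> 0" using assms(3) by linarith
  have "\<alpha> * \<bar>Re s\<bar> \<ge> \<beta> + ln 2" using assms(1,4) by (simp add: field_simps)
  moreover have "Re a * \<bar>Re s\<bar> \<ge> \<alpha> * \<bar>Re s\<bar>" using assms(2) by (intro mult_right_mono) auto
  ultimately have big: "Re a * \<bar>Re s\<bar> \<ge> \<beta> + ln 2" by linarith
  have nrm: "norm (exp (a * s)) = exp (Re a * Re s - Im a * Im s)" by simp
  have ln2: "exp (ln 2 :: real) = 2" by simp
  show ?thesis
  proof (cases "Re s \<ge> 0")
    case True
    then have *: "Re a * Re s \<ge> \<beta> + ln 2" using big by simp
    have "exp (ln 2) \<le> exp (Re a * Re s - Im a * Im s)"
      using * assms(3) unfolding exp_le_cancel_iff by linarith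
    then have ge2: "norm (exp (a * s)) \<ge> 2" by (simp add: nrm ln2 del: norm_exp_eq_Re)
    have "exp (Re a * Re s - Im a * Im s) \<ge> exp (- \<beta> + Re a * Re s)" using assms(3) by simp
    then have "norm (exp (a * s)) \<ge> exp (- \<beta>) * exp (Re a * Re s)"
      by (simp only: nrm exp_add)
    moreover have "max 1 (exp (Re a * Re s)) = exp (Re a * Re s)"
      using * b0 by (intro max_absorb2) (simp add: order.trans[OF _ *])
    moreover have "norm (exp (a * s) - 1) \<ge> norm (exp (a * s)) - 1" by (metis norm_one norm_triangle_ineq2)
    ultimately show ?thesis using ge2 by simp
  next
    case False
    then have *: "Re a * Re s \<le> - \<beta> - ln 2" using big by simp
    have "exp (Re a * Re s - Im a * Im s) \<le> exp (- ln 2)" using * assms(3) by simp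
    then have "norm (exp (a * s)) \<le> 1 / 2" by (simp add: nrm exp_minus ln2 inverse_eq_divide del: norm_exp_eq_Re)
    moreover have "norm (exp (a * s) - 1) \<ge> 1 - norm (exp (a * s))" by (metis norm_minus_commute norm_one norm_triangle_ineq2)
    moreover have mx: "max 1 (exp (Re a * Re s)) = 1"
    proof -
      have "ln 2 > (0 :: real)" by simp
      then have "Re a * Re s \<le> 0" using * b0 by linarith
      then show ?thesis by simp
    qed
    moreover have "exp (- \<beta>) \<le> 1" using b0 by simp
    ultimately show ?thesis unfolding mx by linarith
  qed
qed

text \<open>Beyond \<open>T\<close> the tail estimate applies with constants common to all
  \<open>a\<close> near \<open>a0\<close>; the remaining pairs \<open>(a, t)\<close> form a compact
  set, on which a continuous positive function has a positive minimum.\<close>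

lemma norm_exp_minus_1_line:
  assumes "admissible_height a0 y"
  shows "\<exists>r>0. \<exists>c>0. \<forall>a\<in>ball a0 r. admissible_height a y \<and>
    (\<forall>t. norm (exp (a * Complex t y) - 1) \<ge> c * max 1 (exp (Re a * t)))"
proof -
  have y: "y > 0" using assms by (simp add: admissible_height_def)
  have "open {a. admissible_height a y}"
    unfolding admissible_height_def
    by (intro open_Collect_conj open_Collect_less continuous_intros)
  then obtain r1 where r1: "r1 > 0" "ball a0 r1 \<subseteq> {a. admissible_height a y}"
    using assms unfolding open_contains_ball by blast
  define \<alpha> where "\<alpha> = Re a0 / 2"
  have \<alpha>: "\<alpha> > 0" using assms by (simp add: \<alpha>_def admissible_height_def)
  define r where "r = min (r1 / 2) \<alpha>"
  have r: "r > 0" using r1 \<alpha> by (simp add: r_def)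
  define M where "M = norm a0 + r"
  define \<beta> where "\<beta> = M * y"
  define T where "T = (\<beta> + ln 2) / \<alpha>"
  have adm: "admissible_height a y" if "a \<in> cball a0 r" for a
    using that r1 by (auto simp: r_def subset_iff)
  have Re: "Re a \<ge> \<alpha>" if "a \<in> cball a0 r" for a
  proof -
    have "\<bar>Re (a0 - a)\<bar> \<le> \<alpha>" using that abs_Re_le_cmod[of "a0 - a"] by (simp add: dist_norm r_def)
    then have "Re a0 - Re a \<le> Re a0 / 2" unfolding \<alpha>_def minus_complex.simps by linarith
    then show ?thesis unfolding \<alpha>_def by linarith
  qed
  have nrm: "norm a \<le> M" if "a \<in> cball a0 r" for a
    using that norm_triangle_sub[of a a0] by (simp add: M_def dist_norm norm_minus_commute)
  define K where "K = cball a0 r \<times> {-T..T}"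
  define N where "N = (\<lambda>(a, t). norm (exp (a * Complex t y) - 1))"
  have "continuous_on K N"
    unfolding N_def K_def split_def Complex_eq by (intro continuous_intros)
  moreover have "compact K" unfolding K_def by (intro compact_Times) auto
  moreover have "N x > 0" if "x \<in> K" for x
    using that exp_strip_neq_1 adm y by (fastforce simp: K_def N_def admissible_height_def complex_eq_iff)
  ultimately have "\<exists>c0>0. \<forall>x\<in>K. N x \<ge> c0"
  proof (cases "K = {}")
    case False
    obtain x where "x \<in> K" "\<forall>y\<in>K. N x \<le> N y"
      using continuous_attains_inf[OF \<open>compact K\<close> False \<open>continuous_on K N\<close>] by blast
    with \<open>\<And>x. x \<in> K \<Longrightarrow> N x > 0\<close> show ?thesis by blast
  qed (use zero_less_one in blast)
  then obtain c0 where c0: "c0 > 0" "\<And>x. x \<in> K \<Longrightarrow> N x \<ge> c0" by blast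
  define c where "c = min (exp (- \<beta>) / 2) (c0 / exp (M * \<bar>T\<bar>))"
  have "c * max 1 (exp (Re a * t)) \<le> norm (exp (a * Complex t y) - 1)" if a: "a \<in> cball a0 r" for a t
  proof (cases "\<bar>t\<bar> \<ge> T")
    case True
    have "\<bar>Im a * y\<bar> \<le> \<beta>"
      using abs_Im_le_cmod[of a] nrm[OF a] y by (simp add: \<beta>_def abs_mult mult_right_mono)
    with True \<alpha> Re[OF a] have "norm (exp (a * Complex t y) - 1) \<ge> exp (- \<beta>) / 2 * max 1 (exp (Re a * t))"
      using norm_exp_minus_1_tail[of \<alpha> a "Complex t y" \<beta>] by (simp add: T_def)
    moreover have "c * max 1 (exp (Re a * t)) \<le> exp (- \<beta>) / 2 * max 1 (exp (Re a * t))"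
      by (intro mult_right_mono) (auto simp only: c_def min.cobounded1)
    ultimately show ?thesis by linarith
  next
    case False
    then have "c0 \<le> norm (exp (a * Complex t y) - 1)"
    proof -
      have "(a, t) \<in> K" using False a by (auto simp: K_def abs_le_iff)
      from c0(2)[OF this] show ?thesis by (simp add: N_def)
    qed
    moreover have "max 1 (exp (Re a * t)) \<le> exp (M * \<bar>T\<bar>)"
    proof -
      have "Re a * t \<le> M * \<bar>T\<bar>"
      proof -
        have "Re a * t \<le> \<bar>Re a\<bar> * \<bar>t\<bar>" by (metis abs_ge_self abs_mult)
        also have "\<dots> \<le> M * \<bar>T\<bar>"
          using False nrm[OF a] abs_Re_le_cmod[of a] by (intro mult_mono) (auto simp: M_def r less_imp_le)
        finally show ?thesis .
      qed
      moreover have "0 \<le> M * \<bar>T\<bar>" using r by (simp add: M_def)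
      ultimately show ?thesis by simp
    qed
    then have "c * max 1 (exp (Re a * t)) \<le> c0 / exp (M * \<bar>T\<bar>) * exp (M * \<bar>T\<bar>)"
      using c0 by (intro mult_mono) (auto simp: c_def)
    ultimately show ?thesis by simp
  qed
  moreover have "c > 0" using c0 by (simp add: c_def)
  ultimately show ?thesis
    using r adm by (intro exI[of _ r] conjI exI[of _ c]) auto
qed

text \<open>\<open>ker 1 1 1\<close> is the integrand of \<open>F\<close>, and
  \<open>- ker 2 1 1\<close> taken at \<open>z + a\<close> is that of \<open>G\<close>.
  Differentiation in \<open>z\<close> lowers \<open>k\<close>; taking differences under a shift of
  \<open>z\<close> by a period lowers \<open>m\<close> or \<open>n\<close>.\<close>

definition ker :: "nat \<Rightarrow> nat \<Rightarrow> nat \<Rightarrow> complex ^ 3 \<Rightarrow> complex \<Rightarrow> complex" where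
  "ker m n k p s = exp (p $ 1 * s) / ((exp (p $ 2 * s) - 1) ^ m * (exp (p $ 3 * s) - 1) ^ n * s ^ k)"

text \<open>The lower bound on \<open>Re (p $ 1)\<close> gives exponential decay of the kernel on
  the left, the upper bound decay on the right.\<close>

definition ker_dom :: "nat \<Rightarrow> nat \<Rightarrow> (complex ^ 3) set" where
  "ker_dom m n = {p. Re (p $ 2) > 0 \<and> Re (p $ 3) > 0 \<and> 0 < Re (p $ 1) \<and>
     Re (p $ 1) < real m * Re (p $ 2) + real n * Re (p $ 3)}"

definition height_dom :: "real \<Rightarrow> (complex ^ 3) set" where
  "height_dom y = {p. admissible_height (p $ 2) y \<and> admissible_height (p $ 3) y}"

lemma open_ker_dom: "open (ker_dom m n)"
  unfolding ker_dom_def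
  by (intro open_Collect_conj open_Collect_less continuous_intros)

lemma convex_ker_dom: "convex (ker_dom m n)"
proof (rule convexI)
  fix p q and u v :: real assume "p \<in> ker_dom m n" "q \<in> ker_dom m n" "0 \<le> u" "0 \<le> v" "u + v = 1"
  moreover have pos: "u * x + v * y > 0" if "x > 0" "y > 0" for x y :: real
    using that \<open>0 \<le> u\<close> \<open>0 \<le> v\<close> \<open>u + v = 1\<close>
    by (smt (verit, ccfv_threshold) mult_nonneg_nonneg mult_pos_pos)
  ultimately show "u *\<^sub>R p + v *\<^sub>R q \<in> ker_dom m n"
    using pos[of "real m * Re (p $ 2) + real n * Re (p $ 3) - Re (p $ 1)" "real m * Re (q $ 2) + real n * Re (q $ 3) - Re (q $ 1)"]
    by (auto simp: ker_dom_def pos algebra_simps)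
qed

lemma open_height_dom: "open (height_dom y)"
  unfolding height_dom_def admissible_height_def
  by (intro open_Collect_conj open_Collect_less continuous_intros)

lemma exp_domination:
  fixes z A t :: real
  assumes "\<mu> \<le> z" "z + \<mu> \<le> A" "\<mu> > 0" "D \<ge> max 1 (exp (A * t))"
  shows "exp (z * t) / D \<le> exp (- \<mu> * \<bar>t\<bar>)"
proof -
  have D: "D > 0" using assms(4) by (meson less_le_trans max.boundedE zero_less_one)
  have "exp (z * t) \<le> exp (- \<mu> * \<bar>t\<bar>) * D"
  proof (cases "t \<ge> 0")
    case True
    then have "(z + \<mu>) * t \<le> A * t" using assms(2) by (intro mult_right_mono) auto
    then have "exp (z * t) \<le> exp (- \<mu> * \<bar>t\<bar>) * exp (A * t)" using True by (simp add: algebra_simps flip: exp_add)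
    also have "\<dots> \<le> exp (- \<mu> * \<bar>t\<bar>) * D" using assms(4) by (intro mult_left_mono) auto
    finally show ?thesis .
  next
    case False
    then have "z * t \<le> \<mu> * t" using assms(1) by simp
    then have "exp (z * t) \<le> exp (- \<mu> * \<bar>t\<bar>) * 1" using False by simp
    also have "\<dots> \<le> exp (- \<mu> * \<bar>t\<bar>) * D" using assms(4) by (intro mult_left_mono) auto
    finally show ?thesis .
  qed
  with D show ?thesis by (simp add: field_simps)
qed

text \<open>
  The three factors of the denominator are bounded below separately; the factors \<open>max 1 \<dots>\<close>
  multiply to at least \<open>max 1 (exp ((m Re a + n Re b) t))\<close>.
\<close>

lemma ker_bound:
  assumes "\<mu> > 0" "\<mu> \<le> Re (p $ 1)" "Re (p $ 1) + \<mu> \<le> real m * Re (p $ 2) + real n * Re (p $ 3)"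
    and "c > 0" "d > 0" "e > 0"
    and "norm (exp (p $ 2 * s) - 1) \<ge> c * max 1 (exp (Re (p $ 2) * Re s))"
    and "norm (exp (p $ 3 * s) - 1) \<ge> d * max 1 (exp (Re (p $ 3) * Re s))"
    and "norm s \<ge> e" and B: "\<bar>Im (p $ 1) * Im s\<bar> \<le> \<beta>" and Re: "Re (p $ 2) > 0" "Re (p $ 3) > 0"
  shows "norm (ker m n k p s) \<le> exp \<beta> / (c ^ m * d ^ n * e ^ k) * exp (- \<mu> * \<bar>Re s\<bar>)"
proof -
  define X where "X = max 1 (exp (Re (p $ 2) * Re s)) ^ m * max 1 (exp (Re (p $ 3) * Re s)) ^ n"
  have X: "X \<ge> max 1 (exp ((real m * Re (p $ 2) + real n * Re (p $ 3)) * Re s))"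
  proof (rule max.boundedI)
    have "1 * 1 \<le> X" unfolding X_def by (intro mult_mono one_le_power) auto
    then show "1 \<le> X" by simp
    have "exp (Re (p $ 2) * Re s) ^ m * exp (Re (p $ 3) * Re s) ^ n \<le> X"
      unfolding X_def by (intro mult_mono power_mono) auto
    then show "exp ((real m * Re (p $ 2) + real n * Re (p $ 3)) * Re s) \<le> X"
      by (simp add: distrib_right exp_add flip: exp_of_nat_mult mult.assoc)
  qed
  have "c ^ m * d ^ n * e ^ k * X =
      (c * max 1 (exp (Re (p $ 2) * Re s))) ^ m * (d * max 1 (exp (Re (p $ 3) * Re s))) ^ n * e ^ k"
    by (simp add: X_def power_mult_distrib)
  also have "\<dots> \<le> norm (exp (p $ 2 * s) - 1) ^ m * norm (exp (p $ 3 * s) - 1) ^ n * norm s ^ k"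
    using assms by (intro mult_mono power_mono) auto
  finally have den: "c ^ m * d ^ n * e ^ k * X \<le> norm (exp (p $ 2 * s) - 1) ^ m * norm (exp (p $ 3 * s) - 1) ^ n * norm s ^ k" .
  have Xpos: "X > 0" using X by (meson less_le_trans max.boundedE zero_less_one)
  have num: "norm (exp (p $ 1 * s)) \<le> exp \<beta> * exp (Re (p $ 1) * Re s)"
    using B by (simp flip: exp_add)
  have "norm (ker m n k p s) = norm (exp (p $ 1 * s)) /
      (norm (exp (p $ 2 * s) - 1) ^ m * norm (exp (p $ 3 * s) - 1) ^ n * norm s ^ k)"
    by (simp add: ker_def norm_divide norm_mult norm_power)
  also have "\<dots> \<le> (exp \<beta> * exp (Re (p $ 1) * Re s)) / (c ^ m * d ^ n * e ^ k * X)"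
    by (rule frac_le) (use num den Xpos assms in auto)
  also have "\<dots> = exp \<beta> / (c ^ m * d ^ n * e ^ k) * (exp (Re (p $ 1) * Re s) / X)"
    by simp
  also have "\<dots> \<le> exp \<beta> / (c ^ m * d ^ n * e ^ k) * exp (- \<mu> * \<bar>Re s\<bar>)"
    by (intro mult_left_mono exp_domination[OF assms(2,3,1) X]) (use assms in auto)
  finally show ?thesis .
qed

lemma ker_dom_locally_uniform:
  assumes "p0 \<in> ker_dom m n"
  shows "\<exists>r>0. \<exists>\<mu>>0. \<exists>M. \<forall>p\<in>ball p0 r. \<mu> \<le> Re (p $ 1) \<and>
    Re (p $ 1) + \<mu> \<le> real m * Re (p $ 2) + real n * Re (p $ 3) \<and> norm (p $ 1) \<le> M"
proof -
  define \<mu> where "\<mu> = min (Re (p0 $ 1)) (real m * Re (p0 $ 2) + real n * Re (p0 $ 3) - Re (p0 $ 1)) / 2"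
  have \<mu>: "\<mu> > 0" using assms by (auto simp: \<mu>_def ker_dom_def)
  define Q where "Q = {p :: complex ^ 3. \<mu> < Re (p $ 1) \<and>
    Re (p $ 1) + \<mu> < real m * Re (p $ 2) + real n * Re (p $ 3) \<and> norm (p $ 1) < norm (p0 $ 1) + 1}"
  have "open Q"
    unfolding Q_def by (intro open_Collect_conj open_Collect_less continuous_intros)
  moreover have "p0 \<in> Q" using assms by (auto simp: Q_def \<mu>_def ker_dom_def min_def field_simps)
  ultimately obtain r where "r > 0" "ball p0 r \<subseteq> Q" by (meson open_contains_ball)
  with \<mu> show ?thesis
    by (intro exI[of _ r] exI[of _ \<mu>] exI[of _ "norm (p0 $ 1) + 1"] conjI) (auto simp: Q_def subset_iff less_imp_le)
qed

lemma ker_dominated: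
  assumes p0: "p0 \<in> ker_dom m n" "p0 \<in> height_dom y"
  shows "\<exists>r>0. \<exists>\<mu>>0. \<exists>C. \<forall>p\<in>ball p0 r. \<forall>t. norm (ker m n k p (Complex t y)) \<le> C * exp (- \<mu> * \<bar>t\<bar>)"
proof -
  obtain r1 \<mu> M where 1: "r1 > 0" "\<mu> > 0" "\<And>p. p \<in> ball p0 r1 \<Longrightarrow> \<mu> \<le> Re (p $ 1) \<and>
    Re (p $ 1) + \<mu> \<le> real m * Re (p $ 2) + real n * Re (p $ 3) \<and> norm (p $ 1) \<le> M"
    using ker_dom_locally_uniform[OF p0(1)] by blast
  obtain r2 c where 2: "r2 > 0" "c > 0" "\<And>a t. a \<in> ball (p0 $ 2) r2 \<Longrightarrow> admissible_height a y \<and>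
      norm (exp (a * Complex t y) - 1) \<ge> c * max 1 (exp (Re a * t))"
    using norm_exp_minus_1_line p0(2) unfolding height_dom_def by blast
  obtain r3 d where 3: "r3 > 0" "d > 0" "\<And>a t. a \<in> ball (p0 $ 3) r3 \<Longrightarrow> admissible_height a y \<and>
      norm (exp (a * Complex t y) - 1) \<ge> d * max 1 (exp (Re a * t))"
    using norm_exp_minus_1_line p0(2) unfolding height_dom_def by blast
  define r where "r = min r1 (min r2 r3)"
  have y: "y > 0" using p0(2) by (auto simp: height_dom_def admissible_height_def)
  have "norm (ker m n k p (Complex t y)) \<le> exp (M * y) / (c ^ m * d ^ n * y ^ k) * exp (- \<mu> * \<bar>t\<bar>)"
    if p: "p \<in> ball p0 r" for p t
  proof -
    have "dist (p0 $ i) (p $ i) < r" for i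
      using p dist_vec_nth_le[of p0 i p] by (auto intro: le_less_trans)
    then have b: "p \<in> ball p0 r1" "p $ 2 \<in> ball (p0 $ 2) r2" "p $ 3 \<in> ball (p0 $ 3) r3"
      using p by (auto simp: r_def)
    have "\<bar>Im (p $ 1) * y\<bar> \<le> M * y"
      using 1(3)[OF b(1)] abs_Im_le_cmod[of "p $ 1"] y by (simp add: abs_mult mult_right_mono)
    moreover have "norm (Complex t y) \<ge> y" using abs_Im_le_cmod[of "Complex t y"] y by simp
    ultimately show ?thesis
      using ker_bound[of \<mu> p m n c d y "Complex t y" "M * y" k] 1(2) 1(3)[OF b(1)] 2(2) 2(3)[OF b(2)] 3(2) 3(3)[OF b(3)] y
      by (simp add: admissible_height_def)
  qed
  moreover have "r > 0" using 1 2 3 by (simp add: r_def)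
  ultimately show ?thesis using 1(2) by blast
qed

section \<open>The detour contour as a horizontal line\<close>

lemma set_integrable_exp_decay:
  fixes g :: "real \<Rightarrow> complex"
  assumes A: "closed A" and g: "continuous_on A g" and \<mu>: "\<mu> > 0"
    and bound: "\<And>t. t \<in> A \<Longrightarrow> \<bar>t\<bar> \<ge> T \<Longrightarrow> norm (g t) \<le> C * exp (- \<mu> * \<bar>t\<bar>)"
  shows "set_integrable lborel A g"
proof -
  have "compact (g ` (A \<inter> {-T..T}))"
    using A g by (intro compact_continuous_image closed_Int_compact) (auto intro: continuous_on_subset)
  then obtain M where M: "M > 0" "\<And>t. t \<in> A \<inter> {-T..T} \<Longrightarrow> norm (g t) \<le> M"
    by (metis compact_imp_bounded bounded_pos imageI)
  define K where "K = \<bar>C\<bar> + M * exp (\<mu> * \<bar>T\<bar>)"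
  have le: "norm (g t) \<le> K * exp (- \<mu> * \<bar>t\<bar>)" if "t \<in> A" for t
  proof (cases "\<bar>t\<bar> \<ge> T")
    case True
    have "C \<le> K" using M by (simp add: K_def add_increasing2)
    then have "C * exp (- \<mu> * \<bar>t\<bar>) \<le> K * exp (- \<mu> * \<bar>t\<bar>)" by simp
    with bound[OF that True] show ?thesis by linarith
  next
    case False
    have "\<mu> * \<bar>t\<bar> \<le> \<mu> * \<bar>T\<bar>" using False \<mu> by simp
    then have "M * 1 \<le> M * (exp (\<mu> * \<bar>T\<bar>) * exp (- \<mu> * \<bar>t\<bar>))"
      using M by (intro mult_left_mono) (auto simp flip: exp_add)
    also have "\<dots> \<le> K * exp (- \<mu> * \<bar>t\<bar>)" by (simp add: K_def algebra_simps)
    finally show ?thesis using M(2)[of t] that False by (simp add: abs_if split: if_splits)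
  qed
  have meas: "set_borel_measurable borel A g"
    using A g by (simp add: set_borel_measurable_def borel_measurable_continuous_on_indicator)
  show ?thesis
    unfolding set_integrable_def
  proof (rule Bochner_Integration.integrable_bound)
    show "integrable lborel (\<lambda>t. K * exp (- \<mu> * \<bar>t\<bar>))"
      using integrable_exp_neg_abs[OF \<mu>] by simp
    show "(\<lambda>t. indicator A t *\<^sub>R g t) \<in> borel_measurable lborel"
      using meas by (simp add: set_borel_measurable_def)
    show "AE t in lborel. norm (indicator A t *\<^sub>R g t) \<le> norm (K * exp (- \<mu> * \<bar>t\<bar>))"
    proof (rule AE_I2)
      fix t
      have "K \<ge> 0" using M by (simp add: K_def)
      then show "norm (indicator A t *\<^sub>R g t) \<le> norm (K * exp (- \<mu> * \<bar>t\<bar>))"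
        using le[of t] by (cases "t \<in> A") (auto simp: abs_mult)
    qed
  qed
qed

lemma integral_truncation_tendsto:
  fixes g :: "real \<Rightarrow> complex"
  assumes g: "set_integrable lborel A g" and A: "A \<in> sets borel"
  shows "(\<lambda>n. integral (A \<inter> {- real n..real n}) g) \<longlonglongrightarrow> integral A g"
proof -
  have sub: "set_integrable lborel (A \<inter> {- real n..real n}) g" for n
    using A by (intro set_integrable_subset[OF g]) auto
  have "(\<lambda>n. LINT t|lborel. indicator (A \<inter> {- real n..real n}) t *\<^sub>R g t) \<longlonglongrightarrow> (LINT t|lborel. indicator A t *\<^sub>R g t)"
  proof (rule integral_dominated_convergence)
    show "integrable lborel (\<lambda>t. norm (indicator A t *\<^sub>R g t))"
      using g unfolding set_integrable_def by (rule integrable_norm)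
    show "(\<lambda>t. indicator A t *\<^sub>R g t) \<in> borel_measurable lborel"
      using g unfolding set_integrable_def by auto
    show "(\<lambda>t. indicator (A \<inter> {- real n..real n}) t *\<^sub>R g t) \<in> borel_measurable lborel" for n
      using sub[of n] unfolding set_integrable_def by auto
    show "AE t in lborel. norm (indicator (A \<inter> {- real n..real n}) t *\<^sub>R g t) \<le> norm (indicator A t *\<^sub>R g t)" for n
      by (rule AE_I2) (auto simp: indicator_def)
    show "AE t in lborel. (\<lambda>n. indicator (A \<inter> {- real n..real n}) t *\<^sub>R g t) \<longlonglongrightarrow> indicator A t *\<^sub>R g t"
    proof (rule AE_I2, rule tendsto_eventually)
      fix t
      obtain N where "real N \<ge> \<bar>t\<bar>" using real_arch_simple by blast
      then have "\<bar>t\<bar> \<le> real n" if "n \<ge> N" for n using that by (meson of_nat_le_iff order_trans)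
      then have "\<forall>\<^sub>F n in sequentially. \<bar>t\<bar> \<le> real n"
        unfolding eventually_sequentially by blast
      then show "\<forall>\<^sub>F n in sequentially. indicator (A \<inter> {- real n..real n}) t *\<^sub>R g t = indicator A t *\<^sub>R g t"
        by eventually_elim (auto simp: indicator_def)
    qed
  qed
  then show ?thesis
    using set_borel_integral_eq_integral(2)[OF sub] set_borel_integral_eq_integral(2)[OF g]
    by (simp add: set_lebesgue_integral_def)
qed

text \<open>
  The strip cut along the negative imaginary axis is star-shaped, so that the integrand has a
  primitive there; both contours are evaluated by it.
\<close>

lemma integral_C_eq_line_integral:
  fixes f :: "complex \<Rightarrow> complex"
  assumes y: "0 < y" "y < h" and hol: "f holomorphic_on {s. \<bar>Im s\<bar> < h} - {0}" and \<mu>: "\<mu> > 0"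
    and tail: "\<And>s. \<bar>Re s\<bar> \<ge> T \<Longrightarrow> 0 \<le> Im s \<Longrightarrow> Im s \<le> y \<Longrightarrow> norm (f s) \<le> C * exp (- \<mu> * \<bar>Re s\<bar>)"
  shows "integral_C f = (LINT t|lborel. f (Complex t y))"
proof -
  define S where "S = {s. \<bar>Im s\<bar> < h} - {s. Re s = 0 \<and> Im s \<le> 0}"
  have S0: "S \<subseteq> {s. \<bar>Im s\<bar> < h} - {0}" by (auto simp: S_def)
  have "open S"
    unfolding S_def
    by (intro open_Diff closed_Collect_conj open_Collect_less closed_Collect_eq closed_Collect_le continuous_intros)
  have fcont: "continuous_on S f"
    using holomorphic_on_imp_continuous_on[OF hol] S0 continuous_on_subset by blast
  have "starlike S"
    unfolding starlike_def
  proof (intro bexI ballI subsetI)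
    show "Complex 0 y \<in> S" using y by (auto simp: S_def)
    fix x s assume x: "x \<in> S" and s: "s \<in> closed_segment (Complex 0 y) x"
    then obtain u where u: "0 \<le> u" "u \<le> 1" "s = (1 - u) *\<^sub>R Complex 0 y + u *\<^sub>R x"
      by (auto simp: closed_segment_def)
    have im: "Im s = (1 - u) * y + u * Im x" and re: "Re s = u * Re x" by (simp_all add: u)
    have "\<bar>Im s\<bar> \<le> (1 - u) * \<bar>y\<bar> + u * \<bar>Im x\<bar>"
      unfolding im using u by (intro order.trans[OF abs_triangle_ineq]) (simp add: abs_mult)
    also have "\<dots> < h"
    proof -
      have "(1 - u) * \<bar>y\<bar> + u * \<bar>Im x\<bar> \<le> max \<bar>y\<bar> \<bar>Im x\<bar>"
        using u convex_bound_le[of "\<bar>y\<bar>" "max \<bar>y\<bar> \<bar>Im x\<bar>" "\<bar>Im x\<bar>" "1 - u" u] by simp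
      also have "\<dots> < h" using x y by (auto simp: S_def)
      finally show ?thesis .
    qed
    finally have "\<bar>Im s\<bar> < h" .
    moreover have "Im s > 0" if "Re s = 0"
    proof (cases "u = 0")
      case False
      then have "Im x > 0" using that re x by (auto simp: S_def)
      then show ?thesis unfolding im using u y False
        by (smt (verit) mult_nonneg_nonneg mult_pos_pos)
    qed (use im y in simp)
    ultimately show "s \<in> S" by (auto simp: S_def)
  qed
  have "\<exists>P. \<forall>x\<in>S. (P has_field_derivative f x) (at x)"
  proof (rule holomorphic_starlike_primitive[OF fcont \<open>starlike S\<close> \<open>open S\<close>, of "{}"])
    show "f field_differentiable at x" if "x \<in> S - {}" for x
      using that \<open>open S\<close> holomorphic_on_subset[OF hol S0] by (auto simp: holomorphic_on_open field_differentiable_def)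
  qed auto
  then obtain P where P: "\<And>x. x \<in> S \<Longrightarrow> (P has_field_derivative f x) (at x)" by blast
  have seg: "integral {x1..x2} (\<lambda>t. f (Complex t b)) = P (Complex x2 b) - P (Complex x1 b)"
    if x: "x1 \<le> x2" and sub: "\<And>t. x1 \<le> t \<Longrightarrow> t \<le> x2 \<Longrightarrow> Complex t b \<in> S" for x1 x2 b
  proof (rule integral_unique, rule fundamental_theorem_of_calculus[OF x])
    fix t assume t: "t \<in> {x1..x2}"
    have "((\<lambda>t. Complex t b) has_vector_derivative 1) (at t within {x1..x2})"
      unfolding Complex_eq has_vector_derivative_def
      by (auto intro!: derivative_eq_intros simp: scaleR_conv_of_real)
    then show "((\<lambda>t. P (Complex t b)) has_vector_derivative f (Complex t b)) (at t within {x1..x2})"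
      using field_vector_diff_chain_within[of "\<lambda>t. Complex t b" 1 t "{x1..x2}" P "f (Complex t b)"]
        P[of "Complex t b"] sub[of t] t
      by (auto simp: o_def intro: has_field_derivative_at_within)
  qed
  have up: "Complex t b \<in> S" if "0 < b" "b < h" for t b using that by (auto simp: S_def)
  have re: "Complex t 0 \<in> S" if "t \<noteq> 0" for t using that y by (auto simp: S_def)
  have cont: "continuous_on A (\<lambda>t. f (Complex t b))" if "\<And>t. t \<in> A \<Longrightarrow> Complex t b \<in> S" for A b
  proof (rule continuous_on_compose2[OF fcont])
    show "continuous_on A (\<lambda>t. Complex t b)" unfolding Complex_eq by (intro continuous_intros)
  qed (use that in blast)
  have "set_integrable lborel UNIV (\<lambda>t. f (Complex t y))"
  proof (rule set_integrable_exp_decay[OF _ _ \<mu>])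
    show "norm (f (Complex t y)) \<le> C * exp (- \<mu> * \<bar>t\<bar>)" if "\<bar>t\<bar> \<ge> T" for t
      using tail[of "Complex t y"] that y by simp
  qed (use up y in \<open>auto intro!: cont\<close>)
  note line = this
  have limU: "(\<lambda>n. P (Complex n y) - P (Complex (- real n) y)) \<longlonglongrightarrow> (LINT t|lborel. f (Complex t y))"
  proof -
    have "(\<lambda>n. integral (UNIV \<inter> {- real n..real n}) (\<lambda>t. f (Complex t y))) \<longlonglongrightarrow> integral UNIV (\<lambda>t. f (Complex t y))"
      by (rule integral_truncation_tendsto[OF line]) simp
    moreover have "integral UNIV (\<lambda>t. f (Complex t y)) = (LINT t|lborel. f (Complex t y))"
      using set_borel_integral_eq_integral(2)[OF line] by (simp add: set_lebesgue_integral_def)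
    ultimately show ?thesis using up y by (simp add: seg)
  qed
  \<comment> \<open>The increments of the primitive along the vertical sides disappear in the limit,
    so that the line at height \<open>y\<close> and the real axis have the same total
    increment.\<close>
  have vert: "(\<lambda>n. P (Complex (c * real n) y) - P (Complex (c * real n) 0)) \<longlonglongrightarrow> 0" if c: "c = 1 \<or> c = -1" for c
  proof (rule Lim_null_comparison)
    have "\<forall>\<^sub>F n in sequentially. real n \<ge> max T 1"
      by (intro filterlim_at_top_imp_at_infinity eventually_compose_filterlim[OF eventually_ge_at_top filterlim_real_sequentially])
    then show "\<forall>\<^sub>F n in sequentially. norm (P (Complex (c * real n) y) - P (Complex (c * real n) 0)) \<le> \<bar>C\<bar> * exp (- \<mu> * real n) * y"
    proof eventually_elim
      case (elim n)
      have "norm (P (Complex (c * real n) y) - P (Complex (c * real n) 0)) \<le> \<bar>C\<bar> * exp (- \<mu> * real n) * norm (Complex (c * real n) y - Complex (c * real n) 0)"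
      proof (rule field_differentiable_bound[of "closed_segment (Complex (c * real n) 0) (Complex (c * real n) y)" P f])
        fix s assume "s \<in> closed_segment (Complex (c * real n) 0) (Complex (c * real n) y)"
        then have s: "Re s = c * real n" "0 \<le> Im s" "Im s \<le> y"
          using y by (auto simp: closed_segment_same_Re closed_segment_eq_real_ivl split: if_splits)
        have "s \<in> S" using s elim c y by (auto simp: S_def)
        then show "(P has_field_derivative f s) (at s within closed_segment (Complex (c * real n) 0) (Complex (c * real n) y))"
          using P has_field_derivative_at_within by blast
        have ab: "\<bar>Re s\<bar> = real n" using s c by auto
        have "norm (f s) \<le> C * exp (- \<mu> * \<bar>Re s\<bar>)" using tail[of s] s elim ab by auto
        also have "\<dots> \<le> \<bar>C\<bar> * exp (- \<mu> * real n)" unfolding ab by (intro mult_right_mono) auto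
        finally show "norm (f s) \<le> \<bar>C\<bar> * exp (- \<mu> * real n)" .
      qed auto
      then show ?case using y by (simp add: cmod_def)
    qed
    show "(\<lambda>n. \<bar>C\<bar> * exp (- \<mu> * real n) * y) \<longlonglongrightarrow> 0"
    proof -
      have "filterlim (\<lambda>n. \<mu> * real n) at_top sequentially"
        using \<mu> by (intro filterlim_tendsto_pos_mult_at_top[OF tendsto_const] filterlim_real_sequentially)
      then have "(\<lambda>n. exp (- (\<mu> * real n))) \<longlonglongrightarrow> 0"
        by (intro filterlim_compose[OF exp_at_bot] filterlim_compose[OF filterlim_uminus_at_bot_at_top])
      from tendsto_mult_left_zero[OF tendsto_mult_right_zero[OF this, of "\<bar>C\<bar>"], of y]
      show ?thesis by simp
    qed
  qed
  have limR: "(\<lambda>n. P (of_real (real n)) - P (of_real (- real n))) \<longlonglongrightarrow> (LINT t|lborel. f (Complex t y))"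
  proof -
    have "(\<lambda>n. (P (Complex n y) - P (Complex (- real n) y)) - (P (Complex (1 * real n) y) - P (Complex (1 * real n) 0))
        + (P (Complex (-1 * real n) y) - P (Complex (-1 * real n) 0))) \<longlonglongrightarrow> (LINT t|lborel. f (Complex t y)) - 0 + 0"
      by (intro tendsto_intros limU vert) auto
    then show ?thesis by (simp add: complex_of_real_def)
  qed
  \<comment> \<open>The value is the same for every small \<open>r\<close>; the limit that defines
    \<open>integral_C\<close> is therefore that of an eventually constant function.\<close>
  have bracket: "integral {..-r} (\<lambda>t. f (of_real t)) + contour_integral (part_circlepath 0 r pi 0) f +
     integral {r..} (\<lambda>t. f (of_real t)) = (LINT t|lborel. f (Complex t y))" if r: "0 < r" "r < h" for r
  proof -
    have "(f has_contour_integral (P (pathfinish (part_circlepath 0 r pi 0)) - P (pathstart (part_circlepath 0 r pi 0)))) (part_circlepath 0 r pi 0)"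
    proof (rule contour_integral_primitive[of S])
      show "path_image (part_circlepath 0 r pi 0) \<subseteq> S"
      proof
        fix s assume "s \<in> path_image (part_circlepath 0 r pi 0)"
        moreover have "closed_segment pi 0 = {0..pi}"
          using pi_gt_zero by (simp add: closed_segment_eq_real_ivl less_le_not_le)
        ultimately obtain x where x: "0 \<le> x" "x \<le> pi" "s = of_real r * cis x"
          by (auto simp: path_image_part_circlepath')
        have "0 \<le> sin x" "sin x \<le> 1" using x by (auto simp: sin_ge_zero)
        moreover have "r * sin x \<le> r * 1" using \<open>sin x \<le> 1\<close> r by (intro mult_left_mono) auto
        then have "r * sin x < h" using r by linarith
        moreover have "sin x > 0" if "cos x = 0" using that \<open>0 \<le> sin x\<close> sin_cos_squared_add[of x] by (auto simp: less_le)
        ultimately show "s \<in> S" using r x by (auto simp: S_def abs_mult mult_pos_pos not_le)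
      qed
    qed (use P in \<open>auto intro: has_field_derivative_at_within\<close>)
    then have semi: "contour_integral (part_circlepath 0 r pi 0) f = P (of_real r) - P (of_real (-r))"
      by (auto simp: contour_integral_unique simp flip: cis_conv_exp)
    have ir: "set_integrable lborel A (\<lambda>t. f (of_real t))" if "A = {r..} \<or> A = {..-r}" for A
    proof (rule set_integrable_exp_decay[OF _ _ \<mu>])
      show "norm (f (of_real t)) \<le> C * exp (- \<mu> * \<bar>t\<bar>)" if "\<bar>t\<bar> \<ge> T" for t
        using tail[of "of_real t"] that y by simp
    qed (use that r in \<open>auto simp: complex_of_real_def intro!: cont re\<close>)
    have "(\<lambda>n. integral ({r..} \<inter> {- real n..real n}) (\<lambda>t. f (of_real t))) \<longlonglongrightarrow> integral {r..} (\<lambda>t. f (of_real t))"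
      "(\<lambda>n. integral ({..-r} \<inter> {- real n..real n}) (\<lambda>t. f (of_real t))) \<longlonglongrightarrow> integral {..-r} (\<lambda>t. f (of_real t))"
      by (rule integral_truncation_tendsto[OF ir]; simp)+
    then have "(\<lambda>n. integral ({..-r} \<inter> {- real n..real n}) (\<lambda>t. f (of_real t)) + (P (of_real r) - P (of_real (-r))) + integral ({r..} \<inter> {- real n..real n}) (\<lambda>t. f (of_real t)))
       \<longlonglongrightarrow> integral {..-r} (\<lambda>t. f (of_real t)) + (P (of_real r) - P (of_real (-r))) + integral {r..} (\<lambda>t. f (of_real t))"
      by (intro tendsto_intros)
    moreover have "\<forall>\<^sub>F n in sequentially. integral ({..-r} \<inter> {- real n..real n}) (\<lambda>t. f (of_real t)) + (P (of_real r) - P (of_real (-r))) + integral ({r..} \<inter> {- real n..real n}) (\<lambda>t. f (of_real t))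
      = P (of_real (real n)) - P (of_real (- real n))"
      using eventually_compose_filterlim[OF eventually_ge_at_top filterlim_real_sequentially, of r]
    proof eventually_elim
      case (elim n)
      have sets: "{..-r} \<inter> {- real n..real n} = {- real n..- r}" "{r..} \<inter> {- real n..real n} = {r..real n}"
        using elim r by auto
      have "integral {- real n..- r} (\<lambda>t. f (of_real t)) = P (of_real (-r)) - P (of_real (- real n))"
        unfolding complex_of_real_def using elim r by (intro seg re) auto
      moreover have "integral {r..real n} (\<lambda>t. f (of_real t)) = P (of_real (real n)) - P (of_real r)"
        unfolding complex_of_real_def using elim r by (intro seg re) auto
      ultimately show ?case unfolding sets by simp
    qed
    ultimately have "(\<lambda>n. P (of_real (real n)) - P (of_real (- real n))) \<longlonglongrightarrow> integral {..-r} (\<lambda>t. f (of_real t)) + (P (of_real r) - P (of_real (-r))) + integral {r..} (\<lambda>t. f (of_real t))"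
      by (rule Lim_transform_eventually)
    from LIMSEQ_unique[OF this limR] semi show ?thesis by simp
  qed
  have "\<forall>\<^sub>F r in at_right 0. integral {..-r} (\<lambda>t. f (of_real t)) + contour_integral (part_circlepath 0 r pi 0) f +
     integral {r..} (\<lambda>t. f (of_real t)) = (LINT t|lborel. f (Complex t y))"
    unfolding eventually_at_right_field using y by (intro exI[of _ h]) (auto intro!: bracket)
  then show ?thesis
    unfolding integral_C_def by (intro tendsto_Lim tendsto_eventually) auto
qed

section \<open>The line integrals as functions of their parameters\<close>

lemma height_dom_mono: "p \<in> height_dom y \<Longrightarrow> 0 < y' \<Longrightarrow> y' \<le> y \<Longrightarrow> p \<in> height_dom y'"
  unfolding height_dom_def admissible_height_def
  by (auto intro: le_less_trans[OF mult_right_mono])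

lemma height_dom_exists:
  assumes "p \<in> ker_dom m n"
  obtains y where "p \<in> height_dom y"
proof -
  define u v where "u = 2 * pi * Re (p $ 2) / (norm (p $ 2))\<^sup>2" and "v = 2 * pi * Re (p $ 3) / (norm (p $ 3))\<^sup>2"
  have pos: "Re (p $ 2) > 0" "Re (p $ 3) > 0" using assms by (auto simp: ker_dom_def)
  then have nz: "norm (p $ 2) > 0" "norm (p $ 3) > 0" by auto
  have uv: "u > 0" "v > 0" using pos nz by (auto simp: u_def v_def)
  define y where "y = min u v / 2"
  have "y < u" "y < v" "y > 0" using uv by (auto simp: y_def min_def)
  then have "p \<in> height_dom y"
    using pos nz by (auto simp: height_dom_def admissible_height_def u_def v_def field_simps)
  then show ?thesis by (rule that)
qed

lemma ker_denominator_nonzero: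
  assumes "p \<in> height_dom y" "\<bar>Im s\<bar> \<le> y" "s \<noteq> 0"
  shows "exp (p $ 2 * s) \<noteq> 1" "exp (p $ 3 * s) \<noteq> 1"
proof -
  have "\<bar>Im s\<bar> * (norm (p $ 2))\<^sup>2 \<le> y * (norm (p $ 2))\<^sup>2" "\<bar>Im s\<bar> * (norm (p $ 3))\<^sup>2 \<le> y * (norm (p $ 3))\<^sup>2"
    using assms by (auto intro!: mult_right_mono)
  then have "\<bar>Im s\<bar> * (norm (p $ 2))\<^sup>2 < 2 * pi * Re (p $ 2)" "\<bar>Im s\<bar> * (norm (p $ 3))\<^sup>2 < 2 * pi * Re (p $ 3)"
    using assms(1) unfolding height_dom_def admissible_height_def by auto
  then show "exp (p $ 2 * s) \<noteq> 1" "exp (p $ 3 * s) \<noteq> 1"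
    using assms by (auto simp: height_dom_def admissible_height_def dest: exp_strip_neq_1)
qed

text \<open>For a single \<open>p\<close>, but uniform over a strip of any height, because beyond
  \<open>T\<close> the strip contains no poles. It disposes of the vertical sides of
  contours.\<close>

lemma ker_tail:
  assumes "p \<in> ker_dom m n" "Y > 0"
  shows "\<exists>\<mu>>0. \<exists>T C. \<forall>s. \<bar>Re s\<bar> \<ge> T \<longrightarrow> \<bar>Im s\<bar> \<le> Y \<longrightarrow> norm (ker m n k p s) \<le> C * exp (- \<mu> * \<bar>Re s\<bar>)"
proof -
  define \<mu> where "\<mu> = min (Re (p $ 1)) (real m * Re (p $ 2) + real n * Re (p $ 3) - Re (p $ 1))"
  have \<mu>: "\<mu> > 0" "\<mu> \<le> Re (p $ 1)" "Re (p $ 1) + \<mu> \<le> real m * Re (p $ 2) + real n * Re (p $ 3)"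
    using assms by (auto simp: \<mu>_def ker_dom_def)
  define \<alpha> where "\<alpha> = min (Re (p $ 2)) (Re (p $ 3))"
  define \<beta> where "\<beta> = (norm (p $ 1) + norm (p $ 2) + norm (p $ 3)) * Y"
  define T where "T = max 1 ((\<beta> + ln 2) / \<alpha>)"
  have \<alpha>: "\<alpha> > 0" using assms by (auto simp: \<alpha>_def ker_dom_def)
  have "norm (ker m n k p s) \<le> exp \<beta> / ((exp (- \<beta>) / 2) ^ m * (exp (- \<beta>) / 2) ^ n * 1 ^ k) * exp (- \<mu> * \<bar>Re s\<bar>)"
    if s: "\<bar>Re s\<bar> \<ge> T" "\<bar>Im s\<bar> \<le> Y" for s
  proof (rule ker_bound[OF \<mu>])
    have im: "\<bar>Im (p $ i) * Im s\<bar> \<le> \<beta>" if "i = 1 \<or> i = 2 \<or> i = 3" for i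
    proof -
      have "\<bar>Im (p $ i)\<bar> \<le> norm (p $ 1) + norm (p $ 2) + norm (p $ 3)"
        using abs_Im_le_cmod[of "p $ i"] that by (auto simp: add_increasing add_increasing2)
      then show ?thesis
        unfolding \<beta>_def abs_mult using s assms(2) by (intro mult_mono) auto
    qed
    show "norm (exp (p $ 2 * s) - 1) \<ge> exp (- \<beta>) / 2 * max 1 (exp (Re (p $ 2) * Re s))"
      using s \<alpha> im[of 2] by (intro norm_exp_minus_1_tail[of \<alpha>]) (auto simp: \<alpha>_def T_def)
    show "norm (exp (p $ 3 * s) - 1) \<ge> exp (- \<beta>) / 2 * max 1 (exp (Re (p $ 3) * Re s))"
      using s \<alpha> im[of 3] by (intro norm_exp_minus_1_tail[of \<alpha>]) (auto simp: \<alpha>_def T_def)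
    show "1 \<le> norm s" using s abs_Re_le_cmod[of s] by (simp add: T_def)
    show "\<bar>Im (p $ 1) * Im s\<bar> \<le> \<beta>" by (rule im) auto
  qed (use assms in \<open>auto simp: ker_dom_def\<close>)
  with \<mu>(1) show ?thesis by blast
qed

lemma ker_holomorphic:
  assumes "p \<in> height_dom y"
  shows "ker m n k p holomorphic_on {s. \<bar>Im s\<bar> \<le> y} - {0}"
  unfolding ker_def
  using ker_denominator_nonzero[OF assms] by (intro holomorphic_intros) auto

lemma integrable_ker_line:
  assumes "p \<in> ker_dom m n" "p \<in> height_dom y" "y' \<noteq> 0" "\<bar>y'\<bar> \<le> y"
  shows "integrable lborel (\<lambda>t. ker m n k p (Complex t y'))"
proof -
  have y: "y > 0" using assms(3,4) by linarith
  obtain \<mu> T C where \<mu>: "\<mu> > 0" and tail: "\<And>s. \<bar>Re s\<bar> \<ge> T \<Longrightarrow> \<bar>Im s\<bar> \<le> y \<Longrightarrow> norm (ker m n k p s) \<le> C * exp (- \<mu> * \<bar>Re s\<bar>)"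
    using ker_tail[OF assms(1) y] by blast
  have "set_integrable lborel UNIV (\<lambda>t. ker m n k p (Complex t y'))"
  proof (rule set_integrable_exp_decay[OF _ _ \<mu>])
    show "continuous_on UNIV (\<lambda>t. ker m n k p (Complex t y'))"
    proof (rule continuous_on_compose2[OF holomorphic_on_imp_continuous_on[OF ker_holomorphic[OF assms(2)]]])
      show "continuous_on UNIV (\<lambda>t. Complex t y')" unfolding Complex_eq by (intro continuous_intros)
    qed (use assms in \<open>auto simp: complex_eq_iff\<close>)
    show "norm (ker m n k p (Complex t y')) \<le> C * exp (- \<mu> * \<bar>t\<bar>)" if "\<bar>t\<bar> \<ge> T" for t
      using tail[of "Complex t y'"] that assms(4) by simp
  qed auto
  then show ?thesis by (simp add: set_integrable_def)
qed

definition W :: "nat \<Rightarrow> nat \<Rightarrow> nat \<Rightarrow> complex ^ 3 \<Rightarrow> complex" where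
  "W m n k p = integral_C (ker m n k p)"

text \<open>The factor \<open>c\<close> is there for the minus sign in the integrand of
  \<open>G\<close>.\<close>

lemma integral_C_ker:
  assumes "p \<in> ker_dom m n" "p \<in> height_dom y"
  shows "integral_C (\<lambda>s. c * ker m n k p s) = c * (LINT t|lborel. ker m n k p (Complex t y))"
proof -
  have y: "y > 0" using assms by (auto simp: height_dom_def admissible_height_def)
  obtain \<mu> T C where \<mu>: "\<mu> > 0" and tail: "\<And>s. \<bar>Re s\<bar> \<ge> T \<Longrightarrow> \<bar>Im s\<bar> \<le> y \<Longrightarrow> norm (ker m n k p s) \<le> C * exp (- \<mu> * \<bar>Re s\<bar>)"
    using ker_tail[OF assms(1) y] by blast
  \<comment> \<open>The heights of the first poles above the real axis, one for each factor of the
    denominator. A height \<open>h\<close> between \<open>y\<close> and both of them gives a strip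
    of holomorphy wider than the one that is used.\<close>
  define u v where "u = 2 * pi * Re (p $ 2) / (norm (p $ 2))\<^sup>2" and "v = 2 * pi * Re (p $ 3) / (norm (p $ 3))\<^sup>2"
  have nz: "norm (p $ 2) > 0" "norm (p $ 3) > 0" using assms by (auto simp: ker_dom_def)
  have yuv: "y < u" "y < v"
    using assms nz by (auto simp: height_dom_def admissible_height_def u_def v_def field_simps)
  define h where "h = (y + min u v) / 2"
  have "y < h" "h < min u v" using yuv by (auto simp: h_def)
  then have h: "y < h" "p \<in> height_dom h"
    using assms nz y by (auto simp: height_dom_def admissible_height_def u_def v_def field_simps)
  have "integral_C (\<lambda>s. c * ker m n k p s) = (LINT t|lborel. c * ker m n k p (Complex t y))"
  proof (rule integral_C_eq_line_integral[OF y h(1) _ \<mu>])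
    show "(\<lambda>s. c * ker m n k p s) holomorphic_on {s. \<bar>Im s\<bar> < h} - {0}"
      by (intro holomorphic_intros holomorphic_on_subset[OF ker_holomorphic[OF h(2)]]) auto
    show "norm (c * ker m n k p s) \<le> (norm c * C) * exp (- \<mu> * \<bar>Re s\<bar>)" if "T \<le> \<bar>Re s\<bar>" "0 \<le> Im s" "Im s \<le> y" for s
      using mult_left_mono[OF tail[of s], of "norm c"] that by (simp add: norm_mult mult.assoc)
  qed
  then show ?thesis by simp
qed

lemma W_line:
  assumes "p \<in> ker_dom m n" "p \<in> height_dom y"
  shows "W m n k p = (LINT t|lborel. ker m n k p (Complex t y))"
  using integral_C_ker[OF assms, of 1 k] by (simp add: W_def)

lemma parametric_integral_ker:
  "parametric_integral (\<lambda>p t. ker m n k p (Complex t y)) (ker_dom m n \<inter> height_dom y)"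
proof
  show "open (ker_dom m n \<inter> height_dom y)" by (intro open_Int open_ker_dom open_height_dom)
  fix t
  have "exp (p $ 2 * Complex t y) \<noteq> 1 \<and> exp (p $ 3 * Complex t y) \<noteq> 1 \<and> Complex t y \<noteq> 0"
    if "p \<in> height_dom y" for p
    using ker_denominator_nonzero[OF that, of "Complex t y"] that
    by (auto simp: height_dom_def admissible_height_def complex_eq_iff)
  then show "mv_holomorphic_on (\<lambda>p. ker m n k p (Complex t y)) (ker_dom m n \<inter> height_dom y)"
    unfolding ker_def by (intro mv_intros) auto
next
  fix p assume p: "p \<in> ker_dom m n \<inter> height_dom y"
  then have "y \<noteq> 0" by (auto simp: height_dom_def admissible_height_def)
  with p show "(\<lambda>t. ker m n k p (Complex t y)) \<in> borel_measurable lborel"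
    using integrable_ker_line[of p m n y y k] by (auto simp: height_dom_def admissible_height_def)
  obtain r \<mu> C where "r > 0" "\<mu> > 0" "\<forall>p\<in>ball p r. \<forall>t. norm (ker m n k p (Complex t y)) \<le> C * exp (- \<mu> * \<bar>t\<bar>)"
    using ker_dominated[of p m n y k] p by auto
  then show "\<exists>r>0. \<exists>g. integrable lborel g \<and>
       (\<forall>q\<in>ker_dom m n \<inter> height_dom y \<inter> ball p r. \<forall>t. norm (ker m n k q (Complex t y)) \<le> g t)"
    using integrable_exp_neg_abs[of \<mu>]
    by (intro exI[of _ r] conjI exI[of _ "\<lambda>t. C * exp (- \<mu> * \<bar>t\<bar>)"]) auto
qed

text \<open>The parametric integral provides some derivative; uniqueness of derivatives identifies
  it pointwise in \<open>t\<close>. Thus only one-variable derivatives of the kernel have to be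
  computed.\<close>

lemma W_deriv:
  assumes p: "p \<in> ker_dom m n" "p \<in> height_dom y"
    and D: "\<And>t. ((\<lambda>c. ker m n k (p + c *s h) (Complex t y)) has_field_derivative D t) (at 0)"
  shows "((\<lambda>c. W m n k (p + c *s h)) has_field_derivative (LINT t|lborel. D t)) (at 0)"
proof -
  interpret parametric_integral "\<lambda>p t. ker m n k p (Complex t y)" "ker_dom m n \<inter> height_dom y"
    by (rule parametric_integral_ker)
  have "\<forall>t. \<exists>D. mv_deriv (\<lambda>p. ker m n k p (Complex t y)) D p"
    using hol p unfolding mv_holomorphic_on_iff by blast
  then obtain E where E: "\<And>t. mv_deriv (\<lambda>p. ker m n k p (Complex t y)) (E t) p" by metis
  have ED: "E t h = D t" for t
    using DERIV_unique[OF mv_deriv_imp_field_derivative[OF E] D] .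
  have "mv_deriv (W m n k) (\<lambda>h. LINT t|lborel. E t h) p"
  proof -
    have "mv_deriv (\<lambda>p. LINT t|lborel. ker m n k p (Complex t y)) (\<lambda>h. LINT t|lborel. E t h) p"
      by (rule deriv) (use p E in auto)
    then show ?thesis
      unfolding mv_deriv_def
      using has_derivative_transform_within_open[OF _ open_U, of _ _ p UNIV "W m n k"] p W_line[of _ m n y k]
      by auto
  qed
  from mv_deriv_imp_field_derivative[OF this, of h] show ?thesis by (simp add: ED)
qed

lemma W_holomorphic: "mv_holomorphic_on (W m n k) (ker_dom m n)"
proof (rule mv_holomorphic_on_Union)
  fix p assume p: "p \<in> ker_dom m n"
  then obtain y where y: "p \<in> height_dom y" by (rule height_dom_exists)
  interpret parametric_integral "\<lambda>p t. ker m n k p (Complex t y)" "ker_dom m n \<inter> height_dom y"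
    by (rule parametric_integral_ker)
  have "mv_holomorphic_on (W m n k) (ker_dom m n \<inter> height_dom y)"
    by (rule mv_holomorphic_on_cong[OF holomorphic open_U]) (simp add: W_line[of _ m n y k])
  with p y show "\<exists>U. p \<in> U \<and> mv_holomorphic_on (W m n k) U" by blast
qed

abbreviation v3 :: "complex \<Rightarrow> complex \<Rightarrow> complex \<Rightarrow> complex ^ 3" where
  "v3 z a b \<equiv> vector [z, a, b]"

lemma v3_eq_iff: "(p :: complex ^ 3) = q \<longleftrightarrow> p $ 1 = q $ 1 \<and> p $ 2 = q $ 2 \<and> p $ 3 = q $ 3"
  by (simp add: vec_eq_iff forall_3)

lemma v3_eta: "v3 (p $ 1) (p $ 2) (p $ 3) = p"
  by (simp add: v3_eq_iff)

lemma mv_holomorphic_v3_curve: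
  assumes f: "mv_holomorphic_on f T" and "open S" "x holomorphic_on S" "y holomorphic_on S" "z holomorphic_on S"
    and "\<And>c. c \<in> S \<Longrightarrow> v3 (x c) (y c) (z c) \<in> T"
  shows "(\<lambda>c. f (v3 (x c) (y c) (z c))) holomorphic_on S"
proof (rule mv_holomorphic_on_compose_curve[OF f _ _ \<open>open S\<close>])
  have "\<forall>i. (\<lambda>c. v3 (x c) (y c) (z c) $ i) holomorphic_on S"
    unfolding forall_3 using assms by simp
  then show "(\<lambda>c. v3 (x c) (y c) (z c) $ i) holomorphic_on S" for i by blast
qed (use assms in auto)

lemma mv_holomorphic_v3_compose:
  fixes x y z :: "complex ^ 'm \<Rightarrow> complex"
  assumes f: "mv_holomorphic_on f T" and "mv_holomorphic_on x S" "mv_holomorphic_on y S" "mv_holomorphic_on z S"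
    and "\<And>p. p \<in> S \<Longrightarrow> v3 (x p) (y p) (z p) \<in> T"
  shows "mv_holomorphic_on (\<lambda>p. f (v3 (x p) (y p) (z p))) S"
proof (rule mv_holomorphic_on_compose_vec[OF f])
  have "\<forall>i. mv_holomorphic_on (\<lambda>p. v3 (x p) (y p) (z p) $ i) S"
    unfolding forall_3 using assms by simp
  then show "mv_holomorphic_on (\<lambda>p. v3 (x p) (y p) (z p) $ i) S" for i by blast
qed (use assms in auto)

text \<open>Differentiating \<open>exp (z * s)\<close> in \<open>z\<close> cancels one power of
  \<open>s\<close>.\<close>

lemma W_deriv_z:
  assumes "v3 z a b \<in> ker_dom m n"
  shows "((\<lambda>z. W m n (Suc k) (v3 z a b)) has_field_derivative W m n k (v3 z a b)) (at z)"
proof -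
  obtain y where y: "v3 z a b \<in> height_dom y" using height_dom_exists[OF assms] .
  have ypos: "y > 0" using y by (auto simp: height_dom_def admissible_height_def)
  have eq: "v3 z a b + c *s v3 1 0 0 = v3 (c + z) a b" for c by (simp add: v3_eq_iff)
  have "((\<lambda>c. W m n (Suc k) (v3 z a b + c *s v3 1 0 0)) has_field_derivative
      (LINT t|lborel. ker m n k (v3 z a b) (Complex t y))) (at 0)"
  proof (rule W_deriv[OF assms y])
    fix t
    have "Complex t y \<noteq> 0" using ypos by (simp add: complex_eq_iff)
    moreover have "exp (a * Complex t y) \<noteq> 1" "exp (b * Complex t y) \<noteq> 1"
      using ker_denominator_nonzero[OF y, of "Complex t y"] ypos \<open>Complex t y \<noteq> 0\<close> by auto
    ultimately show "((\<lambda>c. ker m n (Suc k) (v3 z a b + c *s v3 1 0 0) (Complex t y)) has_field_derivative ker m n k (v3 z a b) (Complex t y)) (at 0)"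
      unfolding ker_def eq by (auto intro!: derivative_eq_intros simp: field_simps)
  qed
  then show ?thesis
    unfolding eq using DERIV_shift[of "\<lambda>z. W m n (Suc k) (v3 z a b)" _ 0 z] W_line[OF assms y]
    by (simp add: add.commute)
qed

lemma W_indep_3: "W m 0 k (v3 z a b) = W m 0 k (v3 z a b')"
proof -
  have "ker m 0 k (v3 z a b) = ker m 0 k (v3 z a b')" by (simp add: ker_def fun_eq_iff)
  then show ?thesis by (simp add: W_def)
qed

text \<open>The derivative of \<open>1 / (exp (a * s) - 1)\<close> in \<open>a\<close> is
  \<open>- s * exp (a * s) / (exp (a * s) - 1)\<^sup>2\<close>: the factor \<open>s\<close> lowers
  \<open>k\<close>, and \<open>exp (a * s)\<close> moves \<open>z\<close> to \<open>z + a\<close>.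
  This is how integrals with a squared factor are obtained from those with a simple one.\<close>

lemma W_deriv_a:
  assumes "v3 z a b \<in> ker_dom 1 0"
  shows "((\<lambda>a. W 1 0 (Suc k) (v3 z a b)) has_field_derivative - W 2 0 k (v3 (z + a) a b)) (at a)"
proof -
  obtain y where y: "v3 z a b \<in> height_dom y" using height_dom_exists[OF assms] .
  have ypos: "y > 0" using y by (auto simp: height_dom_def admissible_height_def)
  have eq: "v3 z a b + c *s v3 0 1 0 = v3 z (c + a) b" for c by (simp add: v3_eq_iff)
  have "((\<lambda>c. W 1 0 (Suc k) (v3 z a b + c *s v3 0 1 0)) has_field_derivative
      (LINT t|lborel. - ker 2 0 k (v3 (z + a) a b) (Complex t y))) (at 0)"
  proof (rule W_deriv[OF assms y])
    fix t
    have "Complex t y \<noteq> 0" using ypos by (simp add: complex_eq_iff)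
    moreover have "exp (a * Complex t y) \<noteq> 1"
      using ker_denominator_nonzero[OF y, of "Complex t y"] ypos \<open>Complex t y \<noteq> 0\<close> by auto
    moreover define d where "d = exp (a * Complex t y) - 1"
    ultimately have nz: "Complex t y \<noteq> 0" "d \<noteq> 0" and X: "exp (a * Complex t y) = d + 1" by auto
    have g: "((\<lambda>c. exp ((c + a) * Complex t y) - 1) has_field_derivative Complex t y * (d + 1)) (at 0)"
      by (auto intro!: derivative_eq_intros simp: X)
    have eq1: "(\<lambda>c. ker 1 0 (Suc k) (v3 z a b + c *s v3 0 1 0) (Complex t y)) =
        (\<lambda>c. exp (z * Complex t y) / Complex t y ^ Suc k / (exp ((c + a) * Complex t y) - 1))"
      unfolding ker_def eq by (simp add: fun_eq_iff mult_ac)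
    have eq2: "- ker 2 0 k (v3 (z + a) a b) (Complex t y) =
        (0 * (exp ((0 + a) * Complex t y) - 1) - exp (z * Complex t y) / Complex t y ^ Suc k * (Complex t y * (d + 1))) /
        ((exp ((0 + a) * Complex t y) - 1) * (exp ((0 + a) * Complex t y) - 1))"
      using nz by (simp add: ker_def X distrib_right exp_add power2_eq_square)
    show "((\<lambda>c. ker 1 0 (Suc k) (v3 z a b + c *s v3 0 1 0) (Complex t y)) has_field_derivative - ker 2 0 k (v3 (z + a) a b) (Complex t y)) (at 0)"
      unfolding eq1 eq2 by (rule DERIV_divide[OF DERIV_const g]) (use nz X in simp)
  qed
  moreover have "v3 (z + a) a b \<in> ker_dom 2 0" "v3 (z + a) a b \<in> height_dom y"
    using assms y by (auto simp: ker_dom_def height_dom_def)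
  ultimately show ?thesis
    unfolding eq using DERIV_shift[of "\<lambda>a. W 1 0 (Suc k) (v3 z a b)" _ 0 a] W_line[of "v3 (z + a) a b" 2 0 y k]
    by (simp add: add.commute)
qed

text \<open>Adding \<open>\<i> * T\<close> to \<open>z\<close> multiplies the integrand by
  \<open>exp (\<i> * T * s)\<close>, which has constant norm \<open>exp (- (T * y))\<close> on the
  line at height \<open>y > 0\<close>.\<close>

lemma W_vertical_decay:
  assumes "v3 z a b \<in> ker_dom m n"
  shows "\<exists>y>0. \<exists>K. \<forall>T. norm (W m n k (v3 (z + \<i> * of_real T) a b)) \<le> K * exp (- (T * y))"
proof -
  obtain y where y: "v3 z a b \<in> height_dom y" using height_dom_exists[OF assms] .
  have ypos: "y > 0" using y by (auto simp: height_dom_def admissible_height_def)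
  have "norm (W m n k (v3 (z + \<i> * of_real T) a b)) \<le> (LINT t|lborel. norm (ker m n k (v3 z a b) (Complex t y))) * exp (- (T * y))" for T
  proof -
    have "v3 (z + \<i> * of_real T) a b \<in> ker_dom m n" "v3 (z + \<i> * of_real T) a b \<in> height_dom y"
      using assms y by (auto simp: ker_dom_def height_dom_def)
    note W_line[OF this, of k]
    also have "(LINT t|lborel. ker m n k (v3 (z + \<i> * of_real T) a b) (Complex t y)) =
        (LINT t|lborel. ker m n k (v3 z a b) (Complex t y) * exp (\<i> * of_real T * Complex t y))"
      by (intro Bochner_Integration.integral_cong refl) (simp add: ker_def exp_add distrib_right)
    also have "norm \<dots> \<le> (LINT t|lborel. norm (ker m n k (v3 z a b) (Complex t y) * exp (\<i> * of_real T * Complex t y)))"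
      by (rule integral_norm_bound)
    also have "\<dots> = (LINT t|lborel. norm (ker m n k (v3 z a b) (Complex t y)) * exp (- (T * y)))"
      by (intro Bochner_Integration.integral_cong refl) (simp add: norm_mult)
    finally show ?thesis by simp
  qed
  with ypos show ?thesis by blast
qed

lemma W_vertical_limit:
  assumes "v3 z a b \<in> ker_dom m n"
  shows "((\<lambda>T. W m n k (v3 (z + \<i> * of_real T) a b)) \<longlongrightarrow> 0) at_top"
proof -
  obtain y K where y: "y > 0" and K: "\<And>T. norm (W m n k (v3 (z + \<i> * of_real T) a b)) \<le> K * exp (- (T * y))"
    using W_vertical_decay[OF assms] by blast
  have "((\<lambda>T. K * exp (- (T * y))) \<longlongrightarrow> K * 0) at_top"
    using y by (intro tendsto_intros filterlim_compose[OF exp_at_bot] filterlim_compose[OF filterlim_uminus_at_bot_at_top]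
      filterlim_at_top_mult_tendsto_pos[OF tendsto_const] filterlim_ident)
  then have "((\<lambda>T. K * exp (- (T * y))) \<longlongrightarrow> 0) at_top" by simp
  then show ?thesis by (rule Lim_null_comparison[rotated]) (use K in auto)
qed

text \<open>The substitution \<open>s \<mapsto> s / c\<close> moves the line of integration to another admissible height.\<close>

lemma W_scale_real:
  assumes "v3 z a b \<in> ker_dom m n" "c > 0"
  shows "W m n 1 (v3 (of_real c * z) (of_real c * a) (of_real c * b)) = W m n 1 (v3 z a b)"
proof -
  obtain y where y: "v3 z a b \<in> height_dom y" using height_dom_exists[OF assms(1)] .
  have adm: "admissible_height (of_real c * a) (y / c)" if "admissible_height a y" for a
    using that assms(2) unfolding admissible_height_def
    by (auto simp: norm_mult power_mult_distrib power2_eq_square field_simps)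
  have 1: "v3 (of_real c * z) (of_real c * a) (of_real c * b) \<in> ker_dom m n"
    using assms by (auto simp: ker_dom_def mult_ac simp flip: distrib_left)
  have 2: "v3 (of_real c * z) (of_real c * a) (of_real c * b) \<in> height_dom (y / c)"
    using y adm by (auto simp: height_dom_def)
  have "W m n 1 (v3 z a b) = (LINT t|lborel. ker m n 1 (v3 z a b) (Complex t y))"
    by (rule W_line[OF assms(1) y])
  also have "\<dots> = c *\<^sub>R (LINT t|lborel. ker m n 1 (v3 z a b) (Complex (0 + c * t) y))"
    using lborel_integral_real_affine[of c "\<lambda>t. ker m n 1 (v3 z a b) (Complex t y)" 0] assms(2) by simp
  also have "\<dots> = (LINT t|lborel. c *\<^sub>R ker m n 1 (v3 z a b) (Complex (0 + c * t) y))"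
    by simp
  also have "\<dots> = (LINT t|lborel. ker m n 1 (v3 (of_real c * z) (of_real c * a) (of_real c * b)) (Complex t (y / c)))"
  proof (intro Bochner_Integration.integral_cong refl)
    fix t
    have "Complex (0 + c * t) y = of_real c * Complex t (y / c)"
      using assms(2) by (simp add: complex_eq_iff)
    then show "c *\<^sub>R ker m n 1 (v3 z a b) (Complex (0 + c * t) y) =
        ker m n 1 (v3 (of_real c * z) (of_real c * a) (of_real c * b)) (Complex t (y / c))"
      using assms(2) by (simp add: ker_def scaleR_conv_of_real mult_ac)
  qed
  also have "\<dots> = W m n 1 (v3 (of_real c * z) (of_real c * a) (of_real c * b))"
    by (rule W_line[OF 1 2, symmetric])
  finally show ?thesis ..
qed

text \<open>
  As a function of the scaling factor the integral is holomorphic on a convex set and constant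
  along rays, so that its derivative vanishes.
\<close>

lemma W_scale:
  assumes p: "v3 z a b \<in> ker_dom m n" and q: "v3 (c * z) (c * a) (c * b) \<in> ker_dom m n"
  shows "W m n 1 (v3 (c * z) (c * a) (c * b)) = W m n 1 (v3 z a b)"
proof -
  define \<Lambda> where "\<Lambda> = {c. v3 (c * z) (c * a) (c * b) \<in> ker_dom m n}"
  define f where "f c = W m n 1 (v3 (c * z) (c * a) (c * b))" for c
  have "\<Lambda> = {c. Re (c * a) > 0} \<inter> {c. Re (c * b) > 0} \<inter> {c. 0 < Re (c * z)} \<inter>
      {c. Re (c * z) < real m * Re (c * a) + real n * Re (c * b)}"
    by (auto simp: \<Lambda>_def ker_dom_def)
  then have "open \<Lambda>"
    by (auto intro!: open_Int open_Collect_less continuous_intros)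
  have "convex \<Lambda>"
  proof (rule convexI)
    fix x y and u v :: real assume *: "x \<in> \<Lambda>" "y \<in> \<Lambda>" "0 \<le> u" "0 \<le> v" "u + v = 1"
    have "v3 ((u *\<^sub>R x + v *\<^sub>R y) * z) ((u *\<^sub>R x + v *\<^sub>R y) * a) ((u *\<^sub>R x + v *\<^sub>R y) * b) =
      u *\<^sub>R v3 (x * z) (x * a) (x * b) + v *\<^sub>R v3 (y * z) (y * a) (y * b)"
      by (simp add: v3_eq_iff algebra_simps)
    with * convexD[OF convex_ker_dom[of m n], of "v3 (x * z) (x * a) (x * b)" "v3 (y * z) (y * a) (y * b)" u v]
    show "u *\<^sub>R x + v *\<^sub>R y \<in> \<Lambda>" by (simp add: \<Lambda>_def)
  qed
  have hol: "f holomorphic_on \<Lambda>"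
    unfolding f_def
    by (rule mv_holomorphic_v3_curve[OF W_holomorphic \<open>open \<Lambda>\<close>])
       (auto simp: \<Lambda>_def intro!: holomorphic_intros)
  have "(f has_field_derivative 0) (at x)" if x: "x \<in> \<Lambda>" for x
  proof -
    have d: "(f has_field_derivative deriv f x) (at x)"
      using hol \<open>open \<Lambda>\<close> x by (rule holomorphic_derivI)
    have "((\<lambda>r :: real. f (of_real r * x)) has_vector_derivative x * deriv f x) (at 1)"
    proof -
      have "((\<lambda>r. of_real r * x) has_vector_derivative x) (at 1)"
        unfolding has_vector_derivative_def by (auto intro!: derivative_eq_intros simp: scaleR_conv_of_real)
      from field_vector_diff_chain_at[OF this, of f "deriv f x"] d show ?thesis by (simp add: o_def)
    qed
    moreover have "((\<lambda>r :: real. f (of_real r * x)) has_vector_derivative 0) (at 1)"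
    proof -
      have "\<forall>\<^sub>F r :: real in nhds 1. r \<in> {0<..}"
        by (rule eventually_nhds_in_open) auto
      then have "\<forall>\<^sub>F r in nhds 1. f (of_real r * x) = f x"
      proof eventually_elim
        case (elim r)
        then show ?case
          using W_scale_real[of "x * z" "x * a" "x * b" m n r] x by (auto simp: f_def \<Lambda>_def mult_ac)
      qed
      then have "((\<lambda>r :: real. f (of_real r * x)) has_vector_derivative 0) (at 1) \<longleftrightarrow> ((\<lambda>r :: real. f x) has_vector_derivative 0) (at 1)"
        by (intro has_vector_derivative_cong_ev) (auto dest: eventually_nhds_x_imp_x)
      then show ?thesis by simp
    qed
    ultimately have "x * deriv f x = 0" by (rule vector_derivative_unique_at)
    moreover have "x \<noteq> 0" using x by (auto simp: \<Lambda>_def ker_dom_def)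
    ultimately show ?thesis using d by simp
  qed
  then have "(f has_field_derivative 0) (at x within \<Lambda>)" if "x \<in> \<Lambda>" for x
    using that has_field_derivative_at_within by blast
  then obtain C where "\<And>x. x \<in> \<Lambda> \<Longrightarrow> f x = C"
    using has_field_derivative_zero_constant[OF \<open>convex \<Lambda>\<close>, of f] by blast
  moreover have "1 \<in> \<Lambda>" "c \<in> \<Lambda>" using p q by (auto simp: \<Lambda>_def)
  ultimately have "f c = f 1" by simp
  then show ?thesis by (simp add: f_def)
qed

section \<open>Integrals with one simple factor, by residues\<close>

definition qexp :: "complex \<Rightarrow> complex" where
  "qexp u = exp (2 * of_real pi * \<i> * u)"

lemma qexp_add: "qexp (u + v) = qexp u * qexp v"
  by (simp add: qexp_def distrib_left exp_add)

lemma qexp_minus: "qexp (- u) = inverse (qexp u)"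
  by (simp add: qexp_def exp_minus)

lemma qexp_diff: "qexp (u - v) = qexp u / qexp v"
  by (simp add: qexp_def right_diff_distrib exp_diff)

lemma qexp_0 [simp]: "qexp 0 = 1"
  by (simp add: qexp_def)

lemma qexp_nonzero [simp]: "qexp u \<noteq> 0"
  by (simp add: qexp_def)

lemma norm_qexp: "norm (qexp u) = exp (- (2 * pi * Im u))"
  by (simp add: qexp_def)

lemma qexp_of_int [simp]: "qexp (of_int n) = 1"
proof -
  have "2 * of_real pi * \<i> * of_int n = \<i> * (of_int (2 * n) * of_real pi)" by simp
  then show ?thesis unfolding qexp_def using exp_integer_2pi[of "of_int n"] by (simp add: mult_ac)
qed

lemma qexp_1 [simp]: "qexp 1 = 1"
  using qexp_of_int[of 1] by simp

lemma qexp_eq_1_iff: "qexp u = 1 \<longleftrightarrow> u \<in> \<int>"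
proof
  assume "qexp u = 1"
  then obtain n :: int where n: "- (2 * pi * Im u) = 0" "2 * pi * Re u = of_int (2 * n) * pi"
    by (auto simp: qexp_def exp_eq_1)
  then have "Im u = 0" "Re u = of_int n" by auto
  then have "u = of_int n" by (simp add: complex_eq_iff)
  then show "u \<in> \<int>" by simp
qed (auto elim!: Ints_cases)

lemma qexp_power: "qexp u ^ n = qexp (of_nat n * u)"
  by (simp add: qexp_def mult_ac flip: exp_of_nat_mult)

lemma holomorphic_on_qexp [holomorphic_intros]:
  "f holomorphic_on A \<Longrightarrow> (\<lambda>z. qexp (f z)) holomorphic_on A"
  unfolding qexp_def by (intro holomorphic_intros)

lemma has_field_derivative_qexp [derivative_intros]:
  "(f has_field_derivative D) F \<Longrightarrow>
     ((\<lambda>z. qexp (f z)) has_field_derivative (2 * of_real pi * \<i> * D * qexp (f z))) (at z within A)"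
  if "F = at z within A" for F
  unfolding qexp_def that by (auto intro!: derivative_eq_intros)

lemma contour_integral_horizontal:
  fixes f :: "complex \<Rightarrow> complex"
  assumes "x1 < x2"
  shows "contour_integral (linepath (Complex x1 y) (Complex x2 y)) f = integral {x1..x2} (\<lambda>t. f (Complex t y))"
proof -
  have "linepath (Complex x1 y) (Complex x2 y) = (+) (\<i> * of_real y) \<circ> linepath (of_real x1) (of_real x2)"
    by (auto simp: linepath_def fun_eq_iff complex_eq_iff algebra_simps)
  then have "contour_integral (linepath (Complex x1 y) (Complex x2 y)) f =
      contour_integral (linepath (of_real x1) (of_real x2)) (\<lambda>x. f (x + \<i> * of_real y))"
    by (simp add: contour_integral_translate)
  also have "\<dots> = integral {x1..x2} (\<lambda>t. f (of_real t + \<i> * of_real y))"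
    using assms by (subst contour_integral_linepath_Reals_eq) auto
  finally show ?thesis by (simp add: Complex_eq)
qed

lemma line_integral_limit:
  assumes "integrable lborel (g :: real \<Rightarrow> complex)"
  shows "(\<lambda>n. integral {- real n..real n} g) \<longlonglongrightarrow> (LINT t|lborel. g t)"
proof -
  have si: "set_integrable lborel UNIV g" using assms by (simp add: set_integrable_def)
  have "(\<lambda>n. integral (UNIV \<inter> {- real n..real n}) g) \<longlonglongrightarrow> integral UNIV g"
    by (rule integral_truncation_tendsto[OF si]) simp
  moreover have "integral UNIV g = (LINT t|lborel. g t)"
    using set_borel_integral_eq_integral(2)[OF si] by (simp add: set_lebesgue_integral_def)
  ultimately show ?thesis by simp
qed

text \<open>
  The line at height \<open>- \<delta>\<close> is compared with the one at height \<open>\<delta>\<close> in two ways: by the residue at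
  \<open>0\<close>, and by the quasi-period \<open>2 \<pi> i / a = x\<^sub>0 + 2 i \<delta>\<close> of the integrand.
\<close>

lemma W_1_0_0:
  assumes z: "0 < Re z" "Re z < Re a"
  shows "qexp (z / a) \<noteq> 1" "W 1 0 0 (v3 z a a) = 2 * of_real pi * \<i> / a * (qexp (z / a) / (1 - qexp (z / a)))"
proof -
  define q where "q = qexp (z / a)"
  have a: "Re a > 0" using z by simp
  then have a0: "a \<noteq> 0" "norm a > 0" by auto
  \<comment> \<open>Half the height of the first pole above the real axis. The lines at heights
    \<open>\<delta>\<close> and \<open>- \<delta>\<close> then differ by the imaginary part of one
    period, and the strip up to \<open>h < 2 * \<delta>\<close> contains only the pole at
    \<open>0\<close>.\<close>
  define \<delta> where "\<delta> = pi * Re a / (norm a)\<^sup>2"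
  define h where "h = 3 / 2 * \<delta>"
  have "\<delta> > 0" using a a0 by (auto simp: \<delta>_def)
  then have \<delta>: "\<delta> > 0" "\<delta> < h" by (auto simp: h_def)
  have dom: "v3 z a a \<in> ker_dom 1 0" using z by (auto simp: ker_dom_def)
  have hd: "v3 z a a \<in> height_dom h"
    using a a0 by (auto simp: height_dom_def admissible_height_def h_def \<delta>_def field_simps)
  then have hd\<delta>: "v3 z a a \<in> height_dom \<delta>" using height_dom_mono \<delta> by auto
  define f where "f = ker 1 0 0 (v3 z a a)"
  have f_eq: "f = (\<lambda>s. exp (z * s) / (exp (a * s) - 1))" by (simp add: f_def ker_def fun_eq_iff)
  define M N where "M = (LINT t|lborel. f (Complex t \<delta>))" and "N = (LINT t|lborel. f (Complex t (- \<delta>)))"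
  have intM: "integrable lborel (\<lambda>t. f (Complex t \<delta>))" and intN: "integrable lborel (\<lambda>t. f (Complex t (- \<delta>)))"
    unfolding f_def using integrable_ker_line[OF dom hd] \<delta> by auto
  have MN: "M = q * N"
  proof -
    define x0 where "x0 = 2 * pi * Im a / (norm a)\<^sup>2"
    have per: "Complex x0 (2 * \<delta>) * a = 2 * of_real pi * \<i>"
    proof -
      have "Complex x0 (2 * \<delta>) = 2 * of_real pi * \<i> * cnj a / of_real ((norm a)\<^sup>2)"
        by (simp add: complex_eq_iff x0_def \<delta>_def Re_divide_of_real Im_divide_of_real)
      also have "\<dots> * a = 2 * of_real pi * \<i> * (of_real ((norm a)\<^sup>2) / of_real ((norm a)\<^sup>2))"
        unfolding complex_norm_square by (simp add: mult_ac)
      finally show ?thesis using a0 by simp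
    qed
    have "M = (LINT t|lborel. f (Complex (x0 + 1 * t) \<delta>))"
      unfolding M_def using lborel_integral_real_affine[of 1 "\<lambda>t. f (Complex t \<delta>)" x0] by simp
    also have "\<dots> = (LINT t|lborel. q * f (Complex t (- \<delta>)))"
    proof (intro Bochner_Integration.integral_cong refl)
      fix t
      have s: "Complex (x0 + 1 * t) \<delta> = Complex t (- \<delta>) + Complex x0 (2 * \<delta>)" by (simp add: complex_eq_iff)
      have "Complex x0 (2 * \<delta>) = 2 * of_real pi * \<i> / a" using per a0 by (simp add: field_simps)
      then have "exp (z * Complex x0 (2 * \<delta>)) = q" by (simp add: q_def qexp_def mult_ac)
      moreover have "exp (a * Complex x0 (2 * \<delta>)) = 1" using per by (simp add: mult.commute)
      ultimately show "f (Complex (x0 + 1 * t) \<delta>) = q * f (Complex t (- \<delta>))"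
        unfolding f_eq s by (simp add: distrib_left exp_add mult_ac)
    qed
    finally show ?thesis by (simp add: N_def)
  qed
  have hol: "f holomorphic_on {s. \<bar>Im s\<bar> < h} - {0}"
    unfolding f_def by (rule holomorphic_on_subset[OF ker_holomorphic[OF hd]]) auto
  have "open {s. \<bar>Im s\<bar> < h}" by (intro open_Collect_less continuous_intros)
  have "convex {s. \<bar>Im s\<bar> < h}"
  proof -
    have "{s. \<bar>Im s\<bar> < h} = {s. Im s < h} \<inter> {s. Im s > - h}" by auto
    then show ?thesis by (simp add: convex_Int convex_halfspace_Im_lt convex_halfspace_Im_gt)
  qed
  have "residue f 0 = exp (z * 0) / a"
    unfolding f_eq
    by (rule residue_simple_pole_deriv[of _ UNIV]) (use a0 in \<open>auto intro!: holomorphic_intros derivative_eq_intros\<close>)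
  then have res: "residue f 0 = 1 / a" by simp
  define V where "V x = contour_integral (linepath (Complex x (- \<delta>)) (Complex x \<delta>)) f" for x
  have rect: "integral {- real n..real n} (\<lambda>t. f (Complex t (- \<delta>))) + V (real n) -
      integral {- real n..real n} (\<lambda>t. f (Complex t \<delta>)) - V (- real n) = 2 * of_real pi * \<i> / a" if n: "n > 0" for n
  proof -
    define a1 a3 where "a1 = Complex (- real n) (- \<delta>)" and "a3 = Complex (real n) \<delta>"
    have img: "path_image (rectpath a1 a3) \<subseteq> {s. \<bar>Im s\<bar> < h} - {0}"
      using n \<delta> by (subst path_image_rectpath) (auto simp: a1_def a3_def)
    have "contour_integral (rectpath a1 a3) f = 2 * pi * \<i> * (\<Sum>p\<in>{0}. winding_number (rectpath a1 a3) p * residue f p)"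
    proof (rule Residue_theorem)
      show "\<forall>z. z \<notin> {s. \<bar>Im s\<bar> < h} \<longrightarrow> winding_number (rectpath a1 a3) z = 0"
        using img \<open>convex {s. \<bar>Im s\<bar> < h}\<close> by (auto intro!: winding_number_zero_outside[of _ "{s. \<bar>Im s\<bar> < h}"])
    qed (use hol \<open>open {s. \<bar>Im s\<bar> < h}\<close> \<open>convex {s. \<bar>Im s\<bar> < h}\<close> img in \<open>auto intro: convex_connected\<close>)
    moreover have "winding_number (rectpath a1 a3) 0 = 1"
      using n \<delta> by (intro winding_number_rectpath) (auto simp: in_box_complex_iff a1_def a3_def)
    ultimately have tot: "contour_integral (rectpath a1 a3) f = 2 * pi * \<i> / a" by (simp add: res)
    have ci: "f contour_integrable_on linepath p r" if "closed_segment p r \<subseteq> {s. \<bar>Im s\<bar> < h} - {0}" for p r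
      using holomorphic_on_imp_continuous_on[OF hol] that
      by (intro contour_integrable_continuous_linepath) (auto intro: continuous_on_subset)
    define a2 a4 where "a2 = Complex (real n) (- \<delta>)" and "a4 = Complex (- real n) \<delta>"
    have segs: "closed_segment a1 a2 \<subseteq> {s. \<bar>Im s\<bar> < h} - {0}" "closed_segment a2 a3 \<subseteq> {s. \<bar>Im s\<bar> < h} - {0}"
      "closed_segment a3 a4 \<subseteq> {s. \<bar>Im s\<bar> < h} - {0}" "closed_segment a4 a1 \<subseteq> {s. \<bar>Im s\<bar> < h} - {0}"
      using n \<delta> by (auto simp: a1_def a2_def a3_def a4_def closed_segment_same_Im closed_segment_same_Re closed_segment_eq_real_ivl split: if_splits)
    have "contour_integral (rectpath a1 a3) f = contour_integral (linepath a1 a2) f + contour_integral (linepath a2 a3) f +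
        contour_integral (linepath a3 a4) f + contour_integral (linepath a4 a1) f"
      unfolding rectpath_def Let_def
      using ci[OF segs(1)] ci[OF segs(2)] ci[OF segs(3)] ci[OF segs(4)]
      by (simp add: a1_def a2_def a3_def a4_def contour_integrable_joinI)
    moreover have "contour_integral (linepath a1 a2) f = integral {- real n..real n} (\<lambda>t. f (Complex t (- \<delta>)))"
      unfolding a1_def a2_def using n by (intro contour_integral_horizontal) auto
    moreover have "contour_integral (linepath a3 a4) f = - integral {- real n..real n} (\<lambda>t. f (Complex t \<delta>))"
    proof -
      have "contour_integral (linepath a3 a4) f = - contour_integral (linepath a4 a3) f"
        using holomorphic_on_imp_continuous_on[OF hol] segs(3)
        by (intro contour_integral_reverse_linepath) (auto intro: continuous_on_subset simp: closed_segment_commute)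
      then show ?thesis unfolding a3_def a4_def using n contour_integral_horizontal[of "- real n" "real n" \<delta> f] by simp
    qed
    moreover have "contour_integral (linepath a4 a1) f = - V (- real n)"
      unfolding V_def a4_def[symmetric] a1_def[symmetric]
      using holomorphic_on_imp_continuous_on[OF hol] segs(4)
      by (intro contour_integral_reverse_linepath) (auto intro: continuous_on_subset simp: closed_segment_commute)
    ultimately show ?thesis using tot by (simp add: V_def a2_def a3_def)
  qed
  have Vlim: "(\<lambda>n. V (c * real n)) \<longlonglongrightarrow> 0" if c: "c = 1 \<or> c = -1" for c
  proof -
    obtain \<mu> T C where \<mu>: "\<mu> > 0" and tail: "\<And>s. \<bar>Re s\<bar> \<ge> T \<Longrightarrow> \<bar>Im s\<bar> \<le> h \<Longrightarrow> norm (f s) \<le> C * exp (- \<mu> * \<bar>Re s\<bar>)"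
      using ker_tail[OF dom, of h 0] \<delta> unfolding f_def by force
    show ?thesis
    proof (rule Lim_null_comparison)
      have "\<forall>\<^sub>F n in sequentially. real n \<ge> max T 1"
        by (intro eventually_compose_filterlim[OF eventually_ge_at_top filterlim_real_sequentially])
      then show "\<forall>\<^sub>F n in sequentially. norm (V (c * real n)) \<le> \<bar>C\<bar> * exp (- (\<mu> * real n)) * (2 * \<delta>)"
      proof eventually_elim
        case (elim n)
        have seg: "Re s = c * real n \<and> \<bar>Im s\<bar> \<le> \<delta>" if "s \<in> closed_segment (Complex (c * real n) (- \<delta>)) (Complex (c * real n) \<delta>)" for s
          using that \<delta> by (auto simp: closed_segment_same_Re closed_segment_eq_real_ivl split: if_splits)
        have "norm (V (c * real n)) \<le> \<bar>C\<bar> * exp (- (\<mu> * real n)) * norm (Complex (c * real n) \<delta> - Complex (c * real n) (- \<delta>))"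
          unfolding V_def
        proof (rule contour_integral_bound_linepath)
          have "closed_segment (Complex (c * real n) (- \<delta>)) (Complex (c * real n) \<delta>) \<subseteq> {s. \<bar>Im s\<bar> < h} - {0}"
            using seg elim c \<delta> by fastforce
          then show "f contour_integrable_on linepath (Complex (c * real n) (- \<delta>)) (Complex (c * real n) \<delta>)"
            using holomorphic_on_imp_continuous_on[OF hol]
            by (intro contour_integrable_continuous_linepath) (auto intro: continuous_on_subset)
          fix s assume "s \<in> closed_segment (Complex (c * real n) (- \<delta>)) (Complex (c * real n) \<delta>)"
          note s = seg[OF this]
          have ab: "\<bar>Re s\<bar> = real n" using s c by auto
          have "norm (f s) \<le> C * exp (- \<mu> * \<bar>Re s\<bar>)" using tail[of s] s elim ab \<delta> by auto
          also have "\<dots> \<le> \<bar>C\<bar> * exp (- (\<mu> * real n))" unfolding ab by (simp add: mult_right_mono)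
          finally show "norm (f s) \<le> \<bar>C\<bar> * exp (- (\<mu> * real n))" .
        qed auto
        moreover have "Complex (c * real n) \<delta> - Complex (c * real n) (- \<delta>) = of_real (2 * \<delta>) * \<i>"
          by (simp add: complex_eq_iff)
        ultimately show ?case using \<delta> by (simp add: norm_mult)
      qed
      have "filterlim (\<lambda>n. \<mu> * real n) at_top sequentially"
        using \<mu> by (intro filterlim_tendsto_pos_mult_at_top[OF tendsto_const] filterlim_real_sequentially)
      then have "(\<lambda>n. exp (- (\<mu> * real n))) \<longlonglongrightarrow> 0"
        by (intro filterlim_compose[OF exp_at_bot] filterlim_compose[OF filterlim_uminus_at_bot_at_top])
      from tendsto_mult_left_zero[OF tendsto_mult_right_zero[OF this, of "\<bar>C\<bar>"], of "2 * \<delta>"]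
      show "(\<lambda>n. \<bar>C\<bar> * exp (- (\<mu> * real n)) * (2 * \<delta>)) \<longlonglongrightarrow> 0" .
    qed
  qed
  have lim: "(\<lambda>n. integral {- real n..real n} (\<lambda>t. f (Complex t (- \<delta>))) + V (1 * real n) -
      integral {- real n..real n} (\<lambda>t. f (Complex t \<delta>)) - V (-1 * real n)) \<longlonglongrightarrow> N + 0 - M - 0"
    unfolding M_def N_def by (intro tendsto_intros line_integral_limit intM intN Vlim) auto
  have "\<forall>\<^sub>F n in sequentially. integral {- real n..real n} (\<lambda>t. f (Complex t (- \<delta>))) + V (1 * real n) -
      integral {- real n..real n} (\<lambda>t. f (Complex t \<delta>)) - V (-1 * real n) = 2 * of_real pi * \<i> / a"
    using eventually_gt_at_top[of "0::nat"] by eventually_elim (use rect in simp)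
  then have "N + 0 - M - 0 = 2 * of_real pi * \<i> / a"
    by (intro LIMSEQ_unique[OF lim] tendsto_eventually)
  then have NM: "N * (1 - q) = 2 * of_real pi * \<i> / a" by (simp add: MN algebra_simps)
  moreover have "2 * of_real pi * \<i> / a \<noteq> 0" using a0 by simp
  \<comment> \<open>The residue is nonzero, so that \<open>q \<noteq> 1\<close> follows from the
    same identity that determines the integral.\<close>
  ultimately have q1: "1 - q \<noteq> 0" by force
  then show "qexp (z / a) \<noteq> 1" by (simp add: q_def)
  have "W 1 0 0 (v3 z a a) = M" unfolding M_def f_def by (rule W_line[OF dom hd\<delta>])
  also have "\<dots> = N * (1 - q) * (q / (1 - q))" using q1 by (simp add: MN)
  finally show "W 1 0 0 (v3 z a a) = 2 * of_real pi * \<i> / a * (qexp (z / a) / (1 - qexp (z / a)))"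
    unfolding NM unfolding q_def .
qed

subsection \<open>Polylogarithms\<close>

lemma summable_Li:
  fixes z :: complex
  assumes "norm z < 1"
  shows "summable (\<lambda>n. z ^ Suc n / of_nat (Suc n) ^ k)"
proof (rule summable_comparison_test')
  show "summable (\<lambda>n. norm z ^ Suc n)"
    unfolding power_Suc using assms by (intro summable_mult summable_geometric) auto
  show "norm (z ^ Suc n / of_nat (Suc n) ^ k) \<le> norm z ^ Suc n" if "n \<ge> 0" for n
  proof -
    have "1 \<le> real (Suc n) ^ k" by (intro one_le_power) auto
    then have "norm z ^ Suc n / real (Suc n) ^ k \<le> norm z ^ Suc n / 1"
      by (intro divide_left_mono) auto
    then show ?thesis by (simp add: norm_divide norm_power norm_mult del: of_nat_Suc)
  qed
qed

lemma Li_0: "norm z < 1 \<Longrightarrow> Li 0 z = z / (1 - z)"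
  unfolding Li_def by (simp add: suminf_mult suminf_geometric summable_geometric)

lemma Li_at_0 [simp]: "Li k 0 = 0"
  by (simp add: Li_def)

text \<open>The derivative is kept as a series because it is also needed at \<open>z = 0\<close>,
  where the quotient \<open>Li k z / z\<close> has no meaning.\<close>

lemma Li_has_field_derivative:
  assumes "norm z < 1"
  shows "(Li (Suc k) has_field_derivative (\<Sum>n. z ^ n / of_nat (Suc n) ^ k)) (at z)"
    and "z * (\<Sum>n. z ^ n / of_nat (Suc n) ^ k) = Li k z"
proof -
  define c where "c n = (if n = 0 then 0 else 1 / of_nat n ^ Suc k :: complex)" for n
  have sm: "summable (\<lambda>n. c n * w ^ n)" if "norm w < 1" for w
    using summable_Li[OF that, of "Suc k"] by (subst summable_Suc_iff[symmetric]) (simp add: c_def)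
  have eq: "(\<Sum>n. c n * w ^ n) = Li (Suc k) w" if "norm w < 1" for w
    using suminf_split_head[OF sm[OF that]] by (simp add: c_def Li_def)
  have dc: "diffs c n = 1 / of_nat (Suc n) ^ k" for n
    by (simp add: diffs_def c_def del: of_nat_Suc)
  have "((\<lambda>w. \<Sum>n. c n * w ^ n) has_field_derivative (\<Sum>n. diffs c n * z ^ n)) (at z)"
    by (rule termdiffs_strong'[of 1]) (use sm assms in auto)
  then have "(Li (Suc k) has_field_derivative (\<Sum>n. diffs c n * z ^ n)) (at z)"
    by (rule has_field_derivative_transform_within_open[of _ _ _ "ball 0 1"]) (use assms eq in auto)
  then show "(Li (Suc k) has_field_derivative (\<Sum>n. z ^ n / of_nat (Suc n) ^ k)) (at z)"
    by (simp add: dc)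
  have "summable (\<lambda>n. z ^ n / of_nat (Suc n) ^ k)"
    using termdiff_converges[OF assms sm] by (simp add: dc)
  then show "z * (\<Sum>n. z ^ n / of_nat (Suc n) ^ k) = Li k z"
    by (simp add: Li_def suminf_mult[symmetric])
qed

lemma Li_holomorphic: "Li (Suc k) holomorphic_on ball 0 1"
  unfolding holomorphic_on_open[OF open_ball] using Li_has_field_derivative(1) by (metis mem_ball_0)

lemma norm_qexp_less_1: "Im u > 0 \<Longrightarrow> norm (qexp u) < 1"
  by (simp add: norm_qexp)

lemma Li_qexp_has_field_derivative:
  assumes "Im u > 0"
  shows "((\<lambda>u. Li (Suc k) (qexp u)) has_field_derivative 2 * of_real pi * \<i> * Li k (qexp u)) (at u)"
proof -
  have "((\<lambda>u. qexp u) has_field_derivative 2 * of_real pi * \<i> * 1 * qexp u) (at u)"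
    by (rule has_field_derivative_qexp) (auto intro!: derivative_intros)
  from DERIV_chain2[OF Li_has_field_derivative(1)[OF norm_qexp_less_1[OF assms]] this, of k]
  show ?thesis
    by (rule DERIV_cong)
       (simp only: Li_has_field_derivative(2)[OF norm_qexp_less_1[OF assms], of k, symmetric] mult_1_right mult_1_left mult_ac)
qed

text \<open>\<open>Li 1 z\<close> is \<open>- ln (1 - z)\<close>. The product of
  \<open>exp (Li 1 w)\<close> and \<open>1 - w\<close> has derivative zero and value
  \<open>1\<close> at \<open>0\<close>, which avoids any choice of a logarithm.\<close>

lemma exp_Li_1:
  assumes "norm z < 1"
  shows "exp (Li 1 z) = 1 / (1 - z)"
proof -
  define f where "f w = exp (Li 1 w) * (1 - w)" for w
  have "(f has_field_derivative 0) (at w within ball 0 1)" if "w \<in> ball 0 1" for w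
  proof -
    have w: "norm w < 1" "1 - w \<noteq> 0" using that by auto
    have "(\<Sum>n. w ^ n / of_nat (Suc n) ^ 0) = 1 / (1 - w)"
      using w suminf_geometric[of w] by simp
    then have "(Li 1 has_field_derivative 1 / (1 - w)) (at w)"
      using Li_has_field_derivative(1)[OF w(1), of 0] by simp
    from DERIV_chain2[OF DERIV_exp this]
    have 1: "((\<lambda>w. exp (Li 1 w)) has_field_derivative exp (Li 1 w) * (1 / (1 - w))) (at w)" .
    have 2: "((\<lambda>w. 1 - w) has_field_derivative - 1) (at w)" by (auto intro!: derivative_eq_intros)
    have "(f has_field_derivative 0) (at w)"
      unfolding f_def using DERIV_mult[OF 1 2] by (rule DERIV_cong) (use w in simp)
    then show ?thesis by (rule has_field_derivative_at_within)
  qed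
  then obtain C where "\<And>w. w \<in> ball 0 1 \<Longrightarrow> f w = C"
    using has_field_derivative_zero_constant[OF convex_ball] by blast
  then have "f z = f 0" using assms by simp
  then have "exp (Li 1 z) * (1 - z) = 1" by (simp add: f_def)
  moreover have "1 - z \<noteq> 0" using assms by auto
  ultimately show ?thesis by (simp add: field_simps)
qed

lemma Im_add_vertical: "Im ((z + \<i> * of_real T) / a) = Im (z / a) + T * Re a / (norm a)\<^sup>2"
proof -
  have "Im (\<i> * of_real T / a) = T * Re a / (norm a)\<^sup>2"
    unfolding Im_divide cmod_power2 by simp
  then show ?thesis by (simp add: add_divide_distrib)
qed

lemma convex_Im_div_pos: "convex {z. Im (z / a) > 0}"
proof (rule convexI)
  fix x y and u v :: real assume *: "x \<in> {z. Im (z / a) > 0}" "y \<in> {z. Im (z / a) > 0}" "0 \<le> u" "0 \<le> v" "u + v = 1"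
  have "Im ((u *\<^sub>R x + v *\<^sub>R y) / a) = u * Im (x / a) + v * Im (y / a)"
    by (simp add: add_divide_distrib scaleR_conv_of_real flip: times_divide_eq_right)
  also have "\<dots> > 0"
    using * by (smt (verit, ccfv_threshold) mem_Collect_eq mult_nonneg_nonneg mult_pos_pos)
  finally show "u *\<^sub>R x + v *\<^sub>R y \<in> {z. Im (z / a) > 0}" by simp
qed

lemma convex_Re_strip: "convex {z. l < Re z \<and> Re z < r}"
proof -
  have "{z. l < Re z \<and> Re z < r} = {z. Re z > l} \<inter> {z. Re z < r}" by auto
  then show ?thesis by (simp add: convex_Int convex_halfspace_Re_lt convex_halfspace_Re_gt)
qed

lemma qexp_vertical_limit:
  assumes "Re a > 0"
  shows "((\<lambda>T. qexp ((z + \<i> * of_real T) / a)) \<longlongrightarrow> 0) at_top"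
proof (rule tendsto_norm_zero_cancel)
  have c: "Re a / (norm a)\<^sup>2 > 0" using assms by (auto simp: zero_less_divide_iff)
  have "filterlim (\<lambda>T. 2 * pi * (Im (z / a) + Re a / (norm a)\<^sup>2 * T)) at_top at_top"
    using c by (intro filterlim_tendsto_pos_mult_at_top[OF tendsto_const] filterlim_tendsto_add_at_top[OF tendsto_const] filterlim_ident) auto
  then have "((\<lambda>T. exp (- (2 * pi * (Im (z / a) + Re a / (norm a)\<^sup>2 * T)))) \<longlongrightarrow> 0) at_top"
    by (intro filterlim_compose[OF exp_at_bot] filterlim_compose[OF filterlim_uminus_at_bot_at_top])
  then show "((\<lambda>T. norm (qexp ((z + \<i> * of_real T) / a))) \<longlongrightarrow> 0) at_top"
    unfolding norm_qexp Im_add_vertical by (simp add: mult.commute)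
qed

text \<open>By the residue computation the left-hand side has derivative zero on the strip, and it
  tends to \<open>1\<close> far up along a vertical line. The exponential form holds on the whole
  strip, including the points where \<open>Li 1 (qexp (z / a))\<close> does not converge.\<close>

theorem exp_W_1_0_1:
  assumes z: "0 < Re z" "Re z < Re a"
  shows "exp (W 1 0 1 (v3 z a a)) * (1 - qexp (z / a)) = 1"
proof -
  define f where "f z = exp (W 1 0 1 (v3 z a a)) * (1 - qexp (z / a))" for z
  define R where "R = {z. 0 < Re z \<and> Re z < Re a}"
  have a: "a \<noteq> 0" "Re a > 0" using z by auto
  have "(f has_field_derivative 0) (at w within R)" if w: "w \<in> R" for w
  proof -
    define q where "q = qexp (w / a)"
    have dom: "v3 w a a \<in> ker_dom 1 0" using w by (auto simp: R_def ker_dom_def)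
    have "((\<lambda>z. W 1 0 (Suc 0) (v3 z a a)) has_field_derivative W 1 0 0 (v3 w a a)) (at w)"
      by (rule W_deriv_z[OF dom])
    also have "W 1 0 0 (v3 w a a) = 2 * of_real pi * \<i> / a * (q / (1 - q))"
      unfolding q_def using w by (intro W_1_0_0) (auto simp: R_def)
    finally have 1: "((\<lambda>z. exp (W 1 0 1 (v3 z a a))) has_field_derivative exp (W 1 0 1 (v3 w a a)) * (2 * of_real pi * \<i> / a * (q / (1 - q)))) (at w)"
      by (auto intro!: derivative_eq_intros)
    have 2: "((\<lambda>z. 1 - qexp (z / a)) has_field_derivative - (2 * of_real pi * \<i> * (1 / a) * q)) (at w)"
      unfolding q_def by (auto intro!: derivative_eq_intros simp: a)
    have q1: "1 - q \<noteq> 0" using W_1_0_0(1)[of w a] w by (auto simp: R_def q_def)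
    have "(f has_field_derivative 0) (at w)"
      unfolding f_def using DERIV_mult[OF 1 2]
      by (rule DERIV_cong) (use q1 in \<open>simp add: q_def[symmetric]\<close>)
    then show ?thesis by (rule has_field_derivative_at_within)
  qed
  then obtain C where C: "\<And>w. w \<in> R \<Longrightarrow> f w = C"
    using has_field_derivative_zero_constant[of R f] convex_Re_strip[of 0 "Re a"] unfolding R_def by blast
  have "((\<lambda>T. f (z + \<i> * of_real T)) \<longlongrightarrow> exp 0 * (1 - 0)) at_top"
    unfolding f_def
    by (intro tendsto_intros W_vertical_limit qexp_vertical_limit) (use z in \<open>auto simp: ker_dom_def\<close>)
  moreover have "f (z + \<i> * of_real T) = C" for T using z by (intro C) (auto simp: R_def)
  ultimately have "C = 1" by (simp add: tendsto_const_iff)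
  moreover have "f z = C" using z by (intro C) (auto simp: R_def)
  ultimately show ?thesis by (simp add: f_def)
qed

text \<open>Integration in \<open>z\<close> raises the index on both sides. The constant of
  integration is zero, since both sides tend to \<open>0\<close> far up along a vertical line, which
  stays in the convex region \<open>R\<close>.\<close>

theorem W_1_0_Li:
  assumes z: "0 < Re z" "Re z < Re a" "Im (z / a) > 0"
  shows "W 1 0 k (v3 z a a) = (a / (2 * of_real pi * \<i>)) ^ k * (2 * of_real pi * \<i> / a) * Li k (qexp (z / a))"
  using z
proof (induction k arbitrary: z)
  case 0
  then show ?case
    using W_1_0_0(2)[of z a] Li_0[OF norm_qexp_less_1[OF 0(3)]] by simp
next
  case (Suc k)
  define c where "c k = (a / (2 * of_real pi * \<i>)) ^ k * (2 * of_real pi * \<i> / a)" for k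
  define f where "f z = W 1 0 (Suc k) (v3 z a a) - c (Suc k) * Li (Suc k) (qexp (z / a))" for z
  define R where "R = {z. 0 < Re z \<and> Re z < Re a} \<inter> {z. Im (z / a) > 0}"
  have a: "a \<noteq> 0" "Re a > 0" using Suc.prems by auto
  have "(f has_field_derivative 0) (at w within R)" if w: "w \<in> R" for w
  proof -
    have dom: "v3 w a a \<in> ker_dom 1 0" using w by (auto simp: R_def ker_dom_def)
    have 1: "((\<lambda>z. W 1 0 (Suc k) (v3 z a a)) has_field_derivative c k * Li k (qexp (w / a))) (at w)"
      using W_deriv_z[OF dom, of k] Suc.IH[of w] w by (simp add: R_def c_def)
    have "((\<lambda>z. z / a) has_field_derivative 1 / a) (at w)"
      by (auto intro!: derivative_eq_intros simp: a)
    from DERIV_chain2[OF Li_qexp_has_field_derivative this, of k]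
    have 2: "((\<lambda>z. Li (Suc k) (qexp (z / a))) has_field_derivative 2 * of_real pi * \<i> * Li k (qexp (w / a)) * (1 / a)) (at w)"
      using w by (auto simp: R_def)
    have "(f has_field_derivative 0) (at w)"
      unfolding f_def using DERIV_diff[OF 1 DERIV_cmult[OF 2, of "c (Suc k)"]]
      by (rule DERIV_cong) (use a in \<open>simp add: c_def\<close>)
    then show ?thesis by (rule has_field_derivative_at_within)
  qed
  moreover have "convex R" unfolding R_def by (intro convex_Int convex_Re_strip convex_Im_div_pos)
  ultimately obtain C where C: "\<And>w. w \<in> R \<Longrightarrow> f w = C"
    using has_field_derivative_zero_constant[of R f] by blast
  have "isCont (Li (Suc k)) 0"
    using Li_has_field_derivative(1)[of 0 k] DERIV_isCont by fastforce
  then have "((\<lambda>T. Li (Suc k) (qexp ((z + \<i> * of_real T) / a))) \<longlongrightarrow> Li (Suc k) 0) at_top"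
    by (rule isCont_tendsto_compose) (rule qexp_vertical_limit[OF a(2)])
  then have lim: "((\<lambda>T. f (z + \<i> * of_real T)) \<longlongrightarrow> 0 - c (Suc k) * Li (Suc k) 0) at_top"
    unfolding f_def
    by (intro tendsto_intros W_vertical_limit) (use Suc.prems in \<open>auto simp: ker_dom_def\<close>)
  have const: "f (z + \<i> * of_real T) = C" if "T \<ge> 0" for T
  proof (rule C)
    have "Im ((z + \<i> * of_real T) / a) > 0"
      unfolding Im_add_vertical using Suc.prems that a by (intro add_pos_nonneg) auto
    then show "z + \<i> * of_real T \<in> R" using Suc.prems by (simp add: R_def)
  qed
  have "\<forall>\<^sub>F T in at_top. f (z + \<i> * of_real T) = C"
    by (rule eventually_mono[OF eventually_ge_at_top[of 0]]) (rule const)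
  from Lim_transform_eventually[OF lim this] have "((\<lambda>T :: real. C) \<longlongrightarrow> 0) at_top"
    by simp
  then have "C = 0" by (simp add: tendsto_const_iff)
  moreover have "f z = C" using Suc.prems by (intro C) (auto simp: R_def)
  ultimately show ?case by (simp add: f_def c_def)
qed

text \<open>Minus the derivative in \<open>a\<close> of
  \<open>(a / (2 * pi * \<i>)) ^ k * Li (Suc k) (qexp (z / a))\<close>.\<close>

definition LiS :: "nat \<Rightarrow> complex \<Rightarrow> complex \<Rightarrow> complex" where
  "LiS k z a = (a / (2 * of_real pi * \<i>)) ^ k * (2 * of_real pi * \<i> * z / a\<^sup>2) * Li k (qexp (z / a)) -
     of_nat k * a ^ (k - 1) / (2 * of_real pi * \<i>) ^ k * Li (Suc k) (qexp (z / a))"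

text \<open>Differentiates the evaluation of \<open>W 1 0 (Suc k)\<close> in \<open>a\<close>. The
  condition \<open>Im (z / a) > 0\<close> is rewritten with \<open>cnj a\<close>, which makes the
  set \<open>U\<close> of admissible \<open>a\<close> visibly open.\<close>

lemma W_2_0_Li_aux:
  assumes z: "0 < Re z" "Re z < Re a" "Im (z / a) > 0" and k: "k \<ge> 1"
  shows "W 2 0 k (v3 (z + a) a a) = LiS k z a"
proof -
  have dom: "v3 z a a \<in> ker_dom 1 0" using z by (auto simp: ker_dom_def)
  define U where "U = {a. Re z < Re a} \<inter> {a. Im (z * cnj a) > 0}"
  have im: "Im (z / a) > 0 \<longleftrightarrow> Im (z * cnj a) > 0" if "a \<noteq> 0" for a
  proof -
    have "(Re a)\<^sup>2 + (Im a)\<^sup>2 > 0"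
      using that by (simp add: sum_power2_gt_zero_iff complex_eq_iff)
    then show ?thesis
      unfolding Im_divide by (simp add: zero_less_divide_iff not_less[symmetric] algebra_simps)
  qed
  have "open U" unfolding U_def by (intro open_Int open_Collect_less continuous_intros)
  have a0: "a \<noteq> 0" using z by auto
  have aU: "a \<in> U" using z im[OF a0] by (auto simp: U_def)
  define P where "P a' = (a' / (2 * of_real pi * \<i>)) ^ k * Li (Suc k) (qexp (z / a'))" for a'
  have eq: "W 1 0 (Suc k) (v3 z a' a) = P a'" if "a' \<in> U" for a'
  proof -
    have a': "a' \<noteq> 0" using that z by (auto simp: U_def)
    have "W 1 0 (Suc k) (v3 z a' a) = W 1 0 (Suc k) (v3 z a' a')" by (rule W_indep_3)
    also have "\<dots> = P a'"
      using that z im[OF a'] a' by (subst W_1_0_Li) (auto simp: U_def P_def)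
    finally show ?thesis .
  qed
  have "((\<lambda>a'. W 1 0 (Suc k) (v3 z a' a)) has_field_derivative - W 2 0 k (v3 (z + a) a a)) (at a)"
    by (rule W_deriv_a[OF dom])
  then have d1: "(P has_field_derivative - W 2 0 k (v3 (z + a) a a)) (at a)"
    by (rule has_field_derivative_transform_within_open[OF _ \<open>open U\<close> aU]) (rule eq)
  have "((\<lambda>a. z / a) has_field_derivative - (z / a\<^sup>2)) (at a)"
    using a0 by (auto intro!: derivative_eq_intros simp: power2_eq_square)
  from DERIV_chain2[OF Li_qexp_has_field_derivative[OF z(3)] this, of k]
  have 2: "((\<lambda>a. Li (Suc k) (qexp (z / a))) has_field_derivative 2 * of_real pi * \<i> * Li k (qexp (z / a)) * - (z / a\<^sup>2)) (at a)" .
  have 1: "((\<lambda>a. (a / (2 * of_real pi * \<i>)) ^ k) has_field_derivative of_nat k * (a / (2 * of_real pi * \<i>)) ^ (k - 1) * (1 / (2 * of_real pi * \<i>))) (at a)"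
    using DERIV_power[of "\<lambda>a. a / (2 * of_real pi * \<i>)" "1 / (2 * of_real pi * \<i>)" a UNIV k]
    by (auto intro!: derivative_eq_intros)
  have d2: "(P has_field_derivative - LiS k z a) (at a)"
    unfolding P_def using DERIV_mult[OF 1 2]
  proof (rule DERIV_cong)
    have "of_nat k * (a / (2 * of_real pi * \<i>)) ^ (k - 1) * (1 / (2 * of_real pi * \<i>)) = of_nat k * a ^ (k - 1) / (2 * of_real pi * \<i>) ^ k"
      using k by (cases k) (simp_all add: power_divide)
    then show "of_nat k * (a / (2 * of_real pi * \<i>)) ^ (k - 1) * (1 / (2 * of_real pi * \<i>)) * Li (Suc k) (qexp (z / a)) +
        2 * of_real pi * \<i> * Li k (qexp (z / a)) * - (z / a\<^sup>2) * (a / (2 * of_real pi * \<i>)) ^ k = - LiS k z a"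
      by (simp add: LiS_def mult_ac)
  qed
  from DERIV_unique[OF d1 d2] show ?thesis by simp
qed

lemma W_2_0_holomorphic: "(\<lambda>z. W 2 0 k (v3 (z + a) a a)) holomorphic_on {z. - Re a < Re z \<and> Re z < Re a}"
proof -
  have "open {z. - Re a < Re z \<and> Re z < Re a}"
    by (intro open_Collect_conj open_Collect_less continuous_intros)
  then show ?thesis
    by (intro mv_holomorphic_v3_curve[OF W_holomorphic[of 2 0]] holomorphic_intros) (auto simp: ker_dom_def)
qed

text \<open>With a squared factor and argument \<open>z + a\<close> the integral converges down to
  \<open>Re z > - Re a\<close>, and the evaluation extends there by analytic continuation in
  \<open>z\<close>. The larger strip surrounds \<open>z = 0\<close>, where the value is
  needed.\<close>

lemma W_2_0_Li:
  assumes z: "- Re a < Re z" "Re z < Re a" "Im (z / a) > 0" and k: "k \<ge> 1"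
  shows "W 2 0 k (v3 (z + a) a a) = LiS k z a"
proof -
  have a: "Re a > 0" "a \<noteq> 0" using z by auto
  define R where "R = {z. - Re a < Re z \<and> Re z < Re a} \<inter> {z. Im (z / a) > 0}"
  define R' where "R' = {z. 0 < Re z \<and> Re z < Re a} \<inter> {z. Im (z / a) > 0}"
  have opn: "open {z. Im (z / a) > 0}" using a by (intro open_Collect_less continuous_intros) auto
  have "open R" "open R'" unfolding R_def R'_def using opn
    by (auto intro!: open_Int open_Collect_conj open_Collect_less continuous_intros)
  have "connected R" unfolding R_def
    by (intro convex_connected convex_Int convex_Re_strip convex_Im_div_pos)
  have h1: "(\<lambda>z. W 2 0 k (v3 (z + a) a a)) holomorphic_on R"
    by (rule holomorphic_on_subset[OF W_2_0_holomorphic]) (auto simp: R_def)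
  obtain j where j: "k = Suc j" using k by (cases k) auto
  have Lih: "(\<lambda>z. Li (Suc j) (qexp (z / a))) holomorphic_on R" for j
    by (rule holomorphic_on_compose_gen[of "\<lambda>z. qexp (z / a)" R "Li (Suc j)", unfolded o_def, OF _ Li_holomorphic])
       (use a in \<open>auto intro!: holomorphic_intros norm_qexp_less_1 simp: R_def\<close>)
  have h2: "(\<lambda>z. LiS k z a) holomorphic_on R"
    unfolding LiS_def j by (intro holomorphic_intros Lih) (use a in auto)
  have "\<exists>z. z \<in> R'"
  proof -
    define T where "T = (\<bar>Im (of_real (Re a / 2) / a)\<bar> + 1) * (norm a)\<^sup>2 / Re a"
    have "T * Re a / (norm a)\<^sup>2 = \<bar>Im (of_real (Re a / 2) / a)\<bar> + 1" using a by (simp add: T_def)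
    then have "Im ((of_real (Re a / 2) + \<i> * of_real T) / a) > 0" unfolding Im_add_vertical by linarith
    then have "of_real (Re a / 2) + \<i> * of_real T \<in> R'" using a by (simp add: R'_def)
    then show ?thesis by blast
  qed
  then have ne: "R' \<noteq> {}" by auto
  show ?thesis
    by (rule analytic_continuation_open[OF \<open>open R'\<close> \<open>open R\<close> ne \<open>connected R\<close> _ h1 h2])
       (use z k a in \<open>auto simp: R_def R'_def intro: W_2_0_Li_aux\<close>)
qed

lemma continuous_on_suminf_M_test:
  fixes f :: "nat \<Rightarrow> real \<Rightarrow> complex"
  assumes "\<And>n. continuous_on A (f n)" "\<And>n t. t \<in> A \<Longrightarrow> norm (f n t) \<le> M n" "summable M"
  shows "continuous_on A (\<lambda>t. \<Sum>n. f n t)"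
proof (rule uniform_limit_theorem[OF _ Weierstrass_m_test])
  show "\<forall>\<^sub>F n in sequentially. continuous_on A (\<lambda>x. \<Sum>i<n. f i x)"
    using assms(1) by (intro always_eventually allI continuous_intros) auto
qed (use assms in auto)

lemma summable_inverse_Suc_squares: "summable (\<lambda>n. 1 / (real (Suc n))\<^sup>2)"
  using inverse_squares_sums by (auto simp: sums_iff add.commute)

lemma continuous_on_at_right_limit:
  fixes f :: "real \<Rightarrow> complex"
  assumes "continuous_on {0..} f"
  shows "(f \<longlongrightarrow> f 0) (at_right 0)"
proof -
  have "(f \<longlongrightarrow> f 0) (at 0 within {0..})" using assms by (simp add: continuous_on_def)
  then show ?thesis by (rule tendsto_within_subset) auto
qed

lemma norm_qexp_imaginary: "norm (qexp (\<i> * of_real \<tau>)) = exp (- (2 * pi * \<tau>))"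
  by (simp add: norm_qexp)

lemma continuous_on_qexp_imaginary: "continuous_on A (\<lambda>\<tau> :: real. qexp (\<i> * of_real \<tau>))"
  unfolding qexp_def by (intro continuous_intros)

lemma Li_tendsto_1:
  assumes "k \<ge> 2"
  shows "((\<lambda>\<tau> :: real. Li k (qexp (\<i> * of_real \<tau>))) \<longlongrightarrow> Li k 1) (at_right 0)"
proof -
  have "continuous_on {0..} (\<lambda>\<tau> :: real. Li k (qexp (\<i> * of_real \<tau>)))"
    unfolding Li_def
  proof (rule continuous_on_suminf_M_test[OF _ _ summable_inverse_Suc_squares])
    fix n and \<tau> :: real assume "\<tau> \<in> {0..}"
    then have "norm (qexp (\<i> * of_real \<tau>)) \<le> 1" by (simp add: norm_qexp_imaginary)
    then have "norm (qexp (\<i> * of_real \<tau>)) ^ Suc n \<le> 1" by (intro power_le_one) auto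
    moreover have "real (Suc n) ^ 2 \<le> real (Suc n) ^ k" using assms by (intro power_increasing) auto
    ultimately have "norm (qexp (\<i> * of_real \<tau>)) ^ Suc n / real (Suc n) ^ k \<le> 1 / real (Suc n) ^ 2"
      by (intro frac_le) auto
    then show "norm (qexp (\<i> * of_real \<tau>) ^ Suc n / of_nat (Suc n) ^ k) \<le> 1 / (real (Suc n))\<^sup>2"
      by (simp only: norm_divide norm_power norm_of_nat)
  qed (use continuous_on_qexp_imaginary in \<open>auto intro!: continuous_intros simp del: of_nat_Suc\<close>)
  from continuous_on_at_right_limit[OF this] show ?thesis by simp
qed

text \<open>The factor \<tau> absorbs the logarithmic singularity of \<open>Li 1\<close> at
  \<open>1\<close>: with \<open>x = 2 * pi * \<tau> * (n + 1)\<close> the bound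
  \<open>x * exp (- x) \<le> 1\<close> dominates the terms by \<open>1 / (n + 1)\<^sup>2\<close>,
  uniformly in \<tau>.\<close>

lemma tau_Li_tendsto_0:
  assumes "k \<ge> 1"
  shows "((\<lambda>\<tau> :: real. of_real \<tau> * Li k (qexp (\<i> * of_real \<tau>))) \<longlongrightarrow> 0) (at_right 0)"
proof -
  define f where "f n \<tau> = of_real \<tau> * (qexp (\<i> * of_real \<tau>) ^ Suc n / of_nat (Suc n) ^ k)" for n and \<tau> :: real
  have "continuous_on {0..} (\<lambda>\<tau>. \<Sum>n. f n \<tau>)"
  proof (rule continuous_on_suminf_M_test[OF _ _ summable_inverse_Suc_squares])
    show "continuous_on {0..} (f n)" for n
      unfolding f_def using continuous_on_qexp_imaginary by (auto intro!: continuous_intros simp del: of_nat_Suc)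
    fix n and \<tau> :: real assume \<tau>: "\<tau> \<in> {0..}"
    define x where "x = 2 * pi * \<tau> * real (Suc n)"
    have x: "x \<ge> 0" using \<tau> by (simp add: x_def)
    have "x \<le> exp x" using exp_ge_add_one_self[of x] by linarith
    then have "x * exp (- x) \<le> 1" by (simp add: exp_minus field_simps)
    moreover have "norm (qexp (\<i> * of_real \<tau>)) ^ Suc n = exp (- x)"
      by (simp add: norm_qexp_imaginary x_def mult_ac flip: exp_of_nat_mult del: power_Suc of_nat_Suc)
    moreover have "\<tau> * real (Suc n) \<le> x"
    proof -
      have "1 * (\<tau> * real (Suc n)) \<le> 2 * pi * (\<tau> * real (Suc n))"
        using \<tau> pi_ge_two by (intro mult_right_mono) auto
      then show ?thesis by (simp add: x_def mult_ac)
    qed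
    then have "\<tau> * real (Suc n) * exp (- x) \<le> x * exp (- x)" by (intro mult_right_mono) auto
    ultimately have le: "\<tau> * norm (qexp (\<i> * of_real \<tau>)) ^ Suc n * real (Suc n) \<le> 1"
      by (simp only: mult_ac) 
    have "norm (f n \<tau>) = \<tau> * norm (qexp (\<i> * of_real \<tau>)) ^ Suc n / real (Suc n) ^ k"
      using \<tau> by (simp add: f_def norm_mult norm_divide norm_power del: of_nat_Suc)
    also have "\<dots> \<le> \<tau> * norm (qexp (\<i> * of_real \<tau>)) ^ Suc n / real (Suc n) ^ 1"
      using \<tau> assms by (intro divide_left_mono power_increasing) auto
    also have "\<dots> \<le> 1 / (real (Suc n))\<^sup>2"
      using le by (simp add: field_simps power2_eq_square del: of_nat_Suc power_Suc)
    finally show "norm (f n \<tau>) \<le> 1 / (real (Suc n))\<^sup>2" .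
  qed
  from continuous_on_at_right_limit[OF this] have "((\<lambda>\<tau>. \<Sum>n. f n \<tau>) \<longlongrightarrow> 0) (at_right 0)"
    by (simp add: f_def)
  moreover have "\<forall>\<^sub>F \<tau> in at_right 0. (\<Sum>n. f n \<tau>) = of_real \<tau> * Li k (qexp (\<i> * of_real \<tau>))"
    using eventually_at_right_less[of 0]
  proof eventually_elim
    case (elim \<tau>)
    then have "norm (qexp (\<i> * of_real \<tau>)) < 1" by (simp add: norm_qexp_imaginary)
    from suminf_mult[OF summable_Li[OF this, of k], of "of_real \<tau>"]
    show ?case by (simp only: f_def Li_def)
  qed
  ultimately show ?thesis by (rule Lim_transform_eventually)
qed

text \<open>The approach \<open>z = \<i> * \<tau> * a\<close> gives
  \<open>z / a = \<i> * \<tau>\<close>, so that all polylogarithms are evaluated on one curve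
  towards \<open>1\<close>. In \<open>LiS k 0 a\<close> the first summand is \<open>0\<close>, which
  for \<open>k = 1\<close> is the true limit although the series \<open>Li 1 1\<close>
  diverges.\<close>

lemma W_2_0_Li_at_0:
  assumes a: "Re a > 0" and k: "k \<ge> 1"
  shows "W 2 0 k (v3 a a a) = LiS k 0 a"
proof -
  have a0: "a \<noteq> 0" using a by auto
  define z where "z \<tau> = \<i> * of_real \<tau> * a" for \<tau> :: real
  define S where "S = {z. - Re a < Re z \<and> Re z < Re a}"
  have "open S" unfolding S_def by (intro open_Collect_conj open_Collect_less continuous_intros)
  have z0: "(z \<longlongrightarrow> 0) (at_right 0)"
    unfolding z_def by (auto intro!: tendsto_eq_intros)
  have "isCont (\<lambda>z. W 2 0 k (v3 (z + a) a a)) 0"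
    using W_2_0_holomorphic[of k a] \<open>open S\<close> a unfolding S_def[symmetric]
    by (intro holomorphic_on_imp_continuous_on[THEN continuous_on_interior[of S]]) (auto simp: interior_open S_def)
  from isCont_tendsto_compose[OF this z0]
  have l1: "((\<lambda>\<tau>. W 2 0 k (v3 (z \<tau> + a) a a)) \<longlongrightarrow> W 2 0 k (v3 a a a)) (at_right 0)" by simp
  have zS: "\<forall>\<^sub>F \<tau> in at_right 0. z \<tau> \<in> S"
    using a \<open>open S\<close> by (intro topological_tendstoD[OF z0]) (auto simp: S_def)
  have ev: "\<forall>\<^sub>F \<tau> in at_right 0. W 2 0 k (v3 (z \<tau> + a) a a) = LiS k (z \<tau>) a"
    using zS eventually_at_right_less[of 0]
  proof eventually_elim
    case (elim \<tau>)
    have "z \<tau> / a = \<i> * of_real \<tau>" using a0 by (simp add: z_def)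
    with elim show ?case by (intro W_2_0_Li k) (auto simp: S_def)
  qed
  define A where "A = - ((a / (2 * of_real pi * \<i>)) ^ k * (2 * of_real pi) / a)"
  define C where "C = of_nat k * a ^ (k - 1) / (2 * of_real pi * \<i>) ^ k"
  have "LiS k (z \<tau>) a = A * (of_real \<tau> * Li k (qexp (\<i> * of_real \<tau>))) - C * Li (Suc k) (qexp (\<i> * of_real \<tau>))" for \<tau>
    using a0 by (simp add: LiS_def z_def A_def C_def power2_eq_square mult_ac)
  moreover have "((\<lambda>\<tau>. A * (of_real \<tau> * Li k (qexp (\<i> * of_real \<tau>))) - C * Li (Suc k) (qexp (\<i> * of_real \<tau>))) \<longlongrightarrow> A * 0 - C * Li (Suc k) 1) (at_right 0)"
    using k by (intro tendsto_intros Li_tendsto_1 tau_Li_tendsto_0) auto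
  ultimately have "((\<lambda>\<tau>. LiS k (z \<tau>) a) \<longlongrightarrow> LiS k 0 a) (at_right 0)"
    by (simp add: LiS_def C_def)
  from tendsto_unique[OF _ Lim_transform_eventually[OF l1 ev] this] show ?thesis by simp
qed

subsection \<open>The functions F and G\<close>

lemma W_sym: "W m n k (v3 z a b) = W n m k (v3 z b a)"
proof -
  have "ker m n k (v3 z a b) = ker n m k (v3 z b a)" by (simp add: ker_def fun_eq_iff mult_ac)
  then show ?thesis by (simp add: W_def)
qed

lemma W_0_1: "W 0 1 k (v3 z a b) = W 1 0 k (v3 z b b)"
  by (metis W_sym W_indep_3)

text \<open>The kernels satisfy \<open>exp ((z + a) * s) = exp (z * s) * (exp (a * s) - 1) + exp (z
  * s)\<close>, and the bracket cancels one factor of the denominator. All three integrals are taken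
  along the same line.\<close>

lemma W_shift:
  assumes p: "v3 z a b \<in> ker_dom m n"
  shows "W (Suc m) n k (v3 (z + a) a b) = W (Suc m) n k (v3 z a b) + W m n k (v3 z a b)"
proof -
  have a: "Re a > 0" using p by (simp add: ker_dom_def)
  obtain y where y: "v3 z a b \<in> height_dom y" using height_dom_exists[OF p] .
  have ypos: "y > 0" using y by (auto simp: height_dom_def admissible_height_def)
  have d: "v3 z a b \<in> ker_dom (Suc m) n" "v3 (z + a) a b \<in> ker_dom (Suc m) n" "v3 (z + a) a b \<in> height_dom y"
    using p y a by (auto simp: ker_dom_def height_dom_def algebra_simps)
  have eq: "ker (Suc m) n k (v3 (z + a) a b) (Complex t y) =
      ker (Suc m) n k (v3 z a b) (Complex t y) + ker m n k (v3 z a b) (Complex t y)" for t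
  proof -
    have "Complex t y \<noteq> 0" using ypos by (simp add: complex_eq_iff)
    moreover define X where "X = exp (a * Complex t y) - 1"
    ultimately have X: "exp (a * Complex t y) = X + 1" "X \<noteq> 0"
      using ker_denominator_nonzero[OF y, of "Complex t y"] ypos by auto
    show ?thesis
      using X(2) by (simp add: ker_def distrib_right exp_add X(1) add_divide_distrib ring_distribs)
  qed
  have "W (Suc m) n k (v3 (z + a) a b) = (LINT t|lborel. ker (Suc m) n k (v3 z a b) (Complex t y) + ker m n k (v3 z a b) (Complex t y))"
    unfolding W_line[OF d(2,3)] by (simp only: eq)
  also have "\<dots> = W (Suc m) n k (v3 z a b) + W m n k (v3 z a b)"
    unfolding W_line[OF d(1) y] W_line[OF p y]
    using ypos y by (intro Bochner_Integration.integral_add integrable_ker_line[OF _ y] d p) auto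
  finally show ?thesis .
qed

definition Kf :: "complex \<Rightarrow> complex \<Rightarrow> complex \<Rightarrow> complex" where
  "Kf z a b = W 1 1 1 (v3 z a b)"

definition Kg :: "complex \<Rightarrow> complex \<Rightarrow> complex \<Rightarrow> complex" where
  "Kg z a b = - W 2 1 1 (v3 (z + a) a b)"

lemma exp_Kf_shift_a:
  assumes "0 < Re z" "Re z < Re b" "Re a > 0"
  shows "exp (Kf (z + a) a b) * (1 - qexp (z / b)) = exp (Kf z a b)"
proof -
  have "Kf (z + a) a b = Kf z a b + W 1 0 1 (v3 z b b)"
    unfolding Kf_def using W_shift[of z a b 0 1 1, folded One_nat_def] assms
    by (simp add: ker_dom_def W_0_1 del: One_nat_def)
  then show ?thesis
    using exp_W_1_0_1[OF assms(1,2)] by (simp add: exp_add mult_ac)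
qed

lemma Kf_sym: "Kf z a b = Kf z b a"
  unfolding Kf_def by (rule W_sym)

lemma exp_Kf_shift_b:
  assumes "0 < Re z" "Re z < Re a" "Re b > 0"
  shows "exp (Kf (z + b) a b) * (1 - qexp (z / a)) = exp (Kf z a b)"
  using exp_Kf_shift_a[OF assms] by (simp add: Kf_sym)

lemma Kg_shift_a:
  assumes "- Re a < Re z" "Re z < Re b" "Re a > 0" "Re b > 0"
  shows "Kg (z + a) a b = Kg z a b - Kf (z + a) a b"
  unfolding Kf_def Kg_def using W_shift[of "z + a" a b 1 1 1, unfolded Suc_1] assms
  by (simp add: ker_dom_def del: One_nat_def)

lemma Kg_shift_b:
  assumes "- Re a < Re z" "Re z < Re a" "Re b > 0"
  shows "Kg (z + b) a b = Kg z a b - W 2 0 1 (v3 (z + a) a a)"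
proof -
  \<comment> \<open>\<open>W_shift\<close> moves \<open>z\<close> by the first period, hence the
    exchange of \<open>a\<close> and \<open>b\<close>.\<close>
  have "v3 (z + a) b a \<in> ker_dom 0 2" using assms by (simp add: ker_dom_def)
  from W_shift[OF this, of 1, folded One_nat_def]
  have "W 1 2 1 (v3 (z + b + a) b a) = W 1 2 1 (v3 (z + a) b a) + W 0 2 1 (v3 (z + a) b a)"
    by (simp only: add_ac)
  then have "W 2 1 1 (v3 (z + b + a) a b) = W 2 1 1 (v3 (z + a) a b) + W 2 0 1 (v3 (z + a) a b)"
    by (simp only: W_sym[of 2])
  then show ?thesis unfolding Kg_def W_indep_3[of 2 1 "z + a" a b a] by simp
qed

section \<open>Continuation by shifts of z\<close>

definition F_dom :: "complex \<Rightarrow> complex \<Rightarrow> complex \<Rightarrow> bool" where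
  "F_dom z a b \<longleftrightarrow> Re a > 0 \<and> Re b > 0 \<and> 0 < Re z \<and> Re z < Re a + Re b"

lemma F_dom_iff: "F_dom z a b \<longleftrightarrow> v3 z a b \<in> ker_dom 1 1"
  by (auto simp: F_dom_def ker_dom_def)

text \<open>The factor that \<open>F\<close> acquires in the step from \<open>z + j * a\<close> to
  \<open>z + (j + 1) * a\<close>. At the arguments of the theorem it is
  \<open>1 - x * q ^ j\<close>.\<close>

definition xfac :: "complex \<Rightarrow> complex \<Rightarrow> complex \<Rightarrow> int \<Rightarrow> complex" where
  "xfac z a b j = 1 - qexp ((z + of_int j * a) / b)"

text \<open>The value at \<open>z\<close> forced by the shift equation from the value at
  \<open>z + n * a\<close>. According to the sign of \<open>n\<close> one of the two products is
  empty: forward shifts only create zeros, backward shifts only poles.\<close>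

definition Fn :: "int \<Rightarrow> complex \<Rightarrow> complex \<Rightarrow> complex \<Rightarrow> complex" where
  "Fn n z a b = exp (Kf (z + of_int n * a) a b) * (\<Prod>j\<in>{0..<n}. xfac z a b j) / (\<Prod>j\<in>{n..<0}. xfac z a b j)"

text \<open>Obtained by iterating \<open>G z = G (z + a) * F (z + a)\<close>: the factor at
  \<open>j\<close> enters once for each of the \<open>\<bar>j\<bar>\<close> values of
  \<open>F\<close> that contain it. For negative \<open>n\<close> the values of \<open>F\<close> are
  divided out and have the factors in their own denominators, so that the factors of
  \<open>G\<close> stand in the numerator in both cases.\<close>

definition Gn :: "int \<Rightarrow> complex \<Rightarrow> complex \<Rightarrow> complex \<Rightarrow> complex" where
  "Gn n z a b = exp (Kg (z + of_int n * a) a b + of_int n * Kf (z + of_int n * a) a b) *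
     (\<Prod>j\<in>{0..<n} \<union> {n..<0}. xfac z a b j ^ nat \<bar>j\<bar>)"

lemma exp_of_int_mult_cong:
  fixes x y :: complex
  assumes "exp x * c = exp y"
  shows "exp (of_int n * x) * (if n \<ge> 0 then c ^ nat n else inverse (c ^ nat (- n))) = exp (of_int n * y)"
proof -
  have c: "c = exp (y - x)" using assms by (simp add: exp_diff field_simps)
  have "(if n \<ge> 0 then c ^ nat n else inverse (c ^ nat (- n))) = exp (of_int n * (y - x))"
    unfolding c by (auto simp flip: exp_of_nat_mult exp_minus)
  then show ?thesis by (simp add: algebra_simps flip: exp_add)
qed

lemma int_interval_step:
  fixes n :: int
  shows "n \<ge> 0 \<Longrightarrow> {0..<n + 1} = insert n {0..<n}" "n \<ge> 0 \<Longrightarrow> {n..<0} = {}" "n \<ge> 0 \<Longrightarrow> {n + 1..<0} = {}"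
    "n < 0 \<Longrightarrow> {n..<0} = insert n {n + 1..<0}" "n < 0 \<Longrightarrow> {0..<n} = {}" "n < 0 \<Longrightarrow> {0..<n + 1} = {}"
  by auto

text \<open>One more shift multiplies by the factor at \<open>j = n\<close>, which the shift
  equation of \<open>Kf\<close> cancels. In \<open>Gn\<close> the term \<open>n * Kf\<close> in the
  exponent makes it cancel in the power \<open>\<bar>n\<bar>\<close>.\<close>

lemma Fn_Gn_step:
  assumes ok: "F_dom (z + of_int n * a) a b" "F_dom (z + of_int (n + 1) * a) a b"
  shows "Fn (n + 1) z a b = Fn n z a b" "Gn (n + 1) z a b = Gn n z a b"
proof -
  define w where "w = z + of_int n * a"
  define c where "c = xfac z a b n"
  have w1: "z + of_int (n + 1) * a = w + a" by (simp add: w_def algebra_simps)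
  have w: "0 < Re w" "Re w < Re b" "Re a > 0" "Re b > 0"
    using ok unfolding w1 w_def[symmetric] by (auto simp: F_dom_def)
  have K: "exp (Kf (w + a) a b) * c = exp (Kf w a b)"
    using exp_Kf_shift_a[OF w(1-3)] by (simp add: c_def xfac_def w_def)
  have c0: "c \<noteq> 0" using K by auto
  show "Fn (n + 1) z a b = Fn n z a b"
  proof (cases "n \<ge> 0")
    case True
    then show ?thesis
      unfolding Fn_def int_interval_step(1-3)[OF True] w1 w_def[symmetric] K[symmetric]
      using True by (simp add: c_def mult_ac)
  next
    case False
    then have "n < 0" by simp
    then show ?thesis
      unfolding Fn_def int_interval_step(4-6)[OF \<open>n < 0\<close>] w1 w_def[symmetric] K[symmetric]
      using c0 by (simp add: c_def)
  qed
  have Kg1: "Kg (w + a) a b = Kg w a b - Kf (w + a) a b"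
    using w by (intro Kg_shift_a) linarith+
  have e1: "exp (Kg (w + a) a b + of_int (n + 1) * Kf (w + a) a b) = exp (Kg w a b) * exp (of_int n * Kf (w + a) a b)"
    unfolding Kg1 by (simp add: algebra_simps flip: exp_add)
  have e2: "exp (Kg w a b + of_int n * Kf w a b) = exp (Kg w a b) * exp (of_int n * Kf (w + a) a b) * (if n \<ge> 0 then c ^ nat n else inverse (c ^ nat (- n)))"
    using exp_of_int_mult_cong[OF K, of n] by (simp add: exp_add)
  show "Gn (n + 1) z a b = Gn n z a b"
  proof (cases "n \<ge> 0")
    case True
    show ?thesis
      unfolding Gn_def int_interval_step(1-3)[OF True] w1 w_def[symmetric] e1 e2
      using True by (simp add: c_def mult_ac)
  next
    case False
    then have "n < 0" by simp
    then show ?thesis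
      unfolding Gn_def int_interval_step(4-6)[OF \<open>n < 0\<close>] w1 w_def[symmetric] e1 e2
      using c0 by (simp add: c_def)
  qed
qed

lemma Fn_Gn_unique:
  assumes "F_dom (z + of_int n * a) a b" "F_dom (z + of_int m * a) a b"
  shows "Fn n z a b = Fn m z a b \<and> Gn n z a b = Gn m z a b"
proof -
  have aux: "Fn (n + int k) z a b = Fn n z a b \<and> Gn (n + int k) z a b = Gn n z a b"
    if "F_dom (z + of_int n * a) a b" "F_dom (z + of_int (n + int k) * a) a b" for n k
    using that(2)
  proof (induction k)
    case (Suc k)
    have a: "Re a > 0" using that(1) by (simp add: F_dom_def)
    then have "0 \<le> Re a * real k" by simp
    moreover have "Re (z + of_int (n + int k) * a) = Re (z + of_int n * a) + Re a * real k"
      "Re (z + of_int (n + int (Suc k)) * a) = Re (z + of_int n * a) + Re a * real k + Re a"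
      by (simp_all add: algebra_simps)
    ultimately have "F_dom (z + of_int (n + int k) * a) a b"
      using that(1) Suc.prems a unfolding F_dom_def by linarith
    with Suc.IH Fn_Gn_step[OF this] Suc.prems show ?case by (simp add: add_ac)
  qed simp
  show ?thesis
  proof (cases "n \<le> m")
    case True
    then show ?thesis using aux[of n "nat (m - n)"] assms by simp
  next
    case False
    then show ?thesis using aux[of m "nat (n - m)"] assms by simp
  qed
qed

lemma F_dom_shift_exists:
  assumes "Re a > 0" "Re b > 0"
  obtains n :: int where "F_dom (z + of_int n * a) a b"
proof -
  \<comment> \<open>This choice puts \<open>Re (z + n * a)\<close> into the interval from
    \<open>0\<close> (excluded) to \<open>Re a\<close> (included).\<close>
  define n where "n = 1 - \<lceil>Re z / Re a\<rceil>"
  define c where "c = real_of_int \<lceil>Re z / Re a\<rceil>"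
  have "Re z / Re a \<le> c" "c < Re z / Re a + 1" unfolding c_def by linarith+
  then have "Re z \<le> c * Re a" "c * Re a < Re z + Re a"
    using assms by (auto simp: field_simps)
  then have "F_dom (z + of_int n * a) a b"
    using assms by (auto simp: F_dom_def n_def c_def algebra_simps)
  then show ?thesis by (rule that)
qed

definition Fbase :: "complex \<Rightarrow> complex \<Rightarrow> complex \<Rightarrow> complex" where
  "Fbase z a b = Fn (SOME n. F_dom (z + of_int n * a) a b) z a b"

definition Gbase :: "complex \<Rightarrow> complex \<Rightarrow> complex \<Rightarrow> complex" where
  "Gbase z a b = Gn (SOME n. F_dom (z + of_int n * a) a b) z a b"

lemma FGbase_eq:
  assumes "F_dom (z + of_int n * a) a b"
  shows "Fbase z a b = Fn n z a b" "Gbase z a b = Gn n z a b"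
  using Fn_Gn_unique[OF someI[of "\<lambda>n. F_dom (z + of_int n * a) a b", OF assms] assms]
  by (simp_all add: Fbase_def Gbase_def)

lemma prod_int_shift: "(\<Prod>j\<in>{n..<m}. f (j + 1)) = (\<Prod>j\<in>{n + 1..<m + 1 :: int}. f j)"
  by (rule prod.reindex_bij_witness[of _ "\<lambda>j. j - 1" "\<lambda>j. j + 1"]) auto

lemma xfac_add: "xfac (z + a) a b j = xfac z a b (j + 1)"
  by (simp add: xfac_def algebra_simps)

lemma prod_xfac_shift: "prod (xfac (z + a) a b) {n..<m} = prod (xfac z a b) {n + 1..<m + 1}"
  using prod_int_shift[of "xfac z a b" n m] by (simp add: xfac_add)

lemma Fbase_shift_a:
  assumes "Re a > 0" "Re b > 0" "qexp (z / b) \<noteq> 1"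
  shows "Fbase (z + a) a b = Fbase z a b / (1 - qexp (z / b))"
proof -
  obtain n where n: "F_dom (z + a + of_int n * a) a b" using F_dom_shift_exists[OF assms(1,2)] .
  have eq: "z + of_int (n + 1) * a = z + a + of_int n * a" by (simp add: algebra_simps)
  have x0: "xfac z a b 0 = 1 - qexp (z / b)" "xfac z a b 0 \<noteq> 0" using assms(3) by (auto simp: xfac_def)
  have "Fbase z a b = Fn (n + 1) z a b" by (rule FGbase_eq(1)) (simp only: eq n)
  moreover have "Fbase (z + a) a b = Fn n (z + a) a b" by (rule FGbase_eq(1)[OF n])
  moreover have "Fn (n + 1) z a b = Fn n (z + a) a b * xfac z a b 0"
  proof (cases "n \<ge> 0")
    case True
    have i: "{0..<n + 1} = insert 0 {0 + 1..<n + 1}" "{n + 1..<0} = {}" "{n..<0} = {}" using True by auto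
    show ?thesis
      unfolding Fn_def eq xfac_add prod_xfac_shift i by (simp add: mult_ac)
  next
    case False
    have i: "{n + 1..<0 + 1} = insert 0 {n + 1..<0}" "{0..<n + 1} = {}" "{0..<n} = {}" using False by auto
    show ?thesis
      unfolding Fn_def eq xfac_add prod_xfac_shift i using x0 by simp
  qed
  ultimately show ?thesis using x0 by simp
qed

lemma Gbase_shift_a:
  assumes "Re a > 0" "Re b > 0" "Fbase (z + a) a b \<noteq> 0"
  shows "Gbase z a b = Gbase (z + a) a b * Fbase (z + a) a b"
proof -
  obtain n where n: "F_dom (z + a + of_int n * a) a b" using F_dom_shift_exists[OF assms(1,2)] .
  have eq: "z + of_int (n + 1) * a = z + a + of_int n * a" by (simp add: algebra_simps)
  define w where "w = z + a + of_int n * a"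
  have F: "Fbase (z + a) a b = Fn n (z + a) a b" by (rule FGbase_eq(1)[OF n])
  have e: "exp (Kg w a b + of_int (n + 1) * Kf w a b) = exp (Kg w a b + of_int n * Kf w a b) * exp (Kf w a b)"
    by (simp add: algebra_simps flip: exp_add)
  have "Gn (n + 1) z a b = Gn n (z + a) a b * Fn n (z + a) a b"
  proof (cases "n \<ge> 0")
    case True
    have i: "{0..<n + 1} \<union> {n + 1..<0} = insert 0 {0 + 1..<n + 1}" "{0..<n} \<union> {n..<0} = {0..<n}" "{n..<0} = {}" using True by auto
    have "(\<Prod>j\<in>{0 + 1..<n + 1}. xfac z a b j ^ nat \<bar>j\<bar>) =
        (\<Prod>j\<in>{0 + 1..<n + 1}. xfac z a b j ^ nat \<bar>j - 1\<bar> * xfac z a b j)"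
    proof (intro prod.cong refl)
      fix j assume "j \<in> {0 + 1..<n + 1}"
      then have "nat \<bar>j\<bar> = Suc (nat \<bar>j - 1\<bar>)" by auto
      then show "xfac z a b j ^ nat \<bar>j\<bar> = xfac z a b j ^ nat \<bar>j - 1\<bar> * xfac z a b j" by (simp only: power_Suc mult.commute)
    qed
    moreover have "(\<Prod>j\<in>{0..<n}. xfac (z + a) a b j ^ nat \<bar>j\<bar>) = (\<Prod>j\<in>{0 + 1..<n + 1}. xfac z a b j ^ nat \<bar>j - 1\<bar>)"
      unfolding xfac_add using prod_int_shift[of "\<lambda>j. xfac z a b j ^ nat \<bar>j - 1\<bar>" 0 n] by simp
    ultimately show ?thesis
      unfolding Gn_def Fn_def eq w_def[symmetric] e i xfac_add prod_xfac_shift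
      by (simp add: prod.distrib mult_ac)
  next
    case False
    have i: "{0..<n + 1} \<union> {n + 1..<0} = {n + 1..<0}" "{0..<n} \<union> {n..<0} = {n..<0}" "{0..<n} = {}"
      "{n + 1..<0 + 1} = insert 0 {n + 1..<0}" using False by auto
    \<comment> \<open>Division by zero gives \<open>0\<close>, so that a nonzero value of
      \<open>Fn\<close> excludes zeros in its denominator.\<close>
    have nz: "xfac z a b j \<noteq> 0" if "j \<in> {n + 1..<0 + 1}" for j
      using assms(3) that unfolding F Fn_def prod_xfac_shift by auto
    have "(\<Prod>j\<in>{n + 1..<0 + 1}. xfac z a b j ^ nat \<bar>j - 1\<bar>) =
        (\<Prod>j\<in>{n + 1..<0 + 1}. xfac z a b j ^ nat \<bar>j\<bar> * xfac z a b j)"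
    proof (intro prod.cong refl)
      fix j assume "j \<in> {n + 1..<0 + 1}"
      then have "nat \<bar>j - 1\<bar> = Suc (nat \<bar>j\<bar>)" by auto
      then show "xfac z a b j ^ nat \<bar>j - 1\<bar> = xfac z a b j ^ nat \<bar>j\<bar> * xfac z a b j" by (simp only: power_Suc mult.commute)
    qed
    moreover have "(\<Prod>j\<in>{n..<0}. xfac (z + a) a b j ^ nat \<bar>j\<bar>) = (\<Prod>j\<in>{n + 1..<0 + 1}. xfac z a b j ^ nat \<bar>j - 1\<bar>)"
      unfolding xfac_add using prod_int_shift[of "\<lambda>j. xfac z a b j ^ nat \<bar>j - 1\<bar>" n 0] by simp
    moreover have "(\<Prod>j\<in>{n + 1..<0 + 1}. xfac z a b j ^ nat \<bar>j\<bar>) = (\<Prod>j\<in>{n + 1..<0}. xfac z a b j ^ nat \<bar>j\<bar>)"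
      unfolding i by simp
    moreover have "(\<Prod>j\<in>{n + 1..<0 + 1}. xfac z a b j) \<noteq> 0" using nz by simp
    ultimately show ?thesis
      unfolding Gn_def Fn_def eq w_def[symmetric] e i(1-3) xfac_add prod_xfac_shift
      by (simp add: prod.distrib mult_ac)
  qed
  moreover have "Gbase z a b = Gn (n + 1) z a b" by (rule FGbase_eq(2)) (simp only: eq n)
  moreover have "Gbase (z + a) a b = Gn n (z + a) a b" by (rule FGbase_eq(2)[OF n])
  ultimately show ?thesis by (simp add: F)
qed

text \<open>Multiplication by it turns \<open>a\<close> into \<open>csqrt (a / b)\<close> and
  \<open>b\<close> into its inverse. Off the nonpositive reals the principal root has positive real
  part, hence both periods land in the right half-plane, and the factor is holomorphic in
  \<open>a\<close> and \<open>b\<close>.\<close>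

definition lam :: "complex \<Rightarrow> complex \<Rightarrow> complex" where
  "lam a b = inverse (b * csqrt (a / b))"

definition Fc :: "complex \<Rightarrow> complex \<Rightarrow> complex \<Rightarrow> complex" where
  "Fc z a b = Fbase (lam a b * z) (lam a b * a) (lam a b * b)"

definition Gc :: "complex \<Rightarrow> complex \<Rightarrow> complex \<Rightarrow> complex" where
  "Gc z a b = Gbase (lam a b * z) (lam a b * a) (lam a b * b)"

lemma Re_csqrt_pos:
  assumes "c \<notin> \<real>\<^sub>\<le>\<^sub>0"
  shows "Re (csqrt c) > 0"
proof (rule ccontr)
  assume "\<not> ?thesis"
  with csqrt_principal[of c] have "Re (csqrt c) = 0" by linarith
  then have "csqrt c = \<i> * of_real (Im (csqrt c))" by (simp add: complex_eq_iff)
  then have "(csqrt c)\<^sup>2 = (\<i> * of_real (Im (csqrt c)))\<^sup>2" by simp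
  then have "c = of_real (- (Im (csqrt c))\<^sup>2)" by (simp add: power_mult_distrib)
  then have "c \<in> \<real>\<^sub>\<le>\<^sub>0" by (metis nonpos_Reals_of_real_iff neg_le_0_iff_le zero_le_power2)
  with assms show False by simp
qed

lemma lam_props:
  assumes "a / b \<notin> \<real>\<^sub>\<le>\<^sub>0"
  shows "a \<noteq> 0" "b \<noteq> 0" "lam a b \<noteq> 0" "Re (lam a b * a) > 0" "Re (lam a b * b) > 0"
proof -
  show 1: "a \<noteq> 0" "b \<noteq> 0" using assms by auto
  define w where "w = csqrt (a / b)"
  have w: "Re w > 0" unfolding w_def by (rule Re_csqrt_pos[OF assms])
  then have w0: "w \<noteq> 0" by auto
  have w2: "w * w = a / b" unfolding w_def by (metis power2_csqrt power2_eq_square)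
  show "lam a b \<noteq> 0" using 1 w0 by (simp add: lam_def w_def)
  have L: "lam a b = inverse (b * w)" by (simp add: lam_def w_def)
  have aw: "a = w * w * b" using w2 1 by simp
  have "lam a b * a = inverse (b * w) * (w * w * b)" using L aw by metis
  then have "lam a b * a = w" using 1 w0 by (simp add: field_simps)
  then show "Re (lam a b * a) > 0" using w by simp
  have "lam a b * b = inverse w" unfolding L using 1 w0 by (simp add: field_simps)
  then show "Re (lam a b * b) > 0" using w by (simp add: Re_divide inverse_eq_divide sum_power2_gt_zero_iff w0 complex_eq_iff zero_less_divide_iff)
qed

lemma lam_scale: "c \<noteq> 0 \<Longrightarrow> lam (c * a) (c * b) = lam a b / c"
proof -
  assume "c \<noteq> 0"
  then have "c * a / (c * b) = a / b" by simp
  then show ?thesis unfolding lam_def by (simp add: field_simps)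
qed

lemma Fc_scale: "c \<noteq> 0 \<Longrightarrow> Fc (c * z) (c * a) (c * b) = Fc z a b"
  by (simp add: Fc_def lam_scale)

lemma Gc_scale: "c \<noteq> 0 \<Longrightarrow> Gc (c * z) (c * a) (c * b) = Gc z a b"
  by (simp add: Gc_def lam_scale)

section \<open>Regularity on the full domain\<close>

lemma FG_domain_iff: "v3 z a b \<in> FG_domain \<longleftrightarrow> a / b \<notin> \<real>\<^sub>\<le>\<^sub>0"
  by (simp add: FG_domain_def)

lemma open_FG_domain: "open FG_domain"
proof -
  have eq: "FG_domain = {p :: complex ^ 3. p $ 3 \<noteq> 0} \<inter> (\<lambda>p. p $ 2 / p $ 3) -` (- \<real>\<^sub>\<le>\<^sub>0)"
    by (auto simp: FG_domain_def)
  have "open {p :: complex ^ 3. p $ 3 \<noteq> 0}"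
    by (intro open_Collect_neq continuous_intros)
  moreover have "open (- \<real>\<^sub>\<le>\<^sub>0 :: complex set)" by (intro open_Compl closed_nonpos_Reals_complex)
  ultimately show ?thesis
    unfolding eq by (intro continuous_open_preimage continuous_intros) auto
qed

text \<open>Writing \<open>a = c * b\<close>, the domain is the continuous image of a product of the
  plane, the punctured plane and the slit plane.\<close>

lemma connected_FG_domain: "connected FG_domain"
proof -
  define \<phi> :: "complex \<times> complex \<times> complex \<Rightarrow> complex ^ 3"
    where "\<phi> x = (\<chi> i. if i = 1 then fst x else if i = 2 then snd (snd x) * fst (snd x) else fst (snd x))" for x
  define X :: "(complex \<times> complex \<times> complex) set" where "X = UNIV \<times> (- {0}) \<times> (- \<real>\<^sub>\<le>\<^sub>0)"
  have phi: "\<phi> (z, b, c) = v3 z (c * b) b" for z b c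
    by (simp add: v3_eq_iff \<phi>_def)
  have "(\<real>\<^sub>\<le>\<^sub>0 :: complex set) = of_real ` {..0}" by (auto elim!: nonpos_Reals_cases)
  then have "starlike (- \<real>\<^sub>\<le>\<^sub>0 :: complex set)" using starlike_slotted_complex_plane_left[of 0] by metis
  then have "connected X"
    unfolding X_def
    by (intro connected_Times starlike_imp_connected connected_punctured_universe) (auto simp: connected_UNIV)
  moreover have "continuous_on X \<phi>"
    unfolding \<phi>_def
  proof (intro continuous_on_vec_lambda)
    show "continuous_on X (\<lambda>x. if i = 1 then fst x else if i = 2 then snd (snd x) * fst (snd x) else fst (snd x))" for i :: 3
      by (cases "i = 1"; cases "i = 2") (auto intro!: continuous_intros)
  qed
  moreover have "\<phi> ` X = FG_domain"
  proof (intro equalityI subsetI)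
    fix p assume "p \<in> \<phi> ` X"
    then obtain z b c where "(z, b, c) \<in> X" "p = \<phi> (z, b, c)" by (metis imageE prod_cases3)
    then have "b \<noteq> 0" "c \<notin> \<real>\<^sub>\<le>\<^sub>0" "p = v3 z (c * b) b" unfolding phi by (auto simp: X_def)
    then show "p \<in> FG_domain" by (simp add: FG_domain_iff)
  next
    fix p assume p: "p \<in> FG_domain"
    then have "p $ 3 \<noteq> 0" by (auto simp: FG_domain_def)
    then have "p = \<phi> (p $ 1, p $ 3, p $ 2 / p $ 3)" by (simp add: phi v3_eq_iff)
    moreover have "(p $ 1, p $ 3, p $ 2 / p $ 3) \<in> X"
      using p \<open>p $ 3 \<noteq> 0\<close> by (simp add: X_def FG_domain_def)
    ultimately show "p \<in> \<phi> ` X" by (metis imageI)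
  qed
  ultimately show ?thesis using connected_continuous_image by metis
qed

lemma mv_holomorphic_lam: "mv_holomorphic_on (\<lambda>p. lam (p $ 2) (p $ 3)) FG_domain"
proof -
  have "mv_holomorphic_on (\<lambda>p. csqrt (p $ 2 / p $ 3)) FG_domain"
  proof (rule mv_holomorphic_on_compose[of _ _ csqrt "- \<real>\<^sub>\<le>\<^sub>0"])
    show "mv_holomorphic_on (\<lambda>p. p $ 2 / p $ 3) FG_domain"
      by (intro mv_intros) (auto simp: FG_domain_def)
    show "csqrt holomorphic_on - \<real>\<^sub>\<le>\<^sub>0" by (rule holomorphic_on_csqrt)
  qed (auto simp: FG_domain_def closed_nonpos_Reals_complex)
  then show ?thesis
    unfolding lam_def using lam_props(1,2)
    by (intro mv_intros) (auto simp: FG_domain_def)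
qed

lemma xfac_scale: "c \<noteq> 0 \<Longrightarrow> xfac (c * z) (c * a) (c * b) j = xfac z a b j"
proof -
  assume c: "c \<noteq> 0"
  have "c * z + of_int j * (c * a) = c * (z + of_int j * a)" by (simp add: algebra_simps)
  then show ?thesis using c by (simp add: xfac_def)
qed

text \<open>The points that \<open>n\<close> shifts bring into the strip of convergence after
  rescaling. These open sets cover \<open>FG_domain\<close>, and on each of them the continuation is
  one explicit formula.\<close>

definition n_dom :: "int \<Rightarrow> (complex ^ 3) set" where
  "n_dom n = {p \<in> FG_domain. F_dom (lam (p $ 2) (p $ 3) * (p $ 1 + of_int n * p $ 2))
     (lam (p $ 2) (p $ 3) * p $ 2) (lam (p $ 2) (p $ 3) * p $ 3)}"

lemma open_n_dom: "open (n_dom n)"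
proof -
  have cont: "continuous_on FG_domain (\<lambda>p. lam (p $ 2) (p $ 3))"
    using mv_holomorphic_lam mv_holomorphic_on_continuous by (intro continuous_at_imp_continuous_on) auto
  have pre: "open (FG_domain \<inter> f -` {0<..})" if "continuous_on FG_domain f" for f :: "complex ^ 3 \<Rightarrow> real"
    using that open_FG_domain by (intro continuous_open_preimage) auto
  define f1 f2 f3 where "f1 p = Re (lam (p $ 2) (p $ 3) * p $ 2)" and "f2 p = Re (lam (p $ 2) (p $ 3) * p $ 3)"
    and "f3 p = Re (lam (p $ 2) (p $ 3) * (p $ 1 + of_int n * p $ 2))" for p :: "complex ^ 3"
  have c: "continuous_on FG_domain f1" "continuous_on FG_domain f2" "continuous_on FG_domain f3"
    unfolding f1_def f2_def f3_def by (intro continuous_on_Re continuous_on_mult cont continuous_intros)+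
  have eq: "n_dom n = (FG_domain \<inter> f1 -` {0<..}) \<inter> (FG_domain \<inter> f2 -` {0<..}) \<inter> (FG_domain \<inter> f3 -` {0<..})
     \<inter> (FG_domain \<inter> (\<lambda>p. f1 p + f2 p - f3 p) -` {0<..})"
    unfolding n_dom_def F_dom_def f1_def[symmetric] f2_def[symmetric] f3_def[symmetric] by auto
  have "continuous_on FG_domain (\<lambda>p. f1 p + f2 p - f3 p)" by (intro continuous_intros c)
  from open_Int[OF open_Int[OF open_Int[OF pre[OF c(1)] pre[OF c(2)]] pre[OF c(3)]] pre[OF this]]
  show ?thesis unfolding eq .
qed

lemma n_dom_exists:
  assumes "p \<in> FG_domain"
  obtains n where "p \<in> n_dom n"
proof -
  define L where "L = lam (p $ 2) (p $ 3)"
  have "Re (L * p $ 2) > 0" "Re (L * p $ 3) > 0"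
    using lam_props(4,5)[of "p $ 2" "p $ 3"] assms by (auto simp: FG_domain_def L_def)
  then obtain n where "F_dom (L * p $ 1 + of_int n * (L * p $ 2)) (L * p $ 2) (L * p $ 3)"
    using F_dom_shift_exists by blast
  then have "p \<in> n_dom n" using assms by (simp add: n_dom_def L_def algebra_simps)
  then show ?thesis by (rule that)
qed

definition KF :: "int \<Rightarrow> complex ^ 3 \<Rightarrow> complex" where
  "KF n p = Kf (lam (p $ 2) (p $ 3) * (p $ 1 + of_int n * p $ 2)) (lam (p $ 2) (p $ 3) * p $ 2) (lam (p $ 2) (p $ 3) * p $ 3)"

definition KG :: "int \<Rightarrow> complex ^ 3 \<Rightarrow> complex" where
  "KG n p = Kg (lam (p $ 2) (p $ 3) * (p $ 1 + of_int n * p $ 2)) (lam (p $ 2) (p $ 3) * p $ 2) (lam (p $ 2) (p $ 3) * p $ 3)"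

lemma n_dom_subset: "n_dom n \<subseteq> FG_domain"
  by (auto simp: n_dom_def)

lemma mv_holomorphic_KF: "mv_holomorphic_on (KF n) (n_dom n)"
  unfolding KF_def Kf_def
  by (rule mv_holomorphic_v3_compose[OF W_holomorphic[of 1 1]])
     (auto simp: n_dom_def F_dom_iff intro!: mv_intros mv_holomorphic_on_subset[OF mv_holomorphic_lam])

lemma F_dom_imp_G: "F_dom z a b \<Longrightarrow> v3 (z + a) a b \<in> ker_dom 2 1"
  by (auto simp: F_dom_def ker_dom_def)

lemma mv_holomorphic_KG: "mv_holomorphic_on (KG n) (n_dom n)"
  unfolding KG_def Kg_def
  by (intro mv_holomorphic_on_uminus, rule mv_holomorphic_v3_compose[OF W_holomorphic[of 2 1]])
     (auto simp: n_dom_def simp del: One_nat_def intro!: F_dom_imp_G mv_intros mv_holomorphic_on_subset[OF mv_holomorphic_lam])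

lemma Fc_Gc_n_dom:
  assumes "p \<in> n_dom n"
  shows "Fc (p $ 1) (p $ 2) (p $ 3) =
      exp (KF n p) * (\<Prod>j\<in>{0..<n}. xfac (p $ 1) (p $ 2) (p $ 3) j) / (\<Prod>j\<in>{n..<0}. xfac (p $ 1) (p $ 2) (p $ 3) j)"
    and "Gc (p $ 1) (p $ 2) (p $ 3) =
      exp (KG n p + of_int n * KF n p) * (\<Prod>j\<in>{0..<n} \<union> {n..<0}. xfac (p $ 1) (p $ 2) (p $ 3) j ^ nat \<bar>j\<bar>)"
proof -
  define L where "L = lam (p $ 2) (p $ 3)"
  have L: "L \<noteq> 0" using lam_props(3) assms by (auto simp: L_def n_dom_def FG_domain_def)
  have eq: "L * p $ 1 + of_int n * (L * p $ 2) = L * (p $ 1 + of_int n * p $ 2)" by (simp add: algebra_simps)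
  have d: "F_dom (L * p $ 1 + of_int n * (L * p $ 2)) (L * p $ 2) (L * p $ 3)"
    using assms unfolding eq by (simp add: n_dom_def L_def)
  show "Fc (p $ 1) (p $ 2) (p $ 3) =
      exp (KF n p) * (\<Prod>j\<in>{0..<n}. xfac (p $ 1) (p $ 2) (p $ 3) j) / (\<Prod>j\<in>{n..<0}. xfac (p $ 1) (p $ 2) (p $ 3) j)"
    unfolding Fc_def L_def[symmetric] FGbase_eq(1)[OF d] Fn_def eq KF_def xfac_scale[OF L] ..
  show "Gc (p $ 1) (p $ 2) (p $ 3) =
      exp (KG n p + of_int n * KF n p) * (\<Prod>j\<in>{0..<n} \<union> {n..<0}. xfac (p $ 1) (p $ 2) (p $ 3) j ^ nat \<bar>j\<bar>)"
    unfolding Gc_def L_def[symmetric] FGbase_eq(2)[OF d] Gn_def eq KG_def KF_def xfac_scale[OF L] ..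
qed

lemma mv_holomorphic_xfac:
  fixes x y z :: "complex ^ 'm \<Rightarrow> complex"
  assumes "mv_holomorphic_on x S" "mv_holomorphic_on y S" "mv_holomorphic_on z S" "\<And>p. p \<in> S \<Longrightarrow> z p \<noteq> 0"
  shows "mv_holomorphic_on (\<lambda>p. xfac (x p) (y p) (z p) j) S"
  unfolding xfac_def qexp_def using assms by (intro mv_intros)

lemma eventually_qexp_neq_1: "\<forall>\<^sub>F \<tau> :: real in at_right 0. qexp (u + of_real \<tau>) \<noteq> 1"
proof (cases "qexp u = 1")
  case True
  show ?thesis
    unfolding eventually_at_right_field
  proof (intro exI[of _ 1] conjI allI impI)
    fix \<tau> :: real assume \<tau>: "0 < \<tau>" "\<tau> < 1"
    show "qexp (u + of_real \<tau>) \<noteq> 1"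
    proof
      assume "qexp (u + of_real \<tau>) = 1"
      then have "qexp (of_real \<tau>) = 1" using True by (simp add: qexp_add)
      then obtain n :: int where "complex_of_real \<tau> = of_int n" unfolding qexp_eq_1_iff by (auto elim: Ints_cases)
      then have "\<tau> = of_int n" by (metis of_real_of_int_eq of_real_eq_iff)
      with \<tau> show False by auto
    qed
  qed auto
next
  case False
  have "((\<lambda>\<tau>. qexp (u + of_real \<tau>)) \<longlongrightarrow> qexp (u + of_real 0)) (at_right 0)"
    unfolding qexp_def by (intro tendsto_intros)
  then show ?thesis using False by (intro tendsto_imp_eventually_ne) auto
qed

text \<open>Translating \<open>z\<close> by \<open>\<tau> * b\<close> adds the same real number
  \<tau> to the argument of every \<open>qexp\<close>; a small positive \<tau> moves finitely many
  of them off the integers at once.\<close>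

lemma eventually_prod_xfac_nonzero:
  assumes "finite J" "b \<noteq> 0"
  shows "\<forall>\<^sub>F \<tau> :: real in at_right 0. (\<Prod>j\<in>J. xfac (z + of_real \<tau> * b) a b j) \<noteq> 0"
proof -
  have eq: "(z + of_real \<tau> * b + of_int j * a) / b = (z + of_int j * a) / b + of_real \<tau>" for j \<tau>
    using assms(2) by (simp add: field_simps)
  have "\<forall>\<^sub>F \<tau> :: real in at_right 0. \<forall>j\<in>J. qexp ((z + of_int j * a) / b + of_real \<tau>) \<noteq> 1"
    by (intro eventually_ball_finite assms ballI eventually_qexp_neq_1)
  then show ?thesis
    by eventually_elim (use assms in \<open>auto simp: xfac_def eq\<close>)
qed

text \<open>An interior zero would capture the curve that leaves it through nonzero values.\<close>

lemma interior_zeros_empty: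
  fixes h :: "complex ^ 'n \<Rightarrow> complex"
  assumes "\<And>q. q \<in> U \<Longrightarrow> \<exists>\<phi> :: real \<Rightarrow> complex ^ 'n. (\<phi> \<longlongrightarrow> q) (at_right 0) \<and> (\<forall>\<^sub>F \<tau> in at_right 0. h (\<phi> \<tau>) \<noteq> 0)"
  shows "interior {q\<in>U. h q = 0} = {}"
proof (rule ccontr)
  assume "interior {q\<in>U. h q = 0} \<noteq> {}"
  then obtain q where q: "q \<in> interior {q\<in>U. h q = 0}" by auto
  then have "q \<in> U" using interior_subset by blast
  then obtain \<phi> where \<phi>: "(\<phi> \<longlongrightarrow> q) (at_right (0 :: real))" "\<forall>\<^sub>F \<tau> in at_right 0. h (\<phi> \<tau>) \<noteq> 0"
    using assms by blast
  have "\<forall>\<^sub>F \<tau> in at_right 0. \<phi> \<tau> \<in> interior {q\<in>U. h q = 0}"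
    by (rule topological_tendstoD[OF \<phi>(1) open_interior q])
  with \<phi>(2) have "\<forall>\<^sub>F \<tau> :: real in at_right 0. False"
    by eventually_elim (use interior_subset in blast)
  then show False by (simp add: eventually_False)
qed

lemma interior_prod_xfac_zeros:
  assumes "finite J" "U \<subseteq> FG_domain"
  shows "interior {q\<in>U. (\<Prod>j\<in>J. xfac (q $ 1) (q $ 2) (q $ 3) j) = 0} = {}"
proof (rule interior_zeros_empty)
  fix q assume "q \<in> U"
  then have q3: "q $ 3 \<noteq> 0" using assms(2) lam_props(2) by (auto simp: FG_domain_def)
  define \<phi> where "\<phi> \<tau> = v3 (q $ 1 + of_real \<tau> * q $ 3) (q $ 2) (q $ 3)" for \<tau> :: real
  have "(\<phi> \<longlongrightarrow> q) (at_right 0)"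
  proof (rule vec_tendstoI)
    fix i
    have "\<forall>i. ((\<lambda>\<tau>. \<phi> \<tau> $ i) \<longlongrightarrow> q $ i) (at_right 0)"
      unfolding forall_3 \<phi>_def by (auto intro!: tendsto_eq_intros)
    then show "((\<lambda>\<tau>. \<phi> \<tau> $ i) \<longlongrightarrow> q $ i) (at_right 0)" by blast
  qed
  moreover have "\<forall>\<^sub>F \<tau> in at_right 0. (\<Prod>j\<in>J. xfac (\<phi> \<tau> $ 1) (\<phi> \<tau> $ 2) (\<phi> \<tau> $ 3) j) \<noteq> 0"
    using eventually_prod_xfac_nonzero[OF assms(1) q3] by (simp add: \<phi>_def)
  ultimately show "\<exists>\<phi>. (\<phi> \<longlongrightarrow> q) (at_right (0::real)) \<and>
      (\<forall>\<^sub>F \<tau> in at_right 0. (\<Prod>j\<in>J. xfac (\<phi> \<tau> $ 1) (\<phi> \<tau> $ 2) (\<phi> \<tau> $ 3) j) \<noteq> 0)" by blast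
qed

lemma Fc_nicely_meromorphic: "mv_nicely_meromorphic_on (\<lambda>p. Fc (p $ 1) (p $ 2) (p $ 3)) FG_domain"
proof (rule mv_quotient_nicely_meromorphic)
  fix p assume "p \<in> FG_domain"
  then obtain n where n: "p \<in> n_dom n" by (rule n_dom_exists)
  define g where "g q = exp (KF n q) * (\<Prod>j\<in>{0..<n}. xfac (q $ 1) (q $ 2) (q $ 3) j)" for q
  define h where "h q = (\<Prod>j\<in>{n..<0}. xfac (q $ 1) (q $ 2) (q $ 3) j)" for q :: "complex ^ 3"
  have nz: "q $ 3 \<noteq> 0" if "q \<in> n_dom n" for q
    using that lam_props(2) by (auto simp: n_dom_def FG_domain_def)
  have "mv_holomorphic_on g (n_dom n)" "mv_holomorphic_on h (n_dom n)"
    unfolding g_def h_def using mv_holomorphic_KF nz by (intro mv_intros mv_holomorphic_xfac; simp)+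
  moreover have "interior {q\<in>n_dom n. h q = 0} = {}"
    unfolding h_def by (intro interior_prod_xfac_zeros n_dom_subset) auto
  \<comment> \<open>One of the two products is empty, depending on the sign of \<open>n\<close>;
    numerator and denominator therefore never vanish together, as the convention for singular values
    requires.\<close>
  moreover have "(\<forall>q\<in>n_dom n. g q \<noteq> 0) \<or> (\<forall>q\<in>n_dom n. h q \<noteq> 0)"
    by (cases "n \<ge> 0") (auto simp: g_def h_def)
  ultimately show "\<exists>U g h. open U \<and> p \<in> U \<and> mv_holomorphic_on g U \<and> mv_holomorphic_on h U \<and>
       interior {q \<in> U. h q = 0} = {} \<and> ((\<forall>q\<in>U. g q \<noteq> 0) \<or> (\<forall>q\<in>U. h q \<noteq> 0)) \<and>
       (\<forall>q\<in>U. Fc (q $ 1) (q $ 2) (q $ 3) = g q / h q)"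
    using n Fc_Gc_n_dom(1) open_n_dom
    by (intro exI[of _ "n_dom n"] exI[of _ g] exI[of _ h]) (simp add: g_def h_def)
qed

text \<open>All factors of \<open>Gn\<close> occur with nonnegative exponents, so that the
  continuation of \<open>G\<close> has no poles.\<close>

lemma Gc_holomorphic: "mv_holomorphic_on (\<lambda>p. Gc (p $ 1) (p $ 2) (p $ 3)) FG_domain"
proof (rule mv_holomorphic_on_Union)
  fix p assume "p \<in> FG_domain"
  then obtain n where n: "p \<in> n_dom n" by (rule n_dom_exists)
  have nz: "q $ 3 \<noteq> 0" if "q \<in> n_dom n" for q
    using that lam_props(2) by (auto simp: n_dom_def FG_domain_def)
  have "mv_holomorphic_on (\<lambda>p. exp (KG n p + of_int n * KF n p) *
     (\<Prod>j\<in>{0..<n} \<union> {n..<0}. xfac (p $ 1) (p $ 2) (p $ 3) j ^ nat \<bar>j\<bar>)) (n_dom n)"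
    using mv_holomorphic_KF mv_holomorphic_KG nz by (intro mv_intros mv_holomorphic_xfac) auto
  then have "mv_holomorphic_on (\<lambda>p. Gc (p $ 1) (p $ 2) (p $ 3)) (n_dom n)"
    by (rule mv_holomorphic_on_cong[OF _ open_n_dom]) (simp only: Fc_Gc_n_dom(2))
  with n show "\<exists>U. p \<in> U \<and> mv_holomorphic_on (\<lambda>p. Gc (p $ 1) (p $ 2) (p $ 3)) U" by blast
qed

section \<open>Identification with the continued integrals\<close>

lemma right_half_plane_ratio:
  assumes "Re a > 0" "Re b > 0"
  shows "a / b \<notin> \<real>\<^sub>\<le>\<^sub>0"
proof
  assume "a / b \<in> \<real>\<^sub>\<le>\<^sub>0"
  then obtain r where r: "r \<le> 0" "a / b = of_real r" by (auto elim: nonpos_Reals_cases)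
  moreover have "b \<noteq> 0" using assms by auto
  ultimately have "a = of_real r * b" by (simp add: r(2)[symmetric])
  then have "Re a = r * Re b" by simp
  with assms r show False by (simp add: mult_nonpos_nonneg not_le[symmetric])
qed

text \<open>The strip of convergence for \<open>G\<close>. It reaches further left than the one for
  \<open>F\<close> and contains \<open>z = 0\<close>, where the normalising factor is taken.\<close>

definition G_range :: "(complex ^ 3) set" where
  "G_range = {p. v3 (p $ 1 + p $ 2) (p $ 2) (p $ 3) \<in> ker_dom 2 1}"

lemma G_range_iff: "v3 z a b \<in> G_range \<longleftrightarrow> Re a > 0 \<and> Re b > 0 \<and> - Re a < Re z \<and> Re z < Re a + Re b"
  by (auto simp: G_range_def ker_dom_def)

lemma ker_dom_subset_FG: "ker_dom m n \<subseteq> FG_domain"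
  using right_half_plane_ratio by (auto simp: ker_dom_def FG_domain_def)

lemma open_G_range: "open G_range"
  unfolding G_range_def ker_dom_def
  by (simp, intro open_Collect_conj open_Collect_less continuous_intros)

lemma convex_G_range: "convex G_range"
proof (rule convexI)
  fix p q and u v :: real assume *: "p \<in> G_range" "q \<in> G_range" "0 \<le> u" "0 \<le> v" "u + v = 1"
  have "v3 ((u *\<^sub>R p + v *\<^sub>R q) $ 1 + (u *\<^sub>R p + v *\<^sub>R q) $ 2) ((u *\<^sub>R p + v *\<^sub>R q) $ 2) ((u *\<^sub>R p + v *\<^sub>R q) $ 3) =
    u *\<^sub>R v3 (p $ 1 + p $ 2) (p $ 2) (p $ 3) + v *\<^sub>R v3 (q $ 1 + q $ 2) (q $ 2) (q $ 3)"
    by (simp add: v3_eq_iff algebra_simps)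
  with * convexD[OF convex_ker_dom[of 2 1], of "v3 (p $ 1 + p $ 2) (p $ 2) (p $ 3)" "v3 (q $ 1 + q $ 2) (q $ 2) (q $ 3)" u v]
  show "u *\<^sub>R p + v *\<^sub>R q \<in> G_range" by (simp add: G_range_def)
qed

text \<open>The points where the rescaled arguments need no shift; there both sides are integrals.\<close>

lemma no_shift_region:
  defines "V \<equiv> n_dom 0 \<inter> ker_dom 1 1"
  shows "open V" "V \<noteq> {}"
proof -
  show "open V" unfolding V_def by (intro open_Int open_n_dom open_ker_dom)
  have "(1 :: complex) \<notin> \<real>\<^sub>\<le>\<^sub>0" by (simp add: complex_nonpos_Reals_iff)
  then have "v3 1 1 1 \<in> V" by (simp add: V_def n_dom_def ker_dom_def FG_domain_iff F_dom_def lam_def)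
  then show "V \<noteq> {}" by auto
qed

lemma Fc_Gc_no_shift:
  assumes "p \<in> n_dom 0 \<inter> ker_dom 1 1"
  shows "Fc (p $ 1) (p $ 2) (p $ 3) = exp (Kf (p $ 1) (p $ 2) (p $ 3))"
    and "Gc (p $ 1) (p $ 2) (p $ 3) = exp (Kg (p $ 1) (p $ 2) (p $ 3))"
proof -
  define L where "L = lam (p $ 2) (p $ 3)"
  have p: "v3 (p $ 1) (p $ 2) (p $ 3) \<in> ker_dom 1 1" using assms unfolding v3_eta by blast
  have q: "F_dom (L * p $ 1) (L * p $ 2) (L * p $ 3)" using assms by (simp add: n_dom_def L_def)
  have "KF 0 p = Kf (p $ 1) (p $ 2) (p $ 3)"
    unfolding KF_def Kf_def L_def[symmetric] using W_scale[OF p] q by (simp add: F_dom_iff)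
  then show "Fc (p $ 1) (p $ 2) (p $ 3) = exp (Kf (p $ 1) (p $ 2) (p $ 3))"
    using Fc_Gc_n_dom(1)[of p 0] assms by simp
  have "KG 0 p = - W 2 1 1 (v3 (L * p $ 1 + L * p $ 2) (L * p $ 2) (L * p $ 3))"
    by (simp add: KG_def Kg_def L_def)
  also have "\<dots> = - W 2 1 1 (v3 (p $ 1 + p $ 2) (p $ 2) (p $ 3))"
    unfolding distrib_left[symmetric]
    using p F_dom_imp_G[OF q] F_dom_imp_G[of "p $ 1" "p $ 2" "p $ 3"]
    by (intro arg_cong[of _ _ uminus] W_scale) (auto simp: F_dom_iff distrib_left)
  finally show "Gc (p $ 1) (p $ 2) (p $ 3) = exp (Kg (p $ 1) (p $ 2) (p $ 3))"
    using Fc_Gc_n_dom(2)[of p 0] assms by (simp add: Kg_def)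
qed

text \<open>\<open>Fc\<close> rescales its arguments and then shifts. Where no shift occurs,
  invariance of the integral under scaling gives the claim; on the rest of the convex set
  \<open>ker_dom 1 1\<close> it follows by uniqueness.\<close>

lemma Fc_eq_exp_Kf:
  assumes "v3 z a b \<in> ker_dom 1 1"
  shows "Fc z a b = exp (Kf z a b)"
proof -
  have "mv_holomorphic_on (\<lambda>p. exp (Kf (p $ 1) (p $ 2) (p $ 3))) (ker_dom 1 1)"
    unfolding Kf_def v3_eta by (intro mv_intros W_holomorphic)
  then have "mv_nicely_meromorphic_on (\<lambda>p. exp (Kf (p $ 1) (p $ 2) (p $ 3))) (ker_dom 1 1)"
    by (intro mv_holomorphic_imp_nicely open_ker_dom)
  from mv_nicely_meromorphic_unique[OF mv_nicely_meromorphic_on_subset[OF Fc_nicely_meromorphic ker_dom_subset_FG] this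
      open_ker_dom convex_connected[OF convex_ker_dom] no_shift_region _ Fc_Gc_no_shift(1) assms]
  show ?thesis by simp
qed

lemma Gc_eq_exp_Kg:
  assumes "v3 z a b \<in> G_range"
  shows "Gc z a b = exp (Kg z a b)"
proof -
  have sub: "G_range \<subseteq> FG_domain"
    using right_half_plane_ratio by (auto simp: G_range_def ker_dom_def FG_domain_def)
  have "mv_holomorphic_on (\<lambda>p. exp (Kg (p $ 1) (p $ 2) (p $ 3))) G_range"
    unfolding Kg_def
    by (intro mv_intros mv_holomorphic_v3_compose[OF W_holomorphic[of 2 1]]) (auto simp: G_range_def)
  then have n1: "mv_nicely_meromorphic_on (\<lambda>p. exp (Kg (p $ 1) (p $ 2) (p $ 3))) G_range"
    by (intro mv_holomorphic_imp_nicely open_G_range)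
  have n2: "mv_nicely_meromorphic_on (\<lambda>p. Gc (p $ 1) (p $ 2) (p $ 3)) G_range"
    by (intro mv_holomorphic_imp_nicely open_G_range mv_holomorphic_on_subset[OF Gc_holomorphic sub])
  have V: "n_dom 0 \<inter> ker_dom 1 1 \<subseteq> G_range"
    by (auto simp: G_range_def ker_dom_def)
  from mv_nicely_meromorphic_unique[OF n2 n1 open_G_range convex_connected[OF convex_G_range] no_shift_region V Fc_Gc_no_shift(2) assms]
  show ?thesis by simp
qed

lemma F_integral_eq:
  assumes "v3 z a b \<in> ker_dom 1 1"
  shows "F_integral z a b = exp (Kf z a b)"
proof -
  have "(\<lambda>s. exp (z * s) / ((exp (a * s) - 1) * (exp (b * s) - 1)) / s) = ker 1 1 1 (v3 z a b)"
    by (simp add: ker_def fun_eq_iff)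
  then show ?thesis by (simp add: F_integral_def Kf_def W_def)
qed

lemma G_integral_eq:
  assumes "v3 z a b \<in> ker_dom 1 1"
  shows "G_integral z a b = exp (Kg z a b)"
proof -
  have d: "v3 (z + a) a b \<in> ker_dom 2 1" using assms by (auto simp: ker_dom_def)
  obtain y where y: "v3 (z + a) a b \<in> height_dom y" using height_dom_exists[OF d] .
  have "(\<lambda>s. - exp ((z + a) * s) / ((exp (a * s) - 1)\<^sup>2 * (exp (b * s) - 1)) / s) = (\<lambda>s. - 1 * ker 2 1 1 (v3 (z + a) a b) s)"
    by (simp add: ker_def fun_eq_iff)
  then show ?thesis
    using integral_C_ker[OF d y, of "-1" 1] W_line[OF d y, of 1] by (simp add: G_integral_def Kg_def)
qed

lemma integral_range_eq: "integral_range = ker_dom 1 1"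
  by (auto simp: integral_range_def ker_dom_def)

text \<open>The explicit function shows that the choice in \<open>mv_continuation\<close> has a
  candidate, so that the chosen function has the required properties; uniqueness on the connected
  domain then makes the two equal.\<close>

lemma mv_continuation_eq:
  assumes g: "mv_nicely_meromorphic_on g FG_domain" and eq: "\<And>p. p \<in> integral_range \<Longrightarrow> g p = f p" and p: "p \<in> FG_domain"
  shows "mv_continuation FG_domain integral_range f p = g p"
proof -
  define c where "c = mv_continuation FG_domain integral_range f"
  have "mv_nicely_meromorphic_on g FG_domain \<and> (\<forall>p\<in>integral_range. g p = f p)" using g eq by blast
  then have c: "mv_nicely_meromorphic_on c FG_domain \<and> (\<forall>p\<in>integral_range. c p = f p)"
    unfolding c_def mv_continuation_def
    by (rule someI[of "\<lambda>g. mv_nicely_meromorphic_on g FG_domain \<and> (\<forall>p\<in>integral_range. g p = f p)"])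
  have "open integral_range" "integral_range \<noteq> {}" "integral_range \<subseteq> FG_domain"
    unfolding integral_range_eq using open_ker_dom no_shift_region(2) ker_dom_subset_FG by auto
  then have "c p = g p"
    using c eq by (intro mv_nicely_meromorphic_unique[OF _ g open_FG_domain connected_FG_domain _ _ _ _ p, of c integral_range]) auto
  then show ?thesis by (simp add: c_def)
qed

lemma F_integral_v3:
  assumes "p \<in> ker_dom 1 1"
  shows "Fc (p $ 1) (p $ 2) (p $ 3) = F_integral (p $ 1) (p $ 2) (p $ 3)"
proof -
  have "v3 (p $ 1) (p $ 2) (p $ 3) \<in> ker_dom 1 1" using assms unfolding v3_eta .
  then show ?thesis by (simp only: F_integral_eq Fc_eq_exp_Kf)
qed

theorem F_fun_eq_Fc: "a / b \<notin> \<real>\<^sub>\<le>\<^sub>0 \<Longrightarrow> F_fun z a b = Fc z a b"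
  unfolding F_fun_def
  by (subst mv_continuation_eq[OF Fc_nicely_meromorphic])
     (auto simp: FG_domain_iff integral_range_eq F_integral_v3)

theorem G_fun_eq_Gc: "a / b \<notin> \<real>\<^sub>\<le>\<^sub>0 \<Longrightarrow> G_fun z a b = Gc z a b"
proof -
  have "Gc (p $ 1) (p $ 2) (p $ 3) = G_integral (p $ 1) (p $ 2) (p $ 3)" if "p \<in> integral_range" for p
  proof -
    have "v3 (p $ 1) (p $ 2) (p $ 3) \<in> ker_dom 1 1" using that unfolding v3_eta integral_range_eq .
    moreover from this have "v3 (p $ 1) (p $ 2) (p $ 3) \<in> G_range" by (auto simp: G_range_iff ker_dom_def)
    ultimately show ?thesis by (simp add: G_integral_eq Gc_eq_exp_Kg)
  qed
  then show "a / b \<notin> \<real>\<^sub>\<le>\<^sub>0 \<Longrightarrow> G_fun z a b = Gc z a b"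
    unfolding G_fun_def
    by (subst mv_continuation_eq[OF mv_holomorphic_imp_nicely[OF Gc_holomorphic open_FG_domain]])
       (auto simp: FG_domain_iff)
qed

subsection \<open>Difference relations and growth at infinity\<close>

lemma Fc_shift_a:
  assumes "a / b \<notin> \<real>\<^sub>\<le>\<^sub>0" "qexp (z / b) \<noteq> 1"
  shows "Fc (z + a) a b = Fc z a b / (1 - qexp (z / b))"
  unfolding Fc_def distrib_left
  using Fbase_shift_a[of "lam a b * a" "lam a b * b" "lam a b * z"] lam_props[OF assms(1)] assms(2) by simp

lemma Gc_shift_a:
  assumes "a / b \<notin> \<real>\<^sub>\<le>\<^sub>0" "Fc (z + a) a b \<noteq> 0"
  shows "Gc z a b = Gc (z + a) a b * Fc (z + a) a b"
  using Gbase_shift_a[of "lam a b * a" "lam a b * b" "lam a b * z"] lam_props[OF assms(1)] assms(2)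
  by (simp add: Fc_def Gc_def distrib_left)

lemma Fc_Gc_nonzero:
  assumes "p \<in> n_dom n" "\<And>j. j \<in> {0..<n} \<union> {n..<0} \<Longrightarrow> xfac (p $ 1) (p $ 2) (p $ 3) j \<noteq> 0"
  shows "Fc (p $ 1) (p $ 2) (p $ 3) \<noteq> 0" "Gc (p $ 1) (p $ 2) (p $ 3) \<noteq> 0"
  unfolding Fc_Gc_n_dom[OF assms(1)] using assms(2) by auto

lemma isCont_Fc:
  assumes p: "p \<in> FG_domain" and nz: "\<And>j. xfac (p $ 1) (p $ 2) (p $ 3) j \<noteq> 0"
  shows "isCont (\<lambda>p. Fc (p $ 1) (p $ 2) (p $ 3)) p"
proof -
  obtain n where n: "p \<in> n_dom n" using n_dom_exists[OF p] .
  have nz3: "q $ 3 \<noteq> 0" if "q \<in> n_dom n" for q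
    using that lam_props(2) by (auto simp: n_dom_def FG_domain_def)
  have hx: "mv_holomorphic_on (\<lambda>p. \<Prod>j\<in>J. xfac (p $ 1) (p $ 2) (p $ 3) j) (n_dom n)" for J
    using nz3 by (intro mv_intros mv_holomorphic_xfac) auto
  have c: "isCont (\<lambda>p. exp (KF n p) * (\<Prod>j\<in>{0..<n}. xfac (p $ 1) (p $ 2) (p $ 3) j) / (\<Prod>j\<in>{n..<0}. xfac (p $ 1) (p $ 2) (p $ 3) j)) p"
    using nz by (intro isCont_divide isCont_mult isCont_exp' mv_holomorphic_on_continuous[OF hx n]
      mv_holomorphic_on_continuous[OF mv_holomorphic_KF n]) auto
  have "\<forall>\<^sub>F q in nhds p. q \<in> n_dom n" using n open_n_dom by (rule eventually_nhds_in_open[rotated])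
  then have ev: "\<forall>\<^sub>F q in nhds p. exp (KF n q) * (\<Prod>j\<in>{0..<n}. xfac (q $ 1) (q $ 2) (q $ 3) j) / (\<Prod>j\<in>{n..<0}. xfac (q $ 1) (q $ 2) (q $ 3) j) = Fc (q $ 1) (q $ 2) (q $ 3)"
    by eventually_elim (simp only: Fc_Gc_n_dom(1))
  show ?thesis using isCont_cong[OF ev] c by blast
qed

text \<open>The factor \<open>xfac\<close> with \<open>j = 0\<close> vanishes at
  \<open>z = 0\<close>, so that products of such factors are of no help. But \<open>0\<close> lies
  in the strip of convergence after rescaling, where \<open>Gc\<close> is an exponential.\<close>

lemma Gc_at_0_nonzero:
  assumes "a / b \<notin> \<real>\<^sub>\<le>\<^sub>0"
  shows "Gc 0 a b \<noteq> 0"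
proof -
  define L where "L = lam a b"
  have L: "L \<noteq> 0" "v3 0 (L * a) (L * b) \<in> G_range"
    using lam_props[OF assms] by (auto simp: L_def G_range_iff)
  have "Gc 0 a b = Gc (L * 0) (L * a) (L * b)" by (rule Gc_scale[OF L(1), symmetric])
  then show ?thesis using Gc_eq_exp_Kg[OF L(2)] by simp
qed

lemma admissible_iff: "\<epsilon> \<in> admissible w \<phi> \<longleftrightarrow> (w - \<epsilon> * \<phi>) / (- (2 * pi * \<i> * \<epsilon>)) \<notin> \<real>\<^sub>\<le>\<^sub>0"
  by (simp add: admissible_def)

lemma admissible_nonzero: "\<epsilon> \<in> admissible w \<phi> \<Longrightarrow> \<epsilon> \<noteq> 0"
  by (auto simp: admissible_def)

lemma F_star_eq:
  "\<epsilon> \<in> admissible w \<phi> \<Longrightarrow> F_star v w \<theta> \<phi> \<epsilon> = Fc (v - \<epsilon> * \<theta>) (w - \<epsilon> * \<phi>) (- (2 * pi * \<i> * \<epsilon>)) * exp (Q_F v w \<theta> \<phi> \<epsilon>)"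
  unfolding F_star_def by (subst F_fun_eq_Fc) (auto simp: admissible_def)

lemma G_star_eq:
  "\<epsilon> \<in> admissible w \<phi> \<Longrightarrow> G_star v w \<theta> \<phi> \<epsilon> = Gc (v - \<epsilon> * \<theta>) (w - \<epsilon> * \<phi>) (- (2 * pi * \<i> * \<epsilon>)) * exp (Q_G v w \<theta> \<phi> \<epsilon>)"
  unfolding G_star_def by (subst G_fun_eq_Gc) (auto simp: admissible_def)

lemma exp_Li_arg: "exp (2 * pi * \<i> * v / w) = qexp (v / w)"
  by (simp add: qexp_def)

lemma M_plus_shift_nonzero:
  assumes "(v, w) \<in> M_plus"
  shows "v + of_int j * w \<noteq> 0"
proof
  assume "v + of_int j * w = 0"
  moreover have "w \<noteq> 0" using assms by (auto simp: M_plus_def)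
  ultimately have "v / w = of_int (- j)" by (simp add: field_simps add_eq_0_iff)
  then have "Im (v / w) = 0" by simp
  with assms show False by (auto simp: M_plus_def)
qed

lemma xfac_epsilon:
  assumes "\<epsilon> \<noteq> 0"
  shows "xfac (v - \<epsilon> * \<theta>) (w - \<epsilon> * \<phi>) (- (2 * pi * \<i> * \<epsilon>)) j = 1 - exp (\<theta> + of_int j * \<phi> - (v + of_int j * w) / \<epsilon>)"
proof -
  have "2 * of_real pi * \<i> * ((v - \<epsilon> * \<theta> + of_int j * (w - \<epsilon> * \<phi>)) / (- (2 * of_real pi * \<i> * \<epsilon>))) =
      - (v - \<epsilon> * \<theta> + of_int j * (w - \<epsilon> * \<phi>)) / \<epsilon>"
    using assms by (simp add: field_simps)
  also have "\<dots> = \<theta> + of_int j * \<phi> - (v + of_int j * w) / \<epsilon>"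
    using assms by (simp add: field_simps)
  finally show ?thesis by (simp add: xfac_def qexp_def)
qed

text \<open>At a solution of \<open>exp (C - c / \<epsilon>) = 1\<close> the derivative is
  \<open>c / \<epsilon>\<^sup>2\<close>, which is nonzero, so that solutions are isolated.\<close>

lemma eventually_exp_neq_1:
  assumes "\<epsilon>0 \<noteq> 0" "c \<noteq> 0"
  shows "\<forall>\<^sub>F \<epsilon> in at \<epsilon>0. exp (C - c / \<epsilon>) \<noteq> (1 :: complex)"
proof (cases "exp (C - c / \<epsilon>0) = 1")
  case False
  have "((\<lambda>\<epsilon>. exp (C - c / \<epsilon>)) \<longlongrightarrow> exp (C - c / \<epsilon>0)) (at \<epsilon>0)"
    using assms by (intro tendsto_intros) auto
  then show ?thesis using False by (rule tendsto_imp_eventually_ne)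
next
  case True
  define d where "d = exp (C - c / \<epsilon>0) * (c / (\<epsilon>0 * \<epsilon>0))"
  have "((\<lambda>\<epsilon>. exp (C - c / \<epsilon>)) has_field_derivative d) (at \<epsilon>0)"
    using assms by (auto intro!: derivative_eq_intros simp: d_def)
  then have "((\<lambda>\<epsilon>. (exp (C - c / \<epsilon>) - exp (C - c / \<epsilon>0)) / (\<epsilon> - \<epsilon>0)) \<longlongrightarrow> d) (at \<epsilon>0)"
    by (simp add: has_field_derivative_iff)
  moreover have "d \<noteq> 0" using assms by (simp add: d_def)
  ultimately have "\<forall>\<^sub>F \<epsilon> in at \<epsilon>0. (exp (C - c / \<epsilon>) - exp (C - c / \<epsilon>0)) / (\<epsilon> - \<epsilon>0) \<noteq> 0"
    by (rule tendsto_imp_eventually_ne)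
  then show ?thesis by eventually_elim (use True in auto)
qed

lemma eventually_cosparseI:
  fixes P :: "complex \<Rightarrow> bool"
  assumes "\<And>x. x \<in> A \<Longrightarrow> eventually P (at x)"
  shows "eventually P (cosparse A)"
  unfolding eventually_cosparse sparse_in_def
proof
  fix x assume "x \<in> A"
  from assms[OF this] obtain B where B: "open B" "x \<in> B" "\<forall>y\<in>B. y \<noteq> x \<longrightarrow> P y"
    unfolding eventually_at_topological by auto
  have "\<not> y islimpt {x. \<not> P x}" if "y \<in> B" for y
  proof
    assume "y islimpt {x. \<not> P x}"
    then have "infinite (B \<inter> {x. \<not> P x})"
      using B(1) that by (auto simp: islimpt_eq_acc_point Int_commute)
    moreover have "B \<inter> {x. \<not> P x} \<subseteq> {x}" using B by auto
    ultimately show False by (meson finite.emptyI finite_insert finite_subset)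
  qed
  with B show "\<exists>B. x \<in> B \<and> open B \<and> (\<forall>y\<in>B. \<not> y islimpt {x. \<not> P x})" by blast
qed

definition args :: "complex \<Rightarrow> complex \<Rightarrow> complex \<Rightarrow> complex \<Rightarrow> complex \<Rightarrow> complex ^ 3" where
  "args v w \<theta> \<phi> \<epsilon> = v3 (v - \<epsilon> * \<theta>) (w - \<epsilon> * \<phi>) (- (2 * pi * \<i> * \<epsilon>))"

lemma args_in_FG: "args v w \<theta> \<phi> \<epsilon> \<in> FG_domain \<longleftrightarrow> \<epsilon> \<in> admissible w \<phi>"
  by (simp add: args_def FG_domain_iff admissible_def)

lemma tendsto_v3:
  assumes "(x \<longlongrightarrow> x0) F" "(y \<longlongrightarrow> y0) F" "(z \<longlongrightarrow> z0) F"
  shows "((\<lambda>t. v3 (x t) (y t) (z t)) \<longlongrightarrow> v3 x0 y0 z0) F"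
proof (rule vec_tendstoI)
  fix i :: 3
  have "\<forall>i. ((\<lambda>t. v3 (x t) (y t) (z t) $ i) \<longlongrightarrow> v3 x0 y0 z0 $ i) F"
    unfolding forall_3 using assms by simp
  then show "((\<lambda>t. v3 (x t) (y t) (z t) $ i) \<longlongrightarrow> v3 x0 y0 z0 $ i) F" by blast
qed

lemma isCont_args: "isCont (args v w \<theta> \<phi>) \<epsilon>"
  unfolding isCont_def args_def by (intro tendsto_v3 tendsto_intros)

lemma eventually_args:
  assumes "open S" "args v w \<theta> \<phi> \<epsilon>0 \<in> S"
  shows "\<forall>\<^sub>F \<epsilon> in at \<epsilon>0. args v w \<theta> \<phi> \<epsilon> \<in> S"
  using isCont_args assms unfolding isCont_def by (intro topological_tendstoD)

lemma eventually_admissible: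
  assumes "\<epsilon>0 \<in> admissible w \<phi>"
  shows "\<forall>\<^sub>F \<epsilon> in at \<epsilon>0. \<epsilon> \<in> admissible w \<phi>"
  using eventually_args[OF open_FG_domain, of 0 w 0 \<phi> \<epsilon>0] assms by (simp add: args_in_FG)

text \<open>Near \<epsilon>\<open>0\<close> one shift number \<open>n\<close> serves, so that only
  finitely many factors can vanish.\<close>

lemma eventually_Fc_nonzero:
  assumes \<epsilon>0: "\<epsilon>0 \<in> admissible w \<phi>" and v: "\<And>j. v + of_int j * w \<noteq> 0"
  shows "\<forall>\<^sub>F \<epsilon> in at \<epsilon>0. Fc (v - \<epsilon> * \<theta>) (w - \<epsilon> * \<phi>) (- (2 * pi * \<i> * \<epsilon>)) \<noteq> 0"
proof -
  obtain n where n: "args v w \<theta> \<phi> \<epsilon>0 \<in> n_dom n"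
    using n_dom_exists \<epsilon>0 args_in_FG by metis
  have nz: "\<epsilon>0 \<noteq> 0" using admissible_nonzero[OF \<epsilon>0] .
  have "\<forall>\<^sub>F \<epsilon> in at \<epsilon>0. \<forall>j\<in>{0..<n} \<union> {n..<0}. exp (\<theta> + of_int j * \<phi> - (v + of_int j * w) / \<epsilon>) \<noteq> 1"
    by (intro eventually_ball_finite ballI eventually_exp_neq_1 nz v) auto
  moreover have "\<forall>\<^sub>F \<epsilon> in at \<epsilon>0. \<epsilon> \<noteq> 0" using nz by (intro tendsto_imp_eventually_ne[OF tendsto_ident_at])
  ultimately show ?thesis using eventually_args[OF open_n_dom n]
  proof eventually_elim
    case (elim \<epsilon>)
    have "xfac (v - \<epsilon> * \<theta>) (w - \<epsilon> * \<phi>) (- (2 * pi * \<i> * \<epsilon>)) j \<noteq> 0" if "j \<in> {0..<n} \<union> {n..<0}" for j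
      unfolding xfac_epsilon[OF elim(2)] using elim(1) that by (metis right_minus_eq)
    then show ?case
      using Fc_Gc_nonzero(1)[OF elim(3)] unfolding args_def vector_3 by blast
  qed
qed

text \<open>\<open>v / w\<close> grows by \<open>1\<close>, which \<open>qexp\<close> does not see,
  and \<open>v * \<phi> - w * \<theta>\<close> is unchanged. Only the explicit coefficients
  \<open>v - \<epsilon> * \<theta>\<close> and \<open>v / w\<close> in \<open>Q_G\<close> change,
  and their increments assemble to \<open>Q_F\<close>.\<close>

lemma Q_shift:
  assumes "w \<noteq> 0"
  shows "Q_F (v + w) w (\<theta> + \<phi>) \<phi> \<epsilon> = Q_F v w \<theta> \<phi> \<epsilon>"
    and "\<epsilon> \<noteq> 0 \<Longrightarrow> Q_G (v + w) w (\<theta> + \<phi>) \<phi> \<epsilon> = Q_G v w \<theta> \<phi> \<epsilon> - Q_F v w \<theta> \<phi> \<epsilon>"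
proof -
  have q: "qexp ((v + w) / w) = qexp (v / w)"
    using assms by (simp add: add_divide_distrib qexp_add)
  have A: "(v + w) * \<phi> - w * (\<theta> + \<phi>) = v * \<phi> - w * \<theta>" by (simp add: algebra_simps)
  show "Q_F (v + w) w (\<theta> + \<phi>) \<phi> \<epsilon> = Q_F v w \<theta> \<phi> \<epsilon>"
    unfolding Q_F_def exp_Li_arg q A ..
  assume "\<epsilon> \<noteq> 0"
  have B: "v + w - \<epsilon> * (\<theta> + \<phi>) = (v - \<epsilon> * \<theta>) + (w - \<epsilon> * \<phi>)" by (simp add: algebra_simps)
  have C: "(v + w) / w = v / w + 1" using assms by (simp add: add_divide_distrib)
  show "Q_G (v + w) w (\<theta> + \<phi>) \<phi> \<epsilon> = Q_G v w \<theta> \<phi> \<epsilon> - Q_F v w \<theta> \<phi> \<epsilon>"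
    unfolding Q_F_def Q_G_def exp_Li_arg q A B
    unfolding C by (simp add: add_divide_distrib distrib_left distrib_right)
qed

text \<open>The exceptional \<epsilon> are among those with \<open>x = 1\<close> and those where the
  shifted \<open>Fc\<close> has the value \<open>0\<close>, as it also has at its poles. Neither
  kind accumulates in \<open>A\<close>.\<close>

theorem difference_relations:
  assumes vw: "(v, w) \<in> M_plus" and A: "A \<subseteq> admissible w \<phi>"
  shows "\<forall>\<^sub>\<approx>\<epsilon>\<in>A.
     sol_B (v + w) w (\<theta> + \<phi>) \<phi> \<epsilon> = sol_B v w \<theta> \<phi> \<epsilon> * inverse (1 - exp (\<theta> - v / \<epsilon>)) \<and>
     sol_D (v + w) w (\<theta> + \<phi>) \<phi> \<epsilon> = sol_D v w \<theta> \<phi> \<epsilon> * inverse (sol_B (v + w) w (\<theta> + \<phi>) \<phi> \<epsilon>)"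
proof (rule eventually_cosparseI)
  fix \<epsilon>0 assume "\<epsilon>0 \<in> A"
  then have \<epsilon>0: "\<epsilon>0 \<in> admissible w \<phi>" using A by auto
  have w: "w \<noteq> 0" using vw by (auto simp: M_plus_def)
  have v: "v + of_int j * w \<noteq> 0" "v + w + of_int j * w \<noteq> 0" for j
    using M_plus_shift_nonzero[OF vw, of j] M_plus_shift_nonzero[OF vw, of "j + 1"] by (auto simp: algebra_simps)
  have "\<forall>\<^sub>F \<epsilon> in at \<epsilon>0. exp (\<theta> - v / \<epsilon>) \<noteq> 1"
    using admissible_nonzero[OF \<epsilon>0] v(1)[of 0] by (intro eventually_exp_neq_1) auto
  then show "\<forall>\<^sub>F \<epsilon> in at \<epsilon>0. sol_B (v + w) w (\<theta> + \<phi>) \<phi> \<epsilon> = sol_B v w \<theta> \<phi> \<epsilon> * inverse (1 - exp (\<theta> - v / \<epsilon>)) \<and>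
     sol_D (v + w) w (\<theta> + \<phi>) \<phi> \<epsilon> = sol_D v w \<theta> \<phi> \<epsilon> * inverse (sol_B (v + w) w (\<theta> + \<phi>) \<phi> \<epsilon>)"
    using eventually_admissible[OF \<epsilon>0] eventually_Fc_nonzero[OF \<epsilon>0 v(2), of "\<theta> + \<phi>"]
  proof eventually_elim
    case (elim \<epsilon>)
    have \<epsilon>: "\<epsilon> \<noteq> 0" using admissible_nonzero[OF elim(2)] .
    define z a b where "z = v - \<epsilon> * \<theta>" and "a = w - \<epsilon> * \<phi>" and "b = - (2 * pi * \<i> * \<epsilon>)"
    have za: "v + w - \<epsilon> * (\<theta> + \<phi>) = z + a" by (simp add: z_def a_def algebra_simps)
    have ab: "a / b \<notin> \<real>\<^sub>\<le>\<^sub>0" using elim(2) by (simp add: admissible_def a_def b_def)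
    have x: "qexp (z / b) = exp (\<theta> - v / \<epsilon>)"
      using xfac_epsilon[OF \<epsilon>, of v \<theta> w \<phi> 0, folded z_def a_def b_def] by (simp add: xfac_def)
    have nz: "Fc (z + a) a b \<noteq> 0" using elim(3) unfolding za a_def[symmetric] b_def[symmetric] .
    have F: "Fc (z + a) a b = Fc z a b * inverse (1 - exp (\<theta> - v / \<epsilon>))"
      using Fc_shift_a[OF ab, of z] elim(1) x by (simp add: divide_inverse)
    have G: "Gc (z + a) a b = Gc z a b * inverse (Fc (z + a) a b)"
      using Gc_shift_a[OF ab nz] nz by (simp add: field_simps)
    have B1: "sol_B v w \<theta> \<phi> \<epsilon> = Fc z a b * exp (Q_F v w \<theta> \<phi> \<epsilon>)"
      unfolding sol_B_def F_star_eq[OF elim(2)] z_def a_def b_def ..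
    have B2: "sol_B (v + w) w (\<theta> + \<phi>) \<phi> \<epsilon> = Fc (z + a) a b * exp (Q_F v w \<theta> \<phi> \<epsilon>)"
      unfolding sol_B_def F_star_eq[OF elim(2)] za Q_shift(1)[OF w] a_def b_def ..
    have D1: "sol_D v w \<theta> \<phi> \<epsilon> = Gc z a b * exp (Q_G v w \<theta> \<phi> \<epsilon>) * inverse (G_star 0 w 0 \<phi> \<epsilon>)"
      unfolding sol_D_def G_star_eq[OF elim(2), of v] z_def a_def b_def ..
    have D2: "sol_D (v + w) w (\<theta> + \<phi>) \<phi> \<epsilon> = Gc (z + a) a b * exp (Q_G v w \<theta> \<phi> \<epsilon> - Q_F v w \<theta> \<phi> \<epsilon>) * inverse (G_star 0 w 0 \<phi> \<epsilon>)"
      unfolding sol_D_def G_star_eq[OF elim(2), of "v + w"] za Q_shift(2)[OF w \<epsilon>] a_def b_def ..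
    show ?case
      unfolding B1 B2 D1 D2 G by (simp add: F exp_diff divide_inverse mult_ac)
  qed
qed

text \<open>A finite nonzero limit would allow any positive exponent; \<open>1\<close> is
  taken.\<close>

lemma norm_between_powers:
  fixes f :: "complex \<Rightarrow> complex"
  assumes f: "(f \<longlongrightarrow> c) at_infinity" and c: "c \<noteq> 0"
  shows "\<forall>\<^sub>F \<epsilon> in at_infinity. norm \<epsilon> powr (- 1) < norm (f \<epsilon>) \<and> norm (f \<epsilon>) < norm \<epsilon> powr 1"
proof -
  have lim: "((\<lambda>\<epsilon>. norm (f \<epsilon>)) \<longlongrightarrow> norm c) at_infinity" by (intro tendsto_norm f)
  have "\<forall>\<^sub>F \<epsilon> in at_infinity. norm (f \<epsilon>) > norm c / 2" "\<forall>\<^sub>F \<epsilon> in at_infinity. norm (f \<epsilon>) < 2 * norm c"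
    using c by (intro order_tendstoD[OF lim]; simp)+
  moreover have "\<forall>\<^sub>F \<epsilon> :: complex in at_infinity. norm \<epsilon> \<ge> max (2 / norm c) (2 * norm c)"
    unfolding eventually_at_infinity by (intro exI[of _ "max (2 / norm c) (2 * norm c)"]) simp
  moreover have "\<forall>\<^sub>F \<epsilon> :: complex in at_infinity. norm \<epsilon> > 0"
    unfolding eventually_at_infinity by (intro exI[of _ 1]) auto
  ultimately show ?thesis
  proof eventually_elim
    case (elim \<epsilon>)
    have "norm \<epsilon> \<ge> 2 / norm c" using elim(3) by simp
    then have "1 / norm \<epsilon> \<le> norm c / 2" using c elim(4) by (simp add: field_simps)
    then show ?case using elim c by (simp add: powr_minus_divide)
  qed
qed

lemma generic_xfac:
  assumes "generic \<theta> \<phi>"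
  shows "xfac (- \<theta>) (- \<phi>) (- (2 * pi * \<i>)) j \<noteq> 0"
proof
  assume "xfac (- \<theta>) (- \<phi>) (- (2 * pi * \<i>)) j = 0"
  then have "qexp ((- \<theta> + of_int j * - \<phi>) / (- (2 * pi * \<i>))) = 1" by (simp add: xfac_def)
  then have "(- \<theta> + of_int j * - \<phi>) / (- (2 * pi * \<i>)) \<in> \<int>"
    unfolding qexp_eq_1_iff .
  then obtain m :: int where "(- \<theta> + of_int j * - \<phi>) / (- (2 * pi * \<i>)) = of_int m"
    by (rule Ints_cases)
  then have "\<theta> = of_int (- j) * \<phi> + of_int m * (2 * pi * \<i>)" by (simp add: field_simps)
  with assms show False unfolding generic_def by blast
qed

lemma Fc_Gc_nonzero':
  assumes "v3 z a b \<in> FG_domain" "\<And>j. xfac z a b j \<noteq> 0"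
  shows "Fc z a b \<noteq> 0" "Gc z a b \<noteq> 0"
proof -
  obtain n where n: "v3 z a b \<in> n_dom n" using n_dom_exists[OF assms(1)] .
  show "Fc z a b \<noteq> 0" "Gc z a b \<noteq> 0" using Fc_Gc_nonzero[OF n] assms(2) by auto
qed

text \<open>The limit of \<open>a / b\<close> is \<open>\<phi> / (2 * pi * \<i>)\<close>, which
  genericity keeps off the nonpositive reals. Convergence thus holds in a full neighbourhood of
  infinity and not merely in sectors.\<close>

theorem limits_at_infinity:
  assumes vw: "(v, w) \<in> M_plus" and gen: "generic \<theta> \<phi>"
  shows "\<exists>c. c \<noteq> 0 \<and> (sol_B v w \<theta> \<phi> \<longlongrightarrow> c) at_infinity" "\<exists>c. c \<noteq> 0 \<and> (sol_D v w \<theta> \<phi> \<longlongrightarrow> c) at_infinity"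
proof -
  have FG: "v3 z (- \<phi>) (- (2 * pi * \<i>)) \<in> FG_domain" for z
    using gen by (simp add: FG_domain_iff generic_def)
  have inv: "((\<lambda>\<epsilon>. c / \<epsilon>) \<longlongrightarrow> 0) at_infinity" for c :: complex
    using tendsto_mult_right_zero[OF tendsto_inverse_0, of c] by (simp add: divide_inverse)
  have nz: "\<forall>\<^sub>F \<epsilon> :: complex in at_infinity. \<epsilon> \<noteq> 0"
    unfolding eventually_at_infinity by (intro exI[of _ 1]) auto
  have lim_args: "((\<lambda>\<epsilon>. v3 (v / \<epsilon> - \<theta>) (w / \<epsilon> - \<phi>) (- (2 * pi * \<i>))) \<longlongrightarrow> v3 (0 - \<theta>) (0 - \<phi>) (- (2 * pi * \<i>))) at_infinity" for v \<theta>
    by (intro tendsto_v3 tendsto_intros inv)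
  have "\<forall>\<^sub>F \<epsilon> in at_infinity. v3 (0 / \<epsilon> - 0) (w / \<epsilon> - \<phi>) (- (2 * pi * \<i>)) \<in> FG_domain"
    using FG by (intro topological_tendstoD[OF lim_args open_FG_domain]) simp
  with nz have adm: "\<forall>\<^sub>F \<epsilon> in at_infinity. \<epsilon> \<noteq> 0 \<and> \<epsilon> \<in> admissible w \<phi>"
  proof eventually_elim
    case (elim \<epsilon>)
    have "(w - \<epsilon> * \<phi>) / (- (2 * pi * \<i> * \<epsilon>)) = (w / \<epsilon> - \<phi>) / (- (2 * pi * \<i>))"
      using elim(1) by (simp add: field_simps)
    with elim show ?case by (simp add: FG_domain_iff admissible_def)
  qed
  have resc: "v - \<epsilon> * \<theta> = \<epsilon> * (v / \<epsilon> - \<theta>)" "- (2 * pi * \<i> * \<epsilon>) = \<epsilon> * (- (2 * pi * \<i>))" if "\<epsilon> \<noteq> 0" for v \<epsilon> \<theta> :: complex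
    using that by (simp_all add: field_simps)
  have contF: "isCont (\<lambda>p. Fc (p $ 1) (p $ 2) (p $ 3)) (v3 (- \<theta>) (- \<phi>) (- (2 * pi * \<i>)))"
    using FG generic_xfac[OF gen] by (intro isCont_Fc) auto
  have contG: "isCont (\<lambda>p. Gc (p $ 1) (p $ 2) (p $ 3)) (v3 z (- \<phi>) (- (2 * pi * \<i>)))" for z
    using mv_holomorphic_on_continuous[OF Gc_holomorphic FG] .
  have limF: "((\<lambda>\<epsilon>. Fc (v / \<epsilon> - \<theta>) (w / \<epsilon> - \<phi>) (- (2 * pi * \<i>))) \<longlongrightarrow> Fc (- \<theta>) (- \<phi>) (- (2 * pi * \<i>))) at_infinity"
    using isCont_tendsto_compose[OF contF lim_args[of v \<theta>, unfolded diff_0]] unfolding vector_3 .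
  have limG: "((\<lambda>\<epsilon>. Gc (v / \<epsilon> - \<theta>) (w / \<epsilon> - \<phi>) (- (2 * pi * \<i>))) \<longlongrightarrow> Gc (- \<theta>) (- \<phi>) (- (2 * pi * \<i>))) at_infinity" for v \<theta>
    using isCont_tendsto_compose[OF contG lim_args[of v \<theta>, unfolded diff_0]] unfolding vector_3 .
  have a1: "((\<lambda>\<epsilon>. 1 / \<epsilon> * ((w - \<epsilon> * \<phi>) / c)) \<longlongrightarrow> (0 - \<phi>) / c) at_infinity" for w \<phi> c :: complex
  proof (cases "c = 0")
    case False
    have "((\<lambda>\<epsilon>. (w / \<epsilon> - \<phi>) / c) \<longlongrightarrow> (0 - \<phi>) / c) at_infinity" using False by (intro tendsto_intros inv)
    moreover have "\<forall>\<^sub>F \<epsilon> in at_infinity. (w / \<epsilon> - \<phi>) / c = 1 / \<epsilon> * ((w - \<epsilon> * \<phi>) / c)"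
      using nz by eventually_elim (use False in \<open>simp add: field_simps\<close>)
    ultimately show ?thesis by (rule Lim_transform_eventually)
  qed simp
  have a2: "((\<lambda>\<epsilon>. 2 / \<epsilon> * ((w - \<epsilon> * \<phi>) / c)) \<longlongrightarrow> 2 * ((0 - \<phi>) / c)) at_infinity" for w \<phi> c :: complex
    using tendsto_mult[OF tendsto_const a1, of 2 w \<phi> c] by simp
  have limQF: "\<exists>q. ((\<lambda>\<epsilon>. Q_F v w \<theta> \<phi> \<epsilon>) \<longlongrightarrow> q) at_infinity"
    unfolding Q_F_def by (rule exI, rule tendsto_add[OF tendsto_mult[OF a1 tendsto_const] tendsto_const])
  have limQG: "\<exists>q. ((\<lambda>\<epsilon>. Q_G v w \<theta> \<phi> \<epsilon>) \<longlongrightarrow> q) at_infinity" for v \<theta>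
    unfolding Q_G_def
    by (rule exI, rule tendsto_diff[OF tendsto_add[OF tendsto_diff[OF tendsto_mult[OF a2 tendsto_const]
      tendsto_mult[OF a1 tendsto_const]] tendsto_const] tendsto_const])
  from limQF obtain qF where qF: "((\<lambda>\<epsilon>. Q_F v w \<theta> \<phi> \<epsilon>) \<longlongrightarrow> qF) at_infinity" by blast
  have "((\<lambda>\<epsilon>. Fc (v / \<epsilon> - \<theta>) (w / \<epsilon> - \<phi>) (- (2 * pi * \<i>)) * exp (Q_F v w \<theta> \<phi> \<epsilon>)) \<longlongrightarrow> Fc (- \<theta>) (- \<phi>) (- (2 * pi * \<i>)) * exp qF) at_infinity"
    by (intro tendsto_intros limF qF)
  moreover have "\<forall>\<^sub>F \<epsilon> in at_infinity. Fc (v / \<epsilon> - \<theta>) (w / \<epsilon> - \<phi>) (- (2 * pi * \<i>)) * exp (Q_F v w \<theta> \<phi> \<epsilon>) = sol_B v w \<theta> \<phi> \<epsilon>"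
    using adm
  proof eventually_elim
    case (elim \<epsilon>)
    then have "\<epsilon> \<noteq> 0" "\<epsilon> \<in> admissible w \<phi>" by auto
    then show ?case
      unfolding sol_B_def F_star_eq[OF \<open>\<epsilon> \<in> admissible w \<phi>\<close>] resc[OF \<open>\<epsilon> \<noteq> 0\<close>] Fc_scale[OF \<open>\<epsilon> \<noteq> 0\<close>] by simp
  qed
  ultimately have "(sol_B v w \<theta> \<phi> \<longlongrightarrow> Fc (- \<theta>) (- \<phi>) (- (2 * pi * \<i>)) * exp qF) at_infinity"
    by (rule Lim_transform_eventually)
  moreover have "Fc (- \<theta>) (- \<phi>) (- (2 * pi * \<i>)) * exp qF \<noteq> 0"
    using Fc_Gc_nonzero'(1)[OF FG generic_xfac[OF gen]] by simp
  ultimately show "\<exists>c. c \<noteq> 0 \<and> (sol_B v w \<theta> \<phi> \<longlongrightarrow> c) at_infinity" by blast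
  have limGs: "\<exists>q. (G_star v w \<theta> \<phi> \<longlongrightarrow> Gc (- \<theta>) (- \<phi>) (- (2 * pi * \<i>)) * exp q) at_infinity" for v \<theta>
  proof -
    from limQG obtain q where q: "((\<lambda>\<epsilon>. Q_G v w \<theta> \<phi> \<epsilon>) \<longlongrightarrow> q) at_infinity" by blast
    have "((\<lambda>\<epsilon>. Gc (v / \<epsilon> - \<theta>) (w / \<epsilon> - \<phi>) (- (2 * pi * \<i>)) * exp (Q_G v w \<theta> \<phi> \<epsilon>)) \<longlongrightarrow> Gc (- \<theta>) (- \<phi>) (- (2 * pi * \<i>)) * exp q) at_infinity"
      by (intro tendsto_intros limG q)
    moreover have "\<forall>\<^sub>F \<epsilon> in at_infinity. Gc (v / \<epsilon> - \<theta>) (w / \<epsilon> - \<phi>) (- (2 * pi * \<i>)) * exp (Q_G v w \<theta> \<phi> \<epsilon>) = G_star v w \<theta> \<phi> \<epsilon>"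
      using adm
    proof eventually_elim
      case (elim \<epsilon>)
      then have "\<epsilon> \<noteq> 0" "\<epsilon> \<in> admissible w \<phi>" by auto
      then show ?case
        unfolding G_star_eq[OF \<open>\<epsilon> \<in> admissible w \<phi>\<close>] resc[OF \<open>\<epsilon> \<noteq> 0\<close>] Gc_scale[OF \<open>\<epsilon> \<noteq> 0\<close>] by simp
    qed
    ultimately show ?thesis using Lim_transform_eventually by blast
  qed
  from limGs[of v \<theta>] obtain q1 where q1: "(G_star v w \<theta> \<phi> \<longlongrightarrow> Gc (- \<theta>) (- \<phi>) (- (2 * pi * \<i>)) * exp q1) at_infinity" by blast
  from limGs[of 0 0] obtain q2 where q2: "(G_star 0 w 0 \<phi> \<longlongrightarrow> Gc (- 0) (- \<phi>) (- (2 * pi * \<i>)) * exp q2) at_infinity" by blast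
  \<comment> \<open>For the numerator genericity excludes zeros. In the denominator the first
    argument is \<open>0\<close>, which is never generic, and nonvanishing comes from the integral
    instead.\<close>
  have n1: "Gc (- \<theta>) (- \<phi>) (- (2 * pi * \<i>)) \<noteq> 0" by (rule Fc_Gc_nonzero'(2)[OF FG generic_xfac[OF gen]])
  have n2: "Gc (- 0) (- \<phi>) (- (2 * pi * \<i>)) \<noteq> 0"
    unfolding minus_zero using FG[of 0] by (intro Gc_at_0_nonzero) (simp add: FG_domain_iff)
  have "((\<lambda>\<epsilon>. G_star v w \<theta> \<phi> \<epsilon> * inverse (G_star 0 w 0 \<phi> \<epsilon>)) \<longlongrightarrow>
      (Gc (- \<theta>) (- \<phi>) (- (2 * pi * \<i>)) * exp q1) * inverse (Gc (- 0) (- \<phi>) (- (2 * pi * \<i>)) * exp q2)) at_infinity"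
    using n2 by (intro tendsto_intros q1 q2) auto
  then have "(sol_D v w \<theta> \<phi> \<longlongrightarrow> (Gc (- \<theta>) (- \<phi>) (- (2 * pi * \<i>)) * exp q1) * inverse (Gc (- 0) (- \<phi>) (- (2 * pi * \<i>)) * exp q2)) at_infinity"
    by (simp add: sol_D_def[abs_def])
  with n1 n2 show "\<exists>c. c \<noteq> 0 \<and> (sol_D v w \<theta> \<phi> \<longlongrightarrow> c) at_infinity" by (metis exp_not_eq_zero inverse_nonzero_iff_nonzero mult_eq_0_iff)
qed

section \<open>Meromorphy in all five variables\<close>

lemma Li_holomorphic_pos: "k \<ge> 1 \<Longrightarrow> Li k holomorphic_on ball 0 1"
  using Li_holomorphic[of "k - 1"] by simp

lemma isolated_5: "(1 :: 5) \<noteq> 2" "(1 :: 5) \<noteq> 3" "(1 :: 5) \<noteq> 4" "(1 :: 5) \<noteq> 5"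
  by simp_all

definition zz :: "complex ^ 5 \<Rightarrow> complex" where "zz p = p $ 1 - p $ 5 * p $ 3"
definition aa :: "complex ^ 5 \<Rightarrow> complex" where "aa p = p $ 2 - p $ 5 * p $ 4"
definition bb :: "complex ^ 5 \<Rightarrow> complex" where "bb p = - (2 * pi * \<i> * p $ 5)"

text \<open>Contains \<open>BD_domain\<close> and is visibly open; all formulas for the solution
  make sense on it.\<close>

definition ratio_dom :: "(complex ^ 5) set" where
  "ratio_dom = {p. p $ 2 \<noteq> 0 \<and> Im (p $ 1 / p $ 2) > 0 \<and> aa p / bb p \<notin> \<real>\<^sub>\<le>\<^sub>0}"

lemma BD_domain_subset: "BD_domain \<subseteq> ratio_dom"
  by (auto simp: BD_domain_def ratio_dom_def M_plus_def admissible_def aa_def bb_def)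

lemma mv_holomorphic_args: "mv_holomorphic_on zz S" "mv_holomorphic_on aa S" "mv_holomorphic_on bb S"
  unfolding zz_def aa_def bb_def by (intro mv_intros)+

lemma ratio_dom_v3: "p \<in> ratio_dom \<Longrightarrow> v3 z (aa p) (bb p) \<in> FG_domain"
  by (simp add: ratio_dom_def FG_domain_iff)

lemma ratio_dom_admissible: "p \<in> ratio_dom \<Longrightarrow> p $ 5 \<in> admissible (p $ 2) (p $ 4)"
  by (simp add: ratio_dom_def admissible_def aa_def bb_def)

lemma ratio_dom_nonzero:
  assumes "p \<in> ratio_dom"
  shows "p $ 2 \<noteq> 0" "p $ 5 \<noteq> 0" "bb p \<noteq> 0"
  using assms by (auto simp: ratio_dom_def bb_def)

lemma open_ratio_dom: "open ratio_dom"
proof -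
  have "open {p :: complex ^ 5. p $ 2 \<noteq> 0}" by (intro open_Collect_neq continuous_intros)
  moreover have "open ({p :: complex ^ 5. p $ 2 \<noteq> 0} \<inter> (\<lambda>p. Im (p $ 1 / p $ 2)) -` {0<..})"
    using calculation by (intro continuous_open_preimage continuous_intros) auto
  moreover have "open {p. bb p \<noteq> 0}" unfolding bb_def by (intro open_Collect_neq continuous_intros)
  moreover have "open ({p. bb p \<noteq> 0} \<inter> (\<lambda>p. aa p / bb p) -` (- \<real>\<^sub>\<le>\<^sub>0))"
  proof (rule continuous_open_preimage)
    show "continuous_on {p. bb p \<noteq> 0} (\<lambda>p. aa p / bb p)"
      unfolding aa_def bb_def by (intro continuous_intros) auto
  qed (use calculation in \<open>auto simp: closed_nonpos_Reals_complex\<close>)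
  ultimately have "open (({p :: complex ^ 5. p $ 2 \<noteq> 0} \<inter> (\<lambda>p. Im (p $ 1 / p $ 2)) -` {0<..}) \<inter>
      ({p. bb p \<noteq> 0} \<inter> (\<lambda>p. aa p / bb p) -` (- \<real>\<^sub>\<le>\<^sub>0)))"
    using open_Int by blast
  also have "(({p :: complex ^ 5. p $ 2 \<noteq> 0} \<inter> (\<lambda>p. Im (p $ 1 / p $ 2)) -` {0<..}) \<inter>
      ({p. bb p \<noteq> 0} \<inter> (\<lambda>p. aa p / bb p) -` (- \<real>\<^sub>\<le>\<^sub>0))) = ratio_dom"
    by (auto simp: ratio_dom_def)
  finally show ?thesis .
qed

lemma mv_holomorphic_Li:
  assumes "k \<ge> 1"
  shows "mv_holomorphic_on (\<lambda>p. Li k (exp (2 * pi * \<i> * p $ 1 / p $ 2))) ratio_dom"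
proof (rule mv_holomorphic_on_compose[OF _ Li_holomorphic_pos[OF assms]])
  show "mv_holomorphic_on (\<lambda>p. exp (2 * pi * \<i> * p $ 1 / p $ 2)) ratio_dom"
    by (intro mv_intros ratio_dom_nonzero)
  show "(\<lambda>p. exp (2 * pi * \<i> * p $ 1 / p $ 2)) ` ratio_dom \<subseteq> ball 0 1"
    unfolding exp_Li_arg by (auto simp: ratio_dom_def norm_qexp_less_1)
qed auto

lemma mv_holomorphic_Q_F: "mv_holomorphic_on (\<lambda>p. Q_F (p $ 1) (p $ 2) (p $ 3) (p $ 4) (p $ 5)) ratio_dom"
  unfolding Q_F_def using ratio_dom_nonzero
  by (intro mv_holomorphic_on_add mv_holomorphic_on_mult mv_holomorphic_Li mv_holomorphic_on_divide
      mv_holomorphic_on_diff mv_holomorphic_on_const mv_holomorphic_on_component) auto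

lemma mv_holomorphic_Q_G: "mv_holomorphic_on (\<lambda>p. Q_G (p $ 1) (p $ 2) (p $ 3) (p $ 4) (p $ 5)) ratio_dom"
  unfolding Q_G_def using ratio_dom_nonzero
  by (intro mv_holomorphic_on_add mv_holomorphic_on_mult mv_holomorphic_Li mv_holomorphic_on_divide
      mv_holomorphic_on_diff mv_holomorphic_on_const mv_holomorphic_on_component) auto

text \<open>At \<open>v = 0\<close> the polylogarithms are taken at \<open>1\<close>, outside their
  disc of holomorphy. The closed form of \<open>Q_G\<close> there is rational in the remaining
  variables.\<close>

lemma mv_holomorphic_Q_G_0: "mv_holomorphic_on (\<lambda>p. Q_G 0 (p $ 2) 0 (p $ 4) (p $ 5)) ratio_dom"
  unfolding Q_G_at_0 using ratio_dom_nonzero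
  by (intro mv_holomorphic_on_add mv_holomorphic_on_mult mv_holomorphic_on_divide
      mv_holomorphic_on_diff mv_holomorphic_on_const mv_holomorphic_on_component) auto

lemma sol_B_ratio_dom:
  assumes "p \<in> ratio_dom"
  shows "uncurry5 sol_B p = Fc (zz p) (aa p) (bb p) * exp (Q_F (p $ 1) (p $ 2) (p $ 3) (p $ 4) (p $ 5))"
  unfolding uncurry5_def sol_B_def F_star_eq[OF ratio_dom_admissible[OF assms]] zz_def aa_def bb_def ..

lemma sol_D_ratio_dom:
  assumes "p \<in> ratio_dom"
  shows "uncurry5 sol_D p = Gc (zz p) (aa p) (bb p) * exp (Q_G (p $ 1) (p $ 2) (p $ 3) (p $ 4) (p $ 5)) *
    inverse (Gc 0 (aa p) (bb p) * exp (Q_G 0 (p $ 2) 0 (p $ 4) (p $ 5)))"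
  unfolding uncurry5_def sol_D_def G_star_eq[OF ratio_dom_admissible[OF assms]] zz_def aa_def bb_def by simp

lemma mv_meromorphic_sol_B: "mv_meromorphic_on (uncurry5 sol_B) BD_domain"
  unfolding mv_meromorphic_on_def
proof
  fix p0 assume "p0 \<in> BD_domain"
  then have p0: "p0 \<in> ratio_dom" using BD_domain_subset by auto
  obtain n where n: "v3 (zz p0) (aa p0) (bb p0) \<in> n_dom n" using n_dom_exists[OF ratio_dom_v3[OF p0]] .
  define U where "U = ratio_dom \<inter> (\<lambda>p. v3 (zz p) (aa p) (bb p)) -` n_dom n"
  have "continuous_on ratio_dom (\<lambda>p. v3 (zz p) (aa p) (bb p))"
    unfolding continuous_on_def
  proof
    fix x
    have "isCont zz x" "isCont aa x" "isCont bb x"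
      using mv_holomorphic_on_continuous[OF mv_holomorphic_args(1), of x UNIV]
        mv_holomorphic_on_continuous[OF mv_holomorphic_args(2), of x UNIV]
        mv_holomorphic_on_continuous[OF mv_holomorphic_args(3), of x UNIV] by auto
    then show "((\<lambda>p. v3 (zz p) (aa p) (bb p)) \<longlongrightarrow> v3 (zz x) (aa x) (bb x)) (at x within ratio_dom)"
      by (intro tendsto_v3) (auto simp: isCont_def intro: tendsto_within_subset)
  qed
  then have "open U" unfolding U_def by (intro continuous_open_preimage open_ratio_dom open_n_dom)
  have "p0 \<in> U" using p0 n by (simp add: U_def)
  have UR: "U \<subseteq> ratio_dom" by (auto simp: U_def)
  define g where "g p = exp (KF n (v3 (zz p) (aa p) (bb p))) * (\<Prod>j\<in>{0..<n}. xfac (zz p) (aa p) (bb p) j) *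
    exp (Q_F (p $ 1) (p $ 2) (p $ 3) (p $ 4) (p $ 5))" for p
  define h where "h p = (\<Prod>j\<in>{n..<0}. xfac (zz p) (aa p) (bb p) j)" for p
  have hx: "mv_holomorphic_on (\<lambda>p. \<Prod>j\<in>J. xfac (zz p) (aa p) (bb p) j) U" for J
    using UR ratio_dom_nonzero(3) by (intro mv_intros mv_holomorphic_xfac mv_holomorphic_args) auto
  have "mv_holomorphic_on (\<lambda>p. KF n (v3 (zz p) (aa p) (bb p))) U"
    by (rule mv_holomorphic_v3_compose[OF mv_holomorphic_KF mv_holomorphic_args]) (auto simp: U_def)
  then have "mv_holomorphic_on g U"
    unfolding g_def
    by (intro mv_holomorphic_on_mult mv_holomorphic_on_exp hx mv_holomorphic_on_subset[OF mv_holomorphic_Q_F UR])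
  moreover have "mv_holomorphic_on h U" unfolding h_def by (rule hx)
  moreover have "interior {q\<in>U. h q = 0} = {}"
  proof (rule interior_zeros_empty)
    fix q assume "q \<in> U"
    then have b: "bb q \<noteq> 0" using UR ratio_dom_nonzero(3) by auto
    \<comment> \<open>Only the first coordinate moves, so that \<open>zz\<close> changes by a real
      multiple of \<open>bb q\<close> while \<open>aa\<close> and \<open>bb\<close> stay
      fixed.\<close>
    define \<phi> where "\<phi> \<tau> = q + (of_real \<tau> * bb q) *s axis 1 1" for \<tau> :: real
    have comp: "\<phi> \<tau> $ 1 = q $ 1 + of_real \<tau> * bb q" "\<phi> \<tau> $ 2 = q $ 2" "\<phi> \<tau> $ 3 = q $ 3" "\<phi> \<tau> $ 4 = q $ 4" "\<phi> \<tau> $ 5 = q $ 5" for \<tau>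
      using isolated_5 by (simp_all add: \<phi>_def axis_def)
    then have args: "zz (\<phi> \<tau>) = zz q + of_real \<tau> * bb q" "aa (\<phi> \<tau>) = aa q" "bb (\<phi> \<tau>) = bb q" for \<tau>
      by (simp_all add: zz_def aa_def bb_def)
    have "(\<phi> \<longlongrightarrow> q) (at_right 0)"
      unfolding \<phi>_def by (rule vec_tendstoI) (auto intro!: tendsto_eq_intros)
    moreover have "\<forall>\<^sub>F \<tau> in at_right 0. h (\<phi> \<tau>) \<noteq> 0"
      unfolding h_def args by (rule eventually_prod_xfac_nonzero[OF _ b]) auto
    ultimately show "\<exists>\<phi>. (\<phi> \<longlongrightarrow> q) (at_right (0::real)) \<and> (\<forall>\<^sub>F \<tau> in at_right 0. h (\<phi> \<tau>) \<noteq> 0)" by blast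
  qed
  moreover have "uncurry5 sol_B q = g q / h q" if q: "q \<in> U" for q
  proof -
    have "v3 (zz q) (aa q) (bb q) \<in> n_dom n" using q by (simp add: U_def)
    from Fc_Gc_n_dom(1)[OF this] sol_B_ratio_dom[of q] q UR show ?thesis by (auto simp: g_def h_def)
  qed
  ultimately show "\<exists>U g h. open U \<and> p0 \<in> U \<and> mv_holomorphic_on g U \<and> mv_holomorphic_on h U \<and>
      interior {q \<in> U. h q = 0} = {} \<and> (\<forall>q\<in>U. h q \<noteq> 0 \<longrightarrow> uncurry5 sol_B q = g q / h q)"
    using \<open>open U\<close> \<open>p0 \<in> U\<close> by (intro exI[of _ U] exI[of _ g] exI[of _ h]) simp
qed

lemma mv_meromorphic_sol_D: "mv_meromorphic_on (uncurry5 sol_D) BD_domain"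
proof -
  have Gc: "mv_holomorphic_on (\<lambda>p. Gc (z p) (aa p) (bb p)) ratio_dom" if "mv_holomorphic_on z ratio_dom" for z
    using mv_holomorphic_v3_compose[OF Gc_holomorphic that mv_holomorphic_args(2,3)] ratio_dom_v3
    unfolding vector_3 by blast
  have nz: "Gc 0 (aa p) (bb p) \<noteq> 0" if "p \<in> ratio_dom" for p
    using that by (intro Gc_at_0_nonzero) (simp add: ratio_dom_def)
  have "mv_holomorphic_on (\<lambda>p. Gc (zz p) (aa p) (bb p) * exp (Q_G (p $ 1) (p $ 2) (p $ 3) (p $ 4) (p $ 5)) *
    inverse (Gc 0 (aa p) (bb p) * exp (Q_G 0 (p $ 2) 0 (p $ 4) (p $ 5)))) ratio_dom"
    using nz by (intro mv_holomorphic_on_mult mv_holomorphic_on_inverse mv_holomorphic_on_exp Gc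
      mv_holomorphic_args mv_holomorphic_on_const mv_holomorphic_Q_G mv_holomorphic_Q_G_0) auto
  then have "mv_holomorphic_on (uncurry5 sol_D) ratio_dom"
    by (rule mv_holomorphic_on_cong[OF _ open_ratio_dom]) (simp only: sol_D_ratio_dom)
  then have "mv_nicely_meromorphic_on (uncurry5 sol_D) ratio_dom"
    by (rule mv_holomorphic_imp_nicely[OF _ open_ratio_dom])
  then show ?thesis
    using mv_nicely_meromorphic_on_subset[OF _ BD_domain_subset] by (auto simp: mv_nicely_meromorphic_on_def)
qed

subsection \<open>Asymptotics at zero\<close>

text \<open>The remainder after the first two terms of the Bernoulli expansion; its own leading term
  is \<open>x / 12\<close>.\<close>

definition bern :: "complex \<Rightarrow> complex" where
  "bern x = 1 / (exp x - 1) - 1 / x + 1 / 2"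

text \<open>Over the common denominator \<open>2 * x * (exp x - 1)\<close> the terms below third
  order cancel, and the Taylor remainder bounds the rest by a multiple of \<open>norm x ^ 3\<close>.
  The denominator is at least \<open>norm x ^ 2\<close>; the constants are crude.\<close>

lemma norm_bern_small:
  assumes "x \<noteq> 0" "norm x \<le> 1 / 6"
  shows "norm (bern x) \<le> 5 * norm x"
proof -
  define E where "E = exp x - 1"
  define R where "R = E - x - x\<^sup>2 / 2"
  have e3: "exp \<bar>Re x\<bar> \<le> 2"
  proof -
    have "\<bar>Re x\<bar> \<le> 1 / 2" using abs_Re_le_cmod[of x] assms by linarith
    then have "exp \<bar>Re x\<bar> \<le> exp (1 / 2)" by simp
    also have "\<dots> \<le> 2"
    proof -
      have "exp (1 / 2 :: real) ^ 2 = exp 1" by (simp add: exp_of_nat_mult[symmetric])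
      also have "\<dots> \<le> 2 ^ 2" using exp_le by simp
      finally show ?thesis by (rule power2_le_imp_le) simp
    qed
    finally show ?thesis .
  qed
  have "norm (exp x - (\<Sum>k\<le>2. x ^ k / fact k)) \<le> exp \<bar>Re x\<bar> * norm x ^ Suc 2 / fact 2"
    by (rule Taylor_exp)
  also have "exp x - (\<Sum>k\<le>2. x ^ k / fact k) = R"
    by (simp add: R_def E_def atMost_nat_numeral fact_numeral numeral_2_eq_2)
  also have "exp \<bar>Re x\<bar> * norm x ^ Suc 2 / fact 2 \<le> 2 * norm x ^ Suc 2 / fact 2"
    using e3 by (intro divide_right_mono mult_right_mono) auto
  finally have R: "norm R \<le> norm x ^ 3" by (simp add: eval_nat_numeral)
  have E: "E = x + x\<^sup>2 / 2 + R" by (simp add: R_def)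
  have x3: "norm x ^ 3 \<le> norm x / 36"
  proof -
    have "norm x ^ 3 = norm x * (norm x * norm x)" by (simp add: eval_nat_numeral)
    also have "\<dots> \<le> norm x * (1 / 6 * (1 / 6))" using assms by (intro mult_mono) auto
    finally show ?thesis by simp
  qed
  have "norm (x\<^sup>2 / 2) \<le> norm x / 12"
    using mult_left_mono[OF assms(2), of "norm x"] by (simp add: norm_power norm_mult power2_eq_square norm_divide)
  moreover have "norm x \<le> norm E + norm (x\<^sup>2 / 2) + norm R"
    using norm_triangle_ineq4[of "E - x\<^sup>2 / 2" R] norm_triangle_ineq4[of E "x\<^sup>2 / 2"] by (simp add: E)
  ultimately have E2: "norm E \<ge> norm x / 2" using R x3 norm_ge_zero[of x] by linarith
  then have E0: "E \<noteq> 0" using assms by auto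
  have "bern x = (2 * x - 2 * E + x * E) / (2 * x * E)"
    unfolding bern_def E_def[symmetric] using assms(1) E0 by (simp add: divide_simps)
  also have "2 * x - 2 * E + x * E = x ^ 3 / 2 - 2 * R + x * R"
    unfolding E by (simp add: algebra_simps power2_eq_square power3_eq_cube)
  finally have "norm (bern x) = norm (x ^ 3 / 2 - 2 * R + x * R) / (2 * norm x * norm E)"
    by (simp add: norm_divide norm_mult)
  also have "norm (x ^ 3 / 2 - 2 * R + x * R) \<le> norm (x ^ 3 / 2) + norm (2 * R) + norm (x * R)"
    by (intro order.trans[OF norm_triangle_ineq] add_mono norm_triangle_ineq4) auto
  also have "norm (x * R) \<le> 1 / 6 * norm x ^ 3"
    unfolding norm_mult using assms R by (intro mult_mono) auto
  also have "norm (x ^ 3 / 2) + norm (2 * R) + 1 / 6 * norm x ^ 3 \<le> 5 * norm x ^ 3"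
  proof -
    have "norm (x ^ 3 / 2) = norm x ^ 3 / 2" "norm (2 * R) = 2 * norm R" by (simp_all add: norm_mult norm_divide norm_power)
    then show ?thesis using R zero_le_power[OF norm_ge_zero, of x 3] by linarith
  qed
  finally have "norm (bern x) \<le> 5 * norm x ^ 3 / (2 * norm x * norm E)"
    using E0 assms by (simp add: divide_right_mono)
  also have "\<dots> \<le> 5 * norm x ^ 3 / (2 * norm x * (norm x / 2))"
    using E2 E0 assms by (intro divide_left_mono mult_left_mono) auto
  also have "\<dots> = 5 * norm x" using assms by (simp add: eval_nat_numeral)
  finally show ?thesis .
qed

lemma norm_exp_minus_1_ge:
  assumes "\<bar>Re x\<bar> \<ge> \<eta>" "\<eta> \<ge> 0"
  shows "norm (exp x - 1) \<ge> 1 - exp (- \<eta>)"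
proof (cases "Re x \<ge> 0")
  case True
  then have "norm (exp x) \<ge> exp \<eta>" using assms by simp
  moreover have "exp \<eta> \<ge> 1 + \<eta>" "exp (- \<eta>) \<ge> 1 - \<eta>" using exp_ge_add_one_self[of \<eta>] exp_ge_add_one_self[of "- \<eta>"] by auto
  moreover have "norm (exp x - 1) \<ge> norm (exp x) - 1" by (metis norm_one norm_triangle_ineq2)
  ultimately show ?thesis by linarith
next
  case False
  then have "norm (exp x) \<le> exp (- \<eta>)" using assms by simp
  moreover have "norm (exp x - 1) \<ge> 1 - norm (exp x)" by (metis norm_minus_commute norm_one norm_triangle_ineq2)
  ultimately show ?thesis by linarith
qed

text \<open>For small \<open>b * s\<close> this is the Taylor estimate. Otherwise
  \<open>norm b\<close> is small but \<open>norm (b * s)\<close> is not, hence \<open>s\<close> is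
  far out on the line, and since \<open>b\<close> stays in a sector about the positive axis the real
  part of \<open>b * s\<close> is bounded away from \<open>0\<close>. Then
  \<open>exp (b * s) - 1\<close> is bounded below.\<close>

lemma norm_bern_line:
  assumes \<kappa>: "\<kappa> > 0" and y: "y > 0"
  shows "\<exists>r>0. \<exists>C\<ge>0. \<forall>b. norm b < r \<longrightarrow> b \<noteq> 0 \<longrightarrow> Re b \<ge> \<kappa> * norm b \<longrightarrow>
    (\<forall>t. norm (bern (b * Complex t y)) \<le> C * norm (b * Complex t y))"
proof -
  \<comment> \<open>Chosen so that \<open>r * y * (1 + \<kappa>) = \<kappa> / 12\<close>; this
    leaves \<open>\<bar>Re x\<bar> \<ge> \<kappa> / 12\<close> when
    \<open>norm x > 1 / 6\<close>.\<close>
  define r where "r = \<kappa> / (12 * (1 + \<kappa>) * y)"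
  define m where "m = 1 - exp (- (\<kappa> / 12))"
  have r: "r > 0" using assms by (simp add: r_def)
  have m: "m > 0" using \<kappa> by (simp add: m_def)
  have ry: "r * y * (1 + \<kappa>) = \<kappa> / 12"
  proof -
    have "1 + \<kappa> \<noteq> 0" using \<kappa> by simp
    then show ?thesis using y unfolding r_def by (simp add: divide_simps)
  qed
  define C where "C = max 5 (6 * (1 / m + 13 / 2))"
  have "norm (bern (b * Complex t y)) \<le> C * norm (b * Complex t y)"
    if b: "norm b < r" "b \<noteq> 0" "Re b \<ge> \<kappa> * norm b" for b t
  proof -
    define x where "x = b * Complex t y"
    have "Complex t y \<noteq> 0" using y by (simp add: complex_eq_iff)
    then have x0: "x \<noteq> 0" using b(2) by (simp add: x_def)
    have "norm (bern x) \<le> C * norm x"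
    proof (cases "norm x \<le> 1 / 6")
      case True
      have "5 * norm x \<le> C * norm x" unfolding C_def by (intro mult_right_mono) auto
      with norm_bern_small[OF x0 True] show ?thesis by linarith
    next
      case False
      have by_: "norm b * y \<le> r * y" using b y by simp
      have "norm x \<le> norm b * (\<bar>t\<bar> + y)"
        unfolding x_def norm_mult using y by (intro mult_left_mono order.trans[OF cmod_le]) auto
      then have bt: "norm b * \<bar>t\<bar> \<ge> 1 / 6 - r * y" using False by_ by (simp add: distrib_left)
      have "\<bar>Re x\<bar> \<ge> \<bar>Re b * t\<bar> - \<bar>Im b * y\<bar>" unfolding x_def by simp
      moreover have "\<bar>Im b * y\<bar> \<le> r * y"
        using abs_Im_le_cmod[of b] b y by (simp add: abs_mult)
      moreover have "\<bar>Re b * t\<bar> \<ge> \<kappa> * (norm b * \<bar>t\<bar>)"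
      proof -
        have "\<kappa> * norm b * \<bar>t\<bar> \<le> \<bar>Re b\<bar> * \<bar>t\<bar>" using b(3) by (intro mult_right_mono) auto
        then show ?thesis by (simp only: abs_mult mult.assoc)
      qed
      moreover have "\<kappa> * (norm b * \<bar>t\<bar>) \<ge> \<kappa> * (1 / 6 - r * y)" using bt \<kappa> by (intro mult_left_mono) auto
      moreover have "\<kappa> * (1 / 6 - r * y) - r * y = \<kappa> / 12" using ry by (simp add: algebra_simps)
      ultimately have "\<bar>Re x\<bar> \<ge> \<kappa> / 12" by argo
      from norm_exp_minus_1_ge[OF this] \<kappa> have E: "norm (exp x - 1) \<ge> m" by (simp add: m_def)
      have "norm (bern x) \<le> norm (1 / (exp x - 1)) + norm (1 / x) + norm (1 / 2 :: complex)"
        unfolding bern_def by (intro order.trans[OF norm_triangle_ineq] add_mono norm_triangle_ineq4) auto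
      also have "norm (1 / (exp x - 1)) \<le> 1 / m" using E m by (simp add: norm_divide frac_le)
      also have "norm (1 / x) \<le> 6" using False x0 by (simp add: norm_divide field_simps)
      finally have "norm (bern x) \<le> (1 / m + 13 / 2) * 1" by simp
      also have "\<dots> \<le> (1 / m + 13 / 2) * (6 * norm x)" using False m by (intro mult_left_mono) auto
      also have "\<dots> \<le> C * norm x" 
        proof -
          have "(1 / m + 13 / 2) * (6 * norm x) = 6 * (1 / m + 13 / 2) * norm x" by (simp only: mult_ac)
          also have "\<dots> \<le> C * norm x" unfolding C_def by (intro mult_right_mono) auto
          finally show ?thesis .
        qed
      finally show ?thesis .
    qed
    then show ?thesis by (simp add: x_def)
  qed
  moreover have "C \<ge> 0" by (simp add: C_def)
  ultimately show ?thesis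
    using r by (intro exI[of _ r] exI[of _ C] conjI allI impI) assumption+
qed

text \<open>
  The first terms of \<open>1 / (exp x - 1) = 1 / x - 1 / 2 + O(x)\<close> at \<open>x = b s\<close>, integrated against
  the remaining factors of the integrand.
\<close>

lemma W_expansion:
  fixes z a b :: "'e \<Rightarrow> complex"
  assumes p0: "v3 z0 a0 a0 \<in> ker_dom m 0" and \<kappa>: "\<kappa> > 0"
    and z: "(z \<longlongrightarrow> z0) F" and a: "(a \<longlongrightarrow> a0) F" and b: "(b \<longlongrightarrow> 0) F"
    and ev: "\<forall>\<^sub>F \<epsilon> in F. b \<epsilon> \<noteq> 0 \<and> Re (b \<epsilon>) \<ge> \<kappa> * norm (b \<epsilon>)"
  shows "\<forall>\<^sub>F \<epsilon> in F. v3 (z \<epsilon>) (a \<epsilon>) (b \<epsilon>) \<in> ker_dom m 1"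
    and "((\<lambda>\<epsilon>. W m 1 1 (v3 (z \<epsilon>) (a \<epsilon>) (b \<epsilon>)) -
      (W m 0 2 (v3 (z \<epsilon>) (a \<epsilon>) (a \<epsilon>)) / b \<epsilon> - W m 0 1 (v3 (z \<epsilon>) (a \<epsilon>) (a \<epsilon>)) / 2)) \<longlongrightarrow> 0) F"
proof -
  obtain y where y: "v3 z0 a0 a0 \<in> height_dom y" using height_dom_exists[OF p0] .
  have ypos: "y > 0" using y by (auto simp: height_dom_def admissible_height_def)
  obtain \<rho> \<mu> C where \<rho>: "\<rho> > 0" "\<mu> > 0" and C: "\<And>p t. p \<in> ball (v3 z0 a0 a0) \<rho> \<Longrightarrow> norm (ker m 0 0 p (Complex t y)) \<le> C * exp (- \<mu> * \<bar>t\<bar>)"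
    using ker_dominated[OF p0 y, of 0] by blast
  obtain r C' where r: "r > 0" "C' \<ge> 0" and C': "\<And>b t. norm b < r \<Longrightarrow> b \<noteq> 0 \<Longrightarrow> Re b \<ge> \<kappa> * norm b \<Longrightarrow>
      norm (bern (b * Complex t y)) \<le> C' * norm (b * Complex t y)"
    using norm_bern_line[OF \<kappa> ypos] by blast
  have lim: "((\<lambda>\<epsilon>. v3 (z \<epsilon>) (a \<epsilon>) (a \<epsilon>)) \<longlongrightarrow> v3 z0 a0 a0) F" by (intro tendsto_v3 z a)
  have "\<forall>\<^sub>F \<epsilon> in F. v3 (z \<epsilon>) (a \<epsilon>) (a \<epsilon>) \<in> ker_dom m 0 \<inter> height_dom y \<inter> ball (v3 z0 a0 a0) \<rho>"
    using p0 y \<rho> by (intro topological_tendstoD[OF lim] open_Int open_ker_dom open_height_dom open_ball) auto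
  \<comment> \<open>The second bound makes \<open>y\<close> an admissible height for
    \<open>b\<close> too, so that all integrals run along one line.\<close>
  moreover have "\<forall>\<^sub>F \<epsilon> in F. norm (b \<epsilon>) < min r (2 * pi * \<kappa> / y)"
    using r \<kappa> ypos by (intro order_tendstoD(2)[OF tendsto_norm_zero[OF b]]) auto
  ultimately have good: "\<forall>\<^sub>F \<epsilon> in F. v3 (z \<epsilon>) (a \<epsilon>) (a \<epsilon>) \<in> ker_dom m 0 \<and> v3 (z \<epsilon>) (a \<epsilon>) (a \<epsilon>) \<in> height_dom y \<and>
      v3 (z \<epsilon>) (a \<epsilon>) (a \<epsilon>) \<in> ball (v3 z0 a0 a0) \<rho> \<and> norm (b \<epsilon>) < r \<and> b \<epsilon> \<noteq> 0 \<and> Re (b \<epsilon>) \<ge> \<kappa> * norm (b \<epsilon>) \<and> admissible_height (b \<epsilon>) y"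
    using ev
  proof eventually_elim
    case (elim \<epsilon>)
    have nb: "norm (b \<epsilon>) > 0" using elim by simp
    have "Re (b \<epsilon>) > 0" using elim(3) mult_pos_pos[OF \<kappa> nb] by linarith
    moreover have "y * (norm (b \<epsilon>))\<^sup>2 < 2 * pi * Re (b \<epsilon>)"
    proof -
      have "y * norm (b \<epsilon>) < 2 * pi * \<kappa>" using elim(2) ypos by (simp add: field_simps)
      then have "y * norm (b \<epsilon>) * norm (b \<epsilon>) < 2 * pi * \<kappa> * norm (b \<epsilon>)" using nb by (intro mult_strict_right_mono)
      also have "\<dots> \<le> 2 * pi * Re (b \<epsilon>)" using elim(3) by (simp add: mult.assoc)
      finally show ?thesis by (simp add: power2_eq_square mult.assoc)
    qed
    ultimately have "admissible_height (b \<epsilon>) y" using ypos by (simp add: admissible_height_def)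
    with elim show ?case by auto
  qed
  then show ev1: "\<forall>\<^sub>F \<epsilon> in F. v3 (z \<epsilon>) (a \<epsilon>) (b \<epsilon>) \<in> ker_dom m 1"
  proof eventually_elim
    case (elim \<epsilon>)
    then have "v3 (z \<epsilon>) (a \<epsilon>) (a \<epsilon>) \<in> ker_dom m 0" "Re (b \<epsilon>) > 0" by (simp_all add: admissible_height_def)
    then show ?case by (simp add: ker_dom_def)
  qed
  define K where "K = (LINT t|lborel. C * exp (- \<mu> * \<bar>t\<bar>) * C')"
  have Kint: "integrable lborel (\<lambda>t. C * exp (- \<mu> * \<bar>t\<bar>) * C')"
    using integrable_exp_neg_abs[OF \<rho>(2)] by simp
  show "((\<lambda>\<epsilon>. W m 1 1 (v3 (z \<epsilon>) (a \<epsilon>) (b \<epsilon>)) -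
      (W m 0 2 (v3 (z \<epsilon>) (a \<epsilon>) (a \<epsilon>)) / b \<epsilon> - W m 0 1 (v3 (z \<epsilon>) (a \<epsilon>) (a \<epsilon>)) / 2)) \<longlongrightarrow> 0) F"
  proof (rule Lim_null_comparison)
    show "((\<lambda>\<epsilon>. norm (b \<epsilon>) * K) \<longlongrightarrow> 0) F"
      using tendsto_mult_left_zero[OF tendsto_norm_zero[OF b]] .
    show "\<forall>\<^sub>F \<epsilon> in F. norm (W m 1 1 (v3 (z \<epsilon>) (a \<epsilon>) (b \<epsilon>)) -
      (W m 0 2 (v3 (z \<epsilon>) (a \<epsilon>) (a \<epsilon>)) / b \<epsilon> - W m 0 1 (v3 (z \<epsilon>) (a \<epsilon>) (a \<epsilon>)) / 2)) \<le> norm (b \<epsilon>) * K"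
      using good ev1
    proof eventually_elim
      case (elim \<epsilon>)
      define s where "s t = Complex t y" for t
      define p where "p = v3 (z \<epsilon>) (a \<epsilon>) (a \<epsilon>)"
      define q where "q = v3 (z \<epsilon>) (a \<epsilon>) (b \<epsilon>)"
      have p: "p \<in> ker_dom m 0" "p \<in> height_dom y" "p \<in> ball (v3 z0 a0 a0) \<rho>" unfolding p_def using elim(1) by blast+
      have q1: "q \<in> ker_dom m 1" unfolding q_def by (rule elim(2))
      have "admissible_height (b \<epsilon>) y" using elim(1) by blast
      with p(2) have q2: "q \<in> height_dom y" by (simp add: q_def p_def height_dom_def)
      note q = q1 q2
      have b0: "b \<epsilon> \<noteq> 0" using elim(1) by blast
      have int: "integrable lborel (\<lambda>t. ker m 0 k p (s t))" for k
        unfolding s_def using ypos by (intro integrable_ker_line[OF p(1,2)]) auto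
      have intq: "integrable lborel (\<lambda>t. ker m 1 1 q (s t))"
        unfolding s_def using ypos by (intro integrable_ker_line[OF q]) auto
      have eq: "ker m 1 1 q (s t) - (ker m 0 2 p (s t) / b \<epsilon> - ker m 0 1 p (s t) / 2) =
          ker m 0 0 p (s t) * bern (b \<epsilon> * s t) / s t" for t
      proof -
        have s0: "s t \<noteq> 0" using ypos by (simp add: s_def complex_eq_iff)
        define A where "A = ker m 0 0 p (s t)"
        have "ker m 1 1 q (s t) = A * (1 / (exp (b \<epsilon> * s t) - 1)) / s t"
          by (simp add: ker_def A_def p_def q_def)
        moreover have "ker m 0 2 p (s t) = A / (s t)\<^sup>2" "ker m 0 1 p (s t) = A / s t" by (simp_all add: ker_def A_def)
        ultimately show ?thesis
          unfolding A_def[symmetric] bern_def using s0 b0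
          by (simp add: ring_distribs add_divide_distrib diff_divide_distrib power2_eq_square mult_ac)
      qed
      have "W m 1 1 q - (W m 0 2 p / b \<epsilon> - W m 0 1 p / 2) =
          (LINT t|lborel. ker m 1 1 q (s t) - (ker m 0 2 p (s t) / b \<epsilon> - ker m 0 1 p (s t) / 2))"
        unfolding W_line[OF p(1,2)] W_line[OF q] s_def[symmetric] using int intq by simp
      also have "norm \<dots> \<le> (LINT t|lborel. norm (ker m 0 0 p (s t) * bern (b \<epsilon> * s t) / s t))"
        unfolding eq by (rule integral_norm_bound)
      also have "\<dots> \<le> (LINT t|lborel. norm (b \<epsilon>) * (C * exp (- \<mu> * \<bar>t\<bar>) * C'))"
      proof (rule integral_mono)
        have "integrable lborel (\<lambda>t. ker m 1 1 q (s t) - (ker m 0 2 p (s t) / b \<epsilon> - ker m 0 1 p (s t) / 2))"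
          using int intq by auto
        then show "integrable lborel (\<lambda>t. norm (ker m 0 0 p (s t) * bern (b \<epsilon> * s t) / s t))"
          unfolding eq by (rule integrable_norm)
        show "integrable lborel (\<lambda>t. norm (b \<epsilon>) * (C * exp (- \<mu> * \<bar>t\<bar>) * C'))" using Kint by simp
        fix t
        have s0: "norm (s t) > 0" using ypos by (simp add: s_def complex_eq_iff)
        \<comment> \<open>The bound on \<open>bern (b * s)\<close> is linear in
          \<open>b * s\<close>; its factor \<open>s\<close> cancels the division by
          \<open>s\<close>, and its factor \<open>b\<close> makes the whole error small.\<close>
        have "norm (ker m 0 0 p (s t) * bern (b \<epsilon> * s t) / s t) = norm (ker m 0 0 p (s t)) * (norm (bern (b \<epsilon> * s t)) / norm (s t))"
          by (simp add: norm_mult norm_divide)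
        also have "\<dots> \<le> (C * exp (- \<mu> * \<bar>t\<bar>)) * (C' * norm (b \<epsilon> * s t) / norm (s t))"
        proof (intro mult_mono divide_right_mono)
          show "norm (ker m 0 0 p (s t)) \<le> C * exp (- \<mu> * \<bar>t\<bar>)" unfolding s_def by (rule C[OF p(3)])
          show "norm (bern (b \<epsilon> * s t)) \<le> C' * norm (b \<epsilon> * s t)" unfolding s_def by (rule C') (use elim in blast)+
          show "0 \<le> C * exp (- \<mu> * \<bar>t\<bar>)" by (rule order.trans[OF norm_ge_zero C[OF p(3), of t]])
        qed auto
        also have "\<dots> = norm (b \<epsilon>) * (C * exp (- \<mu> * \<bar>t\<bar>) * C')" using s0 by (simp add: norm_mult)
        finally show "norm (ker m 0 0 p (s t) * bern (b \<epsilon> * s t) / s t) \<le> norm (b \<epsilon>) * (C * exp (- \<mu> * \<bar>t\<bar>) * C')" .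
      qed
      also have "\<dots> = norm (b \<epsilon>) * K" by (simp add: K_def)
      finally show ?case by (simp add: p_def q_def)
    qed
  qed
qed

text \<open>The number \<mu> rotates \<open>v\<close> into the open strip belonging to
  \<open>w\<close>, while \<open>R\<close> is a sector on which the rotated second period
  \<open>b = - 2 * pi * \<i> * \<mu> * \<epsilon>\<close> keeps away from the imaginary axis. As
  \<epsilon> tends to \<open>0\<close>, only \<open>b\<close> degenerates.\<close>

locale small_parameter =
  fixes v w \<theta> \<phi> \<mu> :: complex and \<kappa> :: real and R :: "complex set"
  assumes M: "(v, w) \<in> M_plus"
    and lam: "0 < Re (\<mu> * v)" "Re (\<mu> * v) < Re (\<mu> * w)"
    and kappa: "\<kappa> > 0" "\<And>\<epsilon>. \<epsilon> \<in> R \<Longrightarrow> \<kappa> * norm \<epsilon> \<le> Re (- (\<i> * \<mu> * \<epsilon>))"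
begin

abbreviation F0 :: "complex filter" where "F0 \<equiv> at 0 within R"

definition c where "c = 2 * of_real pi * \<i>"
definition z where "z \<epsilon> = \<mu> * (v - \<epsilon> * \<theta>)"
definition a where "a \<epsilon> = \<mu> * (w - \<epsilon> * \<phi>)"
definition b where "b \<epsilon> = \<mu> * (- (2 * pi * \<i> * \<epsilon>))"
definition u where "u \<epsilon> = (v - \<epsilon> * \<theta>) / (w - \<epsilon> * \<phi>)"
text \<open>The coefficient shared by \<open>Q_F\<close> and \<open>Q_G\<close>. As
  \<open>c * A / w\<close> is the derivative of \<open>u\<close> at \<open>\<epsilon> = 0\<close>,
  these terms account for replacing \<open>u\<close> by \<open>v / w\<close> in the
  polylogarithms.\<close>

definition A where "A = (v * \<phi> - w * \<theta>) / (c * w)"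

lemma w0: "w \<noteq> 0" and lam0: "\<mu> \<noteq> 0" and im: "Im (v / w) > 0" and c0: "c \<noteq> 0"
  using M lam by (auto simp: M_plus_def c_def)

lemma ev_nonzero: "\<forall>\<^sub>F \<epsilon> in F0. \<epsilon> \<noteq> 0"
  by (simp add: eventually_at_filter)

lemma ev_b: "\<forall>\<^sub>F \<epsilon> in F0. b \<epsilon> \<noteq> 0 \<and> Re (b \<epsilon>) \<ge> (\<kappa> / norm \<mu>) * norm (b \<epsilon>)"
proof -
  have "b \<epsilon> \<noteq> 0 \<and> Re (b \<epsilon>) \<ge> (\<kappa> / norm \<mu>) * norm (b \<epsilon>)" if "\<epsilon> \<in> R" "\<epsilon> \<noteq> 0" for \<epsilon>
  proof -
    have b: "b \<epsilon> = of_real (2 * pi) * (- (\<i> * \<mu> * \<epsilon>))" by (simp add: b_def)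
    have "Re (b \<epsilon>) = (2 * pi) * Re (- (\<i> * \<mu> * \<epsilon>))" unfolding b by (subst times_complex.sel) simp
    moreover have "norm (b \<epsilon>) = (2 * pi) * (norm \<mu> * norm \<epsilon>)" unfolding b by (simp add: norm_mult)
    moreover have "(2 * pi) * (\<kappa> * norm \<epsilon>) \<le> (2 * pi) * Re (- (\<i> * \<mu> * \<epsilon>))"
      using kappa(2)[OF that(1)] by (intro mult_left_mono) auto
    ultimately show ?thesis using that lam0 by (auto simp: b_def)
  qed
  then show ?thesis by (auto simp: eventually_at_filter intro!: always_eventually)
qed

lemma kappa': "\<kappa> / norm \<mu> > 0"
  using kappa lam0 by simp

lemma lims:
  "(z \<longlongrightarrow> \<mu> * v) F0" "(a \<longlongrightarrow> \<mu> * w) F0" "(b \<longlongrightarrow> 0) F0"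
proof -
  have "(z \<longlongrightarrow> \<mu> * (v - 0 * \<theta>)) F0" unfolding z_def by (intro tendsto_intros)
  then show "(z \<longlongrightarrow> \<mu> * v) F0" by simp
  have "(a \<longlongrightarrow> \<mu> * (w - 0 * \<phi>)) F0" unfolding a_def by (intro tendsto_intros)
  then show "(a \<longlongrightarrow> \<mu> * w) F0" by simp
  have "(b \<longlongrightarrow> \<mu> * (- (2 * pi * \<i> * 0))) F0" unfolding b_def by (intro tendsto_intros)
  then show "(b \<longlongrightarrow> 0) F0" by simp
qed

lemma lim_u: "(u \<longlongrightarrow> v / w) F0"
proof -
  have "(u \<longlongrightarrow> (v - 0 * \<theta>) / (w - 0 * \<phi>)) F0"
    unfolding u_def using w0 by (intro tendsto_intros) auto
  then show ?thesis by simp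
qed

lemma ev_u: "\<forall>\<^sub>F \<epsilon> in F0. Im (u \<epsilon>) > 0 \<and> w - \<epsilon> * \<phi> \<noteq> 0"
proof (rule eventually_conj)
  show "\<forall>\<^sub>F \<epsilon> in F0. Im (u \<epsilon>) > 0"
    by (rule order_tendstoD(1)[OF tendsto_Im[OF lim_u] im])
  have "((\<lambda>\<epsilon>. w - \<epsilon> * \<phi>) \<longlongrightarrow> w - 0 * \<phi>) F0" by (intro tendsto_intros)
  then show "\<forall>\<^sub>F \<epsilon> in F0. w - \<epsilon> * \<phi> \<noteq> 0" using w0 by (intro tendsto_imp_eventually_ne) auto
qed

lemma z_over_a: "z \<epsilon> / a \<epsilon> = u \<epsilon>"
  using lam0 by (simp add: z_def a_def u_def)

lemma has_derivative_u: "(u has_field_derivative (c * A / w)) (at 0)"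
proof -
  have "(u has_field_derivative ((- \<theta>) * (w - 0 * \<phi>) - (v - 0 * \<theta>) * (- \<phi>)) / ((w - 0 * \<phi>) * (w - 0 * \<phi>))) (at 0)"
    unfolding u_def using w0 by (intro DERIV_divide) (auto intro!: derivative_eq_intros)
  moreover have "c * A / w = ((- \<theta>) * (w - 0 * \<phi>) - (v - 0 * \<theta>) * (- \<phi>)) / ((w - 0 * \<phi>) * (w - 0 * \<phi>))"
    using w0 c0 by (simp add: A_def mult_ac)
  ultimately show ?thesis by simp
qed

text \<open>The expansion carries a polylogarithm at \<open>u\<close> with coefficient
  \<open>1 / \<epsilon>\<close>, while \<open>Q_F\<close> and \<open>Q_G\<close> carry it at
  \<open>v / w\<close>. Their difference survives as this derivative.\<close>

lemma Li_quotient: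
  "((\<lambda>\<epsilon>. (Li (Suc k) (qexp (u \<epsilon>)) - Li (Suc k) (qexp (v / w))) / \<epsilon>) \<longlongrightarrow> c * Li k (qexp (v / w)) * (c * A / w)) F0"
proof -
  have u0: "u 0 = v / w" by (simp add: u_def)
  have "((\<lambda>u. Li (Suc k) (qexp u)) has_field_derivative c * Li k (qexp (u 0))) (at (u 0))"
    unfolding c_def u0 by (rule Li_qexp_has_field_derivative[OF im])
  from DERIV_chain2[OF this has_derivative_u]
  have "((\<lambda>\<epsilon>. Li (Suc k) (qexp (u \<epsilon>))) has_field_derivative c * Li k (qexp (u 0)) * (c * A / w)) (at 0 within R)"
    by (rule has_field_derivative_at_within)
  then show ?thesis unfolding has_field_derivative_iff u0 by simp
qed

lemma Li_lim: "((\<lambda>\<epsilon>. Li (Suc k) (qexp (u \<epsilon>))) \<longlongrightarrow> Li (Suc k) (qexp (v / w))) F0"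
proof -
  have "isCont (\<lambda>u. Li (Suc k) (qexp u)) (v / w)"
    by (rule DERIV_isCont[OF Li_qexp_has_field_derivative[OF im]])
  from isCont_tendsto_compose[OF this lim_u] show ?thesis .
qed

lemma expansion:
  assumes "v3 z0 (\<mu> * w) (\<mu> * w) \<in> ker_dom m 0" "(z' \<longlongrightarrow> z0) F0"
  shows "\<forall>\<^sub>F \<epsilon> in F0. v3 (z' \<epsilon>) (a \<epsilon>) (b \<epsilon>) \<in> ker_dom m 1"
    and "((\<lambda>\<epsilon>. W m 1 1 (v3 (z' \<epsilon>) (a \<epsilon>) (b \<epsilon>)) -
      (W m 0 2 (v3 (z' \<epsilon>) (a \<epsilon>) (a \<epsilon>)) / b \<epsilon> - W m 0 1 (v3 (z' \<epsilon>) (a \<epsilon>) (a \<epsilon>)) / 2)) \<longlongrightarrow> 0) F0"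
  by (rule W_expansion[OF assms(1) kappa' assms(2) lims(2,3) ev_b])+

lemma dom_z: "v3 (\<mu> * v) (\<mu> * w) (\<mu> * w) \<in> ker_dom 1 0"
  using lam by (simp add: ker_dom_def)

lemma ev_ker: "\<forall>\<^sub>F \<epsilon> in F0. v3 (z \<epsilon>) (a \<epsilon>) (b \<epsilon>) \<in> ker_dom 1 1 \<and> Re (z \<epsilon>) < Re (a \<epsilon>)"
proof (rule eventually_conj[OF expansion(1)[OF dom_z lims(1)]])
  have "((\<lambda>\<epsilon>. Re (a \<epsilon>) - Re (z \<epsilon>)) \<longlongrightarrow> Re (\<mu> * w) - Re (\<mu> * v)) F0"
    by (intro tendsto_diff tendsto_Re lims)
  from order_tendstoD(1)[OF this, of 0] lam show "\<forall>\<^sub>F \<epsilon> in F0. Re (z \<epsilon>) < Re (a \<epsilon>)" by simp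
qed

lemma ev_admissible: "\<forall>\<^sub>F \<epsilon> in F0. \<epsilon> \<in> admissible w \<phi>"
  using ev_ker
proof eventually_elim
  case (elim \<epsilon>)
  then have "v3 (z \<epsilon>) (a \<epsilon>) (b \<epsilon>) \<in> FG_domain" using ker_dom_subset_FG by blast
  then show ?case unfolding FG_domain_iff admissible_iff a_def b_def mult_divide_mult_cancel_left[OF lam0] .
qed

lemma Q_F_c: "Q_F v w \<theta> \<phi> \<epsilon> = (w - \<epsilon> * \<phi>) / (c\<^sup>2 * \<epsilon>) * Li 2 (qexp (v / w)) + (A + 1 / 2) * Li 1 (qexp (v / w))"
  unfolding Q_F_def exp_Li_arg A_def c_def by (simp add: mult_ac)

lemma Q_G_c: "Q_G v w \<theta> \<phi> \<epsilon> = 2 * (w - \<epsilon> * \<phi>) / (c ^ 3 * \<epsilon>) * Li 3 (qexp (v / w)) - (v - \<epsilon> * \<theta>) / (c\<^sup>2 * \<epsilon>) * Li 2 (qexp (v / w)) +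
    2 / c * (A + 1 / 4) * Li 2 (qexp (v / w)) - v / w * (A + 1 / 2) * Li 1 (qexp (v / w))"
  unfolding Q_G_def exp_Li_arg A_def c_def by (simp add: mult_ac)

lemma quotient_difference: "n / d * ((p - q) / \<epsilon>) = n / (d * \<epsilon>) * p - n / (d * \<epsilon>) * (q :: complex)"
  by (simp add: diff_divide_distrib right_diff_distrib)

lemma sol_B_tendsto_1: "(sol_B v w \<theta> \<phi> \<longlongrightarrow> 1) F0"
proof -
  define y where "y \<epsilon> = qexp (u \<epsilon>)" for \<epsilon>
  define y0 where "y0 = qexp (v / w)"
  define err where "err \<epsilon> = Kf (z \<epsilon>) (a \<epsilon>) (b \<epsilon>) -
      (W 1 0 2 (v3 (z \<epsilon>) (a \<epsilon>) (a \<epsilon>)) / b \<epsilon> - W 1 0 1 (v3 (z \<epsilon>) (a \<epsilon>) (a \<epsilon>)) / 2)" for \<epsilon>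
  \<comment> \<open>The sum \<open>Kf + Q_F\<close>, regrouped so that the two terms of order
    \<open>1 / \<epsilon>\<close> form a difference quotient of \<open>Li 2\<close>. Its limit
    contributes \<open>- A * Li 1 y0\<close>, and everything cancels.\<close>
  define h where "h \<epsilon> = - ((w - \<epsilon> * \<phi>) / c\<^sup>2) * ((Li 2 (y \<epsilon>) - Li 2 y0) / \<epsilon>) + (A + 1 / 2) * Li 1 y0 - 1 / 2 * Li 1 (y \<epsilon>) + err \<epsilon>" for \<epsilon>
  have err: "(err \<longlongrightarrow> 0) F0"
    unfolding err_def Kf_def by (rule expansion(2)[OF dom_z lims(1)])
  have "(h \<longlongrightarrow> - ((w - 0 * \<phi>) / c\<^sup>2) * (c * Li 1 y0 * (c * A / w)) + (A + 1 / 2) * Li 1 y0 - 1 / 2 * Li 1 y0 + 0) F0"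
    unfolding h_def y_def y0_def
    by (intro tendsto_add tendsto_diff tendsto_mult tendsto_minus tendsto_divide tendsto_const tendsto_ident_at err
        Li_lim[of 0, folded One_nat_def] Li_quotient[of 1, unfolded Suc_1]) (use c0 in auto)
  also have "- ((w - 0 * \<phi>) / c\<^sup>2) * (c * Li 1 y0 * (c * A / w)) + (A + 1 / 2) * Li 1 y0 - 1 / 2 * Li 1 y0 + 0 = 0"
    using c0 w0 by (simp add: field_simps power2_eq_square)
  finally have "((\<lambda>\<epsilon>. exp (h \<epsilon>)) \<longlongrightarrow> exp 0) F0" by (rule tendsto_exp)
  moreover have "\<forall>\<^sub>F \<epsilon> in F0. exp (h \<epsilon>) = sol_B v w \<theta> \<phi> \<epsilon>"
    using ev_ker ev_admissible ev_u ev_nonzero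
  proof eventually_elim
    case (elim \<epsilon>)
    have W: "W 1 0 k (v3 (z \<epsilon>) (a \<epsilon>) (a \<epsilon>)) = (a \<epsilon> / c)^k * (c / a \<epsilon>) * Li k (y \<epsilon>)" for k
      unfolding c_def y_def z_over_a[symmetric]
      by (rule W_1_0_Li) (use elim in \<open>auto simp: z_over_a ker_dom_def\<close>)
    have a0: "a \<epsilon> \<noteq> 0" using elim(3) lam0 by (simp add: a_def)
    have W1: "W 1 0 1 (v3 (z \<epsilon>) (a \<epsilon>) (a \<epsilon>)) = Li 1 (y \<epsilon>)" unfolding W using a0 c0 by simp
    have b: "b \<epsilon> = - (\<mu> * c * \<epsilon>)" by (simp add: b_def c_def)
    have W2: "W 1 0 2 (v3 (z \<epsilon>) (a \<epsilon>) (a \<epsilon>)) / b \<epsilon> = - ((w - \<epsilon> * \<phi>) / (c\<^sup>2 * \<epsilon>) * Li 2 (y \<epsilon>))"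
    proof -
      have "W 1 0 2 (v3 (z \<epsilon>) (a \<epsilon>) (a \<epsilon>)) / b \<epsilon> = (a \<epsilon> / c) * Li 2 (y \<epsilon>) / b \<epsilon>"
        unfolding W using a0 c0 by (simp add: power2_eq_square)
      also have "\<dots> = - ((w - \<epsilon> * \<phi>) / (c\<^sup>2 * \<epsilon>) * Li 2 (y \<epsilon>))"
        unfolding b a_def using c0 lam0 elim(4) by (simp add: power2_eq_square)
      finally show ?thesis .
    qed
    have "Kf (z \<epsilon>) (a \<epsilon>) (b \<epsilon>) = err \<epsilon> - (w - \<epsilon> * \<phi>) / (c\<^sup>2 * \<epsilon>) * Li 2 (y \<epsilon>) - Li 1 (y \<epsilon>) / 2"
      unfolding err_def W1 W2 by simp
    then have "h \<epsilon> = Kf (z \<epsilon>) (a \<epsilon>) (b \<epsilon>) + Q_F v w \<theta> \<phi> \<epsilon>"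
      unfolding h_def Q_F_c y0_def[symmetric] mult_minus_left quotient_difference by simp
    moreover have "Fc (v - \<epsilon> * \<theta>) (w - \<epsilon> * \<phi>) (- (2 * pi * \<i> * \<epsilon>)) = exp (Kf (z \<epsilon>) (a \<epsilon>) (b \<epsilon>))"
      using Fc_scale[OF lam0, of "v - \<epsilon> * \<theta>" "w - \<epsilon> * \<phi>" "- (2 * pi * \<i> * \<epsilon>)"] Fc_eq_exp_Kf[of "z \<epsilon>" "a \<epsilon>" "b \<epsilon>"] elim(1)
      unfolding z_def a_def b_def by metis
    ultimately show ?case
      unfolding sol_B_def F_star_eq[OF elim(2)] by (simp add: exp_add)
  qed
  ultimately show ?thesis by (simp add: Lim_transform_eventually)
qed

lemma dom_za: "v3 (\<mu> * v + \<mu> * w) (\<mu> * w) (\<mu> * w) \<in> ker_dom 2 0" "v3 (\<mu> * w) (\<mu> * w) (\<mu> * w) \<in> ker_dom 2 0"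
  using lam by (simp_all add: ker_dom_def)

lemma LiS_quotient:
  assumes "\<epsilon> \<noteq> 0" "w - \<epsilon> * \<phi> \<noteq> 0"
  shows "LiS 2 (\<mu> * x) (a \<epsilon>) / b \<epsilon> = - (x / (c\<^sup>2 * \<epsilon>) * Li 2 (qexp (x / (w - \<epsilon> * \<phi>)))) +
      2 * (w - \<epsilon> * \<phi>) / (c ^ 3 * \<epsilon>) * Li 3 (qexp (x / (w - \<epsilon> * \<phi>)))"
    and "LiS 1 (\<mu> * x) (a \<epsilon>) = x / (w - \<epsilon> * \<phi>) * Li 1 (qexp (x / (w - \<epsilon> * \<phi>))) - Li 2 (qexp (x / (w - \<epsilon> * \<phi>))) / c"
proof -
  define a' where "a' = w - \<epsilon> * \<phi>"
  have a': "a' \<noteq> 0" "\<mu> * x / a \<epsilon> = x / a'" using assms lam0 by (simp_all add: a'_def a_def)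
  have b: "b \<epsilon> = - (\<mu> * c * \<epsilon>)" by (simp add: b_def c_def)
  have s: "Suc 2 = 3" "Suc 1 = 2" by simp_all
  show "LiS 2 (\<mu> * x) (a \<epsilon>) / b \<epsilon> = - (x / (c\<^sup>2 * \<epsilon>) * Li 2 (qexp (x / (w - \<epsilon> * \<phi>)))) +
      2 * (w - \<epsilon> * \<phi>) / (c ^ 3 * \<epsilon>) * Li 3 (qexp (x / (w - \<epsilon> * \<phi>)))"
    unfolding LiS_def c_def[symmetric] a' s unfolding b a_def a'_def[symmetric]
    using a'(1) assms(1) lam0 c0 by (simp add: divide_simps power2_eq_square power3_eq_cube) (simp add: algebra_simps)
  show "LiS 1 (\<mu> * x) (a \<epsilon>) = x / (w - \<epsilon> * \<phi>) * Li 1 (qexp (x / (w - \<epsilon> * \<phi>))) - Li 2 (qexp (x / (w - \<epsilon> * \<phi>))) / c"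
    unfolding LiS_def c_def[symmetric] a' s unfolding a_def a'_def[symmetric]
    using a'(1) lam0 c0 by (simp add: power2_eq_square)
qed

lemma Gc_Kg:
  assumes "v3 (\<mu> * x + a \<epsilon>) (a \<epsilon>) (b \<epsilon>) \<in> ker_dom 2 1"
  shows "Gc x (w - \<epsilon> * \<phi>) (- (2 * pi * \<i> * \<epsilon>)) = exp (Kg (\<mu> * x) (a \<epsilon>) (b \<epsilon>))"
  using Gc_scale[OF lam0, of x "w - \<epsilon> * \<phi>" "- (2 * pi * \<i> * \<epsilon>)"] Gc_eq_exp_Kg[of "\<mu> * x" "a \<epsilon>" "b \<epsilon>"] assms
  unfolding a_def b_def by (simp add: G_range_def)

text \<open>As for \<open>F\<close>, but with two difference quotients, of \<open>Li 2\<close> and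
  \<open>Li 3\<close>. In the limit the coefficients of \<open>Li 1 y0\<close> and of
  \<open>Li 2 y0\<close> cancel separately.\<close>

lemma G_star_tendsto_1: "(G_star v w \<theta> \<phi> \<longlongrightarrow> 1) F0"
proof -
  define y where "y \<epsilon> = qexp (u \<epsilon>)" for \<epsilon>
  define y0 where "y0 = qexp (v / w)"
  define err where "err \<epsilon> = W 2 1 1 (v3 (z \<epsilon> + a \<epsilon>) (a \<epsilon>) (b \<epsilon>)) -
      (W 2 0 2 (v3 (z \<epsilon> + a \<epsilon>) (a \<epsilon>) (a \<epsilon>)) / b \<epsilon> - W 2 0 1 (v3 (z \<epsilon> + a \<epsilon>) (a \<epsilon>) (a \<epsilon>)) / 2)" for \<epsilon>
  define h where "h \<epsilon> = ((v - \<epsilon> * \<theta>) / c\<^sup>2) * ((Li 2 (y \<epsilon>) - Li 2 y0) / \<epsilon>)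
     - (2 * (w - \<epsilon> * \<phi>) / c ^ 3) * ((Li 3 (y \<epsilon>) - Li 3 y0) / \<epsilon>)
     + 1 / 2 * (u \<epsilon> * Li 1 (y \<epsilon>) - Li 2 (y \<epsilon>) / c)
     + 2 / c * (A + 1 / 4) * Li 2 y0 - v / w * (A + 1 / 2) * Li 1 y0 - err \<epsilon>" for \<epsilon>
  have za: "((\<lambda>\<epsilon>. z \<epsilon> + a \<epsilon>) \<longlongrightarrow> \<mu> * v + \<mu> * w) F0" by (intro tendsto_add lims)
  have err: "(err \<longlongrightarrow> 0) F0"
    unfolding err_def by (rule expansion(2)[OF dom_za(1) za])
  have "(h \<longlongrightarrow> ((v - 0 * \<theta>) / c\<^sup>2) * (c * Li 1 y0 * (c * A / w)) - (2 * (w - 0 * \<phi>) / c ^ 3) * (c * Li 2 y0 * (c * A / w))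
     + 1 / 2 * (v / w * Li 1 y0 - Li 2 y0 / c) + 2 / c * (A + 1 / 4) * Li 2 y0 - v / w * (A + 1 / 2) * Li 1 y0 - 0) F0"
    unfolding h_def y_def y0_def
    by (intro tendsto_add tendsto_diff tendsto_mult tendsto_minus tendsto_divide tendsto_const tendsto_ident_at err lim_u
        Li_lim[of 0, folded One_nat_def] Li_lim[of 1, unfolded Suc_1]
        Li_quotient[of 1, unfolded Suc_1] Li_quotient[of 2, simplified Suc_numeral semiring_norm]) (use c0 in auto)
  also have "((v - 0 * \<theta>) / c\<^sup>2) * (c * Li 1 y0 * (c * A / w)) - (2 * (w - 0 * \<phi>) / c ^ 3) * (c * Li 2 y0 * (c * A / w))
     + 1 / 2 * (v / w * Li 1 y0 - Li 2 y0 / c) + 2 / c * (A + 1 / 4) * Li 2 y0 - v / w * (A + 1 / 2) * Li 1 y0 - 0 = 0"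
    using c0 w0 by (simp add: divide_simps power2_eq_square power3_eq_cube) (simp add: algebra_simps)
  finally have "((\<lambda>\<epsilon>. exp (h \<epsilon>)) \<longlongrightarrow> exp 0) F0" by (rule tendsto_exp)
  moreover have "\<forall>\<^sub>F \<epsilon> in F0. exp (h \<epsilon>) = G_star v w \<theta> \<phi> \<epsilon>"
    using ev_ker ev_admissible ev_u ev_nonzero expansion(1)[OF dom_za(1) za]
  proof eventually_elim
    case (elim \<epsilon>)
    have W: "W 2 0 k (v3 (z \<epsilon> + a \<epsilon>) (a \<epsilon>) (a \<epsilon>)) = LiS k (z \<epsilon>) (a \<epsilon>)" if "k \<ge> 1" for k
      by (rule W_2_0_Li[OF _ _ _ that]) (use elim in \<open>auto simp: z_over_a ker_dom_def\<close>)
    have W2: "W 2 0 2 (v3 (z \<epsilon> + a \<epsilon>) (a \<epsilon>) (a \<epsilon>)) / b \<epsilon> = - ((v - \<epsilon> * \<theta>) / (c\<^sup>2 * \<epsilon>) * Li 2 (y \<epsilon>)) +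
        2 * (w - \<epsilon> * \<phi>) / (c ^ 3 * \<epsilon>) * Li 3 (y \<epsilon>)"
      unfolding y_def u_def LiS_quotient(1)[OF elim(4) conjunct2[OF elim(3)], symmetric]
      using W[of 2] by (simp add: z_def)
    have W1: "W 2 0 1 (v3 (z \<epsilon> + a \<epsilon>) (a \<epsilon>) (a \<epsilon>)) = u \<epsilon> * Li 1 (y \<epsilon>) - Li 2 (y \<epsilon>) / c"
      unfolding y_def u_def LiS_quotient(2)[OF elim(4) conjunct2[OF elim(3)], symmetric]
      using W[of 1] by (simp add: z_def)
    have "Kg (z \<epsilon>) (a \<epsilon>) (b \<epsilon>) = (v - \<epsilon> * \<theta>) / (c\<^sup>2 * \<epsilon>) * Li 2 (y \<epsilon>) -
        2 * (w - \<epsilon> * \<phi>) / (c ^ 3 * \<epsilon>) * Li 3 (y \<epsilon>) + 1 / 2 * (u \<epsilon> * Li 1 (y \<epsilon>) - Li 2 (y \<epsilon>) / c) - err \<epsilon>"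
      unfolding Kg_def err_def W1 W2 by simp
    then have "h \<epsilon> = Kg (z \<epsilon>) (a \<epsilon>) (b \<epsilon>) + Q_G v w \<theta> \<phi> \<epsilon>"
      unfolding h_def Q_G_c y0_def[symmetric] quotient_difference by simp
    moreover have "Gc (v - \<epsilon> * \<theta>) (w - \<epsilon> * \<phi>) (- (2 * pi * \<i> * \<epsilon>)) = exp (Kg (z \<epsilon>) (a \<epsilon>) (b \<epsilon>))"
      unfolding z_def using elim(5) by (intro Gc_Kg) (simp add: z_def)
    ultimately show ?case
      unfolding G_star_eq[OF elim(2)] by (simp add: exp_add)
  qed
  ultimately show ?thesis by (simp add: Lim_transform_eventually)
qed

text \<open>At \<open>z = 0\<close> the arguments of the polylogarithms do not depend on \<epsilon>,
  so that the expansion and \<open>Q_G\<close> cancel exactly and only the error term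
  remains.\<close>

lemma G_star_0_tendsto_1: "(G_star 0 w 0 \<phi> \<longlongrightarrow> 1) F0"
proof -
  define err where "err \<epsilon> = W 2 1 1 (v3 (a \<epsilon>) (a \<epsilon>) (b \<epsilon>)) -
      (W 2 0 2 (v3 (a \<epsilon>) (a \<epsilon>) (a \<epsilon>)) / b \<epsilon> - W 2 0 1 (v3 (a \<epsilon>) (a \<epsilon>) (a \<epsilon>)) / 2)" for \<epsilon>
  have "(err \<longlongrightarrow> 0) F0"
    unfolding err_def by (rule expansion(2)[OF dom_za(2) lims(2)])
  then have "((\<lambda>\<epsilon>. exp (- err \<epsilon>)) \<longlongrightarrow> exp (- 0)) F0" by (intro tendsto_exp tendsto_minus)
  moreover have "\<forall>\<^sub>F \<epsilon> in F0. exp (- err \<epsilon>) = G_star 0 w 0 \<phi> \<epsilon>"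
    using ev_ker ev_admissible ev_u ev_nonzero expansion(1)[OF dom_za(2) lims(2)]
  proof eventually_elim
    case (elim \<epsilon>)
    have W: "W 2 0 k (v3 (a \<epsilon>) (a \<epsilon>) (a \<epsilon>)) = LiS k (\<mu> * 0) (a \<epsilon>)" if "k \<ge> 1" for k
      using W_2_0_Li_at_0[OF _ that, of "a \<epsilon>"] elim(1) by (simp add: ker_dom_def)
    have W2: "W 2 0 2 (v3 (a \<epsilon>) (a \<epsilon>) (a \<epsilon>)) / b \<epsilon> = 2 * (w - \<epsilon> * \<phi>) / (c ^ 3 * \<epsilon>) * Li 3 1"
      using LiS_quotient(1)[OF elim(4) conjunct2[OF elim(3)], of 0] W[of 2] by simp
    have W1: "W 2 0 1 (v3 (a \<epsilon>) (a \<epsilon>) (a \<epsilon>)) = of_real pi * \<i> / 12"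
      using LiS_quotient(2)[OF elim(4) conjunct2[OF elim(3)], of 0] W[of 1]
      by (simp add: Li_2_1 c_def complex_eq_iff Re_divide Im_divide power2_eq_square)
    have "Kg 0 (a \<epsilon>) (b \<epsilon>) + Q_G 0 w 0 \<phi> \<epsilon> = - err \<epsilon>"
      unfolding Kg_def err_def W2 W1 Q_G_at_0 c_def by (simp add: mult_ac)
    moreover have "Gc 0 (w - \<epsilon> * \<phi>) (- (2 * pi * \<i> * \<epsilon>)) = exp (Kg 0 (a \<epsilon>) (b \<epsilon>))"
      using Gc_Kg[of 0 \<epsilon>] elim(5) by simp
    ultimately show ?case
      unfolding G_star_eq[OF elim(2)] by (simp flip: exp_add)
  qed
  ultimately show ?thesis by (simp add: Lim_transform_eventually)
qed

lemma sol_D_tendsto_1: "(sol_D v w \<theta> \<phi> \<longlongrightarrow> 1) F0"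
proof -
  have "((\<lambda>\<epsilon>. G_star v w \<theta> \<phi> \<epsilon> * inverse (G_star 0 w 0 \<phi> \<epsilon>)) \<longlongrightarrow> 1 * inverse 1) F0"
    by (intro tendsto_mult tendsto_inverse G_star_tendsto_1 G_star_0_tendsto_1) simp
  then show ?thesis unfolding sol_D_def[abs_def] by simp
qed

end

section \<open>From local sectors to closed subsectors\<close>

lemma half_plane_ray: "\<epsilon> \<in> half_plane (ray z) \<Longrightarrow> z \<noteq> 0 \<Longrightarrow> Re (\<epsilon> / z) > 0"
  unfolding half_plane_def ray_def by auto

lemma small_perturbation_pos: "x > (0 :: real) \<Longrightarrow> \<forall>\<^sub>F \<eta> in at_right 0. x + \<eta> * y > 0"
proof -
  assume "x > 0"
  have "((\<lambda>\<eta>. x + \<eta> * y) \<longlongrightarrow> x + 0 * y) (at_right 0)" by (intro tendsto_intros)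
  with order_tendstoD(1)[OF this, of 0] \<open>x > 0\<close> show ?thesis by simp
qed

text \<open>If \<epsilon> lies in the half-plane about \<open>v\<close>, the rotation taking
  \<open>v\<close> to \<open>\<i>\<close> satisfies the conditions up to
  \<open>Re (\<mu> * v) = 0\<close>. If it lies in the one about \<open>v - w\<close>, the rotation
  taking \<open>w - v\<close> to \<open>- \<i>\<close> fails only by
  \<open>Re (\<mu> * v) = Re (\<mu> * w)\<close>. A small tilt \<eta> makes all inequalities
  strict.\<close>

lemma small_parameter_exists:
  assumes M: "(v, w) \<in> M_plus" and \<epsilon>: "\<epsilon> \<in> V_region v w 0"
  obtains \<mu> where "0 < Re (\<mu> * v)" "Re (\<mu> * v) < Re (\<mu> * w)" "Re (- (\<i> * \<mu> * \<epsilon>)) > 0"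
proof -
  define u where "u = v / w"
  have w: "w \<noteq> 0" and u: "Im u > 0" using M by (auto simp: M_plus_def u_def)
  have v: "v = u * w" "u \<noteq> 0" "u \<noteq> 1" using w u by (auto simp: u_def)
  have pos: "\<forall>\<^sub>F \<eta> :: real in at_right 0. \<eta> > 0" by (rule eventually_at_right_less)
  consider "Re (\<epsilon> / v) > 0" | "Re (\<epsilon> / (v - w)) > 0"
    using \<epsilon> half_plane_ray[of \<epsilon> v] half_plane_ray[of \<epsilon> "v - w"] v w
    by (fastforce simp: V_region_def ell_def)
  then show thesis
  proof cases
    case 1
    define p where "p = 1 / u"
    define e where "e = \<epsilon> / v"
    have "Im p < 0" using u by (simp add: p_def Im_divide sum_power2_gt_zero_iff)
    then have "\<forall>\<^sub>F \<eta> in at_right 0. \<eta> > 0 \<and> Re e + \<eta> * Im e > 0 \<and> - Im p + \<eta> * (Re p - 1) > 0"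
      using 1 by (intro eventually_conj pos small_perturbation_pos) (auto simp: e_def)
    then obtain \<eta> where \<eta>: "\<eta> > 0" "Re e + \<eta> * Im e > 0" "- Im p + \<eta> * (Re p - 1) > 0"
      using eventually_happens'[OF trivial_limit_at_right_real] by blast
    define \<mu> where "\<mu> = Complex \<eta> 1 / v"
    have "\<mu> * v = Complex \<eta> 1" using v w by (simp add: \<mu>_def)
    moreover have "\<mu> * w = Complex \<eta> 1 * p" using v w by (simp add: \<mu>_def p_def)
    moreover have "- (\<i> * \<mu> * \<epsilon>) = - (\<i> * Complex \<eta> 1) * e" by (simp add: \<mu>_def e_def)
    ultimately have "Re (\<mu> * v) = \<eta>" "Re (\<mu> * w) = \<eta> * Re p - Im p"
      "Re (- (\<i> * \<mu> * \<epsilon>)) = Re e + \<eta> * Im e" by (simp_all only:) simp_all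
    with \<eta> show thesis by (intro that[of \<mu>]) (simp_all add: right_diff_distrib)
  next
    case 2
    define p where "p = u / (1 - u)"
    define e where "e = \<epsilon> / (v - w)"
    have "Im p > 0"
    proof -
      have "(Re (1 - u))\<^sup>2 + (Im (1 - u))\<^sup>2 > 0" using u by (simp add: sum_power2_gt_zero_iff)
      moreover have "Im u * Re (1 - u) - Re u * Im (1 - u) = Im u" by (simp add: algebra_simps)
      ultimately show ?thesis using u unfolding p_def Im_divide by simp
    qed
    then have "\<forall>\<^sub>F \<eta> in at_right 0. \<eta> > 0 \<and> Re e + \<eta> * (- Im e) > 0 \<and> Im p + \<eta> * Re p > 0"
      using 2 by (intro eventually_conj pos small_perturbation_pos) (auto simp: e_def)
    then obtain \<eta> where \<eta>: "\<eta> > 0" "Re e + \<eta> * (- Im e) > 0" "Im p + \<eta> * Re p > 0"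
      using eventually_happens'[OF trivial_limit_at_right_real] by blast
    define \<mu> where "\<mu> = Complex \<eta> (- 1) / (w - v)"
    have wv: "w - v = (1 - u) * w" "1 - u \<noteq> 0" using v by (simp_all add: algebra_simps)
    have "\<mu> * (w - v) = Complex \<eta> (- 1)" using wv w by (simp add: \<mu>_def)
    moreover have "\<mu> * v = Complex \<eta> (- 1) * p" 
    proof -
      have "v / (w - v) = (u * w) / ((1 - u) * w)" using v(1) wv(1) by metis
      also have "\<dots> = p" using w by (simp add: p_def)
      finally have "v / (w - v) = p" .
      moreover have "\<mu> * v = Complex \<eta> (- 1) * (v / (w - v))" by (simp add: \<mu>_def)
      ultimately show ?thesis by simp
    qed
    moreover have "- (\<i> * \<mu> * \<epsilon>) = \<i> * Complex \<eta> (- 1) * e"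
    proof -
      have *: "e = - (\<epsilon> / (w - v))" unfolding e_def using divide_minus_right[of \<epsilon> "w - v"] by simp
      show ?thesis unfolding * \<mu>_def by simp
    qed
    ultimately have "Re (\<mu> * (w - v)) = \<eta>" "Re (\<mu> * v) = \<eta> * Re p + Im p"
      "Re (- (\<i> * \<mu> * \<epsilon>)) = Re e - \<eta> * Im e" by (simp_all only:) simp_all
    with \<eta> show thesis by (intro that[of \<mu>]) (simp_all add: right_diff_distrib)
  qed
qed

text \<open>The directions of a closed sector form the image of a compact interval, so that finitely
  many of the local sectors cover it. Taking for \<kappa> half the value at a direction makes that
  direction an interior one.\<close>

lemma tendsto_within_closed_subsector:
  assumes S: "closed_subsector S V"
    and loc: "\<And>\<epsilon>. \<epsilon> \<in> V \<Longrightarrow> \<exists>\<mu>. Re (\<mu> * \<epsilon>) > 0 \<and> (\<forall>\<kappa>>0. (f \<longlongrightarrow> l) (at 0 within {\<epsilon>. \<kappa> * norm \<epsilon> \<le> Re (\<mu> * \<epsilon>)}))"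
  shows "(f \<longlongrightarrow> l) (at (0 :: complex) within S)"
proof -
  obtain \<alpha> \<beta> where S': "S = closed_sector \<alpha> \<beta>" "S \<subseteq> V" using S by (auto simp: closed_subsector_def)
  define R where "R = (\<lambda>(\<mu>, \<kappa>). {\<epsilon>. \<kappa> * norm \<epsilon> \<le> Re (\<mu> * \<epsilon>)})"
  define U where "U = (\<lambda>(\<mu>, \<kappa>). {t. \<kappa> < Re (\<mu> * cis t)})"
  define C where "C = {(\<mu>, \<kappa>). (f \<longlongrightarrow> l) (at 0 within R (\<mu>, \<kappa>))}"
  have "\<exists>d\<in>C. t \<in> U d" if t: "t \<in> {\<alpha>..\<beta>}" for t
  proof -
    have "cis t \<in> S" unfolding S' closed_sector_def using t by (force intro: exI[of _ 1])
    with S' loc obtain \<mu> where \<mu>: "Re (\<mu> * cis t) > 0" "\<forall>\<kappa>>0. (f \<longlongrightarrow> l) (at 0 within {\<epsilon>. \<kappa> * norm \<epsilon> \<le> Re (\<mu> * \<epsilon>)})"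
      by blast
    then have "(\<mu>, Re (\<mu> * cis t) / 2) \<in> C"
      unfolding C_def R_def mem_Collect_eq prod.case using half_gt_zero by blast
    moreover have "t \<in> U (\<mu>, Re (\<mu> * cis t) / 2)" using \<mu>(1) by (simp add: U_def del: times_complex.sel)
    ultimately show ?thesis by blast
  qed
  then have "{\<alpha>..\<beta>} \<subseteq> (\<Union>d\<in>C. U d)" by auto
  moreover have "open (U d)" for d
    unfolding U_def by (cases d) (auto intro!: open_Collect_less continuous_intros simp del: times_complex.sel)
  ultimately obtain D where D: "D \<subseteq> C" "finite D" "{\<alpha>..\<beta>} \<subseteq> (\<Union>d\<in>D. U d)"
    using compactE_image[OF compact_Icc, of C U \<alpha> \<beta>] by metis
  have "(f \<longlongrightarrow> l) (at 0 within (\<Union>d\<in>D. R d))" using D(2,1)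
  proof (induction D)
    case (insert d D)
    have "(f \<longlongrightarrow> l) (at 0 within R d)" using insert.prems by (cases d) (auto simp: C_def)
    with insert show ?case by (simp add: Lim_Un)
  qed simp
  moreover have "S \<subseteq> (\<Union>d\<in>D. R d)"
  proof
    fix \<epsilon> assume "\<epsilon> \<in> S"
    then obtain r t where e: "\<epsilon> = of_real r * cis t" "r > 0" "t \<in> {\<alpha>..\<beta>}" unfolding S' closed_sector_def by auto
    with D(3) obtain \<mu> \<kappa> where d: "(\<mu>, \<kappa>) \<in> D" "t \<in> U (\<mu>, \<kappa>)" by auto
    have "r * \<kappa> \<le> r * Re (\<mu> * cis t)" using d(2) e(2) by (simp add: U_def del: times_complex.sel)
    also have "\<dots> = Re (of_real r * (\<mu> * cis t))" by (subst times_complex.sel) simp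
    also have "of_real r * (\<mu> * cis t) = \<mu> * \<epsilon>" by (simp add: e)
    finally have "\<epsilon> \<in> R (\<mu>, \<kappa>)" using e by (simp add: R_def norm_mult mult.commute del: times_complex.sel)
    with d(1) show "\<epsilon> \<in> (\<Union>d\<in>D. R d)" by blast
  qed
  ultimately show ?thesis by (rule tendsto_within_subset)
qed

lemma limits_at_zero:
  assumes M: "(v, w) \<in> M_plus" and S: "closed_subsector S (V_region v w 0)"
  shows "(sol_B v w \<theta> \<phi> \<longlongrightarrow> 1) (at 0 within S)" "(sol_D v w \<theta> \<phi> \<longlongrightarrow> 1) (at 0 within S)"
proof -
  have *: "\<exists>\<mu>. Re (\<mu> * \<epsilon>) > 0 \<and> (\<forall>\<kappa>>0. (sol_B v w \<theta> \<phi> \<longlongrightarrow> 1) (at 0 within {\<epsilon>. \<kappa> * norm \<epsilon> \<le> Re (\<mu> * \<epsilon>)}) \<and>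
      (sol_D v w \<theta> \<phi> \<longlongrightarrow> 1) (at 0 within {\<epsilon>. \<kappa> * norm \<epsilon> \<le> Re (\<mu> * \<epsilon>)}))" if \<epsilon>: "\<epsilon> \<in> V_region v w 0" for \<epsilon>
  proof -
    obtain \<mu> where \<mu>: "0 < Re (\<mu> * v)" "Re (\<mu> * v) < Re (\<mu> * w)" "Re (- (\<i> * \<mu> * \<epsilon>)) > 0"
      using small_parameter_exists[OF M \<epsilon>] .
    have "(sol_B v w \<theta> \<phi> \<longlongrightarrow> 1) (at 0 within {\<epsilon>. \<kappa> * norm \<epsilon> \<le> Re (- (\<i> * \<mu>) * \<epsilon>)}) \<and>
      (sol_D v w \<theta> \<phi> \<longlongrightarrow> 1) (at 0 within {\<epsilon>. \<kappa> * norm \<epsilon> \<le> Re (- (\<i> * \<mu>) * \<epsilon>)})" if "\<kappa> > 0" for \<kappa>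
    proof -
      interpret small_parameter v w \<theta> \<phi> \<mu> \<kappa> "{\<epsilon>. \<kappa> * norm \<epsilon> \<le> Re (- (\<i> * \<mu>) * \<epsilon>)}"
        using M \<mu> that by unfold_locales auto
      show ?thesis using sol_B_tendsto_1 sol_D_tendsto_1 by blast
    qed
    moreover have "Re (- (\<i> * \<mu>) * \<epsilon>) > 0" using \<mu>(3) by simp
    ultimately show ?thesis by (intro exI[of _ "- (\<i> * \<mu>)"]) blast
  qed
  show "(sol_B v w \<theta> \<phi> \<longlongrightarrow> 1) (at 0 within S)" by (rule tendsto_within_closed_subsector[OF S]) (use * in blast)
  show "(sol_D v w \<theta> \<phi> \<longlongrightarrow> 1) (at 0 within S)" by (rule tendsto_within_closed_subsector[OF S]) (use * in blast)
qed

subsection \<open>Reflection formulas\<close>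

text \<open>No factor along the whole orbit of \<open>z\<close> under shifts by \<open>a\<close>
  vanishes. Unlike membership in a strip, this survives shifts by \<open>a\<close> and by
  \<open>b\<close> and the passage from \<open>b\<close> to \<open>- b\<close>.\<close>

definition regular :: "complex \<Rightarrow> complex \<Rightarrow> complex \<Rightarrow> bool" where
  "regular z a b \<longleftrightarrow> (\<forall>j. xfac z a b j \<noteq> 0)"

lemma regular_shift_a: "regular (z + a) a b \<longleftrightarrow> regular z a b"
proof -
  have "xfac (z + a) a b j = xfac z a b (j + 1)" for j
    by (simp add: xfac_def algebra_simps)
  moreover have "(\<forall>j. xfac z a b (j + 1) \<noteq> 0) \<longleftrightarrow> (\<forall>j. xfac z a b j \<noteq> 0)"
    by (metis diff_add_cancel)
  ultimately show ?thesis by (simp add: regular_def)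
qed

lemma regular_shift_b:
  assumes "b \<noteq> 0"
  shows "regular (z + b) a b \<longleftrightarrow> regular z a b"
proof -
  have "qexp ((z + b + of_int j * a) / b) = qexp ((z + of_int j * a) / b)" for j
    using assms qexp_add[of "(z + of_int j * a) / b" 1] by (simp add: add_divide_distrib add_ac)
  then show ?thesis by (simp add: regular_def xfac_def)
qed

lemma regular_minus_b: "regular z a (- b) \<longleftrightarrow> regular z a b"
  by (simp add: regular_def xfac_def qexp_minus)

lemma regular_neq_1: "regular z a b \<Longrightarrow> qexp (z / b) \<noteq> 1"
  unfolding regular_def by (auto simp: xfac_def dest: spec[of _ 0])

lemma regular_Fc_nonzero:
  assumes "a / b \<notin> \<real>\<^sub>\<le>\<^sub>0" "regular z a b"
  shows "Fc z a b \<noteq> 0"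
proof -
  obtain n where "v3 z a b \<in> n_dom n" using n_dom_exists assms(1) FG_domain_iff by metis
  from Fc_Gc_nonzero(1)[OF this] assms(2) show ?thesis by (simp add: regular_def)
qed

text \<open>Carries an assertion from the strip of convergence, where it can be read off the
  integrals, to every point satisfying \<open>R\<close>.\<close>

lemma int_shift_iff:
  fixes a z :: complex
  assumes R: "\<And>z. R (z + a) \<longleftrightarrow> R z" and P: "\<And>z. R z \<Longrightarrow> P (z + a) \<longleftrightarrow> P z" and z: "R z"
  shows "P (z + of_int n * a) \<longleftrightarrow> P z"
proof -
  have "R (z + of_int n * a) \<and> (P (z + of_int n * a) \<longleftrightarrow> P z)"
  proof (induction n rule: int_induct[of _ 0])
    case base
    then show ?case using z by simp
  next
    case (step1 n)
    have "z + of_int (n + 1) * a = (z + of_int n * a) + a" by (simp add: algebra_simps)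
    then show ?case using step1 R P by metis
  next
    case (step2 n)
    have "z + of_int n * a = (z + of_int (n - 1) * a) + a" by (simp add: algebra_simps)
    then show ?case using step2 R P by metis
  qed
  then show ?thesis by blast
qed

lemma exists_int_mult_gt:
  assumes "(k :: real) \<noteq> 0"
  shows "\<exists>m :: int. C < of_int m * k"
proof (cases "k > 0")
  case True
  have "C / k < of_int (\<lfloor>C / k\<rfloor> + 1)" by linarith
  with True show ?thesis by (metis pos_divide_less_eq)
next
  case False
  have "of_int (\<lceil>C / k\<rceil> - 1) < C / k" by linarith
  with False assms show ?thesis by (metis neg_less_divide_eq linorder_neqE_linordered_idom)
qed

text \<open>Rotating \<open>a\<close> off the real axis far enough brings a translate of \<open>z\<close> into the strip of convergence.\<close>

lemma strip_exists:
  assumes z: "Im (z / a) > 0" and b: "Im (b / a) \<noteq> 0"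
  obtains m :: int and \<mu> where "\<mu> \<noteq> 0" "Re (\<mu> * (z + of_int m * a)) = 1 / 2" "Re (\<mu> * a) = 1" "Re (\<mu> * b) > 0"
proof -
  have a: "a \<noteq> 0" using z by auto
  \<comment> \<open>Once \<open>T\<close> is chosen so that
    \<open>Re (\<mu> * (z + m * a)) = 1 / 2\<close>, the number \<open>Re (\<mu> * b)\<close> is
    affine in \<open>m\<close> with slope \<open>k\<close>. As the slope is nonzero, some integer
    \<open>m\<close> makes it positive.\<close>
  define k where "k = - (Im (b / a) / Im (z / a))"
  have "k \<noteq> 0" using z b by (simp add: k_def)
  then obtain m :: int where m: "- Re (b / a) - (Re (z / a) - 1 / 2) * k < of_int m * k"
    using exists_int_mult_gt by blast
  define T where "T = (Re (z / a) + of_int m - 1 / 2) / Im (z / a)"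
  define \<mu> where "\<mu> = Complex 1 T / a"
  have "\<mu> * (z + of_int m * a) = Complex 1 T * (z / a + of_int m)" using a by (simp add: \<mu>_def field_simps)
  then have "Re (\<mu> * (z + of_int m * a)) = Re (Complex 1 T * (z / a + of_int m))" by (simp only:)
  also have "\<dots> = Re (z / a) + of_int m - T * Im (z / a)" by simp
  also have "\<dots> = 1 / 2" using z by (simp add: T_def)
  finally have 1: "Re (\<mu> * (z + of_int m * a)) = 1 / 2" .
  have "\<mu> * b = Complex 1 T * (b / a)" by (simp add: \<mu>_def)
  then have "Re (\<mu> * b) = Re (Complex 1 T * (b / a))" by (simp only:)
  also have "\<dots> = Re (b / a) - T * Im (b / a)" by (simp del: times_divide_eq_right)
  also have "\<dots> = Re (b / a) + (Re (z / a) + of_int m - 1 / 2) * k" by (simp add: T_def k_def)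
  also have "\<dots> > 0" using m by (simp add: algebra_simps)
  finally have 2: "Re (\<mu> * b) > 0" .
  have 3: "\<mu> * a = Complex 1 T" using a by (simp add: \<mu>_def)
  have "\<mu> \<noteq> 0" using a by (simp add: \<mu>_def complex_eq_iff[of "Complex 1 T"])
  from that[OF this 1 _ 2] 3 show thesis by simp
qed

lemma nonreal_ratio:
  assumes "Im (b / a) \<noteq> 0"
  shows "a / b \<notin> \<real>\<^sub>\<le>\<^sub>0"
proof
  assume "a / b \<in> \<real>\<^sub>\<le>\<^sub>0"
  then have "inverse (a / b) \<in> \<real>" by (intro Reals_inverse) (auto dest: nonpos_Reals_subset_Reals[THEN subsetD])
  then show False using assms by (simp add: complex_is_Real_iff)
qed

lemma qexp_shift: "a \<noteq> 0 \<Longrightarrow> qexp ((z + of_int m * a) / a) = qexp (z / a)"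
  by (simp add: add_divide_distrib qexp_add)

lemma qexp_shift_1: "a \<noteq> 0 \<Longrightarrow> qexp ((z + a) / a) = qexp (z / a)"
  using qexp_shift[of a z 1] by simp

lemma Im_pos_neq_1: "Im u > 0 \<Longrightarrow> qexp u \<noteq> 1"
  using norm_qexp_less_1[of u] by auto

text \<open>The construction of \<open>Fc\<close> treats \<open>a\<close> and \<open>b\<close>
  differently, so that this shift has to be proved. It holds where the integrals converge, and the
  shift by \<open>a\<close> multiplies both sides by the same factor, since
  \<open>qexp (z / b)\<close> has period \<open>b\<close>.\<close>

lemma Fc_shift_b:
  assumes z: "Im (z / a) > 0" and b: "Im (b / a) \<noteq> 0" and r: "regular z a b"
  shows "Fc (z + b) a b = Fc z a b / (1 - qexp (z / a))"
proof -
  have a0: "a \<noteq> 0" and b0: "b \<noteq> 0" using z b by auto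
  note ab = nonreal_ratio[OF b]
  define P where "P z \<longleftrightarrow> Fc (z + b) a b * (1 - qexp (z / a)) = Fc z a b" for z
  have step: "P (z + a) \<longleftrightarrow> P z" if "regular z a b" for z
  proof -
    have x: "qexp (z / b) \<noteq> 1" using regular_neq_1[OF that] .
    have x': "qexp ((z + b) / b) \<noteq> 1" "qexp ((z + b) / b) = qexp (z / b)" using x qexp_shift_1[OF b0, of z] by simp_all
    have "Fc (z + a + b) a b = Fc (z + b) a b / (1 - qexp (z / b))"
      using Fc_shift_a[OF ab x'(1)] x'(2) by (simp add: add_ac)
    then show ?thesis unfolding P_def Fc_shift_a[OF ab x] qexp_shift_1[OF a0]
      using x by (simp add: divide_eq_eq)
  qed
  obtain m \<mu> where m: "\<mu> \<noteq> 0" "Re (\<mu> * (z + of_int m * a)) = 1 / 2" "Re (\<mu> * a) = 1" "Re (\<mu> * b) > 0"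
    using strip_exists[OF z b] .
  define Z where "Z = z + of_int m * a"
  have 1: "Fc Z a b = exp (Kf (\<mu> * Z) (\<mu> * a) (\<mu> * b))"
    using m Fc_eq_exp_Kf[of "\<mu> * Z" "\<mu> * a" "\<mu> * b"] Fc_scale[OF m(1), of Z a b] unfolding Z_def[symmetric]
    by (simp add: ker_dom_def)
  have 2: "Fc (Z + b) a b = exp (Kf (\<mu> * Z + \<mu> * b) (\<mu> * a) (\<mu> * b))"
    using m Fc_eq_exp_Kf[of "\<mu> * Z + \<mu> * b" "\<mu> * a" "\<mu> * b"] Fc_scale[OF m(1), of "Z + b" a b]
    unfolding Z_def[symmetric] by (simp add: ker_dom_def distrib_left)
  have "exp (Kf (\<mu> * Z + \<mu> * b) (\<mu> * a) (\<mu> * b)) * (1 - qexp (\<mu> * Z / (\<mu> * a))) = exp (Kf (\<mu> * Z) (\<mu> * a) (\<mu> * b))"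
    by (rule exp_Kf_shift_b) (use m in \<open>simp_all add: Z_def\<close>)
  then have "P Z" using m(1) by (simp add: P_def 1 2)
  then have "P z" unfolding Z_def
    using int_shift_iff[of "\<lambda>z. regular z a b" a P z m, OF regular_shift_a step r] by simp
  moreover have "qexp (z / a) \<noteq> 1" using Im_pos_neq_1[OF z] .
  ultimately show ?thesis by (simp add: P_def field_simps)
qed

lemma LiS_1: "a \<noteq> 0 \<Longrightarrow> LiS 1 z a = z / a * Li 1 (qexp (z / a)) - Li 2 (qexp (z / a)) / (2 * of_real pi * \<i>)"
proof -
  have s: "Suc 1 = 2" by simp
  show "a \<noteq> 0 \<Longrightarrow> LiS 1 z a = z / a * Li 1 (qexp (z / a)) - Li 2 (qexp (z / a)) / (2 * of_real pi * \<i>)"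
    unfolding LiS_def s by (simp add: power2_eq_square)
qed

text \<open>Transferred from the strip as for \<open>F\<close>, but within
  \<open>Im (z / a) > 0\<close>, where \<open>LiS 1\<close> is given by convergent series.\<close>

lemma Gc_shift_b:
  assumes z: "Im (z / a) > 0" and b: "Im (b / a) \<noteq> 0" and r: "regular z a b"
  shows "Gc (z + b) a b = Gc z a b * exp (- LiS 1 z a)"
proof -
  have a0: "a \<noteq> 0" and b0: "b \<noteq> 0" using z b by auto
  note ab = nonreal_ratio[OF b]
  define R where "R z \<longleftrightarrow> regular z a b \<and> Im (z / a) > 0" for z
  define P where "P z \<longleftrightarrow> Gc (z + b) a b = Gc z a b * exp (- LiS 1 z a)" for z
  have R: "R (z + a) \<longleftrightarrow> R z" for z
    using a0 by (simp add: R_def regular_shift_a add_divide_distrib)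
  have step: "P (z + a) \<longleftrightarrow> P z" if "R z" for z
  proof -
    have z: "regular z a b" "Im (z / a) > 0" using that by (auto simp: R_def)
    have za: "regular (z + a) a b" "Im ((z + a) / a) > 0" using that R[of z] by (auto simp: R_def)
    define F where "F = Fc (z + a) a b"
    have F: "F \<noteq> 0" unfolding F_def by (rule regular_Fc_nonzero[OF ab za(1)])
    have y: "qexp (z / a) \<noteq> 1" "norm (qexp (z / a)) < 1"
      using Im_pos_neq_1[OF z(2)] norm_qexp_less_1[OF z(2)] by auto
    have F': "Fc (z + b + a) a b = F / (1 - qexp (z / a))"
      using Fc_shift_b[OF za(2) b za(1)] unfolding qexp_shift_1[OF a0] F_def by (simp add: add_ac)
    then have F'0: "Fc (z + b + a) a b \<noteq> 0" using F y by simp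
    have G: "Gc z a b = Gc (z + a) a b * F" unfolding F_def using Gc_shift_a[OF ab] F F_def by blast
    have G': "Gc (z + b) a b = Gc (z + a + b) a b * (F / (1 - qexp (z / a)))"
      using Gc_shift_a[OF ab F'0] unfolding F' by (simp add: add_ac)
    \<comment> \<open>The shift by \<open>a\<close> adds \<open>Li 1\<close> to the exponent, that
      is, contributes the factor \<open>1 - qexp (z / a)\<close>: exactly what the shift of
      \<open>F\<close> by \<open>b\<close> produces on the other side.\<close>
    have S: "LiS 1 (z + a) a = LiS 1 z a + Li 1 (qexp (z / a))"
      unfolding LiS_1[OF a0] qexp_shift_1[OF a0] using a0 by (simp add: add_divide_distrib distrib_right)
    have "exp (- LiS 1 (z + a) a) = exp (- LiS 1 z a) * (1 - qexp (z / a))"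
      unfolding S using exp_Li_1[OF y(2)] by (simp add: exp_add exp_minus exp_diff divide_inverse)
    moreover have "X * (F / (1 - t)) = g * F * e \<longleftrightarrow> X = g * (e * (1 - t))" if "t \<noteq> 1" for X t g e
    proof -
      have "X * (F / (1 - t)) = g * F * e \<longleftrightarrow> F * X = F * (g * (e * (1 - t)))"
        using that by (simp add: divide_eq_eq mult_ac)
      then show ?thesis using F by simp
    qed
    ultimately show ?thesis unfolding P_def G G' using y(1) by simp
  qed
  obtain m \<mu> where m: "\<mu> \<noteq> 0" "Re (\<mu> * (z + of_int m * a)) = 1 / 2" "Re (\<mu> * a) = 1" "Re (\<mu> * b) > 0"
    using strip_exists[OF z b] .
  define Z where "Z = z + of_int m * a"
  have 1: "Gc Z a b = exp (Kg (\<mu> * Z) (\<mu> * a) (\<mu> * b))"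
    using m Gc_eq_exp_Kg[of "\<mu> * Z" "\<mu> * a" "\<mu> * b"] Gc_scale[OF m(1), of Z a b] unfolding Z_def[symmetric]
    by (simp add: G_range_iff)
  have 2: "Gc (Z + b) a b = exp (Kg (\<mu> * Z + \<mu> * b) (\<mu> * a) (\<mu> * b))"
    using m Gc_eq_exp_Kg[of "\<mu> * Z + \<mu> * b" "\<mu> * a" "\<mu> * b"] Gc_scale[OF m(1), of "Z + b" a b]
    unfolding Z_def[symmetric] by (simp add: G_range_iff distrib_left)
  have Z: "Im (Z / a) > 0" using z a0 by (simp add: Z_def add_divide_distrib)
  have re: "Re (\<mu> * Z) = 1 / 2" using m(2) by (simp only: Z_def)
  have "Kg (\<mu> * Z + \<mu> * b) (\<mu> * a) (\<mu> * b) = Kg (\<mu> * Z) (\<mu> * a) (\<mu> * b) - W 2 0 1 (v3 (\<mu> * Z + \<mu> * a) (\<mu> * a) (\<mu> * a))"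
    by (rule Kg_shift_b) (use re m in linarith)+
  also have "W 2 0 1 (v3 (\<mu> * Z + \<mu> * a) (\<mu> * a) (\<mu> * a)) = LiS 1 (\<mu> * Z) (\<mu> * a)"
  proof (rule W_2_0_Li)
    show "Im (\<mu> * Z / (\<mu> * a)) > 0" using Z m(1) by simp
  qed (use re m in linarith, use re m in linarith, simp)
  also have "\<dots> = LiS 1 Z a" using m(1) a0 LiS_1[of "\<mu> * a" "\<mu> * Z"] LiS_1[of a Z] by simp
  finally have "P Z" unfolding P_def 1 2 by (simp add: exp_diff exp_minus divide_inverse)
  then have "P z" unfolding Z_def
    using int_shift_iff[of R a P z m, OF R step] r z by (simp add: R_def)
  then show ?thesis by (simp add: P_def)
qed

section \<open>Limits along vertical translates\<close>

lemma norm_power_diff_1: "norm ((1 + e) ^ n - 1) \<le> exp (real n * norm e) - (1 :: real)" for e :: complex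
proof -
  have "norm ((1 + e) ^ n - 1) \<le> (1 + norm e) ^ n - 1"
  proof (induction n)
    case (Suc n)
    have "(1 + e) ^ Suc n - 1 = (1 + e) * ((1 + e) ^ n - 1) + e" by (simp add: algebra_simps)
    also have "norm \<dots> \<le> norm (1 + e) * norm ((1 + e) ^ n - 1) + norm e" by (metis norm_mult norm_triangle_ineq)
    also have "\<dots> \<le> (1 + norm e) * ((1 + norm e) ^ n - 1) + norm e"
      using norm_triangle_ineq[of 1 e] Suc by (intro add_right_mono mult_mono) auto
    finally show ?case by (simp add: algebra_simps)
  qed simp
  also have "(1 + norm e) ^ n \<le> exp (norm e) ^ n"
    by (intro power_mono exp_ge_add_one_self) simp
  finally show ?thesis by (simp flip: exp_of_nat_mult)
qed

text \<open>By the preceding bound the error of the \<open>n\<close>-th power is controlled by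
  \<open>n\<close> times the error of the base.\<close>

lemma power_tendsto_1:
  fixes f :: "nat \<Rightarrow> complex"
  assumes "(\<lambda>n. of_nat n * (f n - 1)) \<longlonglongrightarrow> 0"
  shows "(\<lambda>n. f n ^ n) \<longlonglongrightarrow> 1"
proof (subst LIM_zero_iff[symmetric], rule Lim_null_comparison)
  show "\<forall>\<^sub>F n in sequentially. norm (f n ^ n - 1) \<le> exp (norm (of_nat n * (f n - 1))) - 1"
    using norm_power_diff_1[of "f _ - 1"] by (intro always_eventually) (simp add: norm_mult)
  have "(\<lambda>n. exp (norm (of_nat n * (f n - 1))) - 1) \<longlonglongrightarrow> exp 0 - 1"
    by (intro tendsto_diff tendsto_exp tendsto_norm_zero assms tendsto_const)
  then show "(\<lambda>n. exp (norm (of_nat n * (f n - 1))) - 1) \<longlonglongrightarrow> 0" by simp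
qed

lemma tendsto_1_of_scaled:
  fixes f :: "nat \<Rightarrow> complex"
  assumes "(\<lambda>n. of_nat n * (f n - 1)) \<longlonglongrightarrow> 0"
  shows "f \<longlonglongrightarrow> 1"
proof (subst LIM_zero_iff[symmetric], rule Lim_null_comparison)
  show "\<forall>\<^sub>F n in sequentially. norm (f n - 1) \<le> norm (of_nat n * (f n - 1))"
    unfolding eventually_sequentially
  proof (intro exI[of _ 1] allI impI)
    fix n :: nat assume "n \<ge> 1"
    then have "1 * norm (f n - 1) \<le> real n * norm (f n - 1)" by (intro mult_right_mono) auto
    then show "norm (f n - 1) \<le> norm (of_nat n * (f n - 1))" by (simp add: norm_mult)
  qed
  show "(\<lambda>n. norm (of_nat n * (f n - 1))) \<longlonglongrightarrow> 0" by (rule tendsto_norm_zero[OF assms])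
qed

lemma scaled_exp_tendsto:
  fixes k :: "nat \<Rightarrow> complex"
  assumes k: "\<And>n. norm (k n) \<le> K * exp (- (real n * y))" and y: "y > 0"
  shows "(\<lambda>n. of_nat n * (exp (k n) - 1)) \<longlonglongrightarrow> 0"
proof (rule Lim_null_comparison)
  define r where "r = exp (- y)"
  have r: "norm r < 1" using y by (simp add: r_def)
  have K: "K \<ge> 0" using order.trans[OF norm_ge_zero k[of 0]] by simp
  have k': "norm (k n) \<le> K * r ^ n" for n using k[of n] by (simp add: r_def flip: exp_of_nat_mult)
  have e: "norm (exp z - 1) \<le> exp (norm z) * norm z" for z :: complex
    using Taylor_exp_field[of z 0] by simp
  show "\<forall>\<^sub>F n in sequentially. norm (of_nat n * (exp (k n) - 1)) \<le> exp K * (K * (real n * r ^ n))"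
  proof (intro always_eventually allI)
    fix n
    have "r ^ n \<le> 1" using y by (intro power_le_one) (auto simp: r_def)
    then have "norm (k n) \<le> K" using k'[of n] mult_left_mono[of "r ^ n" 1 K] K by simp
    then have "norm (exp (k n) - 1) \<le> exp K * (K * r ^ n)"
      using e[of "k n"] k'[of n] by (intro order.trans[OF e] mult_mono) auto
    then have "real n * norm (exp (k n) - 1) \<le> real n * (exp K * (K * r ^ n))" by (rule mult_left_mono) simp
    then show "norm (of_nat n * (exp (k n) - 1)) \<le> exp K * (K * (real n * r ^ n))" by (simp add: norm_mult mult_ac)
  qed
  have "(\<lambda>n. exp K * (K * (real n * r ^ n))) \<longlonglongrightarrow> exp K * (K * 0)"
    using powser_times_n_limit_0[OF r] by (intro tendsto_intros) simp
  then show "(\<lambda>n. exp K * (K * (real n * r ^ n))) \<longlonglongrightarrow> 0" by simp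
qed

text \<open>
  Along \<open>z + n d\<close> the functions tend to \<open>1\<close>: after rotating by \<open>\<mu>\<close> this is the limit along a
  vertical line in the strip of convergence, where the integrals decay exponentially.
\<close>

locale vertical_shift =
  fixes a b d \<mu> :: complex
  assumes strip: "Re (\<mu> * a) > 0" "Re (\<mu> * b) = Re (\<mu> * a)" and vertical: "\<mu> * d = \<i>"
    and nonreal: "Im (b / a) \<noteq> 0" and r: "norm (qexp (d / b)) < 1"
    and regular_d: "\<And>z. regular z a b \<Longrightarrow> regular (z + d) a b"
begin

text \<open>Stronger than convergence to \<open>1\<close>: the product formula for \<open>G\<close>
  contains the \<open>n\<close>-th power of this value of \<open>F\<close>, and the rate makes that
  power tend to \<open>1\<close> as well.\<close>

definition decays :: "complex \<Rightarrow> bool" where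
  "decays z \<longleftrightarrow> (\<lambda>n. of_nat n * (Fc (z + of_nat n * d) a b - 1)) \<longlonglongrightarrow> 0"

lemma mu_nonzero: "\<mu> \<noteq> 0" using strip by auto

lemma mu_line: "\<mu> * (z + of_nat n * d) = \<mu> * z + \<i> * of_real (real n)"
  using vertical by (simp add: distrib_left mult.left_commute)

lemma regular_nd: "regular z a b \<Longrightarrow> regular (z + of_nat n * d) a b"
proof (induction n)
  case (Suc n)
  then have "regular (z + of_nat n * d + d) a b" by (intro regular_d) simp
  then show ?case by (simp add: algebra_simps)
qed simp

lemma decays_strip:
  assumes "0 < Re (\<mu> * z)" "Re (\<mu> * z) < 2 * Re (\<mu> * a)"
  shows "decays z"
proof -
  have d: "v3 (\<mu> * z) (\<mu> * a) (\<mu> * b) \<in> ker_dom 1 1" using assms strip unfolding ker_dom_def vector_3 mem_Collect_eq by simp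
  from W_vertical_decay[OF this] obtain y K where y: "y > 0"
    "\<And>T. norm (W 1 1 1 (v3 (\<mu> * z + \<i> * of_real T) (\<mu> * a) (\<mu> * b))) \<le> K * exp (- (T * y))"
    by blast
  have "Fc (z + of_nat n * d) a b = exp (Kf (\<mu> * z + \<i> * of_real (real n)) (\<mu> * a) (\<mu> * b))" for n
  proof -
    have "v3 (\<mu> * z + \<i> * of_real (real n)) (\<mu> * a) (\<mu> * b) \<in> ker_dom 1 1"
      using d unfolding ker_dom_def vector_3 mem_Collect_eq by simp
    from Fc_eq_exp_Kf[OF this] show ?thesis
      using Fc_scale[OF mu_nonzero, of "z + of_nat n * d" a b] unfolding mu_line by simp
  qed
  then show ?thesis
    unfolding decays_def Kf_def using scaled_exp_tendsto[OF y(2) y(1)] by (simp only:)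
qed

lemma Gc_strip_limit:
  assumes "- Re (\<mu> * a) < Re (\<mu> * z)" "Re (\<mu> * z) < 2 * Re (\<mu> * a)"
  shows "(\<lambda>n. Gc (z + of_nat n * d) a b) \<longlonglongrightarrow> 1"
proof -
  have d: "v3 (\<mu> * z + \<mu> * a) (\<mu> * a) (\<mu> * b) \<in> ker_dom 2 1"
    using assms strip unfolding ker_dom_def vector_3 mem_Collect_eq by simp
  have "((\<lambda>T. W 2 1 1 (v3 (\<mu> * z + \<mu> * a + \<i> * of_real T) (\<mu> * a) (\<mu> * b))) \<longlongrightarrow> 0) at_top"
    by (rule W_vertical_limit[OF d])
  then have "(\<lambda>n. W 2 1 1 (v3 (\<mu> * z + \<mu> * a + \<i> * of_real (real n)) (\<mu> * a) (\<mu> * b))) \<longlonglongrightarrow> 0"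
    by (rule filterlim_compose[OF _ filterlim_real_sequentially])
  then have "(\<lambda>n. exp (- W 2 1 1 (v3 (\<mu> * z + \<mu> * a + \<i> * of_real (real n)) (\<mu> * a) (\<mu> * b)))) \<longlonglongrightarrow> exp (- 0)"
    by (intro tendsto_exp tendsto_minus)
  moreover have "Gc (z + of_nat n * d) a b = exp (- W 2 1 1 (v3 (\<mu> * z + \<mu> * a + \<i> * of_real (real n)) (\<mu> * a) (\<mu> * b)))" for n
  proof -
    have "v3 (\<mu> * z + \<i> * of_real (real n)) (\<mu> * a) (\<mu> * b) \<in> G_range"
      using d unfolding G_range_def ker_dom_def vector_3 mem_Collect_eq by simp
    from Gc_eq_exp_Kg[OF this] show ?thesis
      using Gc_scale[OF mu_nonzero, of "z + of_nat n * d" a b] unfolding mu_line Kg_def by (simp add: add_ac)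
  qed
  ultimately show ?thesis by simp
qed

lemma ab: "a / b \<notin> \<real>\<^sub>\<le>\<^sub>0"
  by (rule nonreal_ratio[OF nonreal])

lemma x_shift: "qexp ((z + of_nat n * d) / b) = qexp (z / b) * qexp (d / b) ^ n"
  by (simp add: add_divide_distrib qexp_add qexp_power)

lemma x_decay: "(\<lambda>n. of_nat n * qexp ((z + of_nat n * d) / b)) \<longlonglongrightarrow> 0"
proof -
  have "(\<lambda>n. qexp (z / b) * (of_nat n * qexp (d / b) ^ n)) \<longlonglongrightarrow> qexp (z / b) * 0"
    by (intro tendsto_intros powser_times_n_limit_0[OF r])
  then show ?thesis unfolding x_shift by (simp add: mult.left_commute)
qed

lemma x_limit: "(\<lambda>n. 1 - qexp ((z + of_nat n * d) / b)) \<longlonglongrightarrow> 1"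
proof -
  have "(\<lambda>n. 1 - qexp (z / b) * qexp (d / b) ^ n) \<longlonglongrightarrow> 1 - qexp (z / b) * 0"
    by (intro tendsto_intros LIMSEQ_power_zero r)
  then show ?thesis unfolding x_shift by simp
qed

text \<open>The two sequences differ by the factor \<open>1 - x n\<close>, and \<open>x n\<close>
  decays geometrically, faster than the rate in question.\<close>

lemma decays_shift:
  assumes "regular z a b"
  shows "decays (z + a) \<longleftrightarrow> decays z"
proof -
  define x where "x n = qexp ((z + of_nat n * d) / b)" for n
  define f where "f n = Fc (z + of_nat n * d) a b" for n
  define g where "g n = Fc (z + a + of_nat n * d) a b" for n
  have x1: "x n \<noteq> 1" for n using regular_neq_1[OF regular_nd[OF assms]] by (simp add: x_def)
  have g: "g n = f n / (1 - x n)" for n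
    using Fc_shift_a[OF ab x1[unfolded x_def], of n] by (simp add: g_def f_def x_def add_ac)
  have f: "f n = g n * (1 - x n)" for n using x1[of n] by (simp add: g)
  have lx: "(\<lambda>n. of_nat n * x n) \<longlonglongrightarrow> 0" "(\<lambda>n. 1 - x n) \<longlonglongrightarrow> 1" unfolding x_def by (rule x_decay x_limit)+
  show ?thesis
    unfolding decays_def g_def[symmetric] f_def[symmetric]
  proof
    assume "(\<lambda>n. of_nat n * (g n - 1)) \<longlonglongrightarrow> 0"
    then have "(\<lambda>n. of_nat n * (g n - 1) * (1 - x n) - of_nat n * x n) \<longlonglongrightarrow> 0 * 1 - 0" by (intro tendsto_intros lx)
    then show "(\<lambda>n. of_nat n * (f n - 1)) \<longlonglongrightarrow> 0" by (simp add: f algebra_simps)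
  next
    assume "(\<lambda>n. of_nat n * (f n - 1)) \<longlonglongrightarrow> 0"
    then have "(\<lambda>n. (of_nat n * (f n - 1) + of_nat n * x n) / (1 - x n)) \<longlonglongrightarrow> (0 + 0) / 1" by (intro tendsto_intros lx) auto
    moreover have "(of_nat n * (f n - 1) + of_nat n * x n) / (1 - x n) = of_nat n * (g n - 1)" for n
    proof -
      have "of_nat n * (f n - 1) + of_nat n * x n = of_nat n * (g n - 1) * (1 - x n)" by (simp add: f algebra_simps)
      then show ?thesis using x1[of n] by simp
    qed
    ultimately show "(\<lambda>n. of_nat n * (g n - 1)) \<longlonglongrightarrow> 0" by simp
  qed
qed

lemma strip_representative:
  obtains m :: int where "0 < Re (\<mu> * (z + of_int m * a))" "Re (\<mu> * (z + of_int m * a)) < 2 * Re (\<mu> * a)"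
proof -
  define s where "s = Re (\<mu> * z) / Re (\<mu> * a)"
  define m where "m = \<lfloor>- s\<rfloor> + 1"
  have m: "0 < s + of_int m" "s + of_int m < 2" unfolding m_def by linarith+
  have "\<mu> * (z + of_int m * a) = \<mu> * z + of_int m * (\<mu> * a)" by (simp add: algebra_simps)
  then have "Re (\<mu> * (z + of_int m * a)) = Re (\<mu> * z + of_int m * (\<mu> * a))" by (simp only:)
  also have "\<dots> = Re (\<mu> * z) + of_int m * Re (\<mu> * a)" by (simp only: plus_complex.sel) (subst times_complex.sel(1)[of "of_int m"], simp)
  also have "\<dots> = (s + of_int m) * Re (\<mu> * a)" using strip(1) by (simp add: s_def distrib_right del: times_complex.sel)
  finally have e: "Re (\<mu> * (z + of_int m * a)) = (s + of_int m) * Re (\<mu> * a)" .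
  show thesis by (rule that[of m]; unfold e) (use m strip(1) in \<open>auto intro!: mult_pos_pos mult_strict_right_mono simp del: times_complex.sel\<close>)
qed

lemma decays_regular:
  assumes "regular z a b"
  shows "decays z"
proof -
  obtain m :: int where "0 < Re (\<mu> * (z + of_int m * a))" "Re (\<mu> * (z + of_int m * a)) < 2 * Re (\<mu> * a)"
    by (rule strip_representative)
  then have "decays (z + of_int m * a)" by (rule decays_strip)
  then show ?thesis
    using int_shift_iff[of "\<lambda>z. regular z a b" a decays z m, OF regular_shift_a decays_shift assms] by simp
qed

lemma Gc_limit:
  assumes "regular z a b"
  shows "(\<lambda>n. Gc (z + of_nat n * d) a b) \<longlonglongrightarrow> 1"
proof -
  define P where "P z \<longleftrightarrow> (\<lambda>n. Gc (z + of_nat n * d) a b) \<longlonglongrightarrow> 1" for z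
  have step: "P (z + a) \<longleftrightarrow> P z" if "regular z a b" for z
  proof -
    have reg: "regular (z + a) a b" using that by (simp add: regular_shift_a)
    define f where "f n = Fc (z + a + of_nat n * d) a b" for n
    define g where "g n = Gc (z + a + of_nat n * d) a b" for n
    have f0: "f n \<noteq> 0" for n unfolding f_def by (rule regular_Fc_nonzero[OF ab regular_nd[OF reg]])
    have f1: "f \<longlonglongrightarrow> 1"
      unfolding f_def by (rule tendsto_1_of_scaled) (use decays_regular[OF reg] in \<open>simp add: decays_def\<close>)
    have e: "z + of_nat n * d + a = z + a + of_nat n * d" for n by simp
    have g: "Gc (z + of_nat n * d) a b = g n * f n" for n
      using Gc_shift_a[OF ab, of "z + of_nat n * d"] f0[of n] unfolding e f_def g_def by blast
    show ?thesis
      unfolding P_def g g_def[symmetric]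
    proof
      assume "g \<longlonglongrightarrow> 1"
      from tendsto_mult[OF this f1] show "(\<lambda>n. g n * f n) \<longlonglongrightarrow> 1" by simp
    next
      assume "(\<lambda>n. g n * f n) \<longlonglongrightarrow> 1"
      from tendsto_divide[OF this f1] f0 show "g \<longlonglongrightarrow> 1" by simp
    qed
  qed
  obtain m :: int where "0 < Re (\<mu> * (z + of_int m * a))" "Re (\<mu> * (z + of_int m * a)) < 2 * Re (\<mu> * a)"
    by (rule strip_representative)
  then have "P (z + of_int m * a)" unfolding P_def by (intro Gc_strip_limit) (use strip(1) in linarith)+
  then show ?thesis
    using int_shift_iff[of "\<lambda>z. regular z a b" a P z m, OF regular_shift_a step assms] by (simp add: P_def)
qed

lemma Fc_limit: "decays z \<Longrightarrow> (\<lambda>n. Fc (z + of_nat n * d) a b) \<longlonglongrightarrow> 1"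
  unfolding decays_def by (rule tendsto_1_of_scaled)

lemma Fc_power_limit: "decays z \<Longrightarrow> (\<lambda>n. Fc (z + of_nat n * d) a b ^ n) \<longlonglongrightarrow> 1"
  unfolding decays_def by (rule power_tendsto_1)

end

section \<open>Infinite products from repeated translation\<close>

lemma prod_LIMSEQ:
  fixes f :: "nat \<Rightarrow> complex"
  assumes "convergent_prod f"
  shows "(\<lambda>n. \<Prod>i<n. f i) \<longlonglongrightarrow> prodinf f"
proof (subst filterlim_sequentially_Suc[symmetric])
  show "(\<lambda>n. \<Prod>i<Suc n. f i) \<longlonglongrightarrow> prodinf f"
    using convergent_prod_LIMSEQ[OF assms] by (simp only: lessThan_Suc_atMost)
qed

text \<open>The bound on the exponents covers all cases that occur: \<open>1\<close>,
  \<open>n\<close>, \<open>n + 1\<close> and \<open>2 * (n + 1)\<close>.\<close>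

lemma convergent_prod_geometric:
  fixes r t :: complex
  assumes r: "norm r < 1" and f: "\<And>n. f n \<le> 2 * Suc n"
  shows "convergent_prod (\<lambda>n. (1 - t * r ^ n) ^ f n)"
proof (rule abs_convergent_prod_imp_convergent_prod, rule summable_imp_abs_convergent_prod)
  define s where "s n = 2 * norm t * (real (Suc n) * norm r ^ n)" for n
  have s: "summable s"
    unfolding s_def using geometric_deriv_sums[of "norm r"] r by (intro summable_mult) (auto simp: sums_iff)
  have "\<forall>\<^sub>F n in sequentially. s n < 1"
    using summable_LIMSEQ_zero[OF s] by (rule order_tendstoD) simp
  then have "\<forall>\<^sub>F n in sequentially. norm (norm ((1 - t * r ^ n) ^ f n - 1)) \<le> 2 * s n"
  proof eventually_elim
    case (elim n)
    have s0: "0 \<le> s n" by (simp add: s_def)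
    have "norm ((1 + - (t * r ^ n)) ^ f n - 1) \<le> exp (real (f n) * norm (- (t * r ^ n))) - 1"
      by (rule norm_power_diff_1)
    also have "real (f n) * norm (- (t * r ^ n)) \<le> real (2 * Suc n) * norm (- (t * r ^ n))"
      using f[of n] by (intro mult_right_mono of_nat_mono) auto
    also have "\<dots> = s n" by (simp add: s_def norm_mult norm_power algebra_simps)
    finally have "norm ((1 - t * r ^ n) ^ f n - 1) \<le> exp (s n) - 1" by simp
    also have "exp (s n) \<le> 1 + s n + (s n)\<^sup>2" using s0 elim by (intro exp_bound) auto
    also have "(s n)\<^sup>2 \<le> s n" using s0 elim by (simp add: power2_eq_square mult_left_le)
    finally show ?case by simp
  qed
  then show "summable (\<lambda>n. norm ((1 - t * r ^ n) ^ f n - 1))"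
    by (rule summable_comparison_test_ev) (intro summable_mult s)
qed

lemma mult_swap: "(a * b) * (c * d) = (a * c) * (b * (d :: complex))"
  by (simp add: mult_ac)

lemma isCont_Gc:
  assumes "a / b \<notin> \<real>\<^sub>\<le>\<^sub>0"
  shows "isCont (\<lambda>z. Gc z a b) z0"
proof -
  have "v3 z0 a b \<in> FG_domain" using assms by (simp add: FG_domain_iff)
  from mv_holomorphic_on_continuous[OF Gc_holomorphic this]
  have "isCont (\<lambda>p. Gc (p $ 1) (p $ 2) (p $ 3)) (v3 z0 a b)" .
  from isCont_tendsto_compose[OF this, of "\<lambda>z. v3 z a b" "at z0"]
  show ?thesis unfolding isCont_def by (simp add: tendsto_v3)
qed

context vertical_shift begin

text \<open>Needed at translates of \<open>a\<close> and \<open>- b\<close>, which are not regular.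
  Inside the strip of convergence \<open>Fc\<close> is an exponential, whatever its factors
  elsewhere do.\<close>

lemma isCont_Fc_strip:
  assumes "0 < Re (\<mu> * z)" "Re (\<mu> * z) < 2 * Re (\<mu> * a)"
  shows "isCont (\<lambda>z. Fc z a b) z" and "Fc z a b \<noteq> 0"
proof -
  have eq: "Fc z a b = exp (W 1 1 1 (v3 (\<mu> * z) (\<mu> * a) (\<mu> * b))) \<and> v3 (\<mu> * z) (\<mu> * a) (\<mu> * b) \<in> ker_dom 1 1"
    if "0 < Re (\<mu> * z)" "Re (\<mu> * z) < 2 * Re (\<mu> * a)" for z
  proof -
    have d: "v3 (\<mu> * z) (\<mu> * a) (\<mu> * b) \<in> ker_dom 1 1"
      using that strip unfolding ker_dom_def vector_3 mem_Collect_eq by simp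
    then show ?thesis using Fc_eq_exp_Kf[OF d] Fc_scale[OF mu_nonzero, of z a b] by (simp add: Kf_def)
  qed
  show "Fc z a b \<noteq> 0" using eq[OF assms] by simp
  define S where "S = {z. 0 < Re (\<mu> * z)} \<inter> {z. Re (\<mu> * z) < 2 * Re (\<mu> * a)}"
  have "open S" unfolding S_def by (intro open_Int open_Collect_less continuous_intros)
  moreover have "z \<in> S" using assms unfolding S_def by simp
  ultimately have "\<forall>\<^sub>F z in nhds z. z \<in> S" by (rule eventually_nhds_in_open)
  then have ev: "\<forall>\<^sub>F z in nhds z. exp (W 1 1 1 (v3 (\<mu> * z) (\<mu> * a) (\<mu> * b))) = Fc z a b"
    by eventually_elim (use eq in \<open>auto simp: S_def simp del: times_complex.sel\<close>)
  have "isCont (\<lambda>z. W 1 1 1 (v3 z (\<mu> * a) (\<mu> * b))) (\<mu> * z)"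
    by (rule DERIV_isCont[OF W_deriv_z[of "\<mu> * z" "\<mu> * a" "\<mu> * b" 1 1 0, folded One_nat_def]]) (rule conjunct2[OF eq[OF assms]])
  moreover have "isCont (\<lambda>z. \<mu> * z) z" by (rule isCont_mult[OF continuous_const continuous_ident])
  ultimately have "isCont (\<lambda>z. W 1 1 1 (v3 (\<mu> * z) (\<mu> * a) (\<mu> * b))) z"
    by (rule isCont_o2[of z "\<lambda>z. \<mu> * z", rotated])
  then have "isCont (\<lambda>z. exp (W 1 1 1 (v3 (\<mu> * z) (\<mu> * a) (\<mu> * b)))) z" by (rule isCont_exp')
  then show "isCont (\<lambda>z. Fc z a b) z" by (simp only: isCont_cong[OF ev])
qed

end

lemma Im_inverse_neg: "Im w > 0 \<Longrightarrow> Im (1 / w) < 0" and Im_inverse_pos: "Im w < 0 \<Longrightarrow> Im (1 / w) > 0"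
  by (simp_all add: Im_divide sum_power2_gt_zero_iff divide_neg_pos divide_pos_pos)

locale reflection =
  fixes a b :: complex
  assumes im: "Im (a / b) > 0"
begin

lemma a0: "a \<noteq> 0" and b0: "b \<noteq> 0"
  using im by auto

lemma im': "Im (b / a) < 0"
  using Im_inverse_neg[OF im] by simp

definition d where "d = a - b"
definition d' where "d' = - (a + b)"
definition q where "q = qexp (a / b)"
definition p where "p = qexp (- (b / a))"

lemma q1: "norm q < 1" and p1: "norm p < 1" and p0: "p \<noteq> 0"
  using im im' by (simp_all add: q_def p_def norm_qexp_less_1)

lemma regular_b: "regular (z - b) a b \<longleftrightarrow> regular z a b"
  using regular_shift_b[OF b0, of "z - b" a] by simp

lemma regular_d: "regular (z + d) a b \<longleftrightarrow> regular z a b" "regular (z + d') a b \<longleftrightarrow> regular z a b"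
proof -
  show "regular (z + d) a b \<longleftrightarrow> regular z a b"
    using regular_b[of "z + a"] by (simp add: d_def regular_shift_a add_diff_eq)
  show "regular (z + d') a b \<longleftrightarrow> regular z a b"
    using regular_b[of "z - a"] regular_shift_a[of "z - a" a b] by (simp add: d'_def algebra_simps)
qed

text \<open>The rotation \<open>\<i> / d\<close> sends \<open>a - b\<close> to \<open>\<i>\<close>,
  so that both periods acquire the same real part, namely \<open>- Im (a / d)\<close>; its sign is
  that of \<open>Im (a / b)\<close>.\<close>

sublocale V: vertical_shift a b d "\<i> / d"
proof
  have d0: "d \<noteq> 0" using im' a0 by (auto simp: d_def)
  have "a / d = 1 / (1 - b / a)" using a0 d0 by (simp add: d_def field_simps)
  then have "Im (a / d) < 0" using im' Im_inverse_neg[of "1 - b / a"] by simp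
  moreover have e: "\<i> / d * a = \<i> * (a / d)" by simp
  ultimately show 1: "Re (\<i> / d * a) > 0" unfolding e by (simp del: times_divide_eq_right)
  have e': "\<i> / d * b = \<i> / d * a - \<i>" using d0 by (simp add: d_def field_simps)
  show "Re (\<i> / d * b) = Re (\<i> / d * a)" unfolding e' by simp
  show "\<i> / d * d = \<i>" using d0 by simp
  show "Im (b / a) \<noteq> 0" using im' by simp
  show "norm (qexp (d / b)) < 1" using q1 b0 by (simp add: d_def q_def diff_divide_distrib qexp_diff)
qed (simp add: regular_d)

sublocale V': vertical_shift a "- b" d' "\<i> / d'"
proof
  have d0: "d' \<noteq> 0"
  proof
    assume "d' = 0"
    then have "b = - a" by (simp add: d'_def add_eq_0_iff)
    then show False using im' a0 by simp
  qed
  have "1 + b / a = - (d' / a)" using a0 by (simp add: d'_def diff_divide_distrib)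
  then have "a / d' = - (1 / (1 + b / a))" by simp
  then have "Im (a / d') < 0" using im' Im_inverse_pos[of "1 + b / a"] by simp
  moreover have e: "\<i> / d' * a = \<i> * (a / d')" by simp
  ultimately show 1: "Re (\<i> / d' * a) > 0" unfolding e by (simp del: times_divide_eq_right)
  have e': "\<i> / d' * (- b) = \<i> / d' * a + \<i>" using d0 by (simp add: d'_def field_simps)
  show "Re (\<i> / d' * (- b)) = Re (\<i> / d' * a)" unfolding e' by simp
  show "\<i> / d' * d' = \<i>" using d0 by simp
  show "Im (- b / a) \<noteq> 0" using im' by simp
  have "d' / - b = a / b + 1" using b0 by (simp add: d'_def field_simps)
  then show "norm (qexp (d' / - b)) < 1" using q1 by (simp add: q_def qexp_add)
qed (simp add: regular_d regular_minus_b)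

text \<open>Adds to regularity the half-plane in which the polylogarithms at
  \<open>qexp (z / a)\<close> converge. Since \<open>Im (b / a) < 0\<close>, both translations, the
  shift by \<open>a\<close> and the shift by \<open>- b\<close> preserve it.\<close>

definition good :: "complex \<Rightarrow> bool" where
  "good z \<longleftrightarrow> regular z a b \<and> Im (z / a) > 0"

lemma good_shift:
  assumes "good z"
  shows "good (z + d)" "good (z + d')" "good (z + a)" "good (z - b)"
proof -
  have "Im ((z + d) / a) > 0" "Im ((z + d') / a) > 0" "Im ((z + a) / a) > 0" "Im ((z - b) / a) > 0"
    using assms im' a0 by (auto simp: good_def add_divide_distrib diff_divide_distrib d_def d'_def)
  then show "good (z + d)" "good (z + d')" "good (z + a)" "good (z - b)"
    using assms by (auto simp: good_def regular_d regular_shift_a regular_b)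
qed

lemma nd_Suc: "z + of_nat (Suc n) * e = z + of_nat n * e + (e :: complex)"
  by (simp add: algebra_simps)

lemma good_nd:
  assumes "good z"
  shows "good (z + of_nat n * d)" "good (z + of_nat n * d')"
proof -
  show "good (z + of_nat n * d)"
  proof (induction n)
    case (Suc n)
    show ?case unfolding nd_Suc by (rule good_shift(1)[OF Suc])
  qed (use assms in simp)
  show "good (z + of_nat n * d')"
  proof (induction n)
    case (Suc n)
    show ?case unfolding nd_Suc by (rule good_shift(2)[OF Suc])
  qed (use assms in simp)
qed

lemma good_nonzero:
  assumes "good z"
  shows "qexp (z / b) \<noteq> 1" "qexp (z / a) \<noteq> 1" "qexp (z / - b) \<noteq> 1" "Fc z a b \<noteq> 0" "Fc z a (- b) \<noteq> 0"
  using assms regular_neq_1[of z a b] regular_neq_1[of z a "- b"] Im_pos_neq_1 regular_Fc_nonzero[OF V.ab] regular_Fc_nonzero[OF V'.ab]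
  by (auto simp: good_def regular_minus_b)

text \<open>Both chains multiply the exponential for the period \<open>a\<close> by the same
  \<open>p\<close>; for the period \<open>b\<close> one chain turns \<open>x\<close> into
  \<open>x * q ^ n\<close>, the other \<open>inverse x\<close> into
  \<open>inverse x * q ^ n\<close>.\<close>

lemma qexp_nd:
  "qexp ((z + of_nat n * d) / b) = qexp (z / b) * q ^ n"
  "qexp ((z + of_nat n * d) / a) = qexp (z / a) * p ^ n"
  "qexp ((z + of_nat n * d') / - b) = inverse (qexp (z / b)) * q ^ n"
  "qexp ((z + of_nat n * d') / a) = qexp (z / a) * p ^ n"
proof -
  have q: "qexp (d / b) = q" using b0 by (simp add: d_def q_def diff_divide_distrib qexp_diff)
  have "d' / - b = a / b + 1" using b0 by (simp add: d'_def field_simps)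
  then have q': "qexp (d' / - b) = q" by (simp add: q_def qexp_add)
  have "d / a = 1 + - (b / a)" using a0 by (simp add: d_def diff_divide_distrib)
  then have p: "qexp (d / a) = p" by (simp only: p_def qexp_add qexp_1 mult_1_left)
  have "d' / a = of_int (- 1) + - (b / a)" using a0 by (simp add: d'_def field_simps)
  then have p': "qexp (d' / a) = p" by (simp only: p_def qexp_add qexp_of_int mult_1_left)
  show "qexp ((z + of_nat n * d) / b) = qexp (z / b) * q ^ n" unfolding V.x_shift q ..
  show "qexp ((z + of_nat n * d') / - b) = inverse (qexp (z / b)) * q ^ n" unfolding V'.x_shift q' by (simp add: qexp_minus)
  show "qexp ((z + of_nat n * d) / a) = qexp (z / a) * p ^ n"
    unfolding p[symmetric] by (simp add: add_divide_distrib qexp_add qexp_power)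
  show "qexp ((z + of_nat n * d') / a) = qexp (z / a) * p ^ n"
    unfolding p'[symmetric] by (simp add: add_divide_distrib qexp_add qexp_power)
qed

text \<open>The point \<open>z + a = (z + d) + b\<close> is reached from \<open>z\<close> by a shift
  by \<open>a\<close> and from \<open>z + d\<close> by a shift by \<open>b\<close>; comparison of
  the two expressions relates \<open>z\<close> to \<open>z + d\<close>.\<close>

lemma Fc_step:
  assumes "good z"
  shows "Fc z a b = Fc (z + d) a b * ((1 - qexp (z / b)) / (1 - qexp ((z + d) / a)))"
proof -
  have "Fc (z + a) a b = Fc z a b / (1 - qexp (z / b))"
    by (rule Fc_shift_a[OF V.ab good_nonzero(1)[OF assms]])
  moreover have "Fc (z + d + b) a b = Fc (z + d) a b / (1 - qexp ((z + d) / a))"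
    using good_shift(1)[OF assms] by (intro Fc_shift_b V.nonreal) (simp_all add: good_def)
  moreover have "z + d + b = z + a" by (simp add: d_def)
  ultimately have "Fc z a b / (1 - qexp (z / b)) = Fc (z + d) a b / (1 - qexp ((z + d) / a))" by metis
  then show ?thesis using good_nonzero(1)[OF assms] by (simp add: divide_eq_eq)
qed

lemma Fc_step':
  assumes "good z"
  shows "Fc z a (- b) = Fc (z + d') a (- b) * ((1 - qexp (z / a)) / (1 - qexp ((z + d') / - b)))"
proof -
  have "Fc (z + d' + a) a (- b) = Fc (z + d') a (- b) / (1 - qexp ((z + d') / - b))"
    by (rule Fc_shift_a[OF V'.ab good_nonzero(3)[OF good_shift(2)[OF assms]]])
  moreover have "Fc (z + - b) a (- b) = Fc z a (- b) / (1 - qexp (z / a))"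
    using assms by (intro Fc_shift_b V'.nonreal) (simp_all add: good_def regular_minus_b)
  moreover have "z + d' + a = z + - b" by (simp add: d'_def)
  ultimately have "Fc z a (- b) / (1 - qexp (z / a)) = Fc (z + d') a (- b) / (1 - qexp ((z + d') / - b))" by metis
  then show ?thesis using good_nonzero(2)[OF assms] by (simp add: divide_eq_eq del: divide_minus_right)
qed

lemma Gc_step:
  assumes "good z"
  shows "Gc z a b = Gc (z + d) a b * Fc (z + a) a b * exp (- LiS 1 (z + d) a)"
proof -
  have "Gc z a b = Gc (z + a) a b * Fc (z + a) a b"
    by (rule Gc_shift_a[OF V.ab good_nonzero(4)[OF good_shift(3)[OF assms]]])
  moreover have "Gc (z + d + b) a b = Gc (z + d) a b * exp (- LiS 1 (z + d) a)"
    using good_shift(1)[OF assms] by (intro Gc_shift_b V.nonreal) (simp_all add: good_def)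
  moreover have "z + d + b = z + a" by (simp add: d_def)
  ultimately show ?thesis by (simp add: mult_ac)
qed

lemma Gc_step':
  assumes "good z"
  shows "Gc z a (- b) = Gc (z + d') a (- b) * inverse (Fc (z - b) a (- b)) * exp (LiS 1 z a)"
proof -
  have e: "z + d' + a = z - b" by (simp add: d'_def)
  have F: "Fc (z - b) a (- b) \<noteq> 0" by (rule good_nonzero(5)[OF good_shift(4)[OF assms]])
  have "Gc (z + d') a (- b) = Gc (z - b) a (- b) * Fc (z - b) a (- b)"
    using Gc_shift_a[OF V'.ab, of "z + d'"] F unfolding e by blast
  moreover have "Gc (z + - b) a (- b) = Gc z a (- b) * exp (- LiS 1 z a)"
    using assms by (intro Gc_shift_b V'.nonreal) (simp_all add: good_def regular_minus_b)
  ultimately show ?thesis using F by (simp add: exp_minus field_simps)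
qed

lemma Fc_product:
  assumes "good z"
  shows "Fc z a b = Fc (z + of_nat n * d) a b * (\<Prod>k<n. (1 - qexp (z / b) * q ^ k) / (1 - qexp (z / a) * p ^ Suc k))"
proof (induction n)
  case (Suc n)
  have "Fc (z + of_nat n * d) a b = Fc (z + of_nat (Suc n) * d) a b *
      ((1 - qexp (z / b) * q ^ n) / (1 - qexp (z / a) * p ^ Suc n))"
    using Fc_step[OF good_nd(1)[OF assms, of n]] unfolding nd_Suc[symmetric] qexp_nd .
  with Suc show ?case by (simp only: prod.lessThan_Suc mult_ac)
qed simp

lemma Fc_product':
  assumes "good z"
  shows "Fc z a (- b) = Fc (z + of_nat n * d') a (- b) *
    (\<Prod>k<n. (1 - qexp (z / a) * p ^ k) / (1 - inverse (qexp (z / b)) * q ^ Suc k))"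
proof (induction n)
  case (Suc n)
  have "Fc (z + of_nat n * d') a (- b) = Fc (z + of_nat (Suc n) * d') a (- b) *
      ((1 - qexp (z / a) * p ^ n) / (1 - inverse (qexp (z / b)) * q ^ Suc n))"
    using Fc_step'[OF good_nd(2)[OF assms, of n]] unfolding nd_Suc[symmetric] qexp_nd .
  with Suc show ?case by (simp only: prod.lessThan_Suc mult_ac)
qed simp

lemma good_factors:
  assumes "good z"
  shows "1 - qexp (z / b) * q ^ n \<noteq> 0" "1 - inverse (qexp (z / b)) * q ^ n \<noteq> 0" "1 - qexp (z / a) * p ^ n \<noteq> 0"
    "norm (qexp (z / a) * p ^ n) < 1"
proof -
  note g = good_nd(1)[OF assms, of n] good_nd(2)[OF assms, of n]
  show "1 - qexp (z / b) * q ^ n \<noteq> 0" "1 - inverse (qexp (z / b)) * q ^ n \<noteq> 0" "1 - qexp (z / a) * p ^ n \<noteq> 0"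
    using good_nonzero(1,2)[OF g(1)] good_nonzero(3)[OF g(2)] unfolding qexp_nd by auto
  show "norm (qexp (z / a) * p ^ n) < 1"
    using norm_qexp_less_1[of "(z + of_nat n * d) / a"] g(1) unfolding qexp_nd good_def by blast
qed

lemma p_limit: "(\<lambda>n. t * p ^ n) \<longlonglongrightarrow> 0"
  using tendsto_mult_right_zero[OF LIMSEQ_power_zero[OF p1]] .

text \<open>In the product of the two chains the factors with \<open>p\<close> telescope to
  \<open>(1 - y) / (1 - y * p ^ n)\<close>, which leaves \<open>1 - y\<close> in the limit. The
  factors with \<open>q\<close> converge to the infinite products.\<close>

theorem Fc_reflection:
  assumes z: "good z"
  shows "Fc z a b * Fc z a (- b) = (\<Prod>n. 1 - qexp (z / b) * q ^ n) *
    (\<Prod>n. inverse (1 - inverse (qexp (z / b)) * q ^ Suc n)) * (1 - qexp (z / a))"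
proof -
  define x where "x = qexp (z / b)"
  define y where "y = qexp (z / a)"
  note nz = good_factors[OF z, folded x_def y_def]
  define Q where "Q = (\<Prod>n. 1 - inverse x * q ^ Suc n)"
  have c1: "convergent_prod (\<lambda>n. 1 - x * q ^ n)"
    using convergent_prod_geometric[OF q1, of "\<lambda>_. 1" x] by simp
  have c2: "convergent_prod (\<lambda>n. 1 - inverse x * q ^ Suc n)"
    using convergent_prod_geometric[OF q1, of "\<lambda>_. 1" "inverse x * q"] by (simp add: mult.assoc)
  have Q0: "Q \<noteq> 0" unfolding Q_def by (rule prodinf_nonzero[OF c2]) (rule nz(2))
  have inv: "(\<Prod>n. inverse (1 - inverse x * q ^ Suc n)) = inverse Q"
    unfolding Q_def by (rule prodinf_inverse[OF c2])
  have tele: "(\<Prod>k<n. (1 - y * p ^ k) / (1 - y * p ^ Suc k)) = (1 - y) / (1 - y * p ^ n)" for n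
  proof (induction n)
    case (Suc n)
    then show ?case using nz(3)[of n] by (simp del: power_Suc)
  qed (use nz(3)[of 0] in simp)
  have eq: "Fc z a b * Fc z a (- b) = (Fc (z + of_nat n * d) a b * Fc (z + of_nat n * d') a (- b)) *
      ((\<Prod>k<n. 1 - x * q ^ k) / (\<Prod>k<n. 1 - inverse x * q ^ Suc k)) * ((1 - y) / (1 - y * p ^ n))" for n
  proof -
    have "Fc z a b * Fc z a (- b) = (Fc (z + of_nat n * d) a b * Fc (z + of_nat n * d') a (- b)) *
      ((\<Prod>k<n. (1 - x * q ^ k) / (1 - y * p ^ Suc k)) * (\<Prod>k<n. (1 - y * p ^ k) / (1 - inverse x * q ^ Suc k)))"
      unfolding Fc_product[OF z, of n, folded x_def y_def] Fc_product'[OF z, of n, folded x_def y_def] by (rule mult_swap)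
    also have "(\<Prod>k<n. (1 - x * q ^ k) / (1 - y * p ^ Suc k)) * (\<Prod>k<n. (1 - y * p ^ k) / (1 - inverse x * q ^ Suc k)) =
      ((\<Prod>k<n. 1 - x * q ^ k) / (\<Prod>k<n. 1 - inverse x * q ^ Suc k)) * (\<Prod>k<n. (1 - y * p ^ k) / (1 - y * p ^ Suc k))"
      unfolding prod_dividef by (simp only: times_divide_times_eq mult.commute)
    finally show ?thesis unfolding tele mult.assoc .
  qed
  have lF: "(\<lambda>n. Fc (z + of_nat n * d) a b) \<longlonglongrightarrow> 1" "(\<lambda>n. Fc (z + of_nat n * d') a (- b)) \<longlonglongrightarrow> 1"
    by (rule V.Fc_limit V'.Fc_limit, rule V.decays_regular V'.decays_regular, use z in \<open>simp add: good_def regular_minus_b\<close>)+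
  note lP = prod_LIMSEQ[OF c1] prod_LIMSEQ[OF c2, folded Q_def]
  have ly: "(\<lambda>n. 1 - y * p ^ n) \<longlonglongrightarrow> 1 - 0" by (rule tendsto_diff[OF tendsto_const p_limit])
  have "(\<lambda>n. (Fc (z + of_nat n * d) a b * Fc (z + of_nat n * d') a (- b)) *
      ((\<Prod>k<n. 1 - x * q ^ k) / (\<Prod>k<n. 1 - inverse x * q ^ Suc k)) * ((1 - y) / (1 - y * p ^ n)))
      \<longlonglongrightarrow> (1 * 1) * ((\<Prod>n. 1 - x * q ^ n) / Q) * ((1 - y) / (1 - 0))"
    by (rule tendsto_mult[OF tendsto_mult[OF tendsto_mult[OF lF] tendsto_divide[OF lP Q0]] tendsto_divide[OF tendsto_const ly]]) simp
  then have "(\<lambda>n. Fc z a b * Fc z a (- b)) \<longlonglongrightarrow> (1 * 1) * ((\<Prod>n. 1 - x * q ^ n) / Q) * ((1 - y) / (1 - 0))"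
    unfolding eq[symmetric] .
  then have "(1 * 1) * ((\<Prod>n. 1 - x * q ^ n) / Q) * ((1 - y) / (1 - 0)) = Fc z a b * Fc z a (- b)"
    by (simp only: LIMSEQ_const_iff)
  then have "Fc z a b * Fc z a (- b) = (\<Prod>n. 1 - x * q ^ n) * inverse Q * (1 - y)"
    by (simp add: divide_inverse)
  then show ?thesis unfolding x_def[symmetric] y_def[symmetric] inv .
qed

end

lemma isCont_Li_qexp:
  assumes "Im (z / a) > 0"
  shows "isCont (\<lambda>z. Li (Suc k) (qexp (z / a))) z"
proof -
  have "isCont (\<lambda>u. Li (Suc k) (qexp u)) (z / a)"
    by (rule DERIV_isCont[OF Li_qexp_has_field_derivative[OF assms]])
  moreover have "isCont (\<lambda>z. z / a) z" unfolding divide_inverse by (rule isCont_mult[OF continuous_ident continuous_const])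
  ultimately show ?thesis by (rule isCont_o2[of z "\<lambda>z. z / a", rotated])
qed

lemma isCont_LiS:
  assumes "Im (z / a) > 0"
  shows "isCont (\<lambda>z. LiS 1 z a) z"
proof -
  have a: "a \<noteq> 0" using assms by auto
  note c = isCont_Li_qexp[OF assms, of 0, folded One_nat_def] isCont_Li_qexp[OF assms, of 1, unfolded Suc_1]
  show ?thesis
    unfolding LiS_1[OF a] divide_inverse[of _ a] divide_inverse[of "Li 2 _"] using c
    by (intro isCont_diff isCont_mult continuous_const continuous_ident) (simp_all only: divide_inverse)
qed

context reflection begin

text \<open>Every step of \<open>G\<close> brings in a value of \<open>F\<close>. Rewriting these
  values through the last one produces its \<open>n\<close>-th power, and the factor of step
  \<open>k\<close> is collected with exponent \<open>k + 1\<close>.\<close>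

lemma Gc_product:
  assumes z: "good z"
  shows "Gc z a b = Gc (z + of_nat n * d) a b * Fc (z + a + of_nat n * d) a b ^ n *
    (\<Prod>k<n. ((1 - qexp (z / b) * q ^ Suc k) / (1 - qexp (z / a) * p ^ Suc k)) ^ Suc k * exp (- LiS 1 (z + of_nat (Suc k) * d) a))"
    (is "_ = ?G n * ?F n ^ n * ?P n")
proof (induction n)
  case (Suc n)
  define R where "R = (1 - qexp (z / b) * q ^ Suc n) / (1 - qexp (z / a) * p ^ Suc n)"
  define E where "E = exp (- LiS 1 (z + of_nat (Suc n) * d) a)"
  have x: "qexp ((z + a) / b) = qexp (z / b) * q" by (simp add: q_def add_divide_distrib qexp_add)
  have e: "z + of_nat n * d + a = z + a + of_nat n * d" by simp
  have G: "?G n = ?G (Suc n) * ?F n * E"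
    using Gc_step[OF good_nd(1)[OF z, of n]] unfolding nd_Suc[symmetric] e E_def .
  have F: "?F n = ?F (Suc n) * R"
    using Fc_step[OF good_nd(1)[OF good_shift(3)[OF z], of n]]
    unfolding nd_Suc[symmetric] qexp_nd x qexp_shift_1[OF a0] R_def by (simp only: power_Suc mult.assoc)
  have P: "?P (Suc n) = ?P n * (R ^ Suc n * E)" unfolding R_def E_def by (rule prod.lessThan_Suc)
  have "Gc z a b = ?G (Suc n) * ?F n * E * ?F n ^ n * ?P n" using Suc unfolding G .
  also have "\<dots> = ?G (Suc n) * ?F n ^ Suc n * (?P n * E)" by (simp only: power_Suc mult_ac)
  also have "?F n ^ Suc n = ?F (Suc n) ^ Suc n * R ^ Suc n" unfolding F by (rule power_mult_distrib)
  finally show ?case unfolding P by (simp only: mult_ac)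
qed simp

lemma Gc_product':
  assumes z: "good z"
  shows "Gc z a (- b) = Gc (z + of_nat n * d') a (- b) * inverse (Fc (z - b + of_nat n * d') a (- b)) ^ n *
    (\<Prod>k<n. ((1 - inverse (qexp (z / b)) * q ^ Suc k) / (1 - qexp (z / a) * p ^ Suc k)) ^ Suc k * exp (LiS 1 (z + of_nat k * d') a))"
    (is "_ = ?G n * inverse (?F n) ^ n * ?P n")
proof (induction n)
  case (Suc n)
  define R where "R = (1 - inverse (qexp (z / b)) * q ^ Suc n) / (1 - qexp (z / a) * p ^ Suc n)"
  define E where "E = exp (LiS 1 (z + of_nat n * d') a)"
  have x: "qexp ((z - b) / b) = qexp (z / b)" using b0 by (simp add: diff_divide_distrib qexp_diff)
  have "(z - b) / a = z / a + - (b / a)" by (simp add: diff_divide_distrib)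
  then have y: "qexp ((z - b) / a) = qexp (z / a) * p" by (simp only: p_def qexp_add)
  have e: "z + of_nat n * d' - b = z - b + of_nat n * d'" by simp
  have G: "?G n = ?G (Suc n) * inverse (?F n) * E"
    using Gc_step'[OF good_nd(2)[OF z, of n]] unfolding nd_Suc[symmetric] e E_def .
  have F: "?F n = ?F (Suc n) * ((1 - qexp (z / a) * p ^ Suc n) / (1 - inverse (qexp (z / b)) * q ^ Suc n))"
    using Fc_step'[OF good_nd(2)[OF good_shift(4)[OF z], of n]]
    unfolding nd_Suc[symmetric] qexp_nd x y by (simp only: power_Suc mult.assoc)
  have F': "inverse (?F n) = inverse (?F (Suc n)) * R" unfolding F R_def by (simp only: inverse_mult_distrib inverse_divide)
  have P: "?P (Suc n) = ?P n * (R ^ Suc n * E)" unfolding R_def E_def by (rule prod.lessThan_Suc)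
  have "Gc z a (- b) = ?G (Suc n) * inverse (?F n) * E * inverse (?F n) ^ n * ?P n" using Suc unfolding G .
  also have "\<dots> = ?G (Suc n) * inverse (?F n) ^ Suc n * (?P n * E)" by (simp only: power_Suc mult_ac)
  also have "inverse (?F n) ^ Suc n = inverse (?F (Suc n)) ^ Suc n * R ^ Suc n" unfolding F' by (rule power_mult_distrib)
  finally show ?case unfolding P by (simp only: mult_ac)
qed simp

text \<open>The two chains of translates meet the same values of \<open>Li\<close>, which makes the factors with \<open>p\<close> cancel.\<close>

lemma LiS_pair:
  assumes z: "good z"
  shows "inverse (1 - qexp (z / a) * p ^ n) ^ (2 * n) = exp (LiS 1 (z + of_nat n * d) a - LiS 1 (z + of_nat n * d') a)"
proof -
  define Y where "Y = qexp (z / a) * p ^ n"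
  have Y: "norm Y < 1" unfolding Y_def by (rule good_factors(4)[OF z])
  \<comment> \<open>The two translations differ by \<open>2 * a\<close>, so that the coefficients of
    \<open>Li 1\<close> differ by the even integer \<open>2 * n\<close>, which is a genuine exponent
    of \<open>1 - Y\<close>.\<close>
  have "(z + of_nat n * d) / a - (z + of_nat n * d') / a = of_nat (2 * n)"
    using a0 by (simp add: d_def d'_def field_simps)
  then have "((z + of_nat n * d) / a - (z + of_nat n * d') / a) * Li 1 Y = of_nat (2 * n) * Li 1 Y" by (simp only:)
  then have "LiS 1 (z + of_nat n * d) a - LiS 1 (z + of_nat n * d') a = of_nat (2 * n) * Li 1 Y"
    unfolding LiS_1[OF a0] qexp_nd Y_def[symmetric] by (simp only: left_diff_distrib) simp
  then show ?thesis
    unfolding Y_def[symmetric] exp_of_nat_mult exp_Li_1[OF Y] by (simp only: exp_of_nat_mult exp_Li_1[OF Y] inverse_eq_divide)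
qed

lemma Gc_reflection_finite:
  assumes z: "good z"
  shows "Gc z a b * Gc z a (- b) = Gc (z + of_nat n * d) a b * Gc (z + of_nat n * d') a (- b) *
    (Fc (z + a + of_nat n * d) a b ^ n * inverse (Fc (z - b + of_nat n * d') a (- b)) ^ n) *
    (\<Prod>k<n. ((1 - qexp (z / b) * q ^ Suc k) * (1 - inverse (qexp (z / b)) * q ^ Suc k)) ^ Suc k) *
    exp (LiS 1 z a - LiS 1 (z + of_nat n * d') a)"
proof -
  define i where "i k = inverse (1 - qexp (z / a) * p ^ Suc k)" for k
  define A where "A k = 1 - qexp (z / b) * q ^ Suc k" for k
  define B where "B k = 1 - inverse (qexp (z / b)) * q ^ Suc k" for k
  define s where "s k = LiS 1 (z + of_nat k * d) a" for k
  define s' where "s' k = LiS 1 (z + of_nat k * d') a" for k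
  \<comment> \<open>The denominators with \<open>p\<close> are exchanged for the difference of the
    \<open>LiS\<close> values of both chains. This removes the values \<open>s\<close> of the first
    chain, and what remains of the second telescopes.\<close>
  have merge: "((A k / (1 - qexp (z / a) * p ^ Suc k)) ^ Suc k * exp (- s (Suc k))) *
      ((B k / (1 - qexp (z / a) * p ^ Suc k)) ^ Suc k * exp (s' k)) = (A k * B k) ^ Suc k * exp (s' k - s' (Suc k))" for k
  proof -
    have div: "X / (1 - qexp (z / a) * p ^ Suc k) = X * i k" for X by (simp add: i_def field_class.field_divide_inverse)
    have "(A k / (1 - qexp (z / a) * p ^ Suc k)) ^ Suc k * exp (- s (Suc k)) *
      ((B k / (1 - qexp (z / a) * p ^ Suc k)) ^ Suc k * exp (s' k)) =
      (A k * B k) ^ Suc k * (i k ^ (2 * Suc k) * exp (- s (Suc k)) * exp (s' k))"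
      unfolding div power_mult_distrib mult_2 power_add by (simp only: mult_ac)
    also have "i k ^ (2 * Suc k) = exp (s (Suc k) - s' (Suc k))"
      unfolding i_def s_def s'_def by (rule LiS_pair[OF z])
    also have "exp (s (Suc k) - s' (Suc k)) * exp (- s (Suc k)) * exp (s' k) = exp (s' k - s' (Suc k))"
      by (simp flip: exp_add)
    finally show ?thesis .
  qed
  have tele: "(\<Prod>k<n. exp (s' k - s' (Suc k))) = exp (s' 0 - s' n)"
    by (induction n) (simp_all flip: exp_add)
  have "Gc z a b * Gc z a (- b) = Gc (z + of_nat n * d) a b * Gc (z + of_nat n * d') a (- b) *
    (Fc (z + a + of_nat n * d) a b ^ n * inverse (Fc (z - b + of_nat n * d') a (- b)) ^ n) *
    ((\<Prod>k<n. (A k / (1 - qexp (z / a) * p ^ Suc k)) ^ Suc k * exp (- s (Suc k))) *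
     (\<Prod>k<n. (B k / (1 - qexp (z / a) * p ^ Suc k)) ^ Suc k * exp (s' k)))"
    using Gc_product[OF z, of n] Gc_product'[OF z, of n] unfolding A_def B_def s_def s'_def by (simp only: mult_ac)
  also have "(\<Prod>k<n. (A k / (1 - qexp (z / a) * p ^ Suc k)) ^ Suc k * exp (- s (Suc k))) *
     (\<Prod>k<n. (B k / (1 - qexp (z / a) * p ^ Suc k)) ^ Suc k * exp (s' k)) =
     (\<Prod>k<n. (A k * B k) ^ Suc k) * exp (s' 0 - s' n)"
    unfolding prod.distrib[symmetric] merge unfolding prod.distrib tele ..
  finally show ?thesis unfolding A_def B_def s'_def by (simp only: mult.assoc) simp
qed

text \<open>The coefficient of \<open>Li 1\<close> grows only linearly in \<open>n\<close>, while
  its argument decays geometrically and \<open>Li 1 t\<close> is comparable to \<open>t\<close> near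
  \<open>0\<close>.\<close>

lemma LiS_limit: "(\<lambda>n. LiS 1 (z + of_nat n * d') a) \<longlonglongrightarrow> 0"
proof -
  define y where "y = qexp (z / a)"
  define Y where "Y n = y * p ^ n" for n
  have Y0: "Y n \<noteq> 0" for n using p0 by (simp add: Y_def y_def)
  have Y: "Y \<longlonglongrightarrow> 0" unfolding Y_def by (rule p_limit)
  have at0: "filterlim Y (at 0) sequentially" using Y Y0 by (simp add: filterlim_at)
  have der: "(Li (Suc k) has_field_derivative (\<Sum>n. 0 ^ n / of_nat (Suc n) ^ k)) (at 0)" for k
    by (rule Li_has_field_derivative(1)) simp
  have cont: "(\<lambda>n. Li (Suc k) (Y n)) \<longlonglongrightarrow> 0" for k
    using isCont_tendsto_compose[OF DERIV_isCont[OF der] Y, of k] by simp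
  have "((\<lambda>t. Li (Suc 0) t / t) \<longlongrightarrow> (\<Sum>n. 0 ^ n / of_nat (Suc n) ^ 0)) (at 0)"
    using der[of 0] unfolding has_field_derivative_iff by simp
  then have quot: "(\<lambda>n. Li 1 (Y n) / Y n) \<longlonglongrightarrow> (\<Sum>n. 0 ^ n / of_nat (Suc n) ^ 0)"
    unfolding One_nat_def by (rule filterlim_compose[OF _ at0])
  have "(\<lambda>n. y * (of_nat n * p ^ n)) \<longlonglongrightarrow> y * 0" by (intro tendsto_mult tendsto_const powser_times_n_limit_0[OF p1])
  then have nY: "(\<lambda>n. of_nat n * Y n) \<longlonglongrightarrow> 0" by (simp add: Y_def mult.left_commute)
  have "(\<lambda>n. (of_nat n * Y n) * (Li 1 (Y n) / Y n)) \<longlonglongrightarrow> 0" using tendsto_mult[OF nY quot] by simp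
  then have nLi: "(\<lambda>n. of_nat n * Li 1 (Y n)) \<longlonglongrightarrow> 0" using Y0 by simp
  have "(\<lambda>n. z / a * Li 1 (Y n) + d' / a * (of_nat n * Li 1 (Y n)) - Li 2 (Y n) / (2 * of_real pi * \<i>))
      \<longlonglongrightarrow> z / a * 0 + d' / a * 0 - 0 / (2 * of_real pi * \<i>)"
    by (intro tendsto_add tendsto_diff tendsto_mult tendsto_divide tendsto_const nLi
        cont[of 0, folded One_nat_def] cont[of 1, unfolded Suc_1]) simp
  moreover have "LiS 1 (z + of_nat n * d') a = z / a * Li 1 (Y n) + d' / a * (of_nat n * Li 1 (Y n)) - Li 2 (Y n) / (2 * of_real pi * \<i>)" for n
    unfolding LiS_1[OF a0] qexp_nd Y_def y_def by (simp add: add_divide_distrib distrib_right mult_ac)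
  ultimately show ?thesis by simp
qed

lemma convergent_factors:
  "convergent_prod (\<lambda>n. (1 - x * q ^ n) ^ n)" "convergent_prod (\<lambda>n. (1 - x * q ^ Suc n) ^ Suc n)"
  "convergent_prod (\<lambda>n. (1 - q ^ Suc n) ^ (2 * Suc n))"
proof -
  show "convergent_prod (\<lambda>n. (1 - x * q ^ n) ^ n)" by (rule convergent_prod_geometric[OF q1]) simp
  have "convergent_prod (\<lambda>n. (1 - (x * q) * q ^ n) ^ Suc n)" by (rule convergent_prod_geometric[OF q1]) simp
  then show "convergent_prod (\<lambda>n. (1 - x * q ^ Suc n) ^ Suc n)" by (simp only: power_Suc[of q] mult.assoc)
  have "convergent_prod (\<lambda>n. (1 - q * q ^ n) ^ (2 * Suc n))" by (rule convergent_prod_geometric[OF q1]) simp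
  then show "convergent_prod (\<lambda>n. (1 - q ^ Suc n) ^ (2 * Suc n))" by (simp only: power_Suc[of q])
qed

lemma Gc_reflection:
  assumes z: "good z"
  shows "Gc z a b * Gc z a (- b) = (\<Prod>n. (1 - qexp (z / b) * q ^ n) ^ n) *
    (\<Prod>n. (1 - inverse (qexp (z / b)) * q ^ Suc n) ^ Suc n) * exp (LiS 1 z a)"
proof -
  define x where "x = qexp (z / b)"
  have reg: "regular z a b" "regular z a (- b)" "regular (z + a) a b" "regular (z - b) a (- b)"
    using z by (simp_all add: good_def regular_minus_b regular_shift_a regular_b)
  \<comment> \<open>The finite identity starts at the exponent \<open>1\<close>, the infinite
    product at \<open>0\<close>; the extra factor has exponent \<open>0\<close>.\<close>
  have "(\<lambda>n. \<Prod>k<Suc n. (1 - x * q ^ k) ^ k) \<longlonglongrightarrow> (\<Prod>n. (1 - x * q ^ n) ^ n)"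
    using prod_LIMSEQ[OF convergent_factors(1)[of x]] by (subst filterlim_sequentially_Suc)
  moreover have "(\<Prod>k<Suc n. (1 - x * q ^ k) ^ k) = (\<Prod>k<n. (1 - x * q ^ Suc k) ^ Suc k)" for n
    unfolding prod.lessThan_Suc_shift by simp
  ultimately have P1: "(\<lambda>n. \<Prod>k<n. (1 - x * q ^ Suc k) ^ Suc k) \<longlonglongrightarrow> (\<Prod>n. (1 - x * q ^ n) ^ n)" by (simp only:)
  note P2 = prod_LIMSEQ[OF convergent_factors(2)[of "inverse x"]]
  have inv: "(\<lambda>n. inverse (Fc (z - b + of_nat n * d') a (- b)) ^ n) \<longlonglongrightarrow> inverse 1"
    unfolding power_inverse by (intro tendsto_inverse V'.Fc_power_limit V'.decays_regular reg) simp
  have lim: "(\<lambda>n. Gc (z + of_nat n * d) a b * Gc (z + of_nat n * d') a (- b) *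
    (Fc (z + a + of_nat n * d) a b ^ n * inverse (Fc (z - b + of_nat n * d') a (- b)) ^ n) *
    ((\<Prod>k<n. (1 - x * q ^ Suc k) ^ Suc k) * (\<Prod>k<n. (1 - inverse x * q ^ Suc k) ^ Suc k)) *
    exp (LiS 1 z a - LiS 1 (z + of_nat n * d') a)) \<longlonglongrightarrow>
    1 * 1 * (1 * inverse 1) * ((\<Prod>n. (1 - x * q ^ n) ^ n) * (\<Prod>n. (1 - inverse x * q ^ Suc n) ^ Suc n)) * exp (LiS 1 z a - 0)"
    by (rule tendsto_mult[OF tendsto_mult[OF tendsto_mult[OF tendsto_mult[OF V.Gc_limit[OF reg(1)] V'.Gc_limit[OF reg(2)]]
        tendsto_mult[OF V.Fc_power_limit[OF V.decays_regular[OF reg(3)]] inv]] tendsto_mult[OF P1 P2]]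
        tendsto_exp[OF tendsto_diff[OF tendsto_const LiS_limit]]])
  have "Gc z a b * Gc z a (- b) = 1 * 1 * (1 * inverse 1) * ((\<Prod>n. (1 - x * q ^ n) ^ n) * (\<Prod>n. (1 - inverse x * q ^ Suc n) ^ Suc n)) * exp (LiS 1 z a - 0)"
  proof (rule LIMSEQ_unique[OF _ lim])
    show "(\<lambda>n. Gc (z + of_nat n * d) a b * Gc (z + of_nat n * d') a (- b) *
      (Fc (z + a + of_nat n * d) a b ^ n * inverse (Fc (z - b + of_nat n * d') a (- b)) ^ n) *
      ((\<Prod>k<n. (1 - x * q ^ Suc k) ^ Suc k) * (\<Prod>k<n. (1 - inverse x * q ^ Suc k) ^ Suc k)) *
      exp (LiS 1 z a - LiS 1 (z + of_nat n * d') a)) \<longlonglongrightarrow> Gc z a b * Gc z a (- b)"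
    proof -
      have "Gc (z + of_nat n * d) a b * Gc (z + of_nat n * d') a (- b) *
        (Fc (z + a + of_nat n * d) a b ^ n * inverse (Fc (z - b + of_nat n * d') a (- b)) ^ n) *
        ((\<Prod>k<n. (1 - x * q ^ Suc k) ^ Suc k) * (\<Prod>k<n. (1 - inverse x * q ^ Suc k) ^ Suc k)) *
        exp (LiS 1 z a - LiS 1 (z + of_nat n * d') a) = Gc z a b * Gc z a (- b)" for n
        using Gc_reflection_finite[OF z, of n, folded x_def] by (simp only: power_mult_distrib prod.distrib)
      then show ?thesis by (simp only: tendsto_const)
    qed
  qed
  then show ?thesis by (simp add: x_def)
qed

text \<open>
  At \<open>z = 0\<close> the reflection formula degenerates; the finite identity is continued along
  \<open>z = i \<tau> a\<close> with \<open>\<tau> \<rightarrow> 0\<close> before \<open>n\<close> tends to infinity.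
\<close>

lemma eventually_good: "\<forall>\<^sub>F \<tau> :: real in at_right 0. good (\<i> * of_real \<tau> * a)"
proof -
  have "\<forall>\<^sub>F \<tau> :: real in at_right 0. \<tau> < - Im (b / a)"
    using im' order_tendstoD(2)[OF tendsto_ident_at, of 0 "- Im (b / a)"] by simp
  moreover have "\<forall>\<^sub>F \<tau> :: real in at_right 0. \<tau> > 0" by (rule eventually_at_right_less)
  ultimately show ?thesis
  proof eventually_elim
    case (elim \<tau>)
    have "xfac (\<i> * of_real \<tau> * a) a b j \<noteq> 0" for j
    proof
      assume "xfac (\<i> * of_real \<tau> * a) a b j = 0"
      then have "(\<i> * of_real \<tau> * a + of_int j * a) / b \<in> \<int>" by (simp add: xfac_def qexp_eq_1_iff)
      then obtain m where "(\<i> * of_real \<tau> * a + of_int j * a) / b = of_int m" by (elim Ints_cases)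
      then have "\<i> * of_real \<tau> + of_int j = of_int m * (b / a)" using a0 b0 by (simp add: field_simps)
      then have "Im (\<i> * of_real \<tau> + of_int j) = Im (of_int m * (b / a))" by (simp only:)
      \<comment> \<open>A vanishing factor would make \<tau> a positive integer multiple of
        \<open>- Im (b / a)\<close>, which a smaller \<tau> cannot be.\<close>
      then have m: "\<tau> = of_int m * Im (b / a)" by (simp del: times_divide_eq_right)
      have "m < 0"
      proof (rule ccontr)
        assume "\<not> m < 0"
        then have "of_int m * Im (b / a) \<le> 0" using im' by (intro mult_nonneg_nonpos) auto
        then show False using m elim by simp
      qed
      then have "of_int m \<le> (- 1 :: real)" by linarith
      then have "- 1 * Im (b / a) \<le> of_int m * Im (b / a)" using im' by (intro mult_right_mono_neg) auto
      then show False using m elim by simp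
    qed
    then show ?case using elim a0 by (simp add: good_def regular_def)
  qed
qed

lemma Gc_reflection_finite_0:
  assumes n: "n \<ge> 1"
  shows "Gc 0 a b * Gc 0 a (- b) = Gc (0 + of_nat n * d) a b * Gc (0 + of_nat n * d') a (- b) *
    (Fc (0 + a + of_nat n * d) a b ^ n * inverse (Fc (0 - b + of_nat n * d') a (- b)) ^ n) *
    (\<Prod>k<n. ((1 - 1 * q ^ Suc k) * (1 - inverse 1 * q ^ Suc k)) ^ Suc k) *
    exp (LiS 1 0 a - LiS 1 (0 + of_nat n * d') a)"
proof -
  define z where "z \<tau> = \<i> * of_real \<tau> * a" for \<tau> :: real
  have "(z \<longlongrightarrow> \<i> * of_real 0 * a) (at_right 0)"
    unfolding z_def by (intro tendsto_mult tendsto_of_real tendsto_const tendsto_ident_at)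
  then have z: "(z \<longlongrightarrow> 0) (at_right 0)" by simp
  have za: "((\<lambda>\<tau>. z \<tau> + c) \<longlongrightarrow> 0 + c) (at_right 0)" for c by (rule tendsto_add[OF z tendsto_const])
  have "((\<lambda>\<tau>. qexp (z \<tau> / b)) \<longlongrightarrow> qexp (0 / b)) (at_right 0)"
    unfolding qexp_def using b0 by (intro tendsto_exp tendsto_mult tendsto_const tendsto_divide z)
  then have x: "((\<lambda>\<tau>. qexp (z \<tau> / b)) \<longlongrightarrow> 1) (at_right 0)" by simp
  have mua: "\<i> / d * (a + of_nat n * d) = \<i> / d * a + \<i> * of_real (real n)" by (rule V.mu_line)
  have F1: "((\<lambda>\<tau>. Fc (z \<tau> + a + of_nat n * d) a b) \<longlongrightarrow> Fc (0 + a + of_nat n * d) a b) (at_right 0)"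
  proof -
    have "Re (\<i> / d * (0 + a + of_nat n * d)) = Re (\<i> / d * a)" unfolding add_0_left mua by simp
    then have "0 < Re (\<i> / d * (0 + a + of_nat n * d))" "Re (\<i> / d * (0 + a + of_nat n * d)) < 2 * Re (\<i> / d * a)"
      using V.strip(1) by linarith+
    then have c: "isCont (\<lambda>z. Fc z a b) (0 + a + of_nat n * d)" by (rule V.isCont_Fc_strip(1))
    show ?thesis by (rule isCont_tendsto_compose[OF c]) (intro tendsto_add z tendsto_const)
  qed
  have "\<i> / d' * (- b + of_nat n * d') = \<i> / d' * (- b) + \<i> * of_real (real n)" by (rule V'.mu_line)
  then have mub: "Re (\<i> / d' * (0 - b + of_nat n * d')) = Re (\<i> / d' * a)"
    using V'.strip(2) by (simp del: times_divide_eq_left)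
  have strip': "0 < Re (\<i> / d' * (0 - b + of_nat n * d'))" "Re (\<i> / d' * (0 - b + of_nat n * d')) < 2 * Re (\<i> / d' * a)"
    unfolding mub using V'.strip(1) by linarith+
  have F2: "((\<lambda>\<tau>. Fc (z \<tau> - b + of_nat n * d') a (- b)) \<longlongrightarrow> Fc (0 - b + of_nat n * d') a (- b)) (at_right 0)"
    by (rule isCont_tendsto_compose[OF V'.isCont_Fc_strip(1)[OF strip']]) (intro tendsto_add tendsto_diff z tendsto_const)
  \<comment> \<open>Here \<open>n \<ge> 1\<close> matters: it moves the point off the boundary, so
    that \<open>LiS\<close> is continuous there. The term at \<open>z = 0\<close> itself is treated
    by the boundary limits of \<open>Li 1\<close> and \<open>Li 2\<close>.\<close>
  have nd': "Im ((0 + of_nat n * d') / a) > 0"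
  proof -
    have "(0 + of_nat n * d') / a = of_real (real n) * (- 1 - b / a)" using a0 by (simp add: d'_def field_simps)
    then have "Im ((0 + of_nat n * d') / a) = real n * (- Im (b / a))" by (simp only:) (simp del: times_divide_eq_right)
    then show ?thesis using n im' by (simp only:) (simp add: mult_pos_neg)
  qed
  have S0: "((\<lambda>\<tau>. LiS 1 (z \<tau>) a) \<longlongrightarrow> LiS 1 0 a) (at_right 0)"
  proof -
    have "((\<lambda>\<tau>. \<i> * (of_real \<tau> * Li 1 (qexp (\<i> * of_real \<tau>))) - Li 2 (qexp (\<i> * of_real \<tau>)) / (2 * of_real pi * \<i>))
        \<longlongrightarrow> \<i> * 0 - Li 2 1 / (2 * of_real pi * \<i>)) (at_right 0)"
      by (intro tendsto_diff tendsto_mult tendsto_divide tendsto_const tau_Li_tendsto_0 Li_tendsto_1) auto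
    then show ?thesis unfolding LiS_1[OF a0] z_def using a0 by (simp add: mult.assoc)
  qed
  have S1: "((\<lambda>\<tau>. LiS 1 (z \<tau> + of_nat n * d') a) \<longlongrightarrow> LiS 1 (0 + of_nat n * d') a) (at_right 0)"
    by (rule isCont_tendsto_compose[OF isCont_LiS[OF nd'] za])
  have F2': "((\<lambda>\<tau>. inverse (Fc (z \<tau> - b + of_nat n * d') a (- b))) \<longlongrightarrow> inverse (Fc (0 - b + of_nat n * d') a (- b))) (at_right 0)"
    by (rule tendsto_inverse[OF F2 V'.isCont_Fc_strip(2)[OF strip']])
  have P: "((\<lambda>\<tau>. \<Prod>k<n. ((1 - qexp (z \<tau> / b) * q ^ Suc k) * (1 - inverse (qexp (z \<tau> / b)) * q ^ Suc k)) ^ Suc k) \<longlongrightarrow>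
      (\<Prod>k<n. ((1 - 1 * q ^ Suc k) * (1 - inverse 1 * q ^ Suc k)) ^ Suc k)) (at_right 0)"
    by (intro tendsto_prod tendsto_power tendsto_mult tendsto_diff tendsto_const x tendsto_inverse) simp
  have lim: "((\<lambda>\<tau>. Gc (z \<tau> + of_nat n * d) a b * Gc (z \<tau> + of_nat n * d') a (- b) *
    (Fc (z \<tau> + a + of_nat n * d) a b ^ n * inverse (Fc (z \<tau> - b + of_nat n * d') a (- b)) ^ n) *
    (\<Prod>k<n. ((1 - qexp (z \<tau> / b) * q ^ Suc k) * (1 - inverse (qexp (z \<tau> / b)) * q ^ Suc k)) ^ Suc k) *
    exp (LiS 1 (z \<tau>) a - LiS 1 (z \<tau> + of_nat n * d') a)) \<longlongrightarrow>
    Gc (0 + of_nat n * d) a b * Gc (0 + of_nat n * d') a (- b) *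
    (Fc (0 + a + of_nat n * d) a b ^ n * inverse (Fc (0 - b + of_nat n * d') a (- b)) ^ n) *
    (\<Prod>k<n. ((1 - 1 * q ^ Suc k) * (1 - inverse 1 * q ^ Suc k)) ^ Suc k) *
    exp (LiS 1 0 a - LiS 1 (0 + of_nat n * d') a)) (at_right 0)"
    by (rule tendsto_mult[OF tendsto_mult[OF tendsto_mult[OF tendsto_mult[OF
          isCont_tendsto_compose[OF isCont_Gc[OF V.ab] za] isCont_tendsto_compose[OF isCont_Gc[OF V'.ab] za]]
          tendsto_mult[OF tendsto_power[OF F1] tendsto_power[OF F2']]] P] tendsto_exp[OF tendsto_diff[OF S0 S1]]])
  have "((\<lambda>\<tau>. Gc (z \<tau>) a b * Gc (z \<tau>) a (- b)) \<longlongrightarrow> Gc 0 a b * Gc 0 a (- b)) (at_right 0)"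
    by (rule tendsto_mult[OF isCont_tendsto_compose[OF isCont_Gc[OF V.ab] z] isCont_tendsto_compose[OF isCont_Gc[OF V'.ab] z]])
  moreover have "\<forall>\<^sub>F \<tau> in at_right 0. Gc (z \<tau>) a b * Gc (z \<tau>) a (- b) = Gc (z \<tau> + of_nat n * d) a b * Gc (z \<tau> + of_nat n * d') a (- b) *
    (Fc (z \<tau> + a + of_nat n * d) a b ^ n * inverse (Fc (z \<tau> - b + of_nat n * d') a (- b)) ^ n) *
    (\<Prod>k<n. ((1 - qexp (z \<tau> / b) * q ^ Suc k) * (1 - inverse (qexp (z \<tau> / b)) * q ^ Suc k)) ^ Suc k) *
    exp (LiS 1 (z \<tau>) a - LiS 1 (z \<tau> + of_nat n * d') a)"
    using eventually_good unfolding z_def by eventually_elim (rule Gc_reflection_finite)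
  ultimately have "((\<lambda>\<tau>. Gc (z \<tau> + of_nat n * d) a b * Gc (z \<tau> + of_nat n * d') a (- b) *
    (Fc (z \<tau> + a + of_nat n * d) a b ^ n * inverse (Fc (z \<tau> - b + of_nat n * d') a (- b)) ^ n) *
    (\<Prod>k<n. ((1 - qexp (z \<tau> / b) * q ^ Suc k) * (1 - inverse (qexp (z \<tau> / b)) * q ^ Suc k)) ^ Suc k) *
    exp (LiS 1 (z \<tau>) a - LiS 1 (z \<tau> + of_nat n * d') a)) \<longlongrightarrow> Gc 0 a b * Gc 0 a (- b)) (at_right 0)"
    by (rule Lim_transform_eventually)
  from tendsto_unique[OF trivial_limit_at_right_real this lim] show ?thesis .
qed

lemma Gc_reflection_0:
  "Gc 0 a b * Gc 0 a (- b) = (\<Prod>n. (1 - q ^ Suc n) ^ (2 * Suc n)) * exp (- (Li 2 1 / (2 * of_real pi * \<i>)))"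
proof -
  have P: "(\<lambda>n. \<Prod>k<n. ((1 - 1 * q ^ Suc k) * (1 - inverse 1 * q ^ Suc k)) ^ Suc k) \<longlonglongrightarrow> (\<Prod>n. (1 - q ^ Suc n) ^ (2 * Suc n))"
  proof -
    have "((1 - 1 * q ^ Suc k) * (1 - inverse 1 * q ^ Suc k)) ^ Suc k = (1 - q ^ Suc k) ^ (2 * Suc k)" for k
      unfolding mult_2 power_add power_mult_distrib inverse_1 mult_1_left ..
    then show ?thesis using prod_LIMSEQ[OF convergent_factors(3)] by (simp only:)
  qed
  have s0: "Re (\<i> / d * 0) = 0" "Re (\<i> / d' * 0) = 0" by simp_all
  \<comment> \<open>The points \<open>a\<close> and \<open>- b\<close> are not regular; the decay is
    read off the strip of convergence, in which they lie.\<close>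
  have dF: "V.decays (0 + a)" "V'.decays (0 - b)"
    using V.strip(1) V'.strip
    by (intro V.decays_strip V'.decays_strip; simp only: add_0_left diff_0; linarith)+
  have G: "(\<lambda>n. Gc (0 + of_nat n * d) a b) \<longlonglongrightarrow> 1" "(\<lambda>n. Gc (0 + of_nat n * d') a (- b)) \<longlonglongrightarrow> 1"
    by (rule V.Gc_strip_limit V'.Gc_strip_limit; use V.strip(1) V'.strip(1) s0 in linarith)+
  have inv: "(\<lambda>n. inverse (Fc (0 - b + of_nat n * d') a (- b)) ^ n) \<longlonglongrightarrow> inverse 1"
    unfolding power_inverse by (intro tendsto_inverse V'.Fc_power_limit dF) simp
  have lim: "(\<lambda>n. Gc (0 + of_nat n * d) a b * Gc (0 + of_nat n * d') a (- b) *
    (Fc (0 + a + of_nat n * d) a b ^ n * inverse (Fc (0 - b + of_nat n * d') a (- b)) ^ n) *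
    (\<Prod>k<n. ((1 - 1 * q ^ Suc k) * (1 - inverse 1 * q ^ Suc k)) ^ Suc k) *
    exp (LiS 1 0 a - LiS 1 (0 + of_nat n * d') a)) \<longlonglongrightarrow>
    1 * 1 * (1 * inverse 1) * (\<Prod>n. (1 - q ^ Suc n) ^ (2 * Suc n)) * exp (LiS 1 0 a - 0)"
    by (rule tendsto_mult[OF tendsto_mult[OF tendsto_mult[OF tendsto_mult[OF G]
        tendsto_mult[OF V.Fc_power_limit[OF dF(1)] inv]] P] tendsto_exp[OF tendsto_diff[OF tendsto_const LiS_limit]]])
  have "\<forall>\<^sub>F n in sequentially. Gc (0 + of_nat n * d) a b * Gc (0 + of_nat n * d') a (- b) *
    (Fc (0 + a + of_nat n * d) a b ^ n * inverse (Fc (0 - b + of_nat n * d') a (- b)) ^ n) *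
    (\<Prod>k<n. ((1 - 1 * q ^ Suc k) * (1 - inverse 1 * q ^ Suc k)) ^ Suc k) *
    exp (LiS 1 0 a - LiS 1 (0 + of_nat n * d') a) = Gc 0 a b * Gc 0 a (- b)"
    using eventually_ge_at_top[of 1] by eventually_elim (rule Gc_reflection_finite_0[symmetric])
  moreover have "LiS 1 0 a = - (Li 2 1 / (2 * of_real pi * \<i>))" unfolding LiS_1[OF a0] by simp
  ultimately show ?thesis
    using tendsto_unique[OF sequentially_bot tendsto_eventually lim] by (simp only: inverse_1 mult_1_left diff_0_right)
qed

end

section \<open>Assembly of the reflection relations\<close>

lemma eventually_regular:
  assumes vw: "(v, w) \<in> M_plus" and \<epsilon>0: "\<epsilon>0 \<noteq> 0" and q: "norm (exp (\<phi> - w / \<epsilon>0)) < 1"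
  shows "\<forall>\<^sub>F \<epsilon> in at \<epsilon>0. regular (v - \<epsilon> * \<theta>) (w - \<epsilon> * \<phi>) (- (2 * pi * \<i> * \<epsilon>))"
proof -
  define X where "X \<epsilon> = Re (\<theta> - v / \<epsilon>)" for \<epsilon>
  define Y where "Y \<epsilon> = Re (\<phi> - w / \<epsilon>)" for \<epsilon>
  have Y0: "Y \<epsilon>0 < 0" using q by (simp add: Y_def)
  have X: "(X \<longlongrightarrow> X \<epsilon>0) (at \<epsilon>0)" unfolding X_def using \<epsilon>0 by (intro tendsto_intros)
  have Y: "(Y \<longlongrightarrow> Y \<epsilon>0) (at \<epsilon>0)" unfolding Y_def using \<epsilon>0 by (intro tendsto_intros)
  \<comment> \<open>Regularity concerns infinitely many \<open>j\<close>. Since \<open>Y\<close>,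
    the logarithm of \<open>norm q\<close>, stays below \<open>Y \<epsilon>0 / 2 < 0\<close> near
    \<open>\<epsilon>0\<close>, no \<open>j\<close> outside \<open>{-N..N}\<close> can bring
    \<open>x * q ^ j\<close> to norm \<open>1\<close>; the others are finitely many.\<close>
  define N where "N = \<lceil>(\<bar>X \<epsilon>0\<bar> + 1) / (- Y \<epsilon>0 / 2)\<rceil> + 1"
  have "(\<bar>X \<epsilon>0\<bar> + 1) / (- Y \<epsilon>0 / 2) < of_int N" unfolding N_def by linarith
  then have N: "\<bar>X \<epsilon>0\<bar> + 1 < of_int N * (- Y \<epsilon>0 / 2)" using Y0 by (subst (asm) pos_divide_less_eq) auto
  have "\<forall>\<^sub>F \<epsilon> in at \<epsilon>0. \<bar>X \<epsilon>\<bar> < \<bar>X \<epsilon>0\<bar> + 1"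
    by (rule order_tendstoD(2)[OF tendsto_rabs[OF X]]) simp
  moreover have "\<forall>\<^sub>F \<epsilon> in at \<epsilon>0. Y \<epsilon> < Y \<epsilon>0 / 2"
    by (rule order_tendstoD(2)[OF Y]) (use Y0 in simp)
  moreover have "\<forall>\<^sub>F \<epsilon> in at \<epsilon>0. \<forall>j\<in>{-N..N}. exp (\<theta> + of_int j * \<phi> - (v + of_int j * w) / \<epsilon>) \<noteq> 1"
    by (intro eventually_ball_finite ballI eventually_exp_neq_1 \<epsilon>0 M_plus_shift_nonzero[OF vw]) auto
  moreover have "\<forall>\<^sub>F \<epsilon> in at \<epsilon>0. \<epsilon> \<noteq> 0" by (rule tendsto_imp_eventually_ne[OF tendsto_ident_at \<epsilon>0])
  ultimately show ?thesis
  proof eventually_elim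
    case (elim \<epsilon>)
    have "exp (\<theta> + of_int j * \<phi> - (v + of_int j * w) / \<epsilon>) \<noteq> 1" for j
    proof (cases "j \<in> {-N..N}")
      case False
      have "\<theta> + of_int j * \<phi> - (v + of_int j * w) / \<epsilon> = (\<theta> - v / \<epsilon>) + of_real (of_int j) * (\<phi> - w / \<epsilon>)"
        by (simp add: add_divide_distrib algebra_simps)
      then have re: "Re (\<theta> + of_int j * \<phi> - (v + of_int j * w) / \<epsilon>) = X \<epsilon> + of_int j * Y \<epsilon>"
        unfolding X_def Y_def by (simp only: plus_complex.sel times_complex.sel Re_complex_of_real Im_complex_of_real mult_zero_left diff_0_right)
      have "of_int N * (- Y \<epsilon>0 / 2) \<le> of_int \<bar>j\<bar> * (- Y \<epsilon>)"
        using False elim Y0 by (intro mult_mono) auto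
      also have "\<dots> = \<bar>of_int j * Y \<epsilon>\<bar>" using elim(2) Y0 by (simp add: abs_mult)
      finally have "\<bar>X \<epsilon>\<bar> < \<bar>of_int j * Y \<epsilon>\<bar>" using N elim(1) by linarith
      then have "X \<epsilon> + of_int j * Y \<epsilon> \<noteq> 0" by linarith
      moreover have "norm (exp (\<theta> + of_int j * \<phi> - (v + of_int j * w) / \<epsilon>)) = exp (X \<epsilon> + of_int j * Y \<epsilon>)"
        unfolding norm_exp_eq_Re re ..
      ultimately show ?thesis by (metis norm_one exp_eq_one_iff)
    qed (use elim(3) in blast)
    then show ?case unfolding regular_def xfac_epsilon[OF elim(4)] by simp
  qed
qed

text \<open>The products \<open>\<epsilon> * \<theta>\<close> and \<open>\<epsilon> * \<phi>\<close>
  are invariant, so that the terms with \<open>1 / \<epsilon>\<close> are odd, and so is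
  \<open>v * \<phi> - w * \<theta>\<close>. Only the constant \<open>1 / 2\<close> survives,
  twice.\<close>

lemma Q_F_sum:
  "Q_F v w \<theta> \<phi> \<epsilon> + Q_F v w (- \<theta>) (- \<phi>) (- \<epsilon>) = Li 1 (qexp (v / w))"
proof -
  define X where "X = (v * \<phi> - w * \<theta>) / (2 * pi * \<i> * w)"
  have X: "(v * (- \<phi>) - w * (- \<theta>)) / (2 * pi * \<i> * w) = - X" by (simp add: X_def diff_divide_distrib)
  define n where "n = w - \<epsilon> * \<phi>"
  have e: "w - - \<epsilon> * - \<phi> = n" "1 / - \<epsilon> = - (1 / \<epsilon>)" by (simp_all add: n_def)
  show ?thesis unfolding Q_F_def exp_Li_arg X X_def[symmetric] e n_def[symmetric] by (simp add: distrib_right left_diff_distrib)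
qed

lemma Q_G_sum:
  "Q_G v w \<theta> \<phi> \<epsilon> + Q_G v w (- \<theta>) (- \<phi>) (- \<epsilon>) =
    Li 2 (qexp (v / w)) / (2 * of_real pi * \<i>) - v / w * Li 1 (qexp (v / w))"
proof -
  define X where "X = (v * \<phi> - w * \<theta>) / (2 * pi * \<i> * w)"
  have X: "(v * (- \<phi>) - w * (- \<theta>)) / (2 * pi * \<i> * w) = - X" by (simp add: X_def diff_divide_distrib)
  define n where "n = w - \<epsilon> * \<phi>"
  define m where "m = v - \<epsilon> * \<theta>"
  have e: "w - - \<epsilon> * - \<phi> = n" "v - - \<epsilon> * - \<theta> = m" "1 / - \<epsilon> = - (1 / \<epsilon>)" "2 / - \<epsilon> = - (2 / \<epsilon>)"
    by (simp_all add: n_def m_def)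
  define l where "l = Li 2 (qexp (v / w))"
  define k where "k = v / w * Li 1 (qexp (v / w))"
  have "1 / (of_real pi * \<i>) * (X + 1 / 4) * l + 1 / (of_real pi * \<i>) * (- X + 1 / 4) * l = l / (2 * of_real pi * \<i>)"
    unfolding distrib_right[symmetric] distrib_left[symmetric] by simp
  moreover have "v / w * (X + 1 / 2) * Li 1 (qexp (v / w)) + v / w * (- X + 1 / 2) * Li 1 (qexp (v / w)) = k"
    unfolding k_def distrib_right[symmetric] distrib_left[symmetric] by simp
  ultimately show ?thesis
    unfolding Q_G_def exp_Li_arg X X_def[symmetric] e n_def[symmetric] m_def[symmetric] l_def[symmetric] k_def[symmetric]
    by (simp only: mult_minus_left) algebra
qed

text \<open>The odd part cancels and the constant \<open>- pi * \<i> / 24\<close> doubles. Written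
  with \<open>Li 2 1\<close>, it is seen to cancel the exponential in the reflection formula at
  \<open>z = 0\<close>.\<close>

lemma Q_G_0_sum: "Q_G 0 w 0 \<phi> \<epsilon> + Q_G 0 w 0 (- \<phi>) (- \<epsilon>) = Li 2 1 / (2 * of_real pi * \<i>)"
proof -
  have "Li 2 1 / (2 * of_real pi * \<i>) = - (of_real pi * \<i> / 12)"
    by (simp add: Li_2_1 complex_eq_iff Re_divide Im_divide power2_eq_square)
  then show ?thesis unfolding Q_G_at_0 by simp
qed

text \<open>The reflection formulas contribute polylogarithms at \<open>u\<close>, the exponents
  \<open>Q_F\<close> and \<open>Q_G\<close> the same ones at \<open>u0\<close> with opposite sign.
  Their quotients are the two reflection factors; for the normalising factor both are taken at
  \<open>1\<close> and nothing remains.\<close>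

lemma reflection_relations_at:
  assumes vw: "(v, w) \<in> M_plus" and \<epsilon>: "\<epsilon> \<noteq> 0" and q1: "norm (exp (\<phi> - w / \<epsilon>)) < 1"
    and Im_u: "Im ((v - \<epsilon> * \<theta>) / (w - \<epsilon> * \<phi>)) > 0"
    and reg: "regular (v - \<epsilon> * \<theta>) (w - \<epsilon> * \<phi>) (- (2 * pi * \<i> * \<epsilon>))"
  defines "x \<equiv> exp (\<theta> - v / \<epsilon>)" and "q \<equiv> exp (\<phi> - w / \<epsilon>)"
  shows "sol_B v w \<theta> \<phi> \<epsilon> * sol_B v w (- \<theta>) (- \<phi>) (- \<epsilon>) =
      (\<Prod>n. 1 - x * q ^ n) * (\<Prod>n. inverse (1 - inverse x * q ^ Suc n)) * reflection_factor_B v w \<theta> \<phi> \<epsilon>"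
    and "sol_D v w \<theta> \<phi> \<epsilon> * sol_D v w (- \<theta>) (- \<phi>) (- \<epsilon>) =
      (\<Prod>n. (1 - x * q ^ n) ^ n) * (\<Prod>n. (1 - inverse x * q ^ Suc n) ^ Suc n) *
      (\<Prod>k. inverse (1 - q ^ Suc k) ^ (2 * Suc k)) * reflection_factor_D v w \<theta> \<phi> \<epsilon>"
proof -
  define z where "z = v - \<epsilon> * \<theta>"
  define a where "a = w - \<epsilon> * \<phi>"
  define b where "b = - (2 * pi * \<i> * \<epsilon>)"
  have a: "a \<noteq> 0" using Im_u by (auto simp: a_def)
  have bq: "qexp (a / b) = q" "qexp (z / b) = x"
  proof -
    have *: "2 * of_real pi * \<i> * (n / b) = - (n / \<epsilon>)" for n using \<epsilon> by (simp add: b_def)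
    show "qexp (a / b) = q" "qexp (z / b) = x"
      unfolding qexp_def * a_def z_def q_def x_def using \<epsilon> by (simp_all add: diff_divide_distrib)
  qed
  have "exp (- (2 * pi * Im (a / b))) < 1" using q1 unfolding q_def[symmetric] bq(1)[symmetric] norm_qexp .
  then have imab: "Im (a / b) > 0" by (simp add: zero_less_mult_iff)
  interpret reflection a b by unfold_locales (rule imab)
  have q: "reflection.q a b = q" unfolding reflection.q_def[OF reflection_axioms] by (rule bq(1))
  have z: "good z"
    unfolding good_def using reg Im_u unfolding z_def[symmetric] a_def[symmetric] b_def[symmetric] by blast
  define u where "u = z / a"
  define u0 where "u0 = v / w"
  have u0: "Im u0 > 0" using vw by (simp add: u0_def M_plus_def)
  have adm: "\<epsilon> \<in> admissible w \<phi>" unfolding admissible_iff a_def[symmetric] b_def[symmetric] by (rule V.ab)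
  \<comment> \<open>At the reflected parameters the first two arguments are unchanged and only
    \<open>b\<close> changes sign.\<close>
  have args': "w - - \<epsilon> * - \<phi> = a" "v - - \<epsilon> * - \<theta> = z" "- (2 * pi * \<i> * - \<epsilon>) = - b" "0 - - \<epsilon> * 0 = 0"
    by (simp_all add: a_def b_def z_def)
  have adm': "- \<epsilon> \<in> admissible w (- \<phi>)" unfolding admissible_iff args' by (rule V'.ab)
  have rB: "reflection_factor_B v w \<theta> \<phi> \<epsilon> = (1 - qexp u) / (1 - qexp u0)"
    unfolding reflection_factor_B_def Let_def u_def u0_def z_def a_def qexp_def by simp
  have rD: "reflection_factor_D v w \<theta> \<phi> \<epsilon> = exp ((Li 2 (qexp u0) - Li 2 (qexp u)) / (2 * of_real pi * \<i>) -
      (u0 * Li 1 (qexp u0) - u * Li 1 (qexp u)))"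
    unfolding reflection_factor_D_def Let_def u_def u0_def z_def a_def qexp_def by simp
  have "sol_B v w \<theta> \<phi> \<epsilon> * sol_B v w (- \<theta>) (- \<phi>) (- \<epsilon>) = (Fc z a b * Fc z a (- b)) * exp (Q_F v w \<theta> \<phi> \<epsilon> + Q_F v w (- \<theta>) (- \<phi>) (- \<epsilon>))"
    unfolding sol_B_def F_star_eq[OF adm] F_star_eq[OF adm'] args' z_def[symmetric] a_def[symmetric] b_def[symmetric] exp_add
    by (simp only: mult_ac)
  also have "\<dots> = (\<Prod>n. 1 - x * q ^ n) * (\<Prod>n. inverse (1 - inverse x * q ^ Suc n)) * (1 - qexp u) * (1 / (1 - qexp u0))"
    unfolding Fc_reflection[OF z] Q_F_sum exp_Li_1[OF norm_qexp_less_1[OF u0[unfolded u0_def]]] bq(2) q u_def u0_def ..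
  finally show "sol_B v w \<theta> \<phi> \<epsilon> * sol_B v w (- \<theta>) (- \<phi>) (- \<epsilon>) =
      (\<Prod>n. 1 - x * q ^ n) * (\<Prod>n. inverse (1 - inverse x * q ^ Suc n)) * reflection_factor_B v w \<theta> \<phi> \<epsilon>"
    unfolding rB by simp
  define P where "P = (\<Prod>n. (1 - q ^ Suc n) ^ (2 * Suc n))"
  define L where "L = Li 2 1 / (2 * of_real pi * \<i>)"
  have "G_star v w \<theta> \<phi> \<epsilon> * G_star v w (- \<theta>) (- \<phi>) (- \<epsilon>) = (Gc z a b * Gc z a (- b)) * exp (Q_G v w \<theta> \<phi> \<epsilon> + Q_G v w (- \<theta>) (- \<phi>) (- \<epsilon>))"
    unfolding G_star_eq[OF adm] G_star_eq[OF adm'] args' z_def[symmetric] a_def[symmetric] b_def[symmetric] exp_add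
    by (simp only: mult_ac)
  also have "\<dots> = (\<Prod>n. (1 - x * q ^ n) ^ n) * (\<Prod>n. (1 - inverse x * q ^ Suc n) ^ Suc n) *
      (exp (LiS 1 z a) * exp (Li 2 (qexp u0) / (2 * of_real pi * \<i>) - u0 * Li 1 (qexp u0)))"
    unfolding Gc_reflection[OF z] Q_G_sum bq(2) q u0_def by (simp only: mult.assoc)
  also have "exp (LiS 1 z a) * exp (Li 2 (qexp u0) / (2 * of_real pi * \<i>) - u0 * Li 1 (qexp u0)) = reflection_factor_D v w \<theta> \<phi> \<epsilon>"
    unfolding rD LiS_1[OF a] u_def[symmetric] exp_add[symmetric] by (simp add: diff_divide_distrib algebra_simps)
  finally have G: "G_star v w \<theta> \<phi> \<epsilon> * G_star v w (- \<theta>) (- \<phi>) (- \<epsilon>) = (\<Prod>n. (1 - x * q ^ n) ^ n) *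
      (\<Prod>n. (1 - inverse x * q ^ Suc n) ^ Suc n) * reflection_factor_D v w \<theta> \<phi> \<epsilon>" .
  have e0: "0 - \<epsilon> * 0 = (0 :: complex)" by simp
  have "G_star 0 w 0 \<phi> \<epsilon> * G_star 0 w 0 (- \<phi>) (- \<epsilon>) = (Gc 0 a b * Gc 0 a (- b)) * exp (Q_G 0 w 0 \<phi> \<epsilon> + Q_G 0 w 0 (- \<phi>) (- \<epsilon>))"
    unfolding G_star_eq[OF adm] G_star_eq[OF adm'] args' e0 a_def[symmetric] b_def[symmetric] exp_add
    by (simp only: mult_ac)
  also have "\<dots> = P * (exp (- L) * exp L)"
    unfolding Gc_reflection_0 Q_G_0_sum q P_def L_def by (simp only: mult.assoc)
  finally have G0: "G_star 0 w 0 \<phi> \<epsilon> * G_star 0 w 0 (- \<phi>) (- \<epsilon>) = P" by (simp flip: exp_add)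
  have inv: "(\<Prod>k. inverse (1 - q ^ Suc k) ^ (2 * Suc k)) = inverse P"
    unfolding P_def power_inverse by (rule prodinf_inverse[OF convergent_factors(3)[unfolded q]])
  have "sol_D v w \<theta> \<phi> \<epsilon> * sol_D v w (- \<theta>) (- \<phi>) (- \<epsilon>) =
      (G_star v w \<theta> \<phi> \<epsilon> * G_star v w (- \<theta>) (- \<phi>) (- \<epsilon>)) * inverse (G_star 0 w 0 \<phi> \<epsilon> * G_star 0 w 0 (- \<phi>) (- \<epsilon>))"
    unfolding sol_D_def inverse_mult_distrib by (simp only: mult_ac)
  then show "sol_D v w \<theta> \<phi> \<epsilon> * sol_D v w (- \<theta>) (- \<phi>) (- \<epsilon>) =
      (\<Prod>n. (1 - x * q ^ n) ^ n) * (\<Prod>n. (1 - inverse x * q ^ Suc n) ^ Suc n) *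
      (\<Prod>k. inverse (1 - q ^ Suc k) ^ (2 * Suc k)) * reflection_factor_D v w \<theta> \<phi> \<epsilon>"
    unfolding G G0 inv by (simp only: mult_ac)
qed

text \<open>A relation \<open>s * (v - w) + t * v = 0\<close> with positive \<open>s\<close> and
  \<open>t\<close> would make \<open>v / w\<close> real.\<close>

lemma Sigma_sector_nonzero:
  assumes "(v, w) \<in> M_plus"
  shows "0 \<notin> Sigma_sector v w 0"
proof
  assume "0 \<in> Sigma_sector v w 0"
  then obtain s t where st: "s > 0" "t > 0" "of_real s * (v - w) + of_real t * v = 0"
    by (auto simp: Sigma_sector_def ell_def ray_def)
  have w: "w \<noteq> 0" "Im (v / w) > 0" using assms by (auto simp: M_plus_def)
  have "of_real (s + t) * (v / w) = of_real s" using st(3) w by (simp add: field_simps)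
  then have "Im (of_real (s + t) * (v / w)) = Im (of_real s)" by (simp only:)
  then have "(s + t) * Im (v / w) = 0" by (simp del: times_divide_eq_right of_real_add)
  then show False using st w by simp
qed

lemma reflection_relations:
  assumes vw: "(v, w) \<in> M_plus"
  shows "\<forall>\<^sub>\<approx>\<epsilon>\<in>{\<epsilon> \<in> (\<lambda>z. - \<i> * z) ` Sigma_sector v w 0. norm (exp (\<phi> - w / \<epsilon>)) < 1 \<and> (v - \<epsilon> * \<theta>, w - \<epsilon> * \<phi>) \<in> M_plus}.
     let x = exp (\<theta> - v / \<epsilon>); q = exp (\<phi> - w / \<epsilon>)
     in sol_B v w \<theta> \<phi> \<epsilon> * sol_B v w (- \<theta>) (- \<phi>) (- \<epsilon>) =
          (\<Prod>n. 1 - x * q ^ n) * (\<Prod>n. inverse (1 - inverse x * q ^ Suc n)) * reflection_factor_B v w \<theta> \<phi> \<epsilon> \<and>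
        sol_D v w \<theta> \<phi> \<epsilon> * sol_D v w (- \<theta>) (- \<phi>) (- \<epsilon>) =
          (\<Prod>n. (1 - x * q ^ n) ^ n) * (\<Prod>n. (1 - inverse x * q ^ Suc n) ^ Suc n) *
          (\<Prod>k. inverse (1 - q ^ Suc k) ^ (2 * Suc k)) * reflection_factor_D v w \<theta> \<phi> \<epsilon>"
proof (rule eventually_cosparseI)
  fix \<epsilon>0 assume "\<epsilon>0 \<in> {\<epsilon> \<in> (\<lambda>z. - \<i> * z) ` Sigma_sector v w 0. norm (exp (\<phi> - w / \<epsilon>)) < 1 \<and> (v - \<epsilon> * \<theta>, w - \<epsilon> * \<phi>) \<in> M_plus}"
  then have \<epsilon>0: "\<epsilon>0 \<noteq> 0" and q: "norm (exp (\<phi> - w / \<epsilon>0)) < 1" and M: "w - \<epsilon>0 * \<phi> \<noteq> 0" "Im ((v - \<epsilon>0 * \<theta>) / (w - \<epsilon>0 * \<phi>)) > 0"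
    using Sigma_sector_nonzero[OF vw] by (auto simp: M_plus_def)
  have "((\<lambda>\<epsilon>. norm (exp (\<phi> - w / \<epsilon>))) \<longlongrightarrow> norm (exp (\<phi> - w / \<epsilon>0))) (at \<epsilon>0)"
    using \<epsilon>0 by (intro tendsto_norm tendsto_exp tendsto_diff tendsto_divide tendsto_const tendsto_ident_at)
  then have "\<forall>\<^sub>F \<epsilon> in at \<epsilon>0. norm (exp (\<phi> - w / \<epsilon>)) < 1" by (rule order_tendstoD(2)[OF _ q])
  moreover have "((\<lambda>\<epsilon>. Im ((v - \<epsilon> * \<theta>) / (w - \<epsilon> * \<phi>))) \<longlongrightarrow> Im ((v - \<epsilon>0 * \<theta>) / (w - \<epsilon>0 * \<phi>))) (at \<epsilon>0)"
    using M(1) by (intro tendsto_Im tendsto_diff tendsto_mult tendsto_divide tendsto_const tendsto_ident_at)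
  then have "\<forall>\<^sub>F \<epsilon> in at \<epsilon>0. Im ((v - \<epsilon> * \<theta>) / (w - \<epsilon> * \<phi>)) > 0" by (rule order_tendstoD(1)[OF _ M(2)])
  moreover have "\<forall>\<^sub>F \<epsilon> in at \<epsilon>0. \<epsilon> \<noteq> 0" by (rule tendsto_imp_eventually_ne[OF tendsto_ident_at \<epsilon>0])
  ultimately show "\<forall>\<^sub>F \<epsilon> in at \<epsilon>0. let x = exp (\<theta> - v / \<epsilon>); q = exp (\<phi> - w / \<epsilon>)
     in sol_B v w \<theta> \<phi> \<epsilon> * sol_B v w (- \<theta>) (- \<phi>) (- \<epsilon>) =
          (\<Prod>n. 1 - x * q ^ n) * (\<Prod>n. inverse (1 - inverse x * q ^ Suc n)) * reflection_factor_B v w \<theta> \<phi> \<epsilon> \<and>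
        sol_D v w \<theta> \<phi> \<epsilon> * sol_D v w (- \<theta>) (- \<phi>) (- \<epsilon>) =
          (\<Prod>n. (1 - x * q ^ n) ^ n) * (\<Prod>n. (1 - inverse x * q ^ Suc n) ^ Suc n) *
          (\<Prod>k. inverse (1 - q ^ Suc k) ^ (2 * Suc k)) * reflection_factor_D v w \<theta> \<phi> \<epsilon>"
    using eventually_regular[OF vw \<epsilon>0 q, of \<theta>]
  proof eventually_elim
    case (elim \<epsilon>)
    show ?case unfolding Let_def
      using reflection_relations_at[OF vw elim(3) elim(1) elim(2) elim(4)] by (intro conjI)
  qed
qed

text \<open>The estimates hold in a full neighbourhood of infinity, hence along every
  \<open>S\<close>, and one exponent serves all subsectors.\<close>

lemma growth_at_infinity:
  assumes vw: "(v, w) \<in> M_plus" and gen: "generic \<theta> \<phi>"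
  shows "\<forall>\<^sub>F \<epsilon> in inf at_infinity (principal S).
    norm \<epsilon> powr (- 1) < norm (sol_B v w \<theta> \<phi> \<epsilon>) \<and> norm (sol_B v w \<theta> \<phi> \<epsilon>) < norm \<epsilon> powr 1 \<and>
    norm \<epsilon> powr (- 1) < norm (sol_D v w \<theta> \<phi> \<epsilon>) \<and> norm (sol_D v w \<theta> \<phi> \<epsilon>) < norm \<epsilon> powr 1"
proof -
  obtain c c' where "c \<noteq> 0" "(sol_B v w \<theta> \<phi> \<longlongrightarrow> c) at_infinity" "c' \<noteq> 0" "(sol_D v w \<theta> \<phi> \<longlongrightarrow> c') at_infinity"
    using limits_at_infinity[OF vw gen] by auto
  then have "\<forall>\<^sub>F \<epsilon> in at_infinity. (norm \<epsilon> powr (- 1) < norm (sol_B v w \<theta> \<phi> \<epsilon>) \<and> norm (sol_B v w \<theta> \<phi> \<epsilon>) < norm \<epsilon> powr 1) \<and>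
      norm \<epsilon> powr (- 1) < norm (sol_D v w \<theta> \<phi> \<epsilon>) \<and> norm (sol_D v w \<theta> \<phi> \<epsilon>) < norm \<epsilon> powr 1"
    by (intro eventually_conj norm_between_powers)
  then have "\<forall>\<^sub>F \<epsilon> in inf at_infinity (principal S). (norm \<epsilon> powr (- 1) < norm (sol_B v w \<theta> \<phi> \<epsilon>) \<and> norm (sol_B v w \<theta> \<phi> \<epsilon>) < norm \<epsilon> powr 1) \<and>
      norm \<epsilon> powr (- 1) < norm (sol_D v w \<theta> \<phi> \<epsilon>) \<and> norm (sol_D v w \<theta> \<phi> \<epsilon>) < norm \<epsilon> powr 1"
    by (rule filter_leD[OF inf_le1])
  then show ?thesis by (simp only: conj_assoc)
qed

theorem theorem9p4:
  fixes B D :: "complex \<Rightarrow> complex \<Rightarrow> complex \<Rightarrow> complex \<Rightarrow> complex \<Rightarrow> complex"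
  defines "B \<equiv> sol_B" and "D \<equiv> sol_D"
  shows
    "mv_meromorphic_on (uncurry5 B) BD_domain \<and> mv_meromorphic_on (uncurry5 D) BD_domain \<and>
     (\<forall>v w \<theta> \<phi>. (v, w) \<in> M_plus \<longrightarrow> generic \<theta> \<phi> \<longrightarrow>
        \<comment> \<open>(i)\<close>
        (\<forall>S. closed_subsector S (V_region v w 0) \<longrightarrow>
           (B v w \<theta> \<phi> \<longlongrightarrow> 1) (at 0 within S) \<and> (D v w \<theta> \<phi> \<longlongrightarrow> 1) (at 0 within S)) \<and>
        \<comment> \<open>(ii)\<close>
        (\<exists>k>0. \<forall>S. closed_subsector S (V_region v w 0) \<longrightarrow>
           (\<forall>\<^sub>F \<epsilon> in inf at_infinity (principal S).
              norm \<epsilon> powr (- k) < norm (B v w \<theta> \<phi> \<epsilon>) \<and> norm (B v w \<theta> \<phi> \<epsilon>) < norm \<epsilon> powr k \<and>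
              norm \<epsilon> powr (- k) < norm (D v w \<theta> \<phi> \<epsilon>) \<and> norm (D v w \<theta> \<phi> \<epsilon>) < norm \<epsilon> powr k)) \<and>
        \<comment> \<open>(iii)\<close>
        (\<forall>\<^sub>\<approx>\<epsilon>\<in>H_region v w 0 \<inter> admissible w \<phi>.
           let x = exp (\<theta> - v / \<epsilon>)
           in B (v + w) w (\<theta> + \<phi>) \<phi> \<epsilon> = B v w \<theta> \<phi> \<epsilon> * inverse (1 - x) \<and>
              D (v + w) w (\<theta> + \<phi>) \<phi> \<epsilon> = D v w \<theta> \<phi> \<epsilon> * inverse (B (v + w) w (\<theta> + \<phi>) \<phi> \<epsilon>)) \<and>
        \<comment> \<open>(iv)\<close>
        (\<forall>\<^sub>\<approx>\<epsilon>\<in>{\<epsilon> \<in> (\<lambda>z. - \<i> * z) ` Sigma_sector v w 0.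
                 norm (exp (\<phi> - w / \<epsilon>)) < 1 \<and> (v - \<epsilon> * \<theta>, w - \<epsilon> * \<phi>) \<in> M_plus}.
           let x = exp (\<theta> - v / \<epsilon>); q = exp (\<phi> - w / \<epsilon>)
           in B v w \<theta> \<phi> \<epsilon> * B v w (- \<theta>) (- \<phi>) (- \<epsilon>) =
                (\<Prod>n. 1 - x * q ^ n) * (\<Prod>n. inverse (1 - inverse x * q ^ Suc n)) *
                reflection_factor_B v w \<theta> \<phi> \<epsilon> \<and>
              D v w \<theta> \<phi> \<epsilon> * D v w (- \<theta>) (- \<phi>) (- \<epsilon>) =
                (\<Prod>n. (1 - x * q ^ n) ^ n) * (\<Prod>n. (1 - inverse x * q ^ Suc n) ^ Suc n) *
                (\<Prod>k. inverse (1 - q ^ Suc k) ^ (2 * Suc k)) *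
                reflection_factor_D v w \<theta> \<phi> \<epsilon>))"
proof -
  have iii: "\<forall>\<^sub>\<approx>\<epsilon>\<in>H_region v w 0 \<inter> admissible w \<phi>. let x = exp (\<theta> - v / \<epsilon>)
      in sol_B (v + w) w (\<theta> + \<phi>) \<phi> \<epsilon> = sol_B v w \<theta> \<phi> \<epsilon> * inverse (1 - x) \<and>
         sol_D (v + w) w (\<theta> + \<phi>) \<phi> \<epsilon> = sol_D v w \<theta> \<phi> \<epsilon> * inverse (sol_B (v + w) w (\<theta> + \<phi>) \<phi> \<epsilon>)"
    if "(v, w) \<in> M_plus" for v w \<theta> \<phi>
    unfolding Let_def by (rule difference_relations[OF that]) blast
  show ?thesis
    unfolding B_def D_def
  proof (intro conjI allI impI)
    fix v w \<theta> \<phi> :: complex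
    assume vw: "(v, w) \<in> M_plus" and gen: "generic \<theta> \<phi>"
    show "\<exists>k>0. \<forall>S. closed_subsector S (V_region v w 0) \<longrightarrow>
        (\<forall>\<^sub>F \<epsilon> in inf at_infinity (principal S).
           norm \<epsilon> powr (- k) < norm (sol_B v w \<theta> \<phi> \<epsilon>) \<and> norm (sol_B v w \<theta> \<phi> \<epsilon>) < norm \<epsilon> powr k \<and>
           norm \<epsilon> powr (- k) < norm (sol_D v w \<theta> \<phi> \<epsilon>) \<and> norm (sol_D v w \<theta> \<phi> \<epsilon>) < norm \<epsilon> powr k)"
      by (intro exI[of _ 1] conjI allI impI zero_less_one growth_at_infinity[OF vw gen])
  qed (fact mv_meromorphic_sol_B mv_meromorphic_sol_D | erule (1) limits_at_zero | erule iii | erule reflection_relations)+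
qed

end
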